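(* Let $n\ge 2$ and let $\gamma$ be a rotation invariant log-concave measure on $\mathbb{R}^n$. Let $R\in(0,\infty)$ and let $\psi\in C^2(\mathbb{S}^{n-1})$. Then there exists a sufficiently small $a>0$ such that for every $\epsilon_1,\epsilon_2\in(0,a)$ the functions $h_1=R+\epsilon_1\psi$ and $h_2=R+\epsilon_2\psi$ on $\mathbb{S}^{n-1}$ are support functions of convex bodies $K_1$ and $K_2$ respectively, and for every $\lambda\in[0,1]$ $$\gamma(\lambda K_1+(1-\lambda)K_2)^{\frac1n}\ \ge\ \lambda\,\gamma(K_1)^{\frac1n}+(1-\lambda)\,\gamma(K_2)^{\frac1n}.$$
   Context: All measures are Radon measures. A measure $\gamma$ on $\mathbb{R}^n$ is log-concave if for all nonempty measurable sets $A,B$ (with $\lambda A+(1-\lambda)B$ measurable) and all $\lambda\in[0,1]$, $\gamma(\lambda A+(1-\lambda)B)\ge\gamma(A)^{\lambda}\gamma(B)^{1-\lambda}$. It is rotation invariant if $\gamma(TA)=\gamma(A)$ for every measurable $A$ and every rotation $T$ of $\mathbb{R}^n$. A convex body is a compact convex set with non-empty interior. The support function of a convex body $K$ is $h_K:\mathbb{S}^{n-1}\to\mathbb{R}$, $h_K(u)=\sup_{x\in K}\langle x,u\rangle$; it determines $K$ uniquely. Sums and multiples of sets are Minkowski sums and dilations. *)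

theory Defs
  imports "HOL-Analysis.Analysis"
begin

definition radon_measure :: "'a::euclidean_space measure \<Rightarrow> bool" where
  "radon_measure M \<longleftrightarrow> sets M = sets borel \<and>
     (\<forall>K. compact K \<longrightarrow> emeasure M K < \<infinity>) \<and>
     (\<forall>A\<in>sets borel. emeasure M A = (SUP K\<in>{K. compact K \<and> K \<subseteq> A}. emeasure M K))"

(* Conventions x^0 = 1 (also for x = 0 and x = infinity) and infinity^p = infinity for p > 0;
   used for 0 <= p only. *)
definition ennreal_powr :: "ennreal \<Rightarrow> real \<Rightarrow> ennreal" where
  "ennreal_powr x p =
     (if p = 0 then 1 else if x = \<infinity> then \<infinity> else ennreal (enn2real x powr p))"

(* Sums of sets are Minkowski sums (HOL-Library.Set_Algebras); the product on the right-hand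
   side satisfies 0 * infinity = 0, as always in ennreal. *)
definition log_concave_measure :: "'a::euclidean_space measure \<Rightarrow> bool" where
  "log_concave_measure M \<longleftrightarrow>
     (\<forall>A\<in>sets M. \<forall>B\<in>sets M. \<forall>l\<in>{0..1::real}.
        A \<noteq> {} \<longrightarrow> B \<noteq> {} \<longrightarrow> (*\<^sub>R) l ` A + (*\<^sub>R) (1 - l) ` B \<in> sets M \<longrightarrow>
        emeasure M ((*\<^sub>R) l ` A + (*\<^sub>R) (1 - l) ` B)
          \<ge> ennreal_powr (emeasure M A) l * ennreal_powr (emeasure M B) (1 - l))"

definition rotation_invariant_measure :: "(real ^ 'n) measure \<Rightarrow> bool" where
  "rotation_invariant_measure M \<longleftrightarrow>
     (\<forall>A\<in>sets M. \<forall>T :: real ^ 'n ^ 'n. rotation_matrix T \<longrightarrow>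
        emeasure M ((*v) T ` A) = emeasure M A)"

definition convex_body :: "'a::euclidean_space set \<Rightarrow> bool" where
  "convex_body K \<longleftrightarrow> compact K \<and> convex K \<and> interior K \<noteq> {}"

definition support_function :: "'a::euclidean_space set \<Rightarrow> 'a \<Rightarrow> real" where
  "support_function K u = (SUP x\<in>K. x \<bullet> u)"

definition C2_on_open :: "'a::euclidean_space set \<Rightarrow> ('a \<Rightarrow> real) \<Rightarrow> bool" where
  "C2_on_open U F \<longleftrightarrow> open U \<and>
     (\<exists>(F' :: 'a \<Rightarrow> 'a \<Rightarrow>\<^sub>L real) (F'' :: 'a \<Rightarrow> 'a \<Rightarrow>\<^sub>L ('a \<Rightarrow>\<^sub>L real)).
        (\<forall>x\<in>U. (F has_derivative blinfun_apply (F' x)) (at x)) \<and>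
        (\<forall>x\<in>U. (F' has_derivative blinfun_apply (F'' x)) (at x)) \<and>
        continuous_on U F'')"

(* C^2 functions on a subset of Euclidean space, such as an embedded submanifold: locally the
   restriction of a C^2 function of the ambient space. Values of f outside S are irrelevant. *)
definition C2_on_submanifold :: "'a::euclidean_space set \<Rightarrow> ('a \<Rightarrow> real) \<Rightarrow> bool" where
  "C2_on_submanifold S f \<longleftrightarrow>
     (\<forall>p\<in>S. \<exists>U F. p \<in> U \<and> C2_on_open U F \<and> (\<forall>x\<in>S \<inter> U. F x = f x))"

end

theory Submission
  imports Defs
begin

text \<open>
  Both sides are compared along the family of bodies K(e) with support function R + e \<psi>: since
  \<lambda> K(e1) + (1 - \<lambda>) K(e2) = K(\<lambda> e1 + (1 - \<lambda>) e2), the claim is that the n-th root of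
  f(e) = \<gamma>(K(e)) is concave for small e > 0. In polar coordinates f(e) is the mean over the sphere of
  G(\<rho>(e)), where G(t) is the measure of the ball of radius t and \<rho>(e), the radial function of K(e), is
  concave in e. The measure has, apart from a possible atom at the origin, a nonincreasing log-concave
  radial density \<phi> = exp(-V). No smoothness of V is available, so concavity is tested by symmetric
  second differences at each fixed e.

  If t^(n-1) \<phi>(t) decreases near R, then G is concave there and f itself is concave. Otherwise put
  \<alpha> = \<phi>(R) > 0, let v be the left derivative of V at R, and write f = \<alpha> L - j, where L is the
  Lebesgue measure of K(e). By the Brunn-Minkowski inequality the n-th root of L is concave; the
  convexity of j has to make up for passing from L to f. If v > 0, then
  (n - v R) G(R) \<le> n \<alpha> |B| R^n, with B the unit ball, makes the comparison strict. If v = 0, the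
  measure is a multiple of Lebesgue measure inside the ball of radius R, and outside of it the second
  variation of j dominates j and its first variation. If the density vanishes outside the ball of radius
  R, the same is done for the intersections of the bodies with that ball.
\<close>

section \<open>Polar coordinates\<close>

text \<open>Log-concavity is assumed for sets only, and \<gamma> may be singular, so there is no
  density to start from. The mass of the ball of fixed radius r around x is a log-concave function
  of x; statements about the density are proved for these averages and survive r -> 0.

  A second difference of f^(1/n) weighs two quantities quadratic in the displacement of the
  boundary. The loss between L and f is, to leading order, proportional to f - \<alpha> L. The gain
  is the slope of j', about k = n |B| R^(n-1) \<alpha> v if v > 0. The bound on G(R) says that in
  the limit the loss is at most (1 - 1/n) k / 2, against a gain of k / 2; the margin k / (2 n) pays
  for radii other than R. If v = 0, both sides vanish as e -> 0 and only their ratio counts: at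
  distance of order e beyond R, convexity of V makes the slope of j' at least of order j' / e, so
  the gain wins by a factor 1 / e.

  Concavity of the radial functions in e works against convexity of j where j' > 0. There the
  smoothness of \<psi> enters, as a lower bound of order s^2 on their second differences.\<close>

definition sphere_law :: "'a::euclidean_space measure" where
  "sphere_law = distr (uniform_measure lborel (cball 0 1)) borel sgn"

lemma borel_measurable_sgn [measurable]: "(sgn :: 'a::euclidean_space \<Rightarrow> 'a) \<in> borel_measurable borel"
  unfolding sgn_div_norm[abs_def] by measurable

lemma sets_sphere_law [simp, measurable_cong]: "sets sphere_law = sets borel"
  by (simp add: sphere_law_def)

lemma space_sphere_law [simp]: "space sphere_law = UNIV"
  by (simp add: sphere_law_def)

lemma unit_ball_vol_DIM_pos [simp]: "unit_ball_vol (real DIM('a::euclidean_space)) > 0"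
  by simp

lemma emeasure_sphere_law:
  fixes A :: "'a::euclidean_space set"
  assumes [measurable]: "A \<in> sets borel"
  shows "ennreal (unit_ball_vol DIM('a)) * emeasure sphere_law A
           = emeasure lborel {x. norm x \<le> 1 \<and> sgn x \<in> A}"
proof -
  have "emeasure sphere_law A = emeasure (uniform_measure lborel (cball 0 1)) (sgn -` A)"
    unfolding sphere_law_def by (subst emeasure_distr) (auto simp: uniform_measure_def)
  also have "\<dots> = emeasure lborel (cball 0 1 \<inter> sgn -` A) / emeasure lborel (cball (0::'a) 1)"
    by (rule emeasure_uniform_measure) (simp_all add: measurable_sets_borel[OF borel_measurable_sgn assms])
  also have "emeasure lborel (cball (0::'a) 1) = ennreal (unit_ball_vol DIM('a))"
    by (simp add: emeasure_cball)
  also have "cball 0 1 \<inter> sgn -` A = {x. norm x \<le> 1 \<and> sgn x \<in> A}" by auto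
  finally have *: "emeasure sphere_law A
     = emeasure lborel {x. norm x \<le> 1 \<and> sgn x \<in> A} / ennreal (unit_ball_vol DIM('a))" .
  show ?thesis unfolding *
    unfolding ennreal_times_divide mult.commute[of "ennreal _"]
    using unit_ball_vol_DIM_pos[where 'a='a]
    by (intro ennreal_mult_divide_eq) (auto simp: ennreal_eq_0_iff simp flip: not_less)
qed

lemma prob_sphere_law: "emeasure (sphere_law :: 'a::euclidean_space measure) UNIV = 1"
proof -
  have "ennreal (unit_ball_vol DIM('a)) * emeasure (sphere_law :: 'a measure) UNIV
     = emeasure lborel (cball (0::'a) 1)"
    by (subst emeasure_sphere_law) (auto intro!: arg_cong[where f="emeasure lborel"])
  also have "\<dots> = ennreal (unit_ball_vol DIM('a)) * 1"
    by (simp add: emeasure_cball)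
  finally show ?thesis
    unfolding ennreal_mult_cancel_left using unit_ball_vol_DIM_pos[where 'a='a] by (auto simp: ennreal_eq_0_iff simp flip: not_less)
qed

interpretation sphere_law: finite_measure "sphere_law :: 'a::euclidean_space measure"
  by (rule finite_measureI) (simp add: prob_sphere_law)

lemma measure_sphere_law_UNIV [simp]: "measure (sphere_law :: 'a::euclidean_space measure) UNIV = 1"
  by (simp add: measure_def prob_sphere_law)

text \<open>Only the origin is mapped off the sphere by \<open>sgn\<close>, and it is a Lebesgue
  null set.\<close>

lemma AE_sphere_law: "AE u in (sphere_law :: 'a::euclidean_space measure). u \<in> sphere 0 1"
proof -
  have "ennreal (unit_ball_vol DIM('a)) * emeasure (sphere_law :: 'a measure) (- sphere 0 1)
     = emeasure lborel {x :: 'a. norm x \<le> 1 \<and> sgn x \<in> - sphere 0 1}"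
    by (rule emeasure_sphere_law) auto
  also have "{x :: 'a. norm x \<le> 1 \<and> sgn x \<in> - sphere 0 1} = {0}"
    by (auto simp: norm_sgn)
  finally have "emeasure (sphere_law :: 'a measure) (- sphere 0 1) = 0"
    using unit_ball_vol_DIM_pos[where 'a='a] by (auto simp: ennreal_eq_0_iff simp flip: not_less)
  thus ?thesis
    by (intro AE_I[of _ _ "- sphere 0 1"]) (auto simp: dist_norm)
qed

lemma emeasure_cone:
  fixes A :: "'a::euclidean_space set"
  assumes A [measurable]: "A \<in> sets borel" and t: "t \<ge> 0"
  shows "emeasure lborel {x. norm x \<le> t \<and> sgn x \<in> A}
           = emeasure lborel (cball (0::'a) t) * emeasure sphere_law A"
proof (cases "t = 0")
  case True
  have "emeasure lborel {x. norm x \<le> t \<and> sgn x \<in> A} \<le> emeasure lborel {0::'a}"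
    using True by (intro emeasure_mono) auto
  with True show ?thesis by simp
next
  case False
  with t have t: "t > 0" by simp
  let ?C = "{x. norm x \<le> 1 \<and> sgn x \<in> A}"
  have "{x. norm x \<le> t \<and> sgn x \<in> A} = (\<lambda>x. t *\<^sub>R x + 0) ` ?C"
  proof (intro equalityI subsetI)
    fix x assume x: "x \<in> {x. norm x \<le> t \<and> sgn x \<in> A}"
    then have "x = t *\<^sub>R (x /\<^sub>R t) + 0" "x /\<^sub>R t \<in> ?C"
      using t by (auto simp: sgn_scaleR divide_simps)
    then show "x \<in> (\<lambda>x. t *\<^sub>R x + 0) ` ?C" by blast
  qed (use t in \<open>auto simp: sgn_scaleR mult_left_le\<close>)
  moreover have C: "?C \<in> sets borel" "{x. norm x \<le> t \<and> sgn x \<in> A} \<in> sets borel"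
    by measurable
  ultimately have "emeasure lborel {x. norm x \<le> t \<and> sgn x \<in> A}
      = ennreal (t ^ DIM('a)) * emeasure lborel ?C"
    using emeasure_lebesgue_affine[of t 0 ?C] t by (auto simp: ennreal_power)
  also have "emeasure lborel ?C = ennreal (unit_ball_vol DIM('a)) * emeasure sphere_law A"
    by (simp add: emeasure_sphere_law)
  finally show ?thesis
    using t by (simp add: emeasure_cball ennreal_mult' mult_ac)
qed

text \<open>Norm and direction are independent under Lebesgue measure because a cone fills the same
  proportion of every centred ball (\<open>emeasure_cone\<close>).\<close>

lemma distr_norm_sgn_eq_pair:
  "distr lborel borel (norm :: 'a \<Rightarrow> real) \<Otimes>\<^sub>M sphere_law
     = distr lborel (borel \<Otimes>\<^sub>M borel) (\<lambda>x :: 'a::euclidean_space. (norm x, sgn x))"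
    (is "?N \<Otimes>\<^sub>M _ = ?D")
proof (rule pair_measure_eqI)
  have N: "emeasure ?N {..t} = emeasure lborel (cball (0::'a) t)" for t
  proof -
    have "norm -` {..t} = cball (0::'a) t" by auto
    then show ?thesis by (subst emeasure_distr) simp_all
  qed
  show "sigma_finite_measure ?N"
  proof (rule sigma_finite_measure.intro, intro exI conjI ballI)
    show "countable (range (\<lambda>n::nat. {..real n}))" by simp
    show "\<Union> (range (\<lambda>n::nat. {..real n})) = space ?N"
      using real_arch_simple by auto
    show "emeasure ?N a \<noteq> \<infinity>" if "a \<in> range (\<lambda>n::nat. {..real n})" for a
      using that N by (auto simp: emeasure_cball)
  qed auto
  show "sigma_finite_measure (sphere_law :: 'a measure)"
    by (rule sphere_law.sigma_finite_measure_axioms)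
  show "sets (?N \<Otimes>\<^sub>M sphere_law) = sets ?D"
    unfolding sets_distr by (rule sets_pair_measure_cong) simp_all
  fix X :: "real set" and A :: "'a set"
  assume X: "X \<in> sets ?N" and "A \<in> sets sphere_law"
  then have A [measurable]: "A \<in> sets borel" by simp
  \<comment> \<open>For a fixed set A of directions both sides are measures in X. They agree on the
    half-lines {..t}, which generate the Borel sets and are closed under intersection.\<close>
  let ?M1 = "scale_measure (emeasure sphere_law A) ?N"
  let ?M2 = "distr (restrict_space lborel (sgn -` A)) borel norm"
  have 2: "emeasure ?M2 X = emeasure lborel {x. norm x \<in> X \<and> sgn x \<in> A}" if "X \<in> sets borel" for X
  proof -
    have "emeasure ?M2 X = emeasure (restrict_space lborel (sgn -` A)) (norm -` X \<inter> (sgn -` A))"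
      using that by (subst emeasure_distr) (simp_all add: space_restrict_space measurable_restrict_space1)
    also have "\<dots> = emeasure lborel (norm -` X \<inter> (sgn -` A))"
      by (rule emeasure_restrict_space) (simp_all add: measurable_sets_borel[OF borel_measurable_sgn A])
    finally show ?thesis by (auto simp: vimage_def Int_def)
  qed
  have "?M1 = ?M2"
  proof (rule measure_eqI_generator_eq)
    show "Int_stable (range (atMost :: real \<Rightarrow> _))"
      by (auto simp: Int_stable_def Int_atMost)
    show "sets ?M1 = sigma_sets UNIV (range atMost)" "sets ?M2 = sigma_sets UNIV (range atMost)"
      by (simp_all add: borel_eq_atMost)
    show "range (\<lambda>n::nat. {..real n}) \<subseteq> range atMost" by auto
    show "(\<Union>n. {..real n}) = UNIV" using real_arch_simple by auto
    show "emeasure ?M1 {..real n} \<noteq> \<infinity>" for n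
      by (simp add: N emeasure_cball ennreal_mult_eq_top_iff sphere_law.emeasure_finite)
    show "emeasure ?M1 X = emeasure ?M2 X" if "X \<in> range atMost" for X
    proof -
      from that obtain t where X: "X = {..t}" by auto
      show ?thesis
      proof (cases "t \<ge> 0")
        case True
        then show ?thesis by (simp add: X 2 N emeasure_cone mult_ac)
      next
        case False
        then have "\<not> norm x \<le> t" for x :: 'a
          using norm_ge_zero[of x] by linarith
        then have "{x :: 'a. norm x \<le> t \<and> sgn x \<in> A} = {}"
          by blast
        then have "emeasure ?M2 X = emeasure lborel ({} :: 'a set)"
          unfolding X by (subst 2) (simp_all only: atMost_iff atMost_borel)
        with False show ?thesis by (simp add: X N)
      qed
    qed
  qed auto
  then have "emeasure ?M1 X = emeasure ?M2 X" by simp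
  moreover have "emeasure ?D (X \<times> A) = emeasure lborel {x. norm x \<in> X \<and> sgn x \<in> A}"
    using X by (subst emeasure_distr) (auto intro!: arg_cong[where f="emeasure lborel"])
  ultimately show "emeasure ?N X * emeasure sphere_law A = emeasure ?D (X \<times> A)"
    using X by (simp add: 2 mult.commute)
qed

text \<open>For a fixed direction u the condition \<open>norm x \<le> \<rho> (sgn x)\<close> turns
  into membership in the ball of radius \<rho>(u), and the radial density does not see u.\<close>

lemma emeasure_radial_density_star:
  fixes g :: "real \<Rightarrow> ennreal" and \<rho> :: "'a::euclidean_space \<Rightarrow> real"
  defines "D \<equiv> density lborel (\<lambda>x :: 'a. g (norm x))"
  assumes [measurable]: "g \<in> borel_measurable borel" "\<rho> \<in> borel_measurable borel"
  shows "emeasure D {x. norm x \<le> \<rho> (sgn x)}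
           = (\<integral>\<^sup>+u. emeasure D (cball 0 (\<rho> u)) \<partial>sphere_law)"
proof -
  let ?N = "distr lborel borel (norm :: 'a \<Rightarrow> real)"
  interpret N: sigma_finite_measure ?N
  proof (rule sigma_finite_measure.intro, intro exI conjI ballI)
    show "countable (range (\<lambda>n::nat. {..real n}))" by simp
    show "\<Union> (range (\<lambda>n::nat. {..real n})) = space ?N"
      using real_arch_simple by auto
    fix a assume "a \<in> range (\<lambda>n::nat. {..real n})"
    then obtain n where a: "a = {..real n}" by auto
    have "norm -` {..real n} = cball (0::'a) (real n)" by auto
    then have "emeasure ?N {..real n} = emeasure lborel (cball (0::'a) (real n))"
      by (simp add: emeasure_distr)
    then show "emeasure ?N a \<noteq> \<infinity>" by (auto simp: a emeasure_cball)
  qed auto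
  interpret P: pair_sigma_finite ?N "sphere_law :: 'a measure" ..
  let ?h = "\<lambda>p :: real \<times> 'a. g (fst p) * indicator {p. fst p \<le> \<rho> (snd p)} p"
  have "emeasure D {x. norm x \<le> \<rho> (sgn x)}
      = (\<integral>\<^sup>+x. g (norm x) * indicator {x. norm x \<le> \<rho> (sgn x)} x \<partial>lborel)"
    unfolding D_def by (rule emeasure_density) auto
  also have "\<dots> = (\<integral>\<^sup>+x. ?h (norm x, sgn x) \<partial>lborel)"
    by (rule nn_integral_cong) (auto split: split_indicator)
  also have "\<dots> = (\<integral>\<^sup>+p. ?h p \<partial>distr lborel (borel \<Otimes>\<^sub>M borel) (\<lambda>x :: 'a. (norm x, sgn x)))"
    by (subst nn_integral_distr) auto
  also have "\<dots> = (\<integral>\<^sup>+p. ?h p \<partial>(?N \<Otimes>\<^sub>M sphere_law))"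
    by (simp add: distr_norm_sgn_eq_pair)
  also have "\<dots> = (\<integral>\<^sup>+u. \<integral>\<^sup>+t. ?h (t, u) \<partial>?N \<partial>sphere_law)"
    by (rule P.nn_integral_snd[symmetric]) measurable
  also have "\<dots> = (\<integral>\<^sup>+u. emeasure D (cball 0 (\<rho> u)) \<partial>sphere_law)"
  proof (rule nn_integral_cong)
    fix u :: 'a
    have "(\<integral>\<^sup>+t. ?h (t, u) \<partial>?N) = (\<integral>\<^sup>+(x::'a). ?h (norm x, u) \<partial>lborel)"
      by (subst nn_integral_distr) auto
    also have "\<dots> = (\<integral>\<^sup>+(x::'a). g (norm x) * indicator (cball 0 (\<rho> u)) x \<partial>lborel)"
      by (rule nn_integral_cong) (auto split: split_indicator)
    also have "\<dots> = emeasure D (cball 0 (\<rho> u))"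
      unfolding D_def by (rule emeasure_density[symmetric]) auto
    finally show "(\<integral>\<^sup>+t. ?h (t, u) \<partial>?N) = emeasure D (cball 0 (\<rho> u))" .
  qed
  finally show ?thesis .
qed

section \<open>Averages over small balls\<close>

lemma compact_scaled_sum:
  fixes A B :: "'a::real_normed_vector set"
  assumes "compact A" "compact B"
  shows "compact ((*\<^sub>R) l ` A + (*\<^sub>R) m ` B)"
  unfolding set_plus_image split_def
  by (intro compact_continuous_image continuous_intros compact_Times compact_scaling assms)

locale rot_log_concave =
  fixes \<gamma> :: "(real ^ 'n) measure" and n :: nat and \<omega> :: real
  assumes n_eq: "n = CARD('n)" and omega_eq: "\<omega> = unit_ball_vol (real CARD('n))"
    and dim: "n \<ge> 2"
    and radon: "radon_measure \<gamma>"
    and rot: "rotation_invariant_measure \<gamma>"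
    and logc: "log_concave_measure \<gamma>"
begin

lemma sets_gamma [simp, measurable_cong]: "sets \<gamma> = sets borel"
  using radon by (simp add: radon_measure_def)

lemma space_gamma [simp]: "space \<gamma> = UNIV"
  using sets_eq_imp_space_eq[OF sets_gamma] by simp

lemma finite_gamma: "compact K \<Longrightarrow> emeasure \<gamma> K \<noteq> \<infinity>"
  using radon by (auto simp: radon_measure_def)

lemma emeasure_gamma: "compact K \<Longrightarrow> emeasure \<gamma> K = ennreal (measure \<gamma> K)"
  using finite_gamma[of K] by (simp add: emeasure_eq_ennreal_measure)

lemma omega_pos [simp]: "\<omega> > 0"
  by (simp add: omega_eq)

lemma sigma_finite_gamma: "sigma_finite_measure \<gamma>"
proof (rule sigma_finite_measure.intro, intro exI conjI ballI)
  show "countable (range (\<lambda>k::nat. cball (0 :: real ^ 'n) (real k)))" by simp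
  show "\<Union> (range (\<lambda>k::nat. cball (0 :: real ^ 'n) (real k))) = space \<gamma>"
    using real_arch_simple by auto
  show "emeasure \<gamma> a \<noteq> \<infinity>" if "a \<in> range (\<lambda>k::nat. cball (0 :: real ^ 'n) (real k))" for a
    using that finite_gamma by auto
qed auto

lemma measure_gamma_mono: "A \<subseteq> B \<Longrightarrow> compact A \<Longrightarrow> compact B \<Longrightarrow> measure \<gamma> A \<le> measure \<gamma> B"
  using finite_gamma by (intro measure_mono_fmeasurable) (auto simp: fmeasurable_def less_top borel_compact)

lemma log_concave_compact:
  assumes "compact A" "compact B" "A \<noteq> {}" "B \<noteq> {}" "0 < l" "l < 1"
  shows "measure \<gamma> A powr l * measure \<gamma> B powr (1 - l)
      \<le> measure \<gamma> ((*\<^sub>R) l ` A + (*\<^sub>R) (1 - l) ` B)"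
proof -
  have c: "compact ((*\<^sub>R) l ` A + (*\<^sub>R) (1 - l) ` B)"
    using assms by (intro compact_scaled_sum)
  have "emeasure \<gamma> ((*\<^sub>R) l ` A + (*\<^sub>R) (1 - l) ` B)
      \<ge> ennreal_powr (emeasure \<gamma> A) l * ennreal_powr (emeasure \<gamma> B) (1 - l)"
    using logc assms c unfolding log_concave_measure_def by (auto simp: borel_compact)
  then show ?thesis
    using assms c by (simp add: emeasure_gamma ennreal_powr_def flip: ennreal_mult)
qed

definition u :: "real \<Rightarrow> real ^ 'n \<Rightarrow> real" where
  "u r x = measure \<gamma> (cball x r)"

lemma u_nonneg [simp]: "u r x \<ge> 0"
  by (simp add: u_def)

text \<open>A convex combination of two balls of radius r lies in the ball of radius r around the
  combined centre. This turns log-concavity for sets into log-concavity of a function.\<close>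

lemma u_log_concave:
  assumes "r > 0" "0 < l" "l < 1"
  shows "u r x powr l * u r y powr (1 - l) \<le> u r (l *\<^sub>R x + (1 - l) *\<^sub>R y)"
proof -
  let ?S = "(*\<^sub>R) l ` cball x r + (*\<^sub>R) (1 - l) ` cball y r"
  have c: "compact ?S"
    by (intro compact_scaled_sum compact_cball)
  have "?S \<subseteq> cball (l *\<^sub>R x + (1 - l) *\<^sub>R y) r"
  proof
    fix z assume "z \<in> ?S"
    then obtain a b where ab: "norm (x - a) \<le> r" "norm (y - b) \<le> r" "z = l *\<^sub>R a + (1 - l) *\<^sub>R b"
      by (auto simp: set_plus_def dist_norm)
    have "l *\<^sub>R x + (1 - l) *\<^sub>R y - z = l *\<^sub>R (x - a) + (1 - l) *\<^sub>R (y - b)"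
      by (simp add: ab algebra_simps)
    also have "norm \<dots> \<le> l * norm (x - a) + (1 - l) * norm (y - b)"
      using assms by (intro norm_triangle_le) auto
    also have "\<dots> \<le> l * r + (1 - l) * r"
      using ab assms by (intro add_mono mult_left_mono) auto
    finally show "z \<in> cball (l *\<^sub>R x + (1 - l) *\<^sub>R y) r"
      by (simp add: dist_norm algebra_simps)
  qed
  with c have "measure \<gamma> ?S \<le> u r (l *\<^sub>R x + (1 - l) *\<^sub>R y)"
    unfolding u_def by (intro measure_gamma_mono) auto
  moreover have "u r x powr l * u r y powr (1 - l) \<le> measure \<gamma> ?S"
    unfolding u_def using assms by (intro log_concave_compact) auto
  ultimately show ?thesis by linarith
qed

text \<open>Dimension at least 2 provides a rotation, and not merely a reflection, that carries x to
  y.\<close>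

lemma u_rotation:
  assumes "norm x = norm y"
  shows "u r x = u r y"
proof -
  obtain f where f: "orthogonal_transformation f" "det (matrix f) = 1" "f x = y"
    using rotation_exists[OF dim[unfolded n_eq] assms] .
  have lin: "linear f" using f(1) orthogonal_transformation_linear by blast
  have T: "rotation_matrix (matrix f)"
    using f by (simp add: rotation_matrix_def orthogonal_transformation_matrix)
  have "(*v) (matrix f) ` cball x r = f ` cball x r"
    using lin by (simp add: matrix_works)
  also have "\<dots> = cball (f x) r"
    using f(1) by (rule image_orthogonal_transformation_cball)
  finally have "emeasure \<gamma> (cball y r) = emeasure \<gamma> (cball x r)"
    using rot[unfolded rotation_invariant_measure_def, rule_format, OF _ T, of "cball x r"] f(3)
    by simp
  then show ?thesis by (simp add: u_def measure_def)
qed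

text \<open>The point x lies on the segment between two antipodal points of norm |y|, where u takes
  the same value; log-concavity gives at least this value at x.\<close>

lemma u_antimono:
  assumes r: "r > 0" and le: "norm x \<le> norm y"
  shows "u r y \<le> u r x"
proof (cases "y = 0")
  case True
  with le show ?thesis by simp
next
  case False
  define y' where "y' = (if x = 0 then y else (norm y / norm x) *\<^sub>R x)"
  have y': "norm y' = norm y" "x = (norm x / norm y) *\<^sub>R y'"
    using False by (auto simp: y'_def)
  have r1: "norm x / norm y \<le> 1" using le False by simp
  define l where "l = (1 + norm x / norm y) / 2"
  have l: "0 < l" "l \<le> 1" using r1 by (simp_all add: l_def add_pos_nonneg)
  have "l - (1 - l) = norm x / norm y" by (simp add: l_def field_simps)
  then have x: "x = l *\<^sub>R y' + (1 - l) *\<^sub>R (- y')"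
    using y'(2) by (metis scaleR_diff_left scaleR_minus_right uminus_add_conv_diff add.commute)
  have eq: "u r y' = u r y" "u r (- y') = u r y"
    using y'(1) by (auto intro: u_rotation)
  show ?thesis
  proof (cases "l < 1")
    case True
    have "u r y = u r y' powr l * u r (- y') powr (1 - l)"
      unfolding eq by (simp flip: powr_add)
    also have "\<dots> \<le> u r x"
      using u_log_concave[OF r l(1) True, of y' "- y'"] unfolding x[symmetric] .
    finally show ?thesis .
  next
    case False
    then have "norm x = norm y" using r1 \<open>y \<noteq> 0\<close> by (auto simp: l_def)
    then show ?thesis using u_rotation by (metis order_refl)
  qed
qed

text \<open>Truncation of t at 0 makes \<open>g r\<close> monotone on the whole line, hence
  measurable.\<close>

definition g :: "real \<Rightarrow> real \<Rightarrow> real" where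
  "g r t = u r (max 0 t *\<^sub>R axis undefined 1)"

lemma u_eq_g: "u r x = g r (norm x)"
  unfolding g_def by (rule u_rotation) simp

lemma g_nonneg [simp]: "g r t \<ge> 0"
  by (simp add: g_def)

lemma g_antimono: "r > 0 \<Longrightarrow> s \<le> t \<Longrightarrow> g r t \<le> g r s"
  unfolding g_def by (rule u_antimono) auto

lemma g_log_concave:
  assumes "r > 0" "0 < l" "l < 1" "0 \<le> s" "0 \<le> t"
  shows "g r s powr l * g r t powr (1 - l) \<le> g r (l * s + (1 - l) * t)"
  using u_log_concave[OF assms(1-3), of "s *\<^sub>R axis undefined 1" "t *\<^sub>R axis undefined 1"] assms
  by (simp add: g_def max_def scaleR_add_left)

lemma g_measurable [measurable]: "r > 0 \<Longrightarrow> g r \<in> borel_measurable borel"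
  using borel_measurable_mono[of "\<lambda>t. - g r t"] g_antimono
  by (auto simp: mono_def)

text \<open>Up to normalization, D r is the convolution of \<gamma> with the uniform distribution on the ball of
  radius r. It has a density even if \<gamma> does not.\<close>

definition D :: "real \<Rightarrow> (real ^ 'n) measure" where
  "D r = density lborel (\<lambda>x. ennreal (g r (norm x)))"

text \<open>Fubini for the pairs (x, y) with x in A at distance at most r: slicing in x yields the
  density, slicing in y the right-hand side.\<close>

lemma D_eq:
  assumes r: "r > 0" and [measurable]: "A \<in> sets borel"
  shows "emeasure (D r) A = (\<integral>\<^sup>+y. emeasure lborel (A \<inter> cball y r) \<partial>\<gamma>)"
proof -
  interpret \<gamma>: sigma_finite_measure \<gamma> by (rule sigma_finite_gamma)
  interpret P: pair_sigma_finite "lborel :: (real ^ 'n) measure" \<gamma> ..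
  note [measurable] = g_measurable[OF r]
  define S where "S = {p :: (real ^ 'n) \<times> (real ^ 'n). dist (fst p) (snd p) \<le> r \<and> fst p \<in> A}"
  have "closed {p :: (real ^ 'n) \<times> (real ^ 'n). dist (fst p) (snd p) \<le> r}"
    by (intro closed_Collect_le continuous_intros)
  then have "{p. dist (fst p) (snd p) \<le> r} \<inter> (A \<times> UNIV) \<in> sets (borel \<Otimes>\<^sub>M borel)"
    unfolding borel_prod by (intro sets.Int borel_Times) auto
  also have "{p. dist (fst p) (snd p) \<le> r} \<inter> (A \<times> UNIV) = S"
    by (auto simp: S_def)
  finally have [measurable]: "S \<in> sets (borel \<Otimes>\<^sub>M borel)" .
  let ?h = "indicator S :: (real ^ 'n) \<times> (real ^ 'n) \<Rightarrow> ennreal"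
  have "emeasure (D r) A = (\<integral>\<^sup>+x. ennreal (g r (norm x)) * indicator A x \<partial>lborel)"
    unfolding D_def by (rule emeasure_density) auto
  also have "\<dots> = (\<integral>\<^sup>+x. \<integral>\<^sup>+y. ?h (x, y) \<partial>\<gamma> \<partial>lborel)"
  proof (rule nn_integral_cong)
    fix x :: "real ^ 'n"
    have "(\<integral>\<^sup>+y. ?h (x, y) \<partial>\<gamma>) = (\<integral>\<^sup>+y. indicator A x * indicator (cball x r) y \<partial>\<gamma>)"
      by (rule nn_integral_cong) (auto simp: S_def split: split_indicator)
    also have "\<dots> = indicator A x * emeasure \<gamma> (cball x r)"
      by (subst nn_integral_cmult_indicator) auto
    finally show "ennreal (g r (norm x)) * indicator A x = (\<integral>\<^sup>+y. ?h (x, y) \<partial>\<gamma>)"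
      by (simp add: emeasure_gamma mult.commute flip: u_eq_g) (simp add: u_def)
  qed
  also have "\<dots> = (\<integral>\<^sup>+y. \<integral>\<^sup>+x. ?h (x, y) \<partial>lborel \<partial>\<gamma>)"
    by (rule P.Fubini'[symmetric]) measurable
  also have "\<dots> = (\<integral>\<^sup>+y. emeasure lborel (A \<inter> cball y r) \<partial>\<gamma>)"
  proof (rule nn_integral_cong)
    fix y :: "real ^ 'n"
    have "(\<integral>\<^sup>+x. ?h (x, y) \<partial>lborel) = (\<integral>\<^sup>+x. indicator (A \<inter> cball y r) x \<partial>lborel)"
      by (rule nn_integral_cong) (auto simp: S_def dist_commute split: split_indicator)
    then show "(\<integral>\<^sup>+x. ?h (x, y) \<partial>lborel) = emeasure lborel (A \<inter> cball y r)" by simp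
  qed
  finally show ?thesis .
qed

lemma emeasure_cball_n: "r \<ge> 0 \<Longrightarrow> emeasure lborel (cball (y :: real ^ 'n) r) = ennreal (\<omega> * r ^ n)"
  by (simp add: emeasure_cball n_eq omega_eq)

text \<open>A point y outside K has no point of A within distance r, and any other y sees at most a
  full ball. Together with \<open>D_lower\<close> this exchanges \<gamma> for \<open>D r\<close> at
  the price of moving the boundary by r.\<close>

lemma D_upper:
  assumes r: "r > 0" and A: "A \<in> sets borel" and K: "K \<in> sets borel"
    and sub: "\<And>x. x \<in> A \<Longrightarrow> cball x r \<subseteq> K"
  shows "emeasure (D r) A \<le> ennreal (\<omega> * r ^ n) * emeasure \<gamma> K"
proof -
  have "emeasure (D r) A \<le> (\<integral>\<^sup>+y. ennreal (\<omega> * r ^ n) * indicator K y \<partial>\<gamma>)"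
    unfolding D_eq[OF r A]
  proof (rule nn_integral_mono)
    fix y
    show "emeasure lborel (A \<inter> cball y r) \<le> ennreal (\<omega> * r ^ n) * indicator K y"
    proof (cases "y \<in> K")
      case True
      have "emeasure lborel (A \<inter> cball y r) \<le> emeasure lborel (cball y r)"
        by (rule emeasure_mono) auto
      then show ?thesis using True r by (simp add: emeasure_cball_n)
    next
      case False
      then have "A \<inter> cball y r = {}"
        using sub by (auto simp: dist_commute subset_iff)
      then show ?thesis by simp
    qed
  qed
  also have "\<dots> = ennreal (\<omega> * r ^ n) * emeasure \<gamma> K"
    using K by (subst nn_integral_cmult_indicator) auto
  finally show ?thesis .
qed

lemma D_lower:
  assumes r: "r > 0" and A: "A \<in> sets borel" and K: "K \<in> sets borel"
    and sub: "\<And>x. x \<in> K \<Longrightarrow> cball x r \<subseteq> A"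
  shows "ennreal (\<omega> * r ^ n) * emeasure \<gamma> K \<le> emeasure (D r) A"
proof -
  have "ennreal (\<omega> * r ^ n) * emeasure \<gamma> K = (\<integral>\<^sup>+y. ennreal (\<omega> * r ^ n) * indicator K y \<partial>\<gamma>)"
    using K by (subst nn_integral_cmult_indicator) auto
  also have "\<dots> \<le> emeasure (D r) A"
    unfolding D_eq[OF r A]
  proof (rule nn_integral_mono)
    fix y
    show "ennreal (\<omega> * r ^ n) * indicator K y \<le> emeasure lborel (A \<inter> cball y r)"
    proof (cases "y \<in> K")
      case True
      then have "A \<inter> cball y r = cball y r" using sub by auto
      then show ?thesis using True r by (simp add: emeasure_cball_n)
    qed simp
  qed
  finally show ?thesis .
qed

end

section \<open>The radial density\<close>

context rot_log_concave
begin

definition G :: "real \<Rightarrow> real" where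
  "G t = measure \<gamma> (cball 0 t)"

text \<open>Divided by the volume of the averaging ball, \<open>Gr r t\<close> tends to
  \<open>G t\<close> as r -> 0 for t > 0; \<open>w r\<close> is the density that belongs to
  \<open>Gr r\<close>.\<close>

definition Gr :: "real \<Rightarrow> real \<Rightarrow> real" where
  "Gr r t = measure (D r) (cball 0 t) / (\<omega> * r ^ n)"

definition w :: "real \<Rightarrow> real \<Rightarrow> real" where
  "w r t = g r t / (\<omega> * r ^ n)"

lemma G_nonneg [simp]: "G t \<ge> 0"
  by (simp add: G_def)

lemma G_mono: "s \<le> t \<Longrightarrow> G s \<le> G t"
  unfolding G_def by (rule measure_gamma_mono) auto

lemma omega_simps [simp]: "0 \<le> \<omega>" "\<omega> \<noteq> 0"
  using omega_pos by linarith+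

lemma n_simps [simp]: "n > 0" "n \<noteq> 0"
  using dim by auto

lemma sets_D [simp]: "sets (D r) = sets borel"
  by (simp add: D_def)

lemma vol_pos [simp]: "r > 0 \<Longrightarrow> \<omega> * r ^ n > 0"
  by simp

lemma D_ball:
  assumes "r > 0" "t \<ge> 0"
  shows "emeasure (D r) (cball 0 t) = ennreal (\<omega> * r ^ n * Gr r t)"
proof -
  have "emeasure (D r) (cball 0 t) \<le> ennreal (\<omega> * r ^ n) * emeasure \<gamma> (cball 0 (t + r))"
    using assms by (intro D_upper) (auto simp: cball_subset_cball_iff)
  also have "\<dots> < \<infinity>"
    using finite_gamma[of "cball 0 (t + r)"] by (simp add: ennreal_mult_less_top less_top)
  finally have "emeasure (D r) (cball 0 t) = ennreal (measure (D r) (cball 0 t))"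
    by (intro emeasure_eq_ennreal_measure) auto
  then show ?thesis using assms vol_pos[of r] by (simp add: Gr_def)
qed

lemma Gr_nonneg [simp]: "r > 0 \<Longrightarrow> Gr r t \<ge> 0"
  by (simp add: Gr_def)

lemma Gr_upper:
  assumes "r > 0" "t \<ge> 0"
  shows "Gr r t \<le> G (t + r)"
proof -
  have "ennreal (\<omega> * r ^ n * Gr r t) \<le> ennreal (\<omega> * r ^ n) * emeasure \<gamma> (cball 0 (t + r))"
    unfolding D_ball[OF assms, symmetric]
    using assms by (intro D_upper) (auto simp: cball_subset_cball_iff)
  also have "\<dots> = ennreal (\<omega> * r ^ n * G (t + r))"
    using vol_pos[of r] assms by (simp add: emeasure_gamma G_def ennreal_mult')
  finally have "\<omega> * r ^ n * Gr r t \<le> \<omega> * r ^ n * G (t + r)"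
    using assms by (subst (asm) ennreal_le_iff) auto
  then show ?thesis using assms by simp
qed

lemma Gr_lower:
  assumes "r > 0" "r \<le> t"
  shows "G (t - r) \<le> Gr r t"
proof -
  have "ennreal (\<omega> * r ^ n * G (t - r)) = ennreal (\<omega> * r ^ n) * emeasure \<gamma> (cball 0 (t - r))"
    using vol_pos[of r] assms by (simp add: emeasure_gamma G_def ennreal_mult')
  also have "\<dots> \<le> ennreal (\<omega> * r ^ n * Gr r t)"
    using assms D_ball[of r t, symmetric]
    by (simp, intro D_lower) (auto simp: cball_subset_cball_iff)
  finally have "\<omega> * r ^ n * G (t - r) \<le> \<omega> * r ^ n * Gr r t"
    using assms by (subst (asm) ennreal_le_iff) auto
  then show ?thesis using assms by simp
qed

text \<open>The shell between the radii s and t has volume \<omega> (t^n - s^n), and the monotone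
  density is caught between its values at the two radii.\<close>

lemma Gr_sandwich:
  assumes r: "r > 0" and st: "0 \<le> s" "s \<le> t"
  shows "w r t * (\<omega> * (t ^ n - s ^ n)) \<le> Gr r t - Gr r s"
    and "Gr r t - Gr r s \<le> w r s * (\<omega> * (t ^ n - s ^ n))"
proof -
  let ?A = "cball (0 :: real ^ 'n) t - cball 0 s"
  have pw: "s ^ n \<le> t ^ n" using st by (simp add: power_mono)
  note [measurable] = g_measurable[OF r]
  have "emeasure lborel ?A = emeasure lborel (cball (0 :: real ^ 'n) t) - emeasure lborel (cball (0 :: real ^ 'n) s)"
    using st by (intro emeasure_Diff) (auto simp: emeasure_cball_n cball_subset_cball_iff)
  also have "\<dots> = ennreal (\<omega> * (t ^ n - s ^ n))"
    using st by (simp add: emeasure_cball_n ennreal_minus less_imp_le right_diff_distrib)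
  finally have vol: "emeasure lborel ?A = ennreal (\<omega> * (t ^ n - s ^ n))" .
  have "emeasure (D r) ?A = emeasure (D r) (cball 0 t) - emeasure (D r) (cball 0 s)"
    using st r by (intro emeasure_Diff) (auto simp: D_ball cball_subset_cball_iff)
  also have "\<dots> = ennreal (\<omega> * r ^ n * (Gr r t - Gr r s))"
    using st r by (simp add: D_ball ennreal_minus right_diff_distrib)
  finally have D: "emeasure (D r) ?A = ennreal (\<omega> * r ^ n * (Gr r t - Gr r s))" .
  have "emeasure (D r) (cball 0 s) \<le> emeasure (D r) (cball 0 t)"
    using st by (intro emeasure_mono) (auto simp: cball_subset_cball_iff)
  then have "\<omega> * r ^ n * Gr r s \<le> \<omega> * r ^ n * Gr r t"
    using st r by (simp add: D_ball)
  then have Gle: "Gr r s \<le> Gr r t" using r by simp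
  have De: "emeasure (D r) ?A = (\<integral>\<^sup>+x. ennreal (g r (norm x)) * indicator ?A x \<partial>lborel)"
    unfolding D_def by (rule emeasure_density) auto
  have "ennreal (g r t * (\<omega> * (t ^ n - s ^ n))) = (\<integral>\<^sup>+x. ennreal (g r t) * indicator ?A x \<partial>lborel)"
    by (subst nn_integral_cmult_indicator) (auto simp: vol ennreal_mult')
  also have "\<dots> \<le> emeasure (D r) ?A"
    unfolding De using r
    by (intro nn_integral_mono) (auto split: split_indicator intro!: ennreal_leI g_antimono)
  finally have "g r t * (\<omega> * (t ^ n - s ^ n)) \<le> \<omega> * r ^ n * (Gr r t - Gr r s)"
    unfolding D using r Gle by (subst (asm) ennreal_le_iff) auto
  then show "w r t * (\<omega> * (t ^ n - s ^ n)) \<le> Gr r t - Gr r s"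
    using r by (simp add: w_def field_simps)
  have "emeasure (D r) ?A \<le> (\<integral>\<^sup>+x. ennreal (g r s) * indicator ?A x \<partial>lborel)"
    unfolding De using r
    by (intro nn_integral_mono) (auto split: split_indicator intro!: ennreal_leI g_antimono)
  also have "\<dots> = ennreal (g r s * (\<omega> * (t ^ n - s ^ n)))"
    by (subst nn_integral_cmult_indicator) (auto simp: vol ennreal_mult')
  finally have "\<omega> * r ^ n * (Gr r t - Gr r s) \<le> g r s * (\<omega> * (t ^ n - s ^ n))"
    unfolding D using r pw by (subst (asm) ennreal_le_iff) auto
  then show "Gr r t - Gr r s \<le> w r s * (\<omega> * (t ^ n - s ^ n))"
    using r by (simp add: w_def field_simps)
qed

lemma w_nonneg [simp]: "r > 0 \<Longrightarrow> w r t \<ge> 0"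
  using vol_pos[of r] by (simp add: w_def)

lemma w_log_concave:
  assumes "r > 0" "0 < l" "l < 1" "0 \<le> s" "0 \<le> t"
  shows "w r s powr l * w r t powr (1 - l) \<le> w r (l * s + (1 - l) * t)"
proof -
  let ?v = "\<omega> * r ^ n"
  have "w r s powr l * w r t powr (1 - l) = (g r s powr l * g r t powr (1 - l)) / (?v powr l * ?v powr (1 - l))"
    using assms vol_pos[of r] by (simp add: w_def powr_divide)
  also have "?v powr l * ?v powr (1 - l) = ?v"
    using vol_pos[of r] assms by (simp flip: powr_add)
  also have "(g r s powr l * g r t powr (1 - l)) / ?v \<le> g r (l * s + (1 - l) * t) / ?v"
    using vol_pos[of r] assms by (intro divide_right_mono g_log_concave) auto
  finally show ?thesis by (simp add: w_def)
qed

text \<open>Averaging spreads out a possible atom at the origin, so \<open>Gr r\<close> vanishes at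
  0 even when G does not.\<close>

lemma Gr_0 [simp]:
  assumes "r > 0"
  shows "Gr r 0 = 0"
proof -
  have "emeasure (D r) {0} = (\<integral>\<^sup>+y. emeasure lborel ({0} \<inter> cball y r) \<partial>\<gamma>)"
    using assms by (rule D_eq) auto
  also have "\<dots> = (\<integral>\<^sup>+y. 0 \<partial>\<gamma>)"
  proof (rule nn_integral_cong)
    fix y :: "real ^ 'n"
    have "emeasure lborel ({0} \<inter> cball y r) \<le> emeasure lborel {0 :: real ^ 'n}"
      by (rule emeasure_mono) auto
    then show "emeasure lborel ({0} \<inter> cball y r) = 0" by simp
  qed
  finally show ?thesis by (simp add: Gr_def measure_def)
qed

text \<open>The quotient G(t) / t^n is nonincreasing because the density is: beyond s the density is
  at most its value at s, within the ball of radius s at least that. An atom at the origin only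
  enlarges G(s), on the right side.\<close>

lemma G_growth:
  assumes s: "0 < s" and st: "s \<le> t"
  shows "G t * s ^ n \<le> G s * t ^ n"
proof -
  \<comment> \<open>The averaged form: moving the inner radius inward and the outer one outward by r
    absorbs the averaging.\<close>
  have ev: "(G t - G s) * (s - r) ^ n \<le> G s * ((t + r) ^ n - (s - r) ^ n)" if r: "0 < r" "r < s" for r
  proof -
    have "w r (s - r) * (\<omega> * ((s - r) ^ n - 0 ^ n)) \<le> Gr r (s - r) - Gr r 0"
      using r by (intro Gr_sandwich) auto
    also have "\<dots> \<le> G s" using Gr_upper[of r "s - r"] r by simp
    finally have 1: "w r (s - r) * (\<omega> * (s - r) ^ n) \<le> G s" by (simp add: power_0_left)
    have "(G t - G s) * (s - r) ^ n \<le> (Gr r (t + r) - Gr r (s - r)) * (s - r) ^ n"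
      using Gr_lower[of r "t + r"] Gr_upper[of r "s - r"] r st
      by (intro mult_right_mono) auto
    also have "\<dots> \<le> (w r (s - r) * (\<omega> * ((t + r) ^ n - (s - r) ^ n))) * (s - r) ^ n"
      using Gr_sandwich(2)[of r "s - r" "t + r"] r st by (intro mult_right_mono) auto
    also have "\<dots> = (w r (s - r) * (\<omega> * (s - r) ^ n)) * ((t + r) ^ n - (s - r) ^ n)" by simp
    also have "\<dots> \<le> G s * ((t + r) ^ n - (s - r) ^ n)"
      using 1 r st by (intro mult_right_mono) (auto intro!: power_mono)
    finally show ?thesis .
  qed
  have "(G t - G s) * s ^ n \<le> G s * (t ^ n - s ^ n)"
  proof (rule tendsto_le[of "at_right 0"])
    show "((\<lambda>r. G s * ((t + r) ^ n - (s - r) ^ n)) \<longlongrightarrow> G s * (t ^ n - s ^ n)) (at_right 0)"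
      by (auto intro!: tendsto_eq_intros)
    show "((\<lambda>r. (G t - G s) * (s - r) ^ n) \<longlongrightarrow> (G t - G s) * s ^ n) (at_right 0)"
      by (auto intro!: tendsto_eq_intros)
    show "\<forall>\<^sub>F r in at_right 0. (G t - G s) * (s - r) ^ n \<le> G s * ((t + r) ^ n - (s - r) ^ n)"
      using s by (auto simp: eventually_at_right_field intro!: exI[of _ s] ev)
  qed auto
  then show ?thesis by (simp add: algebra_simps)
qed

text \<open>Near t the value G(s) lies between G(t) and G(t) (s / t)^n, by monotonicity on one side
  and by \<open>G_growth\<close> on the other. Thus centred spheres of positive radius are null
  sets.\<close>

lemma G_continuous:
  assumes t: "0 < t"
  shows "isCont G t"
proof -
  let ?lo = "\<lambda>s. min (G t) (G t * (s / t) ^ n)" and ?hi = "\<lambda>s. max (G t) (G t * (s / t) ^ n)"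
  have b: "?lo s \<le> G s \<and> G s \<le> ?hi s" if s: "s > 0" for s
  proof (cases "s \<le> t")
    case True
    then show ?thesis
      using G_growth[of s t] G_mono[of s t] s t by (auto simp: power_divide field_simps min_le_iff_disj le_max_iff_disj)
  next
    case False
    then show ?thesis
      using G_growth[of t s] G_mono[of t s] s t by (auto simp: power_divide field_simps min_le_iff_disj le_max_iff_disj)
  qed
  have e: "eventually (\<lambda>s. s > 0) (at t)"
    using t by (auto intro: eventually_at_in_open' [of "{0<..}", THEN eventually_mono])
  have "(G \<longlongrightarrow> G t) (at t)"
  proof (rule tendsto_sandwich)
    show "\<forall>\<^sub>F s in at t. ?lo s \<le> G s" "\<forall>\<^sub>F s in at t. G s \<le> ?hi s"
      using e by (auto elim!: eventually_mono dest: b)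
    show "(?lo \<longlongrightarrow> G t) (at t)" "(?hi \<longlongrightarrow> G t) (at t)"
      using t by (auto intro!: tendsto_eq_intros)
  qed
  then show ?thesis by (simp add: isCont_def)
qed

lemma Gr_tendsto:
  assumes t: "t > 0"
  shows "((\<lambda>r. Gr r t) \<longlongrightarrow> G t) (at_right 0)"
proof (rule tendsto_sandwich)
  show "\<forall>\<^sub>F r in at_right 0. G (t - r) \<le> Gr r t" "\<forall>\<^sub>F r in at_right 0. Gr r t \<le> G (t + r)"
    using t by (auto simp: eventually_at_right_field intro!: exI[of _ t] Gr_lower Gr_upper)
  show "((\<lambda>r. G (t - r)) \<longlongrightarrow> G t) (at_right 0)" "((\<lambda>r. G (t + r)) \<longlongrightarrow> G t) (at_right 0)"
    using t by (auto intro!: isCont_tendsto_compose[OF G_continuous] tendsto_eq_intros)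
qed

section \<open>Difference quotients of the ball mass with respect to volume, and their limit\<close>

definition Q :: "real \<Rightarrow> real \<Rightarrow> real" where
  "Q s t = (G t - G s) / (\<omega> * (t ^ n - s ^ n))"

definition Qr :: "real \<Rightarrow> real \<Rightarrow> real \<Rightarrow> real" where
  "Qr r s t = (Gr r t - Gr r s) / (\<omega> * (t ^ n - s ^ n))"

lemma shell_pos: "0 \<le> s \<Longrightarrow> s < t \<Longrightarrow> 0 < \<omega> * (t ^ n - s ^ n)"
  by (simp add: power_strict_mono)

lemma Qr_tendsto:
  assumes "0 < s" "s < t"
  shows "((\<lambda>r. Qr r s t) \<longlongrightarrow> Q s t) (at_right 0)"
  unfolding Qr_def Q_def using assms shell_pos[of s t]
  by (intro tendsto_intros Gr_tendsto) auto

lemma Q_nonneg: "0 < s \<Longrightarrow> s < t \<Longrightarrow> 0 \<le> Q s t"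
  unfolding Q_def using shell_pos[of s t] G_mono[of s t] by simp

lemma Qr_w:
  assumes "r > 0" "0 \<le> s" "s < t"
  shows "w r t \<le> Qr r s t" "Qr r s t \<le> w r s"
  using Gr_sandwich[of r s t] shell_pos[of s t] assms by (auto simp: Qr_def pos_le_divide_eq pos_divide_le_eq)

text \<open>For the averaged quotients, the density \<open>w r t\<close> at the common radius
  separates the two shells; the inequality passes to the limit r -> 0.\<close>

lemma Q_antimono:
  assumes "0 < s" "s < t" "t < v"
  shows "Q t v \<le> Q s t"
proof (rule tendsto_le[of "at_right 0"])
  show "((\<lambda>r. Qr r s t) \<longlongrightarrow> Q s t) (at_right 0)" "((\<lambda>r. Qr r t v) \<longlongrightarrow> Q t v) (at_right 0)"
    using assms by (auto intro: Qr_tendsto)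
  show "\<forall>\<^sub>F r in at_right 0. Qr r t v \<le> Qr r s t"
    using eventually_at_right_less[of 0] by eventually_elim (use assms Qr_w order_trans in \<open>metis less_imp_le less_trans\<close>)
qed auto

text \<open>The density of \<gamma> at distance t from the origin, obtained as the left derivative of G with
  respect to the volume of the ball.\<close>

definition \<phi> :: "real \<Rightarrow> real" where
  "\<phi> t = (INF s\<in>{0<..<t}. Q s t)"

lemma phi_le: "0 < s \<Longrightarrow> s < t \<Longrightarrow> \<phi> t \<le> Q s t"
  unfolding \<phi>_def by (rule cINF_lower) (auto intro!: bdd_belowI2[of _ 0] Q_nonneg)

lemma phi_greatest: "0 < t \<Longrightarrow> (\<And>s. 0 < s \<Longrightarrow> s < t \<Longrightarrow> m \<le> Q s t) \<Longrightarrow> m \<le> \<phi> t"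
  unfolding \<phi>_def using dense[of 0 t] by (intro cINF_greatest) auto

lemma Q_le_phi: "0 < s \<Longrightarrow> s < t \<Longrightarrow> Q s t \<le> \<phi> s"
  by (auto intro: phi_greatest Q_antimono)

lemma phi_nonneg: "0 < t \<Longrightarrow> 0 \<le> \<phi> t"
  by (auto intro: phi_greatest Q_nonneg)

lemma phi_antimono: "0 < s \<Longrightarrow> s \<le> t \<Longrightarrow> \<phi> t \<le> \<phi> s"
  using phi_le[of s t] Q_le_phi[of s t] by (cases "s = t") auto

text \<open>Log-concavity is available for \<open>w r\<close>, while convergence is available only
  for quotients over shells. Each density value is therefore traded for the mean over a thin
  shell.\<close>

lemma phi_log_concave:
  assumes xy: "0 < x" "0 < y" and l: "0 < l" "l < 1"
  shows "\<phi> x powr l * \<phi> y powr (1 - l) \<le> \<phi> (l * x + (1 - l) * y)"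
proof (cases "\<phi> x = 0 \<or> \<phi> y = 0")
  case True
  then show ?thesis using phi_nonneg[of "l * x + (1 - l) * y"] assms by (auto simp: add_pos_pos)
next
  case False
  then have pos: "\<phi> x > 0" "\<phi> y > 0" using phi_nonneg xy by (metis less_eq_real_def)+
  let ?z = "l * x + (1 - l) * y"
  have z: "?z > 0" using assms by (simp add: add_pos_pos)
  show ?thesis
  proof (rule phi_greatest[OF z])
    fix s assume s: "0 < s" "s < ?z"
    define d where "d = Min {x, y, ?z - s}"
    have d: "d > 0" "d \<le> x" "d \<le> y" "d \<le> ?z - s" using xy s by (auto simp: d_def)
    \<comment> \<open>The limit r -> 0 is taken first, with shells of width h just inside x and y.
      Their inner radii x - h and y - h combine to z - h, the outer radius of the shell that starts
      at s. Only then does h tend to 0.\<close>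
    have *: "\<phi> x powr l * \<phi> y powr (1 - l) \<le> Q s (?z - h)" if h: "0 < h" "h < d" for h
    proof -
      have Qpos: "Q (x - h) x > 0" "Q (y - h) y > 0"
        using phi_le[of "x - h" x] phi_le[of "y - h" y] pos h d by auto
      have "Q (x - h) x powr l * Q (y - h) y powr (1 - l) \<le> Q s (?z - h)"
      proof (rule tendsto_le[of "at_right 0"])
        show "((\<lambda>r. Qr r s (?z - h)) \<longlongrightarrow> Q s (?z - h)) (at_right 0)"
          using s h d by (auto intro: Qr_tendsto)
        show "((\<lambda>r. Qr r (x - h) x powr l * Qr r (y - h) y powr (1 - l)) \<longlongrightarrow>
            Q (x - h) x powr l * Q (y - h) y powr (1 - l)) (at_right 0)"
          using Qpos h d by (auto intro!: tendsto_intros Qr_tendsto)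
        show "\<forall>\<^sub>F r in at_right 0.
            Qr r (x - h) x powr l * Qr r (y - h) y powr (1 - l) \<le> Qr r s (?z - h)"
          using eventually_at_right_less[of 0]
        proof eventually_elim
          case (elim r)
          have nn: "0 \<le> Qr r (x - h) x" "0 \<le> Qr r (y - h) y"
            using Qr_w(1)[of r "x - h" x] Qr_w(1)[of r "y - h" y] h d elim
              w_nonneg[of r x] w_nonneg[of r y] by linarith+
          have "Qr r (x - h) x powr l * Qr r (y - h) y powr (1 - l)
              \<le> w r (x - h) powr l * w r (y - h) powr (1 - l)"
            using nn Qr_w(2)[of r "x - h" x] Qr_w(2)[of r "y - h" y] h d l elim
            by (intro mult_mono powr_mono2) auto
          also have "\<dots> \<le> w r (l * (x - h) + (1 - l) * (y - h))"
            using elim l h d by (intro w_log_concave) auto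
          also have "l * (x - h) + (1 - l) * (y - h) = ?z - h" by (simp add: algebra_simps)
          also have "w r (?z - h) \<le> Qr r s (?z - h)"
            using elim h d s by (intro Qr_w) auto
          finally show ?case .
        qed
      qed auto
      moreover have "\<phi> x powr l * \<phi> y powr (1 - l) \<le> Q (x - h) x powr l * Q (y - h) y powr (1 - l)"
        using pos h d l phi_le[of "x - h" x] phi_le[of "y - h" y]
        by (intro mult_mono powr_mono2) auto
      ultimately show ?thesis by linarith
    qed
    show "\<phi> x powr l * \<phi> y powr (1 - l) \<le> Q s ?z"
    proof (rule tendsto_le[of "at_right 0"])
      have "((\<lambda>h. G (?z - h)) \<longlongrightarrow> G ?z) (at_right 0)"
        using z by (auto intro!: isCont_tendsto_compose[OF G_continuous] tendsto_eq_intros)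
      then show "((\<lambda>h. Q s (?z - h)) \<longlongrightarrow> Q s ?z) (at_right 0)"
        unfolding Q_def using s shell_pos[of s ?z] by (auto intro!: tendsto_eq_intros)
      show "((\<lambda>h. \<phi> x powr l * \<phi> y powr (1 - l)) \<longlongrightarrow> \<phi> x powr l * \<phi> y powr (1 - l)) (at_right 0)"
        by simp
      show "\<forall>\<^sub>F h in at_right 0. \<phi> x powr l * \<phi> y powr (1 - l) \<le> Q s (?z - h)"
        using d(1) by (auto simp: eventually_at_right_field intro!: exI[of _ d] *)
    qed auto
  qed
qed

text \<open>Log-concavity at 0, a/2 and a bounds the averaged density at 0 by (w r (a/2))^2 / w r a,
  and this stays bounded as r -> 0. So a positive density at some T rules out an atom at the
  origin.\<close>

lemma G_le_power:
  assumes T: "0 < T" "\<phi> T > 0"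
  shows "\<exists>M. \<forall>t>0. G t \<le> M * t ^ n"
proof -
  define a where "a = T / 2"
  \<comment> \<open>As \<open>w r\<close> is decreasing, a shell outside radius a bounds
    \<open>w r a\<close> from below, and a shell inside radius a/2 bounds \<open>w r (a / 2)\<close>
    from above.\<close>
  define q where "q = Q a T"
  define p where "p = Q (a / 4) (a / 2)"
  have a: "a > 0" "a < T" using T by (auto simp: a_def)
  have q: "q > 0" using phi_le[of a T] T a by (simp add: q_def)
  define M where "M = (p + 1) ^ 2 / (q / 2)"
  have "\<forall>\<^sub>F r in at_right 0. Qr r a T > q / 2"
    using order_tendstoD(1)[OF Qr_tendsto[of a T], of "q / 2"] a q by (auto simp: q_def)
  moreover have "\<forall>\<^sub>F r in at_right 0. Qr r (a / 4) (a / 2) < p + 1"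
    using order_tendstoD(2)[OF Qr_tendsto[of "a / 4" "a / 2"], of "p + 1"] a by (auto simp: p_def)
  ultimately have ev: "\<forall>\<^sub>F r in at_right 0. w r 0 \<le> M"
    using eventually_at_right_less[of 0]
  proof eventually_elim
    case (elim r)
    have 1: "w r a \<ge> q / 2" using elim a Qr_w(2)[of r a T] by auto
    have 2: "w r (a / 2) \<le> p + 1" using elim a Qr_w(1)[of r "a / 4" "a / 2"] by auto
    have "w r 0 powr (1/2) * w r a powr (1 - 1/2) \<le> w r ((1/2) * 0 + (1 - 1/2) * a)"
      using elim a by (intro w_log_concave) auto
    then have "sqrt (w r 0) * sqrt (w r a) \<le> w r (a / 2)"
      using elim by (simp add: powr_half_sqrt)
    also have "\<dots> \<le> p + 1" by (rule 2)
    finally have "(sqrt (w r 0) * sqrt (w r a)) ^ 2 \<le> (p + 1) ^ 2"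
      using elim by (intro power_mono) auto
    then have "w r 0 * w r a \<le> (p + 1) ^ 2"
      using elim by (simp add: power_mult_distrib)
    moreover have "w r 0 * (q / 2) \<le> w r 0 * w r a"
      using 1 elim by (intro mult_left_mono) auto
    ultimately show ?case using q by (simp add: M_def field_simps)
  qed
  have "G t \<le> (M * \<omega>) * t ^ n" if t: "t > 0" for t
  proof (rule tendsto_le[OF _ tendsto_const Gr_tendsto[OF t]])
    show "\<forall>\<^sub>F r in at_right 0. Gr r t \<le> M * \<omega> * t ^ n"
      using ev eventually_at_right_less[of 0]
    proof eventually_elim
      case (elim r)
      have "Gr r t \<le> w r 0 * (\<omega> * t ^ n)"
        using Gr_sandwich(2)[of r 0 t] elim t by (simp add: power_0_left)
      also have "\<dots> \<le> M * (\<omega> * t ^ n)"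
        using elim t by (intro mult_right_mono) (auto intro: less_imp_le)
      finally show ?case by (simp add: mult_ac)
    qed
  qed auto
  then show ?thesis by blast
qed

end

section \<open>Star bodies and radial functions\<close>

lemma power_diff_bounds:
  fixes a b :: real
  assumes "0 \<le> a" "a \<le> b"
  shows "real n * a ^ (n - 1) * (b - a) \<le> b ^ n - a ^ n"
    and "b ^ n - a ^ n \<le> real n * b ^ (n - 1) * (b - a)"
proof -
  have "real n * a ^ (n - 1) * (b - a) \<le> b ^ n - a ^ n \<and> b ^ n - a ^ n \<le> real n * b ^ (n - 1) * (b - a)"
  proof (cases "a = b")
    case False
    with assms have "a < b" by simp
    then obtain z where z: "a < z" "z < b" "b ^ n - a ^ n = (b - a) * (real n * z ^ (n - 1))"
      using MVT2[of a b "\<lambda>x. x ^ n" "\<lambda>x. real n * x ^ (n - 1)"] by (auto intro!: derivative_eq_intros)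
    have "a ^ (n - 1) \<le> z ^ (n - 1)" "z ^ (n - 1) \<le> b ^ (n - 1)"
      using z assms by (auto intro!: power_mono)
    then show ?thesis
      unfolding z(3) using \<open>a < b\<close>
      by (auto simp: mult_ac intro!: mult_left_mono)
  qed simp
  then show "real n * a ^ (n - 1) * (b - a) \<le> b ^ n - a ^ n"
    "b ^ n - a ^ n \<le> real n * b ^ (n - 1) * (b - a)" by auto
qed

text \<open>Summing over an equidistant partition, the total error telescopes.\<close>

lemma constant_if_increments_small:
  fixes D p :: "real \<Rightarrow> real"
  assumes st: "s \<le> t"
    and D: "\<And>a b. s \<le> a \<Longrightarrow> a \<le> b \<Longrightarrow> b \<le> t \<Longrightarrow> \<bar>D b - D a\<bar> \<le> C * (b - a) * (p a - p b)"
  shows "D t = D s"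
proof -
  define K where "K = C * (t - s) * (p s - p t)"
  have *: "real N * \<bar>D t - D s\<bar> \<le> K" if N: "N > 0" for N :: nat
  proof -
    define x where "x i = s + real i * (t - s) / real N" for i
    define h where "h = (t - s) / real N"
    have xs: "x (Suc i) - x i = h" for i by (simp add: x_def h_def add_divide_distrib diff_divide_distrib algebra_simps)
    have xb: "s \<le> x i" "x i \<le> t" if "i \<le> N" for i
    proof -
      have "real i * (t - s) \<le> real N * (t - s)" using that st by (intro mult_right_mono) auto
      then have "real i * (t - s) / real N \<le> t - s"
        using N by (simp add: pos_divide_le_eq mult.commute)
      moreover have "0 \<le> real i * (t - s) / real N" using st by simp
      ultimately show "s \<le> x i" "x i \<le> t" unfolding x_def by linarith+
    qed
    have h: "h \<ge> 0" using st by (simp add: h_def)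
    have "D t - D s = (\<Sum>i<N. D (x (Suc i)) - D (x i))"
      using N by (subst sum_lessThan_telescope) (simp add: x_def)
    also have "\<bar>\<dots>\<bar> \<le> (\<Sum>i<N. \<bar>D (x (Suc i)) - D (x i)\<bar>)" by (rule sum_abs)
    also have "\<dots> \<le> (\<Sum>i<N. C * h * (p (x i) - p (x (Suc i))))"
    proof (rule sum_mono)
      fix i assume "i \<in> {..<N}"
      then have "\<bar>D (x (Suc i)) - D (x i)\<bar> \<le> C * (x (Suc i) - x i) * (p (x i) - p (x (Suc i)))"
        using xs[of i] h xb[of i] xb[of "Suc i"] by (intro D) auto
      then show "\<bar>D (x (Suc i)) - D (x i)\<bar> \<le> C * h * (p (x i) - p (x (Suc i)))"
        by (simp add: xs)
    qed
    also have "\<dots> = C * h * (p (x 0) - p (x N))"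
      by (subst sum_lessThan_telescope' [symmetric]) (simp add: sum_distrib_left)
    also have "\<dots> = K / real N"
      using N by (simp add: x_def h_def K_def)
    finally show ?thesis using N by (simp add: field_simps)
  qed
  have "\<bar>D t - D s\<bar> \<le> 0"
  proof (rule ccontr)
    assume "\<not> \<bar>D t - D s\<bar> \<le> 0"
    then have pos: "\<bar>D t - D s\<bar> > 0" by simp
    then obtain N where N: "real N * \<bar>D t - D s\<bar> > K"
      using reals_Archimedean3 by blast
    have "real (Suc N) * \<bar>D t - D s\<bar> > K"
      using N pos by (simp add: distrib_right)
    with *[of "Suc N"] show False by simp
  qed
  then show ?thesis by simp
qed

text \<open>The value 0 off the unit sphere makes this a Borel function on the whole space, which
  carries \<open>sphere_law\<close>.\<close>

definition radial :: "'a::euclidean_space set \<Rightarrow> 'a \<Rightarrow> real" where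
  "radial K u = (if norm u = 1 then Sup {t. 0 \<le> t \<and> t *\<^sub>R u \<in> K} else 0)"

definition star_body :: "'a::euclidean_space set \<Rightarrow> bool" where
  "star_body K \<longleftrightarrow> compact K \<and> convex K \<and> (\<exists>\<eta>>0. cball 0 \<eta> \<subseteq> K)"

lemma star_bodyE:
  assumes "star_body K"
  obtains \<eta> where "\<eta> > 0" "cball 0 \<eta> \<subseteq> K"
  using assms by (auto simp: star_body_def)

lemma zero_in_star_body: "star_body K \<Longrightarrow> 0 \<in> K"
  by (auto simp: star_body_def)

lemma radial_iff:
  assumes K: "star_body K" and u: "norm u = 1" and t: "0 \<le> t"
  shows "t *\<^sub>R u \<in> K \<longleftrightarrow> t \<le> radial K u"
proof -
  let ?S = "{t. 0 \<le> t \<and> t *\<^sub>R u \<in> K}"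
  have "bounded K" using K by (simp add: star_body_def compact_imp_bounded)
  then obtain b where b: "\<And>x. x \<in> K \<Longrightarrow> norm x \<le> b" by (auto simp: bounded_iff)
  have bdd: "bdd_above ?S"
  proof (rule bdd_aboveI)
    fix t assume "t \<in> ?S"
    then show "t \<le> b" using b[of "t *\<^sub>R u"] u by simp
  qed
  have "?S = {0..} \<inter> (\<lambda>t. t *\<^sub>R u) -` K" by auto
  moreover have "closed ((\<lambda>t. t *\<^sub>R u) -` K)"
    using K by (intro continuous_closed_vimage compact_imp_closed) (auto simp: star_body_def)
  ultimately have "closed ?S" by (simp only: closed_Int closed_atLeast)
  moreover have ne: "?S \<noteq> {}" using zero_in_star_body[OF K] by (auto intro!: exI[of _ 0])
  ultimately have Sup: "Sup ?S \<in> ?S" using bdd by (intro closed_contains_Sup)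
  show ?thesis
  proof
    assume "t *\<^sub>R u \<in> K"
    then show "t \<le> radial K u"
      using t u bdd by (auto simp: radial_def intro!: cSup_upper)
  next
    assume le: "t \<le> radial K u"
    define \<rho> where "\<rho> = radial K u"
    have \<rho>: "\<rho> *\<^sub>R u \<in> K" "0 \<le> \<rho>" using Sup u by (auto simp: \<rho>_def radial_def)
    show "t *\<^sub>R u \<in> K"
    proof (cases "\<rho> = 0")
      case True
      then show ?thesis using le t \<rho> by (simp add: \<rho>_def)
    next
      case False
      have "t *\<^sub>R u = (t / \<rho>) *\<^sub>R (\<rho> *\<^sub>R u) + (1 - t / \<rho>) *\<^sub>R 0"
        using False by simp
      moreover have "t / \<rho> \<le> 1" "0 \<le> t / \<rho>" using le \<rho> t False by (auto simp: \<rho>_def)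
      ultimately show ?thesis
        using K \<rho> zero_in_star_body[OF K] convexD_alt[of K 0 "\<rho> *\<^sub>R u" "t / \<rho>"]
        by (auto simp: star_body_def add.commute)
    qed
  qed
qed

lemma radial_eqI:
  assumes "star_body K" "norm u = 1" "0 \<le> t" "\<And>s. 0 \<le> s \<Longrightarrow> s *\<^sub>R u \<in> K \<longleftrightarrow> s \<le> t"
  shows "radial K u = t"
proof (rule antisym)
  have "0 \<le> radial K u"
    using radial_iff[OF assms(1,2), of 0] zero_in_star_body[OF assms(1)] by simp
  then show "radial K u \<le> t" using assms radial_iff[OF assms(1,2), of "radial K u"] by auto
  show "t \<le> radial K u" using assms radial_iff[OF assms(1,2), of t] by auto
qed

lemma radial_ge:
  assumes "star_body K" "norm u = 1" "cball 0 \<eta> \<subseteq> K" "0 \<le> \<eta>"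
  shows "\<eta> \<le> radial K u"
  using assms by (subst radial_iff[symmetric]) (auto simp: subset_iff)

lemma radial_nonneg: "star_body K \<Longrightarrow> 0 \<le> radial K u"
  using radial_ge[of K u 0] by (cases "norm u = 1") (auto simp: radial_def zero_in_star_body)

lemma radial_pos: "star_body K \<Longrightarrow> norm u = 1 \<Longrightarrow> 0 < radial K u"
  by (meson less_le_trans less_imp_le radial_ge star_bodyE)

lemma radial_le:
  assumes "star_body K" "K \<subseteq> cball 0 b" "0 \<le> b"
  shows "radial K u \<le> b"
proof (cases "norm u = 1")
  case True
  then have "radial K u *\<^sub>R u \<in> K"
    using assms radial_iff radial_nonneg by blast
  then show ?thesis using assms True radial_nonneg[OF assms(1), of u] by (force simp: subset_iff)
qed (use assms in \<open>simp add: radial_def\<close>)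

lemma star_body_bounded:
  assumes "star_body K"
  obtains b where "0 < b" "K \<subseteq> cball 0 b"
proof -
  have "bounded K" using assms by (auto simp: star_body_def compact_imp_bounded)
  then obtain b where "0 < b" "K \<subseteq> cball 0 b"
    unfolding bounded_pos by (auto simp: subset_iff)
  then show thesis using that by blast
qed

lemma borel_measurable_radial [measurable]:
  assumes K: "star_body K"
  shows "radial K \<in> borel_measurable borel"
proof (rule borel_measurableI_ge)
  fix t
  have "{u. t \<le> radial K u} \<in> sets borel"
  proof (cases "t \<le> 0")
    case True
    then have "{u. t \<le> radial K u} = UNIV" using radial_nonneg[OF K] order_trans by blast
    then show ?thesis by simp
  next
    case False
    then have "{u. t \<le> radial K u} = sphere 0 1 \<inter> (\<lambda>u. t *\<^sub>R u) -` K"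
      using radial_iff[OF K] by (auto simp: radial_def split: if_splits)
    moreover have "closed ((\<lambda>u. t *\<^sub>R u) -` K)"
      using K by (intro continuous_closed_vimage compact_imp_closed) (auto simp: star_body_def)
    ultimately show ?thesis by simp
  qed
  then show "{u \<in> space borel. t \<le> radial K u} \<in> sets borel" by simp
qed

lemma star_body_eq_Collect:
  assumes K: "star_body K"
  shows "K = {x. norm x \<le> radial K (sgn x)}"
proof -
  have "x \<in> K \<longleftrightarrow> norm x \<le> radial K (sgn x)" for x
  proof (cases "x = 0")
    case True
    then show ?thesis using zero_in_star_body[OF K] radial_nonneg[OF K] by simp
  next
    case False
    then show ?thesis using radial_iff[OF K, of "sgn x" "norm x"] by (simp add: norm_sgn sgn_div_norm)
  qed
  then show ?thesis by blast
qed

lemma star_body_scale: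
  assumes K: "star_body K" and c: "c > 0"
  shows "star_body ((*\<^sub>R) c ` K)"
proof -
  obtain \<eta> where e: "\<eta> > 0" "cball 0 \<eta> \<subseteq> K" using K by (rule star_bodyE)
  have "cball 0 (c * \<eta>) \<subseteq> (*\<^sub>R) c ` K"
  proof
    fix x :: 'a assume "x \<in> cball 0 (c * \<eta>)"
    then have "x /\<^sub>R c \<in> K" using e c by (auto simp: field_simps)
    then show "x \<in> (*\<^sub>R) c ` K" using c by (intro image_eqI[of _ _ "x /\<^sub>R c"]) auto
  qed
  moreover have "c * \<eta> > 0" using c e by simp
  ultimately show ?thesis
    using K unfolding star_body_def by (blast intro: compact_scaling convex_scaling)
qed

lemma radial_scale:
  assumes K: "star_body K" and c: "c > 0"
  shows "radial ((*\<^sub>R) c ` K) u = c * radial K u"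
proof (cases "norm u = 1")
  case True
  show ?thesis
  proof (rule radial_eqI[OF star_body_scale[OF K c] True])
    show "0 \<le> c * radial K u" using c radial_nonneg[OF K] by simp
    fix s :: real assume s: "0 \<le> s"
    have "s *\<^sub>R u \<in> (*\<^sub>R) c ` K \<longleftrightarrow> (s / c) *\<^sub>R u \<in> K"
    proof
      assume "(s / c) *\<^sub>R u \<in> K"
      then show "s *\<^sub>R u \<in> (*\<^sub>R) c ` K"
        using c by (intro image_eqI[of _ _ "(s / c) *\<^sub>R u"]) auto
    next
      assume "s *\<^sub>R u \<in> (*\<^sub>R) c ` K"
      then obtain k where k: "k \<in> K" "s *\<^sub>R u = c *\<^sub>R k" by auto
      have "(s / c) *\<^sub>R u = (1 / c) *\<^sub>R (s *\<^sub>R u)" by simp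
      also have "\<dots> = k" unfolding k(2) using c by simp
      finally show "(s / c) *\<^sub>R u \<in> K" using k by simp
    qed
    also have "\<dots> \<longleftrightarrow> s / c \<le> radial K u" using radial_iff[OF K True] s c by simp
    finally show "s *\<^sub>R u \<in> (*\<^sub>R) c ` K \<longleftrightarrow> s \<le> c * radial K u"
      using c by (simp add: field_simps)
  qed
qed (simp add: radial_def)

lemma star_body_sum:
  fixes A B :: "'a::euclidean_space set"
  assumes A: "star_body A" and B: "star_body B" and l: "0 < l" "l < 1"
  shows "star_body ((*\<^sub>R) l ` A + (*\<^sub>R) (1 - l) ` B)"
proof -
  obtain \<eta> where e: "\<eta> > 0" "cball 0 \<eta> \<subseteq> (*\<^sub>R) l ` A"
    using star_body_scale[OF A l(1)] by (rule star_bodyE)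
  have "0 \<in> (*\<^sub>R) (1 - l) ` B" using zero_in_star_body[OF B] by force
  then have "(*\<^sub>R) l ` A \<subseteq> (*\<^sub>R) l ` A + (*\<^sub>R) (1 - l) ` B"
    using set_zero_plus2 by (metis set_plus_intro add.right_neutral subsetI)
  with e show ?thesis
    using A B unfolding star_body_def
    by (auto intro!: compact_scaled_sum convex_set_plus convex_scaling)
qed

lemma star_body_Int_cball:
  assumes K: "star_body K" and R: "R > 0"
  shows "star_body (K \<inter> cball 0 R)"
proof -
  obtain \<eta> where e: "\<eta> > 0" "cball 0 \<eta> \<subseteq> K" using K by (rule star_bodyE)
  then have "cball 0 (min \<eta> R) \<subseteq> K \<inter> cball 0 R" "min \<eta> R > 0" using R by auto
  then show ?thesis
    using K unfolding star_body_def by (blast intro: compact_Int_closed closed_cball convex_Int convex_cball)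
qed

lemma radial_Int_cball:
  assumes K: "star_body K" and R: "R > 0"
  shows "radial (K \<inter> cball 0 R) u = min (radial K u) R"
proof (cases "norm u = 1")
  case True
  show ?thesis
    by (rule radial_eqI[OF star_body_Int_cball[OF K R] True])
       (use True R radial_nonneg[OF K, of u] radial_iff[OF K True] in auto)
qed (use R in \<open>simp add: radial_def\<close>)

lemma radial_mono:
  assumes "star_body A" "star_body B" "A \<subseteq> B"
  shows "radial A u \<le> radial B u"
proof (cases "norm u = 1")
  case True
  have "radial A u *\<^sub>R u \<in> B" using assms radial_iff[OF assms(1) True] radial_nonneg[OF assms(1)] by blast
  then show ?thesis using radial_iff[OF assms(2) True] radial_nonneg[OF assms(1)] by blast
qed (simp add: radial_def)

lemma radial_sum_ge:
  fixes A B :: "'a::euclidean_space set"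
  assumes A: "star_body A" and B: "star_body B" and l: "0 < l" "l < 1"
  shows "l * radial A u + (1 - l) * radial B u \<le> radial ((*\<^sub>R) l ` A + (*\<^sub>R) (1 - l) ` B) u"
proof (cases "norm u = 1")
  case True
  have "radial A u *\<^sub>R u \<in> A" "radial B u *\<^sub>R u \<in> B"
    using A B radial_iff[OF A True] radial_iff[OF B True] radial_nonneg by blast+
  then have "l *\<^sub>R (radial A u *\<^sub>R u) + (1 - l) *\<^sub>R (radial B u *\<^sub>R u) \<in> (*\<^sub>R) l ` A + (*\<^sub>R) (1 - l) ` B"
    by (intro set_plus_intro imageI)
  then have "(l * radial A u + (1 - l) * radial B u) *\<^sub>R u \<in> (*\<^sub>R) l ` A + (*\<^sub>R) (1 - l) ` B"
    by (simp add: scaleR_add_left)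
  then show ?thesis
    using radial_iff[OF star_body_sum[OF A B l] True] l radial_nonneg[OF A, of u] radial_nonneg[OF B, of u]
    by simp
qed (simp add: radial_def)

text \<open>A point within \<eta> d of (1 - d) k is a convex combination of k and a point of the
  ball of radius \<eta>. Together with \<open>star_body_expand\<close>, a shift of the boundary by
  \<eta> d is thus bounded by a dilation.\<close>

lemma star_body_shrink:
  assumes K: "star_body K" and e: "cball 0 \<eta> \<subseteq> K" and d: "0 < d" "d < 1"
    and x: "x \<in> (*\<^sub>R) (1 - d) ` K"
  shows "cball x (\<eta> * d) \<subseteq> K"
proof
  fix y assume y: "y \<in> cball x (\<eta> * d)"
  from x obtain k where k: "k \<in> K" "x = (1 - d) *\<^sub>R k" by auto
  define z where "z = (y - x) /\<^sub>R d"
  have "norm z = norm (x - y) / d" using d by (simp add: z_def norm_minus_commute divide_inverse)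
  then have "norm z \<le> \<eta>" using y d by (simp add: dist_norm pos_divide_le_eq)
  then have "z \<in> K" using e by (auto simp: subset_iff)
  moreover have "y = (1 - d) *\<^sub>R k + d *\<^sub>R z" using d k by (simp add: z_def)
  ultimately show "y \<in> K" using K k d by (auto simp: star_body_def intro!: convexD)
qed

lemma star_body_expand:
  assumes K: "star_body K" and e: "cball 0 \<eta> \<subseteq> K" and d: "0 < d"
    and x: "x \<in> K"
  shows "cball x (\<eta> * d) \<subseteq> (*\<^sub>R) (1 + d) ` K"
proof
  fix y assume y: "y \<in> cball x (\<eta> * d)"
  define z where "z = (y - x) /\<^sub>R d"
  have "norm z = norm (x - y) / d" using d by (simp add: z_def norm_minus_commute divide_inverse)
  then have "norm z \<le> \<eta>" using y d by (simp add: dist_norm pos_divide_le_eq)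
  then have z: "z \<in> K" using e by (auto simp: subset_iff)
  have "(1 / (1 + d)) *\<^sub>R x + (d / (1 + d)) *\<^sub>R z \<in> K"
    using K z x d by (intro convexD) (auto simp: star_body_def field_simps)
  moreover have "y = (1 + d) *\<^sub>R ((1 / (1 + d)) *\<^sub>R x + (d / (1 + d)) *\<^sub>R z)"
    using d by (simp add: z_def scaleR_add_right)
  ultimately show "y \<in> (*\<^sub>R) (1 + d) ` K" by blast
qed

section \<open>The ball mass as an integral of the density\<close>

context rot_log_concave
begin

lemma G_increment:
  assumes "0 < s" "s \<le> t"
  shows "\<omega> * (t ^ n - s ^ n) * \<phi> t \<le> G t - G s" "G t - G s \<le> \<omega> * (t ^ n - s ^ n) * \<phi> s"
proof -
  have "\<omega> * (t ^ n - s ^ n) * \<phi> t \<le> G t - G s \<and> G t - G s \<le> \<omega> * (t ^ n - s ^ n) * \<phi> s"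
  proof (cases "s = t")
    case False
    then have st: "0 < s" "s < t" using assms by auto
    have "\<phi> t \<le> Q s t" "Q s t \<le> \<phi> s" using st by (auto intro: phi_le Q_le_phi)
    then show ?thesis
      unfolding Q_def using shell_pos[of s t] st by (simp add: pos_le_divide_eq pos_divide_le_eq mult.commute)
  qed simp
  then show "\<omega> * (t ^ n - s ^ n) * \<phi> t \<le> G t - G s" "G t - G s \<le> \<omega> * (t ^ n - s ^ n) * \<phi> s"
    by auto
qed

lemma power_has_integral:
  fixes a b :: real
  assumes "a \<le> b"
  shows "((\<lambda>x. real n * x ^ (n - 1)) has_integral (b ^ n - a ^ n)) {a..b}"
  using assms by (intro fundamental_theorem_of_calculus)
    (auto intro!: derivative_eq_intros simp flip: has_real_derivative_iff_has_vector_derivative)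

text \<open>The second mean value theorem makes the product of a monotone and an integrable function
  integrable; the sign is changed because \<phi> decreases.\<close>

lemma phi_integrable:
  assumes "0 < s" "s \<le> t"
  shows "(\<lambda>x. real n * \<omega> * x ^ (n - 1) * \<phi> x) integrable_on {s..t}"
proof -
  define f where "f x = real n * x ^ (n - 1)" for x :: real
  have "f integrable_on {s..t}"
    using power_has_integral[OF assms(2)] unfolding f_def by blast
  then obtain c where "((\<lambda>x. (- \<phi> x) * f x) has_integral
      ((- \<phi> s) * integral {s..c} f + (- \<phi> t) * integral {c..t} f)) {s..t}"
  proof (rule second_mean_value_theorem_full[where g = "\<lambda>x. - \<phi> x"])
    show "- \<phi> x \<le> - \<phi> y" if "s \<le> x" "x \<le> y" "y \<le> t" for x y
      using that assms by (auto intro: phi_antimono)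
  qed (use assms in auto)
  then have "(\<lambda>x. (- \<phi> x) * f x) integrable_on {s..t}" by blast
  from integrable_on_cmult_left[OF this, of "- \<omega>"] show ?thesis
    by (simp add: f_def mult_ac)
qed

text \<open>Over a short interval the increments of G and of the integral both lie between the shell
  volume times \<phi> at either end. They differ by at most a constant times (b - a) (\<phi>(a) -
  \<phi>(b)), and such errors sum to nothing. No differentiability of G enters.\<close>

lemma G_has_integral:
  assumes st: "0 < s" "s \<le> t"
  shows "((\<lambda>x. real n * \<omega> * x ^ (n - 1) * \<phi> x) has_integral (G t - G s)) {s..t}"
proof -
  let ?q = "\<lambda>x. real n * \<omega> * x ^ (n - 1) * \<phi> x"
  define D where "D b = G b - integral {s..b} ?q" for b
  have "D t = D s"
  proof (rule constant_if_increments_small[OF st(2)])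
    fix a b assume ab: "s \<le> a" "a \<le> b" "b \<le> t"
    then have a: "0 < a" using st by simp
    have int: "?q integrable_on {a..b}" using phi_integrable a ab by simp
    have "integral {s..a} ?q + integral {a..b} ?q = integral {s..b} ?q"
      using ab st phi_integrable[of s b] by (intro Henstock_Kurzweil_Integration.integral_combine) auto
    then have Dd: "D b - D a = (G b - G a) - integral {a..b} ?q" by (simp add: D_def)
    have hi: "((\<lambda>x. (real n * x ^ (n - 1)) * (\<omega> * c)) has_integral (b ^ n - a ^ n) * (\<omega> * c)) {a..b}" for c
      using power_has_integral[OF ab(2)] by (intro has_integral_mult_left)
    have up: "integral {a..b} ?q \<le> (b ^ n - a ^ n) * (\<omega> * \<phi> a)"
    proof (rule has_integral_le[OF integrable_integral[OF int] hi])
      fix x assume "x \<in> {a..b}"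
      then show "?q x \<le> (real n * x ^ (n - 1)) * (\<omega> * \<phi> a)"
        using a phi_antimono[of a x] by (auto simp: mult.assoc intro!: mult_left_mono)
    qed
    have lo: "(b ^ n - a ^ n) * (\<omega> * \<phi> b) \<le> integral {a..b} ?q"
    proof (rule has_integral_le[OF hi integrable_integral[OF int]])
      fix x assume "x \<in> {a..b}"
      then show "(real n * x ^ (n - 1)) * (\<omega> * \<phi> b) \<le> ?q x"
        using a phi_antimono[of x b] by (auto simp: mult.assoc intro!: mult_left_mono)
    qed
    have "\<bar>D b - D a\<bar> \<le> (b ^ n - a ^ n) * \<omega> * (\<phi> a - \<phi> b)"
      unfolding Dd using G_increment[OF a ab(2)] up lo by (simp add: abs_le_iff algebra_simps)
    also have "\<dots> \<le> (real n * t ^ (n - 1) * (b - a)) * \<omega> * (\<phi> a - \<phi> b)"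
    proof -
      have "b ^ n - a ^ n \<le> real n * b ^ (n - 1) * (b - a)" using power_diff_bounds(2)[of a b n] a ab by simp
      also have "\<dots> \<le> real n * t ^ (n - 1) * (b - a)"
        using a ab by (intro mult_right_mono mult_left_mono power_mono) auto
      finally show ?thesis using phi_antimono[of a b] a ab by (intro mult_right_mono) auto
    qed
    finally show "\<bar>D b - D a\<bar> \<le> (real n * t ^ (n - 1) * \<omega>) * (b - a) * (\<phi> a - \<phi> b)"
      by (simp add: mult_ac)
  qed
  then have "G t - G s = integral {s..t} ?q" by (simp add: D_def)
  then show ?thesis using phi_integrable[OF st] by (simp add: integrable_integral)
qed

lemma D_star_body:
  assumes K: "star_body K" and r: "r > 0"
  shows "emeasure (D r) K = ennreal (\<omega> * r ^ n) * (\<integral>\<^sup>+u. ennreal (Gr r (radial K u)) \<partial>sphere_law)"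
proof -
  note [measurable] = g_measurable[OF r] borel_measurable_radial[OF K]
  have "mono (Gr r)"
  proof
    fix s t :: real assume st: "s \<le> t"
    show "Gr r s \<le> Gr r t"
    proof (cases "s < 0")
      case True
      then show ?thesis using r by (simp add: Gr_def)
    next
      case False
      then have "emeasure (D r) (cball 0 s) \<le> emeasure (D r) (cball 0 t)"
        using st by (intro emeasure_mono) (auto simp: cball_subset_cball_iff)
      then show ?thesis using False st r by (simp add: D_ball ennreal_le_iff)
    qed
  qed
  then have [measurable]: "Gr r \<in> borel_measurable borel" by (rule borel_measurable_mono)
  have "emeasure (D r) K = emeasure (D r) {x. norm x \<le> radial K (sgn x)}"
    using star_body_eq_Collect[OF K] by simp
  also have "\<dots> = (\<integral>\<^sup>+u. emeasure (D r) (cball 0 (radial K u)) \<partial>sphere_law)"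
    unfolding D_def by (rule emeasure_radial_density_star) measurable
  also have "\<dots> = (\<integral>\<^sup>+u. ennreal (\<omega> * r ^ n) * ennreal (Gr r (radial K u)) \<partial>sphere_law)"
    using r radial_nonneg[OF K] by (intro nn_integral_cong) (simp add: D_ball ennreal_mult')
  also have "\<dots> = ennreal (\<omega> * r ^ n) * (\<integral>\<^sup>+u. ennreal (Gr r (radial K u)) \<partial>sphere_law)"
    by (rule nn_integral_cmult) measurable
  finally show ?thesis .
qed

end

section \<open>The Brunn-Minkowski inequality\<close>

lemma integrable_sphere_law_bounded:
  fixes f :: "'a::euclidean_space \<Rightarrow> real"
  assumes [measurable]: "f \<in> borel_measurable borel" and "\<And>u. norm u = 1 \<Longrightarrow> \<bar>f u\<bar> \<le> B"
  shows "integrable sphere_law f"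
proof (rule sphere_law.integrable_const_bound)
  show "AE u in sphere_law. norm (f u) \<le> B"
    using AE_sphere_law by eventually_elim (use assms in auto)
qed measurable

lemma set_plus_image_image:
  "f ` A + g ` B = (\<lambda>p. f (fst p) + g (snd p)) ` (A \<times> B)"
  unfolding set_plus_image image_paired_Times[symmetric] by (simp add: image_image split_def)

text \<open>In polar coordinates this is the Lebesgue measure of K divided by that of the unit
  ball.\<close>

definition star_volume :: "'a::euclidean_space set \<Rightarrow> real" where
  "star_volume K = (\<integral>u. radial K u ^ DIM('a) \<partial>sphere_law)"

lemma integrable_radial_power:
  assumes K: "star_body K"
  shows "integrable sphere_law (\<lambda>u. radial K u ^ m)"
proof -
  note [measurable] = borel_measurable_radial[OF K]
  obtain b where "0 < b" "K \<subseteq> cball 0 b" using K by (rule star_body_bounded)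
  then have "\<bar>radial K u ^ m\<bar> \<le> b ^ m" for u
    using radial_nonneg[OF K, of u] radial_le[OF K, of b u] by (auto intro: power_mono)
  then show ?thesis by (intro integrable_sphere_law_bounded) measurable
qed

lemma star_volume_pos:
  fixes K :: "'a::euclidean_space set"
  assumes K: "star_body K"
  shows "star_volume K > 0"
proof -
  obtain \<eta> where e: "\<eta> > 0" "cball 0 \<eta> \<subseteq> K" using K by (rule star_bodyE)
  have "(\<integral>u. \<eta> ^ DIM('a) \<partial>(sphere_law :: 'a measure)) \<le> star_volume K"
    unfolding star_volume_def
  proof (rule integral_mono_AE)
    show "AE u in sphere_law. \<eta> ^ DIM('a) \<le> radial K u ^ DIM('a)"
      using AE_sphere_law by eventually_elim (use e radial_ge[OF K] in \<open>auto intro!: power_mono\<close>)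
  qed (auto intro: integrable_radial_power[OF K])
  then show ?thesis using e by (simp add: less_le_trans[OF zero_less_power])
qed

lemma star_volume_scale:
  fixes K :: "'a::euclidean_space set"
  assumes "star_body K" "c > 0"
  shows "star_volume ((*\<^sub>R) c ` K) = c ^ DIM('a) * star_volume K"
  using assms by (simp add: star_volume_def radial_scale power_mult_distrib)

section \<open>Polar coordinates for the measure itself, and Brunn-Minkowski\<close>

context rot_log_concave
begin

lemma G_measurable [measurable]: "G \<in> borel_measurable borel"
  by (rule borel_measurable_mono) (auto intro!: monoI G_mono)

lemma integrable_G_radial:
  assumes K: "star_body K" and c: "c \<ge> 0"
  shows "integrable sphere_law (\<lambda>u. G (c * radial K u))"
proof -
  note [measurable] = borel_measurable_radial[OF K]
  obtain b where b: "0 < b" "K \<subseteq> cball 0 b" using K by (rule star_body_bounded)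
  have "\<bar>G (c * radial K u)\<bar> \<le> G (c * b)" for u
    using radial_le[OF K, of b u] b c by (auto intro!: G_mono mult_left_mono)
  then show ?thesis by (intro integrable_sphere_law_bounded) measurable
qed

lemma nn_integral_G_radial:
  assumes K: "star_body K" and c: "c \<ge> 0"
  shows "(\<integral>\<^sup>+u. ennreal (G (c * radial K u)) \<partial>sphere_law)
      = ennreal (\<integral>u. G (c * radial K u) \<partial>sphere_law)"
  using integrable_G_radial[OF assms] by (intro nn_integral_eq_integral) auto

text \<open>The polar formula is known for \<open>D r\<close>, not yet for \<gamma>. With r = \<eta>
  d, passing between the two costs one dilation of the body by d and one shift of the radius by r,
  which is at most d times the radial function; hence the factors 1 - 2 d and 1 + 2 d.\<close>

lemma measure_star_body_bounds:
  assumes K: "star_body K" and d: "0 < d" "d < 1/2"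
  shows "(\<integral>u. G ((1 - 2 * d) * radial K u) \<partial>sphere_law) \<le> measure \<gamma> K" (is ?l)
    and "measure \<gamma> K \<le> (\<integral>u. G ((1 + 2 * d) * radial K u) \<partial>sphere_law)" (is ?u)
proof -
  obtain \<eta> where e: "\<eta> > 0" "cball 0 \<eta> \<subseteq> K" using K by (rule star_bodyE)
  define r where "r = \<eta> * d"
  have r: "r > 0" using e d by (simp add: r_def)
  have v: "ennreal (\<omega> * r ^ n) \<noteq> 0" "ennreal (\<omega> * r ^ n) \<noteq> \<infinity>" using r by (auto simp: ennreal_eq_0_iff not_le)
  have Kc: "compact K" using K by (simp add: star_body_def)
  have Kb: "(*\<^sub>R) c ` K \<in> sets borel" for c
    using Kc by (intro borel_compact compact_scaling)
  have K1: "star_body ((*\<^sub>R) (1 - d) ` K)" and K2: "star_body ((*\<^sub>R) (1 + d) ` K)"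
    using star_body_scale[OF K] d by auto
  have \<rho>: "AE u in sphere_law. r \<le> d * radial K u"
    using AE_sphere_law by eventually_elim (use e d radial_ge[OF K _ e(2)] in \<open>auto simp: r_def mult.commute\<close>)
  have "ennreal (\<omega> * r ^ n) * (\<integral>\<^sup>+u. ennreal (G ((1 - 2 * d) * radial K u)) \<partial>sphere_law)
     \<le> ennreal (\<omega> * r ^ n) * (\<integral>\<^sup>+u. ennreal (Gr r (radial ((*\<^sub>R) (1 - d) ` K) u)) \<partial>sphere_law)"
  proof (intro mult_left_mono nn_integral_mono_AE)
    show "AE u in sphere_law. ennreal (G ((1 - 2 * d) * radial K u)) \<le> ennreal (Gr r (radial ((*\<^sub>R) (1 - d) ` K) u))"
      using \<rho>
    proof eventually_elim
      case (elim u)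
      have p: "0 \<le> radial K u" by (rule radial_nonneg[OF K])
      then have "d * radial K u \<le> (1 - d) * radial K u" using d by (intro mult_right_mono) auto
      then have "r \<le> (1 - d) * radial K u" using elim by linarith
      moreover have "(1 - 2 * d) * radial K u \<le> (1 - d) * radial K u - r" using elim by (simp add: algebra_simps)
      ultimately have "G ((1 - 2 * d) * radial K u) \<le> Gr r ((1 - d) * radial K u)"
        using Gr_lower[OF r] G_mono order_trans by blast
      then show ?case using d by (simp add: radial_scale[OF K] ennreal_leI)
    qed
  qed simp
  also have "\<dots> = emeasure (D r) ((*\<^sub>R) (1 - d) ` K)"
    by (rule D_star_body[OF K1 r, symmetric])
  also have "\<dots> \<le> ennreal (\<omega> * r ^ n) * emeasure \<gamma> K"
    using d Kb Kc by (intro D_upper r star_body_shrink[OF K e(2) d(1), folded r_def]) (auto simp: borel_compact)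
  finally have "(\<integral>\<^sup>+u. ennreal (G ((1 - 2 * d) * radial K u)) \<partial>sphere_law) \<le> emeasure \<gamma> K"
    using v by (simp add: ennreal_mult_le_mult_iff)
  then show ?l
    using d by (simp add: nn_integral_G_radial[OF K] emeasure_gamma[OF Kc] ennreal_le_iff)
  have "ennreal (\<omega> * r ^ n) * emeasure \<gamma> K \<le> emeasure (D r) ((*\<^sub>R) (1 + d) ` K)"
    using d Kb Kc by (intro D_lower r star_body_expand[OF K e(2) d(1), folded r_def]) (auto simp: borel_compact)
  also have "\<dots> = ennreal (\<omega> * r ^ n) * (\<integral>\<^sup>+u. ennreal (Gr r (radial ((*\<^sub>R) (1 + d) ` K) u)) \<partial>sphere_law)"
    by (rule D_star_body[OF K2 r])
  also have "\<dots> \<le> ennreal (\<omega> * r ^ n) * (\<integral>\<^sup>+u. ennreal (G ((1 + 2 * d) * radial K u)) \<partial>sphere_law)"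
  proof (intro mult_left_mono nn_integral_mono_AE)
    show "AE u in sphere_law. ennreal (Gr r (radial ((*\<^sub>R) (1 + d) ` K) u)) \<le> ennreal (G ((1 + 2 * d) * radial K u))"
      using \<rho>
    proof eventually_elim
      case (elim u)
      have p: "0 \<le> radial K u" by (rule radial_nonneg[OF K])
      have "Gr r ((1 + d) * radial K u) \<le> G ((1 + d) * radial K u + r)"
        using p d by (intro Gr_upper r) auto
      also have "\<dots> \<le> G ((1 + 2 * d) * radial K u)"
        using elim by (intro G_mono) (simp add: algebra_simps)
      finally show ?case using d by (simp add: radial_scale[OF K] ennreal_leI)
    qed
  qed simp
  finally have "emeasure \<gamma> K \<le> (\<integral>\<^sup>+u. ennreal (G ((1 + 2 * d) * radial K u)) \<partial>sphere_law)"
    using v by (simp add: ennreal_mult_le_mult_iff)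
  moreover have "0 \<le> (\<integral>u. G ((1 + 2 * d) * radial K u) \<partial>sphere_law)" by simp
  ultimately show ?u
    using d by (simp add: nn_integral_G_radial[OF K] emeasure_gamma[OF Kc] ennreal_le_iff)
qed

lemma integral_G_radial_tendsto:
  assumes K: "star_body K" and c: "c \<longlonglongrightarrow> 1" "\<And>k. 0 \<le> c k" "\<And>k. c k \<le> 2"
  shows "(\<lambda>k. \<integral>u. G (c k * radial K u) \<partial>sphere_law) \<longlonglongrightarrow> (\<integral>u. G (radial K u) \<partial>sphere_law)"
proof (rule integral_dominated_convergence)
  note [measurable] = borel_measurable_radial[OF K]
  show "(\<lambda>u. G (radial K u)) \<in> borel_measurable sphere_law" by measurable
  show "(\<lambda>u. G (c k * radial K u)) \<in> borel_measurable sphere_law" for k by measurable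
  show "integrable sphere_law (\<lambda>u. G (2 * radial K u))" by (rule integrable_G_radial[OF K]) simp
  show "AE u in sphere_law. (\<lambda>k. G (c k * radial K u)) \<longlonglongrightarrow> G (radial K u)"
    using AE_sphere_law
  proof eventually_elim
    case (elim u)
    then have "radial K u > 0" by (intro radial_pos[OF K]) simp
    moreover have "(\<lambda>k. c k * radial K u) \<longlonglongrightarrow> 1 * radial K u" using c by (intro tendsto_intros)
    ultimately show ?case by (intro isCont_tendsto_compose[OF G_continuous]) auto
  qed
  show "AE u in sphere_law. norm (G (c k * radial K u)) \<le> G (2 * radial K u)" for k
    using c radial_nonneg[OF K] by (auto intro!: G_mono mult_right_mono)
qed

text \<open>As d -> 0 both bounds tend to the same integral by dominated convergence, G being
  continuous at positive radii.\<close>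

lemma measure_star_body:
  assumes K: "star_body K"
  shows "measure \<gamma> K = (\<integral>u. G (radial K u) \<partial>sphere_law)"
proof (rule antisym)
  \<comment> \<open>Starting at 1/3 keeps d strictly below 1/2, as the two bounds require.\<close>
  define d :: "nat \<Rightarrow> real" where "d k = inverse (real (Suc (Suc (Suc k))))" for k
  have d: "0 < d k" "d k < 1/2" for k by (auto simp: d_def field_simps)
  have d0: "d \<longlonglongrightarrow> 0"
    unfolding d_def using LIMSEQ_ignore_initial_segment[OF LIMSEQ_inverse_real_of_nat, of 2] by simp
  have "(\<lambda>k. 1 + 2 * d k) \<longlonglongrightarrow> 1 + 2 * 0" by (intro tendsto_intros d0)
  moreover have "0 \<le> 1 + 2 * d k" "1 + 2 * d k \<le> 2" for k using d[of k] by auto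
  ultimately have "(\<lambda>k. \<integral>u. G ((1 + 2 * d k) * radial K u) \<partial>sphere_law) \<longlonglongrightarrow> (\<integral>u. G (radial K u) \<partial>sphere_law)"
    by (intro integral_G_radial_tendsto[OF K]) auto
  then show "measure \<gamma> K \<le> (\<integral>u. G (radial K u) \<partial>sphere_law)"
    by (rule LIMSEQ_le_const) (use measure_star_body_bounds(2)[OF K d] in auto)
  have "(\<lambda>k. 1 - 2 * d k) \<longlonglongrightarrow> 1 - 2 * 0" by (intro tendsto_intros d0)
  moreover have "0 \<le> 1 - 2 * d k" "1 - 2 * d k \<le> 2" for k using d[of k] by auto
  ultimately have "(\<lambda>k. \<integral>u. G ((1 - 2 * d k) * radial K u) \<partial>sphere_law) \<longlonglongrightarrow> (\<integral>u. G (radial K u) \<partial>sphere_law)"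
    by (intro integral_G_radial_tendsto[OF K]) auto
  then show "(\<integral>u. G (radial K u) \<partial>sphere_law) \<le> measure \<gamma> K"
    by (rule LIMSEQ_le_const2) (use measure_star_body_bounds(1)[OF K d] in auto)
qed

lemma star_volume_eq: "star_volume (K :: (real ^ 'n) set) = (\<integral>u. radial K u ^ n \<partial>sphere_law)"
  by (simp add: star_volume_def n_eq)

text \<open>Blowing up at the origin, where the density is bounded and positive, turns the log-concavity of
  the measure into the multiplicative Brunn-Minkowski inequality for Lebesgue measure.\<close>

lemma star_volume_log_concave:
  fixes A B :: "(real ^ 'n) set"
  assumes T: "0 < T" "\<phi> T > 0" and A: "star_body A" and B: "star_body B" and l: "0 < l" "l < 1"
  shows "star_volume A powr l * star_volume B powr (1 - l) \<le> star_volume ((*\<^sub>R) l ` A + (*\<^sub>R) (1 - l) ` B)"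
proof -
  define C where "C = (*\<^sub>R) l ` A + (*\<^sub>R) (1 - l) ` B"
  have C: "star_body C" unfolding C_def by (rule star_body_sum[OF A B l])
  \<comment> \<open>\<theta> is nonincreasing by \<open>G_growth\<close> and bounded by
    \<open>G_le_power\<close>, so its supremum L is also its limit at 0: up to the factor \<omega>,
    the density at the origin.\<close>
  define \<theta> where "\<theta> t = G t / t ^ n" for t
  obtain M where M: "\<And>t. t > 0 \<Longrightarrow> G t \<le> M * t ^ n" using G_le_power[OF T] by blast
  have anti: "\<theta> t \<le> \<theta> s" if "0 < s" "s \<le> t" for s t
    using G_growth[OF that] that by (simp add: \<theta>_def field_simps)
  have bdd: "bdd_above (\<theta> ` {0<..})"
    using M by (intro bdd_aboveI2[of _ _ M]) (auto simp: \<theta>_def field_simps)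
  define L where "L = (SUP t\<in>{0<..}. \<theta> t)"
  have le_L: "\<theta> t \<le> L" if "t > 0" for t
    unfolding L_def using that by (intro cSUP_upper bdd) auto
  have "0 < \<omega> * (T ^ n - (T/2) ^ n) * \<phi> T" using T shell_pos[of "T/2" T] by simp
  also have "\<dots> \<le> G T - G (T / 2)" using T by (intro G_increment) auto
  also have "\<dots> \<le> G T" by simp
  finally have "\<theta> T > 0" using T by (simp add: \<theta>_def)
  then have Lpos: "L > 0" using le_L[OF T(1)] by simp
  have up: "measure \<gamma> ((*\<^sub>R) \<tau> ` K) \<le> L * (\<tau> ^ n * star_volume K)" if K: "star_body K" and t: "\<tau> > 0" for \<tau> and K :: "(real ^ 'n) set"
  proof -
    have "measure \<gamma> ((*\<^sub>R) \<tau> ` K) = (\<integral>u. G (\<tau> * radial K u) \<partial>sphere_law)"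
      using measure_star_body[OF star_body_scale[OF K t]] t by (simp add: radial_scale[OF K])
    also have "\<dots> \<le> (\<integral>u. L * \<tau> ^ n * radial K u ^ n \<partial>sphere_law)"
    proof (rule integral_mono_AE)
      show "AE u in sphere_law. G (\<tau> * radial K u) \<le> L * \<tau> ^ n * radial K u ^ n"
        using AE_sphere_law
      proof eventually_elim
        case (elim u)
        then have "radial K u > 0" by (intro radial_pos[OF K]) simp
        then have p: "\<tau> * radial K u > 0" using t by simp
        then have "G (\<tau> * radial K u) \<le> L * (\<tau> * radial K u) ^ n"
          using le_L[OF p] zero_less_power[OF p] by (simp add: \<theta>_def pos_divide_le_eq)
        then show ?case by (simp add: power_mult_distrib mult.assoc)
      qed
    qed (use t in \<open>auto intro: integrable_G_radial[OF K] integrable_radial_power[OF K]\<close>)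
    finally show ?thesis by (simp add: star_volume_eq mult_ac)
  qed
  have lo: "\<theta> (\<tau> * b) * (\<tau> ^ n * star_volume K) \<le> measure \<gamma> ((*\<^sub>R) \<tau> ` K)"
    if K: "star_body K" and t: "\<tau> > 0" and b: "0 < b" "K \<subseteq> cball 0 b" for \<tau> b and K :: "(real ^ 'n) set"
  proof -
    have "(\<integral>u. \<theta> (\<tau> * b) * \<tau> ^ n * radial K u ^ n \<partial>sphere_law) \<le> (\<integral>u. G (\<tau> * radial K u) \<partial>sphere_law)"
    proof (rule integral_mono_AE)
      show "AE u in sphere_law. \<theta> (\<tau> * b) * \<tau> ^ n * radial K u ^ n \<le> G (\<tau> * radial K u)"
        using AE_sphere_law
      proof eventually_elim
        case (elim u)
        then have "radial K u > 0" by (intro radial_pos[OF K]) simp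
        then have p: "\<tau> * radial K u > 0" using t by simp
        have "\<theta> (\<tau> * b) \<le> \<theta> (\<tau> * radial K u)"
          using radial_le[OF K b(2)] b t p by (intro anti) auto
        then have "\<theta> (\<tau> * b) * (\<tau> * radial K u) ^ n \<le> G (\<tau> * radial K u)"
          using zero_less_power[OF p] by (simp add: \<theta>_def[of "\<tau> * radial K u"] pos_le_divide_eq)
        then show ?case by (simp add: power_mult_distrib mult.assoc)
      qed
    qed (use t in \<open>auto intro: integrable_G_radial[OF K] integrable_radial_power[OF K]\<close>)
    also have "\<dots> = measure \<gamma> ((*\<^sub>R) \<tau> ` K)"
      using measure_star_body[OF star_body_scale[OF K t]] t by (simp add: radial_scale[OF K])
    finally show ?thesis by (simp add: star_volume_eq mult_ac)
  qed
  obtain bA where bA: "0 < bA" "A \<subseteq> cball 0 bA" using A by (rule star_body_bounded)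
  obtain bB where bB: "0 < bB" "B \<subseteq> cball 0 bB" using B by (rule star_body_bounded)
  define b where "b = max bA bB"
  have b: "0 < b" "A \<subseteq> cball 0 b" "B \<subseteq> cball 0 b"
    using bA bB by (auto simp: b_def)
  have VA: "star_volume A > 0" and VB: "star_volume B > 0" by (auto intro: star_volume_pos A B)
  \<comment> \<open>The factor \<theta>(s) comes from the lower bounds on A and B, the factor L from
    the upper bound on C. The supremum over s turns the former into L, and L cancels.\<close>
  have main: "\<theta> s * (star_volume A powr l * star_volume B powr (1 - l)) \<le> L * star_volume C" if s: "s > 0" for s
  proof -
    define \<tau> where "\<tau> = s / b"
    have \<tau>: "\<tau> > 0" "\<tau> * b = s" using s b by (auto simp: \<tau>_def)
    have \<theta>: "\<theta> s \<ge> 0" using s by (simp add: \<theta>_def)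
    have split: "(*\<^sub>R) \<tau> ` C = (*\<^sub>R) l ` ((*\<^sub>R) \<tau> ` A) + (*\<^sub>R) (1 - l) ` ((*\<^sub>R) \<tau> ` B)"
      by (simp add: C_def image_image set_plus_image_image scaleR_add_right mult.commute)
    have "\<theta> s * \<tau> ^ n * (star_volume A powr l * star_volume B powr (1 - l))
        = (\<theta> s * (\<tau> ^ n * star_volume A)) powr l * (\<theta> s * (\<tau> ^ n * star_volume B)) powr (1 - l)"
    proof -
      have "x powr l * x powr (1 - l) = x" if "x \<ge> 0" for x :: real
        using that by (simp flip: powr_add)
      from this[of "\<theta> s * \<tau> ^ n"] show ?thesis
        using \<theta> \<tau> VA VB by (simp add: powr_mult mult_ac)
    qed
    also have "\<dots> \<le> measure \<gamma> ((*\<^sub>R) \<tau> ` A) powr l * measure \<gamma> ((*\<^sub>R) \<tau> ` B) powr (1 - l)"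
      using lo[OF A \<tau>(1) b(1,2)] lo[OF B \<tau>(1) b(1,3)] \<theta> \<tau> VA VB l
      by (intro mult_mono powr_mono2) auto
    also have "\<dots> \<le> measure \<gamma> ((*\<^sub>R) \<tau> ` C)"
      unfolding split using A B zero_in_star_body[OF A] zero_in_star_body[OF B] l
      by (intro log_concave_compact compact_scaling) (auto simp: star_body_def)
    also have "\<dots> \<le> L * (\<tau> ^ n * star_volume C)" by (rule up[OF C \<tau>(1)])
    finally have "\<tau> ^ n * (\<theta> s * (star_volume A powr l * star_volume B powr (1 - l))) \<le> \<tau> ^ n * (L * star_volume C)"
      by (simp add: mult_ac)
    then show ?thesis using \<tau> by simp
  qed
  have pos: "0 < star_volume A powr l * star_volume B powr (1 - l)" using VA VB by simp
  have "L \<le> L * star_volume C / (star_volume A powr l * star_volume B powr (1 - l))"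
    unfolding L_def[of] by (rule cSUP_least) (use main pos in \<open>auto simp: pos_le_divide_eq L_def\<close>)
  then show ?thesis using pos Lpos by (simp add: C_def pos_le_divide_eq)
qed

text \<open>The usual normalization: A and B are scaled to unit volume, and the multiplicative form
  is applied with the weight l a / m, for which the combination of the scaled bodies is again a
  multiple of C.\<close>

lemma star_volume_brunn_minkowski:
  fixes A B :: "(real ^ 'n) set"
  assumes T: "0 < T" "\<phi> T > 0" and A: "star_body A" and B: "star_body B" and l: "0 < l" "l < 1"
  shows "l * star_volume A powr (1 / real n) + (1 - l) * star_volume B powr (1 / real n)
      \<le> star_volume ((*\<^sub>R) l ` A + (*\<^sub>R) (1 - l) ` B) powr (1 / real n)"
proof -
  define C where "C = (*\<^sub>R) l ` A + (*\<^sub>R) (1 - l) ` B"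
  have C: "star_body C" unfolding C_def by (rule star_body_sum[OF A B l])
  define a where "a = star_volume A powr (1 / real n)"
  define b where "b = star_volume B powr (1 / real n)"
  have VA: "star_volume A > 0" and VB: "star_volume B > 0" by (auto intro: star_volume_pos A B)
  have a: "a > 0" "a ^ n = star_volume A" and b: "b > 0" "b ^ n = star_volume B"
    using VA VB by (auto simp: a_def b_def powr_realpow[symmetric] powr_powr)
  define m where "m = l * a + (1 - l) * b"
  have m: "m > 0" using l a b by (simp add: m_def add_pos_pos)
  define l' where "l' = l * a / m"
  have l': "0 < l'" "l' < 1" "1 - l' = (1 - l) * b / m"
    using l a b m by (auto simp: l'_def m_def field_simps add_pos_pos)
  have "(*\<^sub>R) (1 / m) ` C = (*\<^sub>R) l' ` ((*\<^sub>R) (1 / a) ` A) + (*\<^sub>R) (1 - l') ` ((*\<^sub>R) (1 / b) ` B)"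
  proof -
    have "(*\<^sub>R) (1 / m) ` C = (\<lambda>p. (l / m) *\<^sub>R fst p + ((1 - l) / m) *\<^sub>R snd p) ` (A \<times> B)"
      by (simp add: C_def image_image set_plus_image_image scaleR_add_right)
    also have "\<dots> = (*\<^sub>R) l' ` ((*\<^sub>R) (1 / a) ` A) + (*\<^sub>R) (1 - l') ` ((*\<^sub>R) (1 / b) ` B)"
    proof -
      have "l' / a = l / m" using a by (simp add: l'_def)
      then show ?thesis using b by (simp add: l'(3) image_image set_plus_image_image)
    qed
    finally show ?thesis .
  qed
  moreover have "star_volume ((*\<^sub>R) (1 / a) ` A) = 1" "star_volume ((*\<^sub>R) (1 / b) ` B) = 1"
    using a b A B VA VB by (auto simp: star_volume_scale power_divide simp flip: n_eq)
  ultimately have "1 \<le> star_volume ((*\<^sub>R) (1 / m) ` C)"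
    using star_volume_log_concave[OF T star_body_scale[OF A] star_body_scale[OF B] l'(1,2), of "1 / a" "1 / b"] a b
    by simp
  also have "\<dots> = star_volume C / m ^ n"
    using m C by (simp add: star_volume_scale power_divide flip: n_eq)
  finally have "m ^ n \<le> star_volume C" using m by (simp add: pos_le_divide_eq)
  then have "(m ^ n) powr (1 / real n) \<le> star_volume C powr (1 / real n)"
    using m by (intro powr_mono2) auto
  then show ?thesis using m by (simp add: powr_realpow[symmetric] powr_powr m_def a_def b_def C_def)
qed

end

section \<open>Quadratic approximation of C2 functions on the sphere\<close>

lemma inner_sphere:
  fixes u v :: "'a::real_inner"
  assumes "norm u = 1" "norm v = 1"
  shows "u \<bullet> v = 1 - (norm (u - v))\<^sup>2 / 2"
proof -
  have "u \<bullet> u = 1" "v \<bullet> v = 1" using assms by (simp_all add: norm_eq_1)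
  then have "(norm (u - v))\<^sup>2 = 2 - 2 * (u \<bullet> v)"
    by (simp add: power2_norm_eq_inner inner_diff_left inner_diff_right inner_commute)
  then show ?thesis by (simp add: field_simps)
qed

text \<open>The mean value inequality is used twice: a bound on the second derivative makes the
  first one Lipschitz, and this makes the remainder of the affine approximation quadratic. The
  vector w represents the derivative at x.\<close>

lemma C2_local_quadratic_approximation:
  fixes F :: "'a::euclidean_space \<Rightarrow> real"
  assumes F: "C2_on_open U F" and p: "p \<in> U"
  obtains \<eta> N where "\<eta> > 0" "N \<ge> 0"
    "\<And>x. x \<in> ball p \<eta> \<Longrightarrow> \<bar>F x\<bar> \<le> N"
    "\<And>x. x \<in> ball p \<eta> \<Longrightarrow> \<exists>w. norm w \<le> N \<and> (\<forall>y. norm (y - x) < \<eta> \<longrightarrow>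
        \<bar>F y - F x - w \<bullet> (y - x)\<bar> \<le> N * (norm (y - x))\<^sup>2)"
proof -
  obtain F' :: "'a \<Rightarrow> 'a \<Rightarrow>\<^sub>L real" and F'' :: "'a \<Rightarrow> 'a \<Rightarrow>\<^sub>L ('a \<Rightarrow>\<^sub>L real)"
    where U: "open U"
      and F': "\<And>x. x \<in> U \<Longrightarrow> (F has_derivative blinfun_apply (F' x)) (at x)"
      and F'': "\<And>x. x \<in> U \<Longrightarrow> (F' has_derivative blinfun_apply (F'' x)) (at x)"
      and cont: "continuous_on U F''"
    using F unfolding C2_on_open_def by blast
  obtain r where r: "r > 0" "cball p r \<subseteq> U" using U p open_contains_cball by blast
  have bnd: "\<exists>B. \<forall>x\<in>cball p r. norm (f x) \<le> B" if "continuous_on U f" for f :: "'a \<Rightarrow> 'c::real_normed_vector"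
  proof -
    have "bounded (f ` cball p r)"
      using continuous_on_subset[OF that r(2)] by (intro compact_imp_bounded compact_continuous_image) auto
    then show ?thesis by (auto simp: bounded_iff)
  qed
  have "continuous_on U F'" "continuous_on U F"
    by (rule continuous_at_imp_continuous_on, rule ballI, rule has_derivative_continuous, erule F'')
      (rule continuous_at_imp_continuous_on, rule ballI, rule has_derivative_continuous, erule F')
  from bnd[OF this(2)] bnd[OF this(1)] bnd[OF cont] obtain B B' B'' where
    "\<forall>x\<in>cball p r. norm (F x) \<le> B" "\<forall>x\<in>cball p r. norm (F' x) \<le> B'"
    "\<forall>x\<in>cball p r. norm (F'' x) \<le> B''"
    by (elim exE)
  then have B: "\<And>x. x \<in> cball p r \<Longrightarrow> norm (F x) \<le> B"
    "\<And>x. x \<in> cball p r \<Longrightarrow> norm (F' x) \<le> B'" "\<And>x. x \<in> cball p r \<Longrightarrow> norm (F'' x) \<le> B''"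
    by auto
  define N where "N = max B (max B' B'')"
  have pr: "p \<in> cball p r" using r by simp
  have N: "N \<ge> 0" using order_trans[OF norm_ge_zero B(1)[OF pr]] by (simp add: N_def)
  have lip: "norm (F' y - F' x) \<le> N * norm (y - x)" if "x \<in> cball p r" "y \<in> cball p r" for x y
  proof (rule differentiable_bound[of "cball p r"])
    show "(F' has_derivative blinfun_apply (F'' z)) (at z within cball p r)" if "z \<in> cball p r" for z
      by (rule has_derivative_at_withinI[OF F''[OF subsetD[OF r(2) that]]])
    show "onorm (blinfun_apply (F'' z)) \<le> N" if "z \<in> cball p r" for z
      using B(3)[OF that] by (simp add: N_def norm_blinfun.rep_eq)
  qed (use that in auto)
  show thesis
  proof (rule that[of "r / 2" N])
    show "r / 2 > 0" "N \<ge> 0" using r N by auto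
    show "\<bar>F x\<bar> \<le> N" if "x \<in> ball p (r / 2)" for x
      using B(1)[of x] that r by (auto simp: N_def)
    fix x assume x: "x \<in> ball p (r / 2)"
    then have xr: "x \<in> cball p r" using r by auto
    define w where "w = adjoint (blinfun_apply (F' x)) 1"
    have w: "w \<bullet> y = F' x y" for y
      using adjoint_works[OF linear_conv_bounded_linear[THEN iffD2, OF blinfun.bounded_linear_right], of y "F' x" 1]
      by (simp add: w_def inner_commute)
    have "norm w * norm w = F' x w" using w[of w] by (simp add: power2_norm_eq_inner flip: power2_eq_square)
    also have "\<dots> \<le> norm (F' x) * norm w" using norm_blinfun[of "F' x" w] by simp
    finally have "norm w \<le> norm (F' x)" by (cases "w = 0") auto
    then have wN: "norm w \<le> N" using B(2)[OF xr] by (simp add: N_def)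
    show "\<exists>w. norm w \<le> N \<and> (\<forall>y. norm (y - x) < r / 2 \<longrightarrow>
        \<bar>F y - F x - w \<bullet> (y - x)\<bar> \<le> N * (norm (y - x))\<^sup>2)"
    proof (intro exI[of _ w] conjI allI impI wN)
      fix y assume y: "norm (y - x) < r / 2"
      have "dist p y \<le> dist p x + dist x y" by (rule dist_triangle)
      then have yr: "y \<in> cball p r" using x y by (auto simp: dist_norm norm_minus_commute)
      have seg: "closed_segment x y \<subseteq> cball p r"
        using xr yr by (intro closed_segment_subset convex_cball)
      have "norm ((F y - F' x y) - (F x - F' x x)) \<le> (N * norm (y - x)) * norm (y - x)"
      proof (rule differentiable_bound[of "closed_segment x y" "\<lambda>z. F z - F' x z" "\<lambda>z. blinfun_apply (F' z - F' x)"])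
        fix z assume z: "z \<in> closed_segment x y"
        have zr: "z \<in> cball p r" by (rule subsetD[OF seg z])
        have D: "(F has_derivative blinfun_apply (F' z)) (at z within closed_segment x y)"
          by (rule has_derivative_at_withinI[OF F'[OF subsetD[OF r(2) zr]]])
        have "((\<lambda>z. F z - F' x z) has_derivative (\<lambda>h. F' z h - F' x h)) (at z within closed_segment x y)"
          by (intro has_derivative_diff D bounded_linear_imp_has_derivative blinfun.bounded_linear_right)
        then show "((\<lambda>z. F z - F' x z) has_derivative blinfun_apply (F' z - F' x)) (at z within closed_segment x y)"
          by (simp add: blinfun.diff_left[abs_def])
        have "norm (F' z - F' x) \<le> N * norm (z - x)" by (rule lip[OF xr zr])
        also have "\<dots> \<le> N * norm (y - x)"
          using z N segment_bound1[of z x y] by (intro mult_left_mono) auto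
        finally show "onorm (blinfun_apply (F' z - F' x)) \<le> N * norm (y - x)"
          by (simp add: norm_blinfun.rep_eq)
      qed auto
      then show "\<bar>F y - F x - w \<bullet> (y - x)\<bar> \<le> N * (norm (y - x))\<^sup>2"
        by (simp add: w blinfun.diff_right algebra_simps power2_eq_square)
    qed
  qed
qed

text \<open>For unit vectors u and v a constant k differs from the linear function k (u . v) by k |u
  - v|^2 / 2 only. So the affine approximation of \<psi> at v may be replaced by a linear one,
  uniformly in v by compactness.\<close>

lemma C2_on_sphere_quadratic:
  fixes \<psi> :: "'a::euclidean_space \<Rightarrow> real"
  assumes \<psi>: "C2_on_submanifold (sphere 0 1) \<psi>"
  obtains C where "C \<ge> 1" "\<And>v. v \<in> sphere 0 1 \<Longrightarrow> \<exists>b. b \<bullet> v = \<psi> v \<and> norm b \<le> C \<and>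
      (\<forall>u\<in>sphere 0 1. \<bar>b \<bullet> u - \<psi> u\<bar> \<le> C * (norm (u - v))\<^sup>2)"
proof -
  let ?S = "sphere (0 :: 'a) 1"
  define P where "P p \<eta> N \<longleftrightarrow> \<eta> > 0 \<and> N \<ge> 0 \<and> (\<forall>v\<in>?S \<inter> ball p \<eta>. \<bar>\<psi> v\<bar> \<le> N \<and>
      (\<exists>w. norm w \<le> N \<and> (\<forall>u\<in>?S. norm (u - v) < \<eta> \<longrightarrow>
        \<bar>\<psi> u - \<psi> v - w \<bullet> (u - v)\<bar> \<le> N * (norm (u - v))\<^sup>2)))" for p \<eta> N
  have "\<exists>\<eta> N. P p \<eta> N" if p: "p \<in> ?S" for p
  proof -
    have "\<exists>U F. p \<in> U \<and> C2_on_open U F \<and> (\<forall>x\<in>?S \<inter> U. F x = \<psi> x)"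
      using \<psi> p by (simp only: C2_on_submanifold_def)
    then obtain U F where UF: "p \<in> U" "C2_on_open U F" "\<And>x. x \<in> ?S \<inter> U \<Longrightarrow> F x = \<psi> x"
      by (elim exE conjE) auto
    then have "open U" by (simp add: C2_on_open_def)
    then obtain r where r: "r > 0" "ball p r \<subseteq> U" using UF(1) open_contains_ball by blast
    obtain \<eta> N where e: "\<eta> > 0" "N \<ge> 0"
      "\<And>x. x \<in> ball p \<eta> \<Longrightarrow> \<bar>F x\<bar> \<le> N"
      "\<And>x. x \<in> ball p \<eta> \<Longrightarrow> \<exists>w. norm w \<le> N \<and> (\<forall>y. norm (y - x) < \<eta> \<longrightarrow>
        \<bar>F y - F x - w \<bullet> (y - x)\<bar> \<le> N * (norm (y - x))\<^sup>2)"
      using C2_local_quadratic_approximation[OF UF(2,1)] by blast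
    \<comment> \<open>With r / 2 a point u within \<delta> of v, itself within \<delta> of p, is
      still inside U.\<close>
    define \<delta> where "\<delta> = min \<eta> (r / 2)"
    have "P p \<delta> N"
      unfolding P_def
    proof (intro conjI ballI)
      show "\<delta> > 0" "N \<ge> 0" using e r by (auto simp: \<delta>_def)
      fix v assume v: "v \<in> ?S \<inter> ball p \<delta>"
      have Fv: "F v = \<psi> v" using v r by (intro UF) (auto simp: \<delta>_def)
      have ve: "v \<in> ball p \<eta>" using v by (auto simp: \<delta>_def)
      show "\<bar>\<psi> v\<bar> \<le> N" using e(3)[OF ve] Fv by simp
      obtain w where w: "norm w \<le> N" "\<And>y. norm (y - v) < \<eta> \<Longrightarrow>
        \<bar>F y - F v - w \<bullet> (y - v)\<bar> \<le> N * (norm (y - v))\<^sup>2" using e(4)[OF ve] by blast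
      show "\<exists>w. norm w \<le> N \<and> (\<forall>u\<in>?S. norm (u - v) < \<delta> \<longrightarrow>
        \<bar>\<psi> u - \<psi> v - w \<bullet> (u - v)\<bar> \<le> N * (norm (u - v))\<^sup>2)"
      proof (intro exI[of _ w] conjI ballI impI w(1))
        fix u assume u: "u \<in> ?S" "norm (u - v) < \<delta>"
        have "dist p u \<le> dist p v + dist v u" by (rule dist_triangle)
        also have "\<dots> < r" using u v by (auto simp: \<delta>_def dist_norm norm_minus_commute)
        finally have "F u = \<psi> u" using u r by (intro UF) auto
        then show "\<bar>\<psi> u - \<psi> v - w \<bullet> (u - v)\<bar> \<le> N * (norm (u - v))\<^sup>2"
          using w(2)[of u] u Fv by (simp add: \<delta>_def)
      qed
    qed
    then show ?thesis by blast
  qed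
  then obtain \<eta> N where P: "\<And>p. p \<in> ?S \<Longrightarrow> P p (\<eta> p) (N p)" by metis
  have "compact ?S" by simp
  moreover have "\<And>p. p \<in> ?S \<Longrightarrow> open (ball p (\<eta> p))" by simp
  moreover have "?S \<subseteq> (\<Union>p\<in>?S. ball p (\<eta> p))"
    using P by (auto simp: P_def)
  ultimately obtain T where T: "T \<subseteq> ?S" "finite T" "?S \<subseteq> (\<Union>p\<in>T. ball p (\<eta> p))"
    by (rule compactE_image)
  define d where "d = Min (insert 1 (\<eta> ` T))"
  define M where "M = Max (insert 1 (N ` T))"
  have d: "d > 0" "\<And>p. p \<in> T \<Longrightarrow> d \<le> \<eta> p"
    using T P by (auto simp: d_def P_def)
  have M: "M \<ge> 1" "\<And>p. p \<in> T \<Longrightarrow> N p \<le> M"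
    using T by (auto simp: M_def)
  have cover: "\<exists>p\<in>T. v \<in> ?S \<inter> ball p (\<eta> p)" if "v \<in> ?S" for v
    using subsetD[OF T(3) that] that by blast
  have psi: "\<bar>\<psi> v\<bar> \<le> M" if v: "v \<in> ?S" for v
  proof -
    obtain p where p: "p \<in> T" "v \<in> ?S \<inter> ball p (\<eta> p)" using cover[OF v] by blast
    then have "\<bar>\<psi> v\<bar> \<le> N p" using P[of p] T unfolding P_def by blast
    with M(2)[OF p(1)] show ?thesis by simp
  qed
  \<comment> \<open>The second summand serves points at distance at least d from v, where the left
    side is at most 4 M.\<close>
  define M' where "M' = M + 4 * M / d\<^sup>2"
  have M': "M' \<ge> M" using M d by (simp add: M'_def)
  show thesis
  proof (rule that[of "M' + 4 * M"])
    show "M' + 4 * M \<ge> 1" using M M' by simp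
    fix v assume v: "v \<in> ?S"
    obtain p where p: "p \<in> T" "v \<in> ?S \<inter> ball p (\<eta> p)" using cover[OF v] by blast
    then obtain w where w: "norm w \<le> N p" "\<And>u. u \<in> ?S \<Longrightarrow> norm (u - v) < \<eta> p \<Longrightarrow>
        \<bar>\<psi> u - \<psi> v - w \<bullet> (u - v)\<bar> \<le> N p * (norm (u - v))\<^sup>2"
      using P[of p] T unfolding P_def by blast
    have wM: "norm w \<le> M" using w(1) M(2)[OF p(1)] by simp
    have wi: "\<bar>w \<bullet> x\<bar> \<le> M * norm x" for x
      using Cauchy_Schwarz_ineq2[of w x] wM by (meson mult_right_mono norm_ge_zero order_trans)
    have q: "\<bar>\<psi> u - \<psi> v - w \<bullet> (u - v)\<bar> \<le> M' * (norm (u - v))\<^sup>2" if u: "u \<in> ?S" for u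
    proof (cases "norm (u - v) < \<eta> p")
      case True
      have "\<bar>\<psi> u - \<psi> v - w \<bullet> (u - v)\<bar> \<le> N p * (norm (u - v))\<^sup>2" by (rule w(2)[OF u True])
      also have "\<dots> \<le> M' * (norm (u - v))\<^sup>2" using M(2)[OF p(1)] M' by (intro mult_right_mono) auto
      finally show ?thesis .
    next
      case False
      then have ge: "d \<le> norm (u - v)" using d(2)[OF p(1)] by simp
      have "norm (u - v) \<le> norm u + norm v" by (rule norm_triangle_ineq4)
      then have "norm (u - v) \<le> 2" using u v by simp
      then have "M * norm (u - v) \<le> M * 2" using M by (intro mult_left_mono) auto
      then have "\<bar>\<psi> u - \<psi> v - w \<bullet> (u - v)\<bar> \<le> 4 * M"
        using psi[OF u] psi[OF v] wi[of "u - v"] by linarith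
      also have "\<dots> = 4 * M / d\<^sup>2 * d\<^sup>2" using d by simp
      also have "\<dots> \<le> 4 * M / d\<^sup>2 * (norm (u - v))\<^sup>2"
        using ge d M by (intro mult_left_mono power_mono) auto
      also have "\<dots> \<le> M' * (norm (u - v))\<^sup>2" using M by (intro mult_right_mono) (auto simp: M'_def)
      finally show ?thesis .
    qed
    define k where "k = \<psi> v - w \<bullet> v"
    have k: "\<bar>k\<bar> \<le> 2 * M" using psi[OF v] wi[of v] v by (simp add: k_def)
    define b where "b = w + k *\<^sub>R v"
    have vv: "v \<bullet> v = 1" using v by (simp add: norm_eq_1)
    have "norm b \<le> norm w + \<bar>k\<bar> * norm v" unfolding b_def by (metis norm_scaleR norm_triangle_ineq)
    then have nb: "norm b \<le> M' + 4 * M" using wM k v M M' by simp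
    have "\<bar>b \<bullet> u - \<psi> u\<bar> \<le> (M' + 4 * M) * (norm (u - v))\<^sup>2" if u: "u \<in> ?S" for u
    proof -
      have uv: "u \<bullet> v = 1 - (norm (u - v))\<^sup>2 / 2" using u v by (intro inner_sphere) auto
      have "b \<bullet> u - \<psi> u = - (\<psi> u - \<psi> v - w \<bullet> (u - v)) - k * (norm (u - v))\<^sup>2 / 2"
      proof -
        have "v \<bullet> u = 1 - (norm (u - v))\<^sup>2 / 2" using uv by (simp add: inner_commute)
        then have "b \<bullet> u = w \<bullet> u + k * (1 - (norm (u - v))\<^sup>2 / 2)" by (simp add: b_def inner_add_left)
        moreover have "w \<bullet> (u - v) = w \<bullet> u - w \<bullet> v" by (rule inner_diff_right)
        ultimately show ?thesis unfolding k_def by (simp add: field_simps)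
      qed
      also have "\<bar>\<dots>\<bar> \<le> M' * (norm (u - v))\<^sup>2 + \<bar>k\<bar> * (norm (u - v))\<^sup>2 / 2"
        using q[OF u] abs_mult[of k "(norm (u - v))\<^sup>2"] by simp
      also have "\<dots> \<le> M' * (norm (u - v))\<^sup>2 + (4 * M) * (norm (u - v))\<^sup>2"
      proof -
        have "\<bar>k\<bar> * (norm (u - v))\<^sup>2 \<le> (2 * M) * (norm (u - v))\<^sup>2" using k by (intro mult_right_mono) auto
        moreover have "0 \<le> M * (norm (u - v))\<^sup>2" using M by simp
        ultimately show ?thesis by linarith
      qed
      finally show ?thesis by (simp add: distrib_right)
    qed
    moreover have "b \<bullet> v = \<psi> v" using vv by (simp add: b_def k_def inner_add_left)
    ultimately show "\<exists>b. b \<bullet> v = \<psi> v \<and> norm b \<le> M' + 4 * M \<and>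
      (\<forall>u\<in>?S. \<bar>b \<bullet> u - \<psi> u\<bar> \<le> (M' + 4 * M) * (norm (u - v))\<^sup>2)"
      using nb by blast
  qed
qed

section \<open>The perturbed balls\<close>

locale sphere_perturbation =
  fixes \<psi> :: "'a::euclidean_space \<Rightarrow> real" and C R :: real
  assumes C_ge: "C \<ge> 1" and R_pos: "R > 0"
    and quadratic: "\<And>v. norm v = 1 \<Longrightarrow> \<exists>b. b \<bullet> v = \<psi> v \<and> norm b \<le> C \<and>
      (\<forall>u. norm u = 1 \<longrightarrow> \<bar>b \<bullet> u - \<psi> u\<bar> \<le> C * (norm (u - v))\<^sup>2)"
begin

text \<open>b v is the gradient at v of the 1-homogeneous extension of \<psi>, so that r v + e b(v) is the point
  of K r e with outer normal v.\<close>

definition b :: "'a \<Rightarrow> 'a" where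
  "b v = (SOME b. b \<bullet> v = \<psi> v \<and> norm b \<le> C \<and>
      (\<forall>u. norm u = 1 \<longrightarrow> \<bar>b \<bullet> u - \<psi> u\<bar> \<le> C * (norm (u - v))\<^sup>2))"

lemma b:
  assumes "norm v = 1"
  shows "b v \<bullet> v = \<psi> v" "norm (b v) \<le> C"
    and "norm u = 1 \<Longrightarrow> \<bar>b v \<bullet> u - \<psi> u\<bar> \<le> C * (norm (u - v))\<^sup>2"
  using someI_ex[OF quadratic[OF assms]] unfolding b_def by auto

lemma psi_bound:
  assumes "norm v = 1"
  shows "\<bar>\<psi> v\<bar> \<le> C"
  using Cauchy_Schwarz_ineq2[of "b v" v] b(1,2)[OF assms] assms by simp

lemma e_psi_bound: "norm v = 1 \<Longrightarrow> \<bar>e * \<psi> v\<bar> \<le> \<bar>e\<bar> * C"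
  using psi_bound[of v] by (simp add: abs_mult mult_left_mono)

lemma e_b:
  assumes "norm v = 1" "norm u = 1"
  shows "e * (b v \<bullet> u) \<le> e * \<psi> u + \<bar>e\<bar> * C * (norm (u - v))\<^sup>2"
proof -
  have "e * (b v \<bullet> u) - e * \<psi> u \<le> \<bar>e * (b v \<bullet> u - \<psi> u)\<bar>"
    by (simp add: right_diff_distrib)
  also have "\<dots> \<le> \<bar>e\<bar> * (C * (norm (u - v))\<^sup>2)"
    using b(3)[OF assms] by (simp add: abs_mult mult_left_mono)
  finally show ?thesis by simp
qed

lemma psi_continuous: "continuous_on (sphere 0 1) \<psi>"
proof (rule continuous_onI)
  fix v :: 'a and \<epsilon> :: real assume v: "v \<in> sphere 0 1" and e: "\<epsilon> > 0"
  have *: "\<bar>\<psi> u - \<psi> v\<bar> \<le> 3 * C * norm (u - v)" if u: "norm u = 1" for u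
  proof -
    let ?d = "norm (u - v)"
    have d2: "?d \<le> 2" using norm_triangle_ineq4[of u v] u v by simp
    have "\<bar>b v \<bullet> (u - v)\<bar> \<le> C * ?d"
      using Cauchy_Schwarz_ineq2[of "b v" "u - v"] b(2)[of v] v by (meson mult_right_mono norm_ge_zero order_trans mem_sphere_0)
    moreover have "b v \<bullet> (u - v) = b v \<bullet> u - \<psi> v" using b(1)[of v] v by (simp add: inner_diff_right)
    moreover have "\<bar>b v \<bullet> u - \<psi> u\<bar> \<le> C * ?d\<^sup>2" using b(3)[of v u] u v by simp
    moreover have "C * ?d\<^sup>2 \<le> 2 * C * ?d"
      using d2 C_ge mult_left_mono[OF mult_right_mono[OF d2 norm_ge_zero[of "u - v"]], of C]
      by (simp add: power2_eq_square mult_ac)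
    ultimately show ?thesis by linarith
  qed
  show "\<exists>d>0. \<forall>u\<in>sphere 0 1. dist u v < d \<longrightarrow> dist (\<psi> u) (\<psi> v) \<le> \<epsilon>"
  proof (intro exI[of _ "\<epsilon> / (3 * C)"] conjI ballI impI)
    show "\<epsilon> / (3 * C) > 0" using e C_ge by simp
    fix u assume u: "u \<in> sphere 0 1" "dist u v < \<epsilon> / (3 * C)"
    then have "3 * C * norm (u - v) \<le> \<epsilon>" using C_ge by (simp add: dist_norm field_simps)
    with *[of u] u show "dist (\<psi> u) (\<psi> v) \<le> \<epsilon>" by (simp add: dist_real_def)
  qed
qed

text \<open>The Wulff shape of r + e \<psi>. The radius r is kept variable so that a body can be
  split into a ball and a body of smaller radius with the same perturbation.\<close>

definition K :: "real \<Rightarrow> real \<Rightarrow> 'a set" where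
  "K r e = {x. \<forall>u. norm u = 1 \<longrightarrow> x \<bullet> u \<le> r + e * \<psi> u}"

lemma K_D: "x \<in> K r e \<Longrightarrow> norm u = 1 \<Longrightarrow> x \<bullet> u \<le> r + e * \<psi> u"
  by (simp add: K_def)

text \<open>In direction u the point r v of the ball lies r |u - v|^2 / 2 short of the supporting
  plane; this outweighs the error |e| C |u - v|^2 of the linear approximation as soon as |e| C is at
  most r / 2.\<close>

lemma contact_point:
  assumes v: "norm v = 1" and e: "\<bar>e\<bar> * C \<le> r / 2"
  shows "r *\<^sub>R v + e *\<^sub>R b v \<in> K r e"
proof -
  have "(r *\<^sub>R v + e *\<^sub>R b v) \<bullet> u \<le> r + e * \<psi> u" if u: "norm u = 1" for u
  proof -
    have "(r *\<^sub>R v + e *\<^sub>R b v) \<bullet> u = r * (u \<bullet> v) + e * (b v \<bullet> u)"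
      by (simp add: inner_add_left inner_commute[of v u])
    also have "\<dots> \<le> r * (1 - (norm (u - v))\<^sup>2 / 2) + (e * \<psi> u + \<bar>e\<bar> * C * (norm (u - v))\<^sup>2)"
      using e_b[OF v u, of e] by (simp add: inner_sphere[OF u v])
    also have "\<dots> \<le> r + e * \<psi> u"
      using mult_right_mono[OF e, of "(norm (u - v))\<^sup>2"] by (simp add: algebra_simps)
    finally show ?thesis .
  qed
  then show ?thesis by (simp add: K_def)
qed

lemma contact_point_inner:
  assumes "norm v = 1"
  shows "(r *\<^sub>R v + e *\<^sub>R b v) \<bullet> v = r + e * \<psi> v"
  using b(1)[OF assms] assms by (simp add: inner_add_left norm_eq_1)

lemma convex_K: "convex (K r e)"
proof -
  have "K r e = (\<Inter>u\<in>sphere 0 1. {x. u \<bullet> x \<le> r + e * \<psi> u})"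
    by (auto simp: K_def inner_commute)
  then show ?thesis by (simp add: convex_INT convex_halfspace_le)
qed

lemma closed_K: "closed (K r e)"
proof -
  have "K r e = (\<Inter>u\<in>sphere 0 1. {x. u \<bullet> x \<le> r + e * \<psi> u})"
    by (auto simp: K_def inner_commute)
  then show ?thesis by (simp add: closed_INT closed_halfspace_le)
qed

lemma K_subset_cball:
  assumes "r \<ge> 0"
  shows "K r e \<subseteq> cball 0 (r + \<bar>e\<bar> * C)"
proof
  fix x assume x: "x \<in> K r e"
  show "x \<in> cball 0 (r + \<bar>e\<bar> * C)"
  proof (cases "x = 0")
    case True
    then show ?thesis using assms C_ge by simp
  next
    case False
    then have n: "norm (sgn x) = 1" by (simp add: norm_sgn)
    have "norm x = x \<bullet> sgn x" using False by (simp add: sgn_div_norm power2_norm_eq_inner[symmetric] power2_eq_square)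
    also have "\<dots> \<le> r + \<bar>e\<bar> * C" using K_D[OF x n] e_psi_bound[OF n, of e] by simp
    finally show ?thesis by simp
  qed
qed

lemma cball_subset_K: "cball 0 (r - \<bar>e\<bar> * C) \<subseteq> K r e"
proof
  fix x :: 'a assume x: "x \<in> cball 0 (r - \<bar>e\<bar> * C)"
  have "x \<bullet> u \<le> r + e * \<psi> u" if u: "norm u = 1" for u
    using norm_cauchy_schwarz[of x u] u x e_psi_bound[OF u, of e] by simp
  then show "x \<in> K r e" by (simp add: K_def)
qed

lemma compact_K: "r \<ge> 0 \<Longrightarrow> compact (K r e)"
  using closed_K K_subset_cball bounded_cball bounded_subset compact_eq_bounded_closed by metis

lemma K_0: "r \<ge> 0 \<Longrightarrow> K r 0 = cball 0 r"
  using K_subset_cball[of r 0] cball_subset_K[of r 0] by auto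

lemma star_body_K:
  assumes "r > 0" "\<bar>e\<bar> * C \<le> r / 2"
  shows "star_body (K r e)"
  unfolding star_body_def using assms cball_subset_K[of r e]
  by (intro conjI compact_K convex_K exI[of _ "r - \<bar>e\<bar> * C"]) auto

lemma convex_body_K:
  assumes "r > 0" "\<bar>e\<bar> * C \<le> r / 2"
  shows "convex_body (K r e)"
proof -
  have "0 \<in> interior (K r e)"
    using assms cball_subset_K[of r e] ball_subset_cball[of "0 :: 'a" "r - \<bar>e\<bar> * C"]
    by (intro interiorI[of "ball 0 (r - \<bar>e\<bar> * C)"]) auto
  then show ?thesis using assms by (auto simp: convex_body_def compact_K convex_K)
qed

lemma support_function_K:
  assumes v: "norm v = 1" and e: "\<bar>e\<bar> * C \<le> r / 2"
  shows "support_function (K r e) v = r + e * \<psi> v"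
  unfolding support_function_def
proof (rule cSup_eq_maximum)
  show "r + e * \<psi> v \<in> (\<lambda>x. x \<bullet> v) ` K r e"
    using contact_point[OF v e] contact_point_inner[OF v, of r e] by (metis imageI)
  show "\<And>x. x \<in> (\<lambda>x. x \<bullet> v) ` K r e \<Longrightarrow> x \<le> r + e * \<psi> v"
    using K_D v by auto
qed

text \<open>A point outside the sum would be cut off by a half-space. In the direction of its outer
  normal v both summands have contact points, and these add up to the full support value of the left
  side.\<close>

lemma K_subset_sum:
  assumes l: "0 \<le> l" "0 \<le> m" and r: "0 \<le> r" "0 \<le> s"
    and e: "\<bar>e\<bar> * C \<le> r / 2" "\<bar>f\<bar> * C \<le> s / 2"
  shows "K (l * r + m * s) (l * e + m * f) \<subseteq> (*\<^sub>R) l ` K r e + (*\<^sub>R) m ` K s f" (is "_ \<subseteq> ?S")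
proof
  fix z assume z: "z \<in> K (l * r + m * s) (l * e + m * f)"
  have S: "compact ?S" "convex ?S"
    using r by (auto intro!: compact_scaled_sum compact_K convex_set_plus convex_scaling convex_K)
  show "z \<in> ?S"
  proof (rule ccontr)
    assume "z \<notin> ?S"
    then obtain a \<beta> where a: "a \<bullet> z < \<beta>" "\<And>x. x \<in> ?S \<Longrightarrow> a \<bullet> x > \<beta>"
      using separating_hyperplane_closed_point[of ?S z] S compact_imp_closed by blast
    have mem: "l *\<^sub>R (r *\<^sub>R v + e *\<^sub>R b v) + m *\<^sub>R (s *\<^sub>R v + f *\<^sub>R b v) \<in> ?S" if "norm v = 1" for v
      by (intro set_plus_intro imageI contact_point that e)
    show False
    proof (cases "a = 0")
      case True
      obtain v :: 'a where "norm v = 1" using vector_choose_size[of 1] by auto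
      from a(2)[OF mem[OF this]] a(1) True show False by simp
    next
      case False
      define v where "v = - sgn a"
      have v: "norm v = 1" using False by (simp add: v_def norm_sgn)
      have av: "a = - norm a *\<^sub>R v" using False by (simp add: v_def sgn_div_norm)
      let ?x = "l *\<^sub>R (r *\<^sub>R v + e *\<^sub>R b v) + m *\<^sub>R (s *\<^sub>R v + f *\<^sub>R b v)"
      have "?x \<bullet> v = l * (r + e * \<psi> v) + m * (s + f * \<psi> v)"
        by (simp only: inner_add_left[of "l *\<^sub>R _"] inner_scaleR_left[of l] inner_scaleR_left[of m] contact_point_inner[OF v])
      also have "\<dots> \<ge> z \<bullet> v" using K_D[OF z v] by (simp add: algebra_simps)
      finally have "v \<bullet> z \<le> v \<bullet> ?x" by (simp only: inner_commute)
      then have "a \<bullet> z \<ge> a \<bullet> ?x"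
        by (subst (1 2) av) (simp only: inner_scaleR_left minus_mult_left[symmetric] inner_minus_left neg_le_iff_le mult_left_mono norm_ge_zero)
      then show False using a(1) a(2)[OF mem[OF v]] by simp
    qed
  qed
qed

lemma sum_subset_K:
  assumes "0 \<le> l" "0 \<le> m"
  shows "(*\<^sub>R) l ` K r e + (*\<^sub>R) m ` K s f \<subseteq> K (l * r + m * s) (l * e + m * f)"
proof
  fix x assume "x \<in> (*\<^sub>R) l ` K r e + (*\<^sub>R) m ` K s f"
  then obtain y z where yz: "y \<in> K r e" "z \<in> K s f" "x = l *\<^sub>R y + m *\<^sub>R z"
    by (auto simp: set_plus_def)
  have "x \<bullet> u \<le> (l * r + m * s) + (l * e + m * f) * \<psi> u" if u: "norm u = 1" for u
    using mult_left_mono[OF K_D[OF yz(1) u] assms(1)] mult_left_mono[OF K_D[OF yz(2) u] assms(2)]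
    by (simp add: yz(3) inner_add_left algebra_simps)
  then show "x \<in> K (l * r + m * s) (l * e + m * f)" by (simp add: K_def)
qed

section \<open>The radial functions of the family, to second order in the parameter\<close>

definition \<rho> :: "real \<Rightarrow> 'a \<Rightarrow> real" where
  "\<rho> e u = radial (K R e) u"

text \<open>Chosen with \<open>C2 * a0 = C\<close>, and so that |e| C is at most R / 32. This is
  below R / 8, which contact points of bodies of radius R / 4 require.\<close>

definition a0 :: real where "a0 = R / (32 * C)"

text \<open>The value for which R C2 s^2 / 2 equals 16 C^2 s^2, the bound on the squared
  displacement h in \<open>rho_lower_second_order\<close>.\<close>

definition C2 :: real where "C2 = 32 * C\<^sup>2 / R"

lemma a0_pos: "a0 > 0"
  using C_ge R_pos by (simp add: a0_def)

lemma C2_pos: "C2 > 0"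
  using C_ge R_pos by (simp add: C2_def)

lemma a0_bound:
  assumes "\<bar>e\<bar> \<le> a0"
  shows "\<bar>e\<bar> * C \<le> R / 32"
  using assms C_ge R_pos by (simp add: a0_def field_simps)

lemma star_body_KR: "\<bar>e\<bar> \<le> a0 \<Longrightarrow> star_body (K R e)"
  using a0_bound[of e] R_pos by (intro star_body_K) auto

lemma rho_iff:
  assumes "\<bar>e\<bar> \<le> a0" "norm \<theta> = 1" "0 \<le> t"
  shows "t *\<^sub>R \<theta> \<in> K R e \<longleftrightarrow> t \<le> \<rho> e \<theta>"
  unfolding \<rho>_def by (rule radial_iff[OF star_body_KR]) (use assms in auto)

lemma rho_nonneg: "\<bar>e\<bar> \<le> a0 \<Longrightarrow> 0 \<le> \<rho> e \<theta>"
  unfolding \<rho>_def by (intro radial_nonneg star_body_KR)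

lemma rho_in_K:
  assumes "\<bar>e\<bar> \<le> a0" "norm \<theta> = 1"
  shows "\<rho> e \<theta> *\<^sub>R \<theta> \<in> K R e"
  using rho_iff[OF assms rho_nonneg[OF assms(1)]] by simp

lemma rho_le:
  assumes "\<bar>e\<bar> \<le> a0" "norm \<theta> = 1"
  shows "\<rho> e \<theta> \<le> R + e * \<psi> \<theta>"
  using K_D[OF rho_in_K[OF assms] assms(2)] assms(2) by (simp add: norm_eq_1)

lemma rho_0:
  assumes "norm \<theta> = 1"
  shows "\<rho> 0 \<theta> = R"
proof (rule antisym)
  show "\<rho> 0 \<theta> \<le> R" using rho_le[of 0 \<theta>] assms a0_pos by simp
  show "R \<le> \<rho> 0 \<theta>" using rho_iff[of 0 \<theta> R] assms a0_pos R_pos by (simp add: K_0)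
qed

lemma rho_concave:
  assumes e: "\<bar>e\<bar> \<le> a0" "\<bar>f\<bar> \<le> a0" and l: "0 \<le> l" "l \<le> 1"
  shows "l * \<rho> e \<theta> + (1 - l) * \<rho> f \<theta> \<le> \<rho> (l * e + (1 - l) * f) \<theta>"
proof (cases "norm \<theta> = 1")
  case True
  have "\<bar>l * e + (1 - l) * f\<bar> \<le> l * \<bar>e\<bar> + (1 - l) * \<bar>f\<bar>"
    using l abs_triangle_ineq[of "l * e" "(1 - l) * f"] by (simp add: abs_mult)
  also have "\<dots> \<le> l * a0 + (1 - l) * a0" using l e by (intro add_mono mult_left_mono) auto
  finally have le: "\<bar>l * e + (1 - l) * f\<bar> \<le> a0" by (simp add: algebra_simps)
  have "l *\<^sub>R (\<rho> e \<theta> *\<^sub>R \<theta>) + (1 - l) *\<^sub>R (\<rho> f \<theta> *\<^sub>R \<theta>) \<in> K (l * R + (1 - l) * R) (l * e + (1 - l) * f)"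
    using sum_subset_K[of l "1 - l" R e R f] l
    by (intro subsetD[OF sum_subset_K] set_plus_intro imageI rho_in_K e True) auto
  also have "l *\<^sub>R (\<rho> e \<theta> *\<^sub>R \<theta>) + (1 - l) *\<^sub>R (\<rho> f \<theta> *\<^sub>R \<theta>) = (l * \<rho> e \<theta> + (1 - l) * \<rho> f \<theta>) *\<^sub>R \<theta>"
    by (simp add: scaleR_add_left)
  finally have "(l * \<rho> e \<theta> + (1 - l) * \<rho> f \<theta>) *\<^sub>R \<theta> \<in> K R (l * e + (1 - l) * f)"
    by (simp add: algebra_simps)
  then show ?thesis
    using l rho_nonneg[OF e(1)] rho_nonneg[OF e(2)] by (subst (asm) rho_iff[OF le True]) auto
qed (simp add: \<rho>_def radial_def)

text \<open>The gap between supporting plane and boundary point is minimized over all directions.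
  Were the minimum positive, the point could be moved outward by that amount without leaving the
  body.\<close>

lemma contact_normal:
  assumes e: "\<bar>e\<bar> \<le> a0" and \<theta>: "norm \<theta> = 1"
  obtains v where "norm v = 1" "\<rho> e \<theta> * (\<theta> \<bullet> v) = R + e * \<psi> v"
proof -
  define f where "f v = R + e * \<psi> v - \<rho> e \<theta> * (\<theta> \<bullet> v)" for v
  have "continuous_on (sphere 0 1) f"
    unfolding f_def by (intro continuous_intros psi_continuous)
  moreover have "sphere (0::'a) 1 \<noteq> {}" using \<theta> by (metis mem_sphere_0 empty_iff)
  ultimately obtain v where v: "v \<in> sphere 0 1" "\<And>u. u \<in> sphere 0 1 \<Longrightarrow> f v \<le> f u"
    using continuous_attains_inf[of "sphere 0 1" f] by auto
  have "f v \<ge> 0" using K_D[OF rho_in_K[OF e \<theta>], of v] v by (simp add: f_def)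
  moreover have "\<not> f v > 0"
  proof
    assume pos: "f v > 0"
    have "((\<rho> e \<theta> + f v) *\<^sub>R \<theta>) \<bullet> u \<le> R + e * \<psi> u" if u: "norm u = 1" for u
    proof -
      have "f v * (\<theta> \<bullet> u) \<le> f v * 1"
        using pos norm_cauchy_schwarz[of \<theta> u] \<theta> u by (intro mult_left_mono) auto
      also have "\<dots> \<le> f u" using v(2)[of u] u by simp
      finally show ?thesis by (simp add: f_def algebra_simps)
    qed
    then have "(\<rho> e \<theta> + f v) *\<^sub>R \<theta> \<in> K R e" by (simp add: K_def)
    then show False using rho_iff[OF e \<theta>, of "\<rho> e \<theta> + f v"] pos rho_nonneg[OF e, of \<theta>] by simp
  qed
  ultimately have "f v = 0" by simp
  then show thesis using v(1) by (intro that[of v]) (auto simp: f_def)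
qed

text \<open>A ball of radius R / 2 rolls freely inside every body of the family; moving it together with
  the contact point bounds the radial function from below to second order.\<close>

lemma rho_lower_second_order:
  assumes e: "\<bar>e\<bar> \<le> a0" and \<theta>: "norm \<theta> = 1"
  shows "\<exists>v q. norm v = 1 \<and> \<rho> e \<theta> * (\<theta> \<bullet> v) = R + e * \<psi> v \<and> q * (\<theta> \<bullet> v) = \<psi> v \<and>
    (\<forall>s. \<bar>s\<bar> \<le> a0 \<longrightarrow> \<bar>e + s\<bar> \<le> a0 \<longrightarrow> \<rho> e \<theta> + s * q - C2 * s\<^sup>2 \<le> \<rho> (e + s) \<theta>)"
proof -
  obtain v where v: "norm v = 1" "\<rho> e \<theta> * (\<theta> \<bullet> v) = R + e * \<psi> v"
    by (rule contact_normal[OF e \<theta>])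
  have eC: "\<bar>e\<bar> * C \<le> R / 32" by (rule a0_bound[OF e])
  have \<rho>up: "\<rho> e \<theta> \<le> R + R / 32" using rho_le[OF e \<theta>] e_psi_bound[OF \<theta>, of e] eC by linarith
  have tv: "\<theta> \<bullet> v \<ge> 1 / 2"
  proof (rule ccontr)
    assume "\<not> \<theta> \<bullet> v \<ge> 1 / 2"
    then have "\<rho> e \<theta> * (\<theta> \<bullet> v) \<le> \<rho> e \<theta> * (1 / 2)" using rho_nonneg[OF e] by (intro mult_left_mono) auto
    then have "R + e * \<psi> v \<le> (R + R / 32) / 2" using v(2) \<rho>up by simp
    moreover have "- (R / 32) \<le> e * \<psi> v"
      using e_psi_bound[OF v(1), of e] eC unfolding abs_le_iff by linarith
    ultimately show False using R_pos by simp
  qed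
  \<comment> \<open>A ball of radius 3 R / 4 is split off. As v is an outer normal at the boundary
    point, the contribution y of this ball has to be its extreme point in direction v.\<close>
  have "\<rho> e \<theta> *\<^sub>R \<theta> \<in> K (1 * (3 * R / 4) + 1 * (R / 4)) (1 * 0 + 1 * e)"
    using rho_in_K[OF e \<theta>] by (simp add: field_simps)
  then have "\<rho> e \<theta> *\<^sub>R \<theta> \<in> (*\<^sub>R) 1 ` K (3 * R / 4) 0 + (*\<^sub>R) 1 ` K (R / 4) e"
    by (rule subsetD[OF K_subset_sum, rotated -1]) (use R_pos eC in auto)
  then obtain y z where yz: "norm y \<le> 3 * R / 4" "z \<in> K (R / 4) e" "\<rho> e \<theta> *\<^sub>R \<theta> = y + z"
    using R_pos by (auto simp: set_plus_def K_0)
  have vv: "v \<bullet> v = 1" using v(1) by (simp add: norm_eq_1)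
  have "y \<bullet> v + z \<bullet> v = R + e * \<psi> v" using v(2) yz(3) by (metis inner_add_left inner_scaleR_left)
  then have yv: "y \<bullet> v \<ge> 3 * R / 4" using K_D[OF yz(2) v(1)] by simp
  have "(norm (y - k *\<^sub>R v))\<^sup>2 = (norm y)\<^sup>2 - 2 * k * (y \<bullet> v) + k\<^sup>2" for k
    using vv by (simp add: power2_norm_eq_inner inner_diff_left inner_diff_right inner_commute[of v y]
      power2_eq_square[of k] algebra_simps)
  then have "(norm (y - (3 * R / 4) *\<^sub>R v))\<^sup>2 = (norm y)\<^sup>2 - 2 * (3 * R / 4) * (y \<bullet> v) + (3 * R / 4)\<^sup>2"
    by this
  also have "\<dots> \<le> (3 * R / 4)\<^sup>2 - 2 * (3 * R / 4) * (3 * R / 4) + (3 * R / 4)\<^sup>2"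
    using yz(1) yv R_pos by (intro add_mono diff_mono power_mono mult_left_mono) auto
  also have "\<dots> = 0" by (simp add: power2_eq_square)
  finally have y: "y = (3 * R / 4) *\<^sub>R v" by simp
  define q where "q = \<psi> v / (\<theta> \<bullet> v)"
  have q: "q * (\<theta> \<bullet> v) = \<psi> v" using tv by (simp add: q_def)
  have qb: "\<bar>q\<bar> \<le> 2 * C"
  proof -
    have "\<bar>q\<bar> * (1 / 2) \<le> \<bar>q\<bar> * (\<theta> \<bullet> v)" using tv by (intro mult_left_mono) auto
    also have "\<dots> = \<bar>\<psi> v\<bar>" using q tv by (simp add: abs_mult flip: q)
    finally show ?thesis using psi_bound[OF v(1)] by simp
  qed
  have main: "\<rho> e \<theta> + s * q - C2 * s\<^sup>2 \<le> \<rho> (e + s) \<theta>" if s: "\<bar>s\<bar> \<le> a0" "\<bar>e + s\<bar> \<le> a0" for s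
  proof -
    define t where "t = \<rho> e \<theta> + s * q - C2 * s\<^sup>2"
    \<comment> \<open>The radius is redistributed: z keeps its R / 4, another R / 4 carries the
      contact point for the change s, and the remaining ball of radius R / 2 has to absorb h, the
      discrepancy between moving along \<theta> and moving with the contact point.\<close>
    define h where "h = s *\<^sub>R (q *\<^sub>R \<theta> - b v) - (C2 * s\<^sup>2) *\<^sub>R \<theta>"
    have "norm (q *\<^sub>R \<theta> - b v) \<le> \<bar>q\<bar> * norm \<theta> + norm (b v)"
      by (metis norm_scaleR norm_triangle_ineq4)
    then have "norm (q *\<^sub>R \<theta> - b v) \<le> 3 * C" using qb \<theta> b(2)[OF v(1)] by simp
    then have "norm (s *\<^sub>R (q *\<^sub>R \<theta> - b v)) \<le> \<bar>s\<bar> * (3 * C)" by (simp add: mult_left_mono)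
    moreover have "norm ((C2 * s\<^sup>2) *\<^sub>R \<theta>) \<le> \<bar>s\<bar> * C"
    proof -
      have "C2 * \<bar>s\<bar> \<le> C2 * a0" using s C2_pos by (intro mult_left_mono) auto
      also have "\<dots> = C" using C_ge R_pos by (simp add: C2_def a0_def power2_eq_square)
      finally have "\<bar>s\<bar> * (C2 * \<bar>s\<bar>) \<le> \<bar>s\<bar> * C" by (rule mult_left_mono) simp
      then show ?thesis using \<theta> C2_pos by (simp add: abs_mult power2_eq_square mult_ac)
    qed
    ultimately have "norm h \<le> \<bar>s\<bar> * (4 * C)"
      unfolding h_def using norm_triangle_ineq4[of "s *\<^sub>R (q *\<^sub>R \<theta> - b v)" "(C2 * s\<^sup>2) *\<^sub>R \<theta>"] by simp
    then have "(norm h)\<^sup>2 \<le> (\<bar>s\<bar> * (4 * C))\<^sup>2" by (rule power_mono) simp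
    then have h2: "(norm h)\<^sup>2 \<le> 16 * C\<^sup>2 * s\<^sup>2" by (simp add: power_mult_distrib mult_ac)
    have "v \<bullet> h = s * (q * (\<theta> \<bullet> v) - b v \<bullet> v) - C2 * s\<^sup>2 * (\<theta> \<bullet> v)"
      by (simp add: h_def inner_diff_right inner_commute)
    then have vh: "v \<bullet> h = - C2 * s\<^sup>2 * (\<theta> \<bullet> v)" using q b(1)[OF v(1)] by simp
    have "(norm ((R / 2) *\<^sub>R v + h))\<^sup>2 = (R / 2)\<^sup>2 + R * (v \<bullet> h) + (norm h)\<^sup>2"
      using vv by (simp add: power2_norm_eq_inner inner_add_left inner_add_right inner_commute[of h v]
        power2_eq_square[of "R / 2"] algebra_simps)
    \<comment> \<open>The first-order part of h is orthogonal to v by the choice of q. The retreat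
      C2 s^2 along \<theta> has normal component at least C2 s^2 / 2, and this pays for the square
      of h.\<close>
    also have "\<dots> \<le> (R / 2)\<^sup>2"
    proof -
      have "C2 * s\<^sup>2 * (1 / 2) \<le> C2 * s\<^sup>2 * (\<theta> \<bullet> v)" using tv C2_pos by (intro mult_left_mono) auto
      then have "R * (C2 * s\<^sup>2 * (1 / 2)) \<le> R * (C2 * s\<^sup>2 * (\<theta> \<bullet> v))"
        by (rule mult_left_mono) (use R_pos in simp)
      moreover have "R * (C2 * s\<^sup>2 * (1 / 2)) = 16 * C\<^sup>2 * s\<^sup>2" using R_pos by (simp add: C2_def)
      moreover have "R * (v \<bullet> h) = - (R * (C2 * s\<^sup>2 * (\<theta> \<bullet> v)))" using vh by simp
      ultimately show ?thesis using h2 by linarith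
    qed
    finally have nb: "norm ((R / 2) *\<^sub>R v + h) \<le> R / 2"
      by (rule power2_le_imp_le) (use R_pos in simp)
    have "t *\<^sub>R \<theta> = \<rho> e \<theta> *\<^sub>R \<theta> + (s * q) *\<^sub>R \<theta> - (C2 * s\<^sup>2) *\<^sub>R \<theta>"
      by (simp add: t_def scaleR_add_left scaleR_diff_left)
    also have "\<dots> = z + ((R / 4) *\<^sub>R v + s *\<^sub>R b v) + ((R / 2) *\<^sub>R v + h)"
    proof -
      have "(3 * R / 4) *\<^sub>R v = (R / 4) *\<^sub>R v + (R / 2) *\<^sub>R v" by (simp flip: scaleR_add_left)
      then show ?thesis unfolding yz(3) y by (simp add: h_def algebra_simps)
    qed
    finally have t: "t *\<^sub>R \<theta> = z + ((R / 4) *\<^sub>R v + s *\<^sub>R b v) + ((R / 2) *\<^sub>R v + h)" .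
    have sC: "\<bar>s\<bar> * C \<le> (R / 4) / 2" using a0_bound[OF s(1)] R_pos by linarith
    have "(t *\<^sub>R \<theta>) \<bullet> u \<le> R + (e + s) * \<psi> u" if u: "norm u = 1" for u
    proof -
      have "((R / 2) *\<^sub>R v + h) \<bullet> u \<le> R / 2" using norm_cauchy_schwarz[of "(R / 2) *\<^sub>R v + h" u] nb u by simp
      moreover have "((R / 4) *\<^sub>R v + s *\<^sub>R b v) \<bullet> u \<le> R / 4 + s * \<psi> u"
        by (rule K_D[OF contact_point[OF v(1) sC] u])
      moreover have "z \<bullet> u \<le> R / 4 + e * \<psi> u" by (rule K_D[OF yz(2) u])
      ultimately show ?thesis unfolding t inner_add_left distrib_right by linarith
    qed
    then have "t *\<^sub>R \<theta> \<in> K R (e + s)" by (simp add: K_def)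
    then have "t \<le> \<rho> (e + s) \<theta>"
      using rho_iff[OF s(2) \<theta>, of t] rho_nonneg[OF s(2), of \<theta>] by (cases "t \<ge> 0") auto
    then show ?thesis by (simp add: t_def)
  qed
  show ?thesis using v q main by blast
qed

text \<open>For e = 0 the body is a ball, so the normal at \<theta> is \<theta> itself and q =
  \<psi>(\<theta>).\<close>

lemma rho_ge:
  assumes e: "\<bar>e\<bar> \<le> a0" and \<theta>: "norm \<theta> = 1"
  shows "R + e * \<psi> \<theta> - C2 * e\<^sup>2 \<le> \<rho> e \<theta>"
proof -
  have a: "\<bar>0::real\<bar> \<le> a0" using a0_pos by simp
  obtain v q where v: "norm v = 1" "\<rho> 0 \<theta> * (\<theta> \<bullet> v) = R + 0 * \<psi> v" "q * (\<theta> \<bullet> v) = \<psi> v"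
    "\<forall>s. \<bar>s\<bar> \<le> a0 \<longrightarrow> \<bar>0 + s\<bar> \<le> a0 \<longrightarrow> \<rho> 0 \<theta> + s * q - C2 * s\<^sup>2 \<le> \<rho> (0 + s) \<theta>"
    using rho_lower_second_order[OF a \<theta>] by (elim exE conjE) (rule that)
  have tv: "\<theta> \<bullet> v = 1" using v(2) rho_0[OF \<theta>] R_pos by simp
  then have "(norm (\<theta> - v))\<^sup>2 = 0" using inner_sphere[OF \<theta> v(1)] by simp
  then have "v = \<theta>" by simp
  then have "q = \<psi> \<theta>" using v(3) tv by simp
  then show ?thesis using v(4)[rule_format, of e] e by (simp add: rho_0[OF \<theta>])
qed

text \<open>The lower bound is the sum of the expansions for s and - s with the same q; the upper
  bound is concavity.\<close>

lemma rho_second_difference: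
  assumes e: "\<bar>e\<bar> \<le> a0" and s: "\<bar>s\<bar> \<le> a0" "\<bar>e + s\<bar> \<le> a0" "\<bar>e - s\<bar> \<le> a0" and \<theta>: "norm \<theta> = 1"
  shows "- 2 * C2 * s\<^sup>2 \<le> \<rho> (e + s) \<theta> + \<rho> (e - s) \<theta> - 2 * \<rho> e \<theta>"
    and "\<rho> (e + s) \<theta> + \<rho> (e - s) \<theta> - 2 * \<rho> e \<theta> \<le> 0"
proof -
  obtain q where q: "\<And>s. \<bar>s\<bar> \<le> a0 \<Longrightarrow> \<bar>e + s\<bar> \<le> a0 \<Longrightarrow> \<rho> e \<theta> + s * q - C2 * s\<^sup>2 \<le> \<rho> (e + s) \<theta>"
    using rho_lower_second_order[OF e \<theta>] by (elim exE conjE) auto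
  from q[OF s(1,2)] q[of "- s"] s show "- 2 * C2 * s\<^sup>2 \<le> \<rho> (e + s) \<theta> + \<rho> (e - s) \<theta> - 2 * \<rho> e \<theta>"
    by simp
  have E: "(1/2) * (e + s) + (1 - 1/2) * (e - s) = e" by (simp add: field_simps)
  show "\<rho> (e + s) \<theta> + \<rho> (e - s) \<theta> - 2 * \<rho> e \<theta> \<le> 0"
    using rho_concave[OF s(2,3), of "1/2" \<theta>, unfolded E] by simp
qed

text \<open>By concavity, increments at e are compared with the chords over [0, e] and [e, 2 e]; at
  0, e and 2 e the linear approximation is known with an error of order C2 e^2.\<close>

lemma rho_increment:
  assumes e: "0 < e" "2 * e \<le> a0" and s: "0 < s" "s \<le> e" and \<theta>: "norm \<theta> = 1"
  shows "s * \<psi> \<theta> - 4 * C2 * e * s \<le> \<rho> (e + s) \<theta> - \<rho> e \<theta>"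
    and "\<rho> (e + s) \<theta> - \<rho> e \<theta> \<le> s * \<psi> \<theta>"
    and "s * \<psi> \<theta> - 4 * C2 * e * s \<le> \<rho> e \<theta> - \<rho> (e - s) \<theta>"
    and "\<rho> e \<theta> - \<rho> (e - s) \<theta> \<le> s * \<psi> \<theta>"
proof -
  have r2: "\<rho> (2 * e) \<theta> \<ge> R + 2 * e * \<psi> \<theta> - 4 * C2 * e\<^sup>2"
    using rho_ge[of "2 * e" \<theta>] e \<theta> by (simp add: power_mult_distrib)
  have re: "\<rho> e \<theta> \<le> R + e * \<psi> \<theta>" using e \<theta> by (intro rho_le) auto
  have E: "(1 - s / e) * e + (1 - (1 - s / e)) * (2 * e) = e + s" using e by (simp add: field_simps)
  have "(1 - s / e) * \<rho> e \<theta> + (s / e) * \<rho> (2 * e) \<theta> \<le> \<rho> (e + s) \<theta>"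
    using rho_concave[of e "2 * e" "1 - s / e" \<theta>, unfolded E] e s by simp
  then have 1: "(s / e) * (\<rho> (2 * e) \<theta> - \<rho> e \<theta>) \<le> \<rho> (e + s) \<theta> - \<rho> e \<theta>" by (simp add: algebra_simps)
  have "(s / e) * (e * \<psi> \<theta> - 4 * C2 * e\<^sup>2) \<le> (s / e) * (\<rho> (2 * e) \<theta> - \<rho> e \<theta>)"
    using r2 re e s by (intro mult_left_mono) auto
  moreover have "(s / e) * (e * \<psi> \<theta> - 4 * C2 * e\<^sup>2) = s * \<psi> \<theta> - 4 * C2 * e * s"
    using e by (simp add: field_simps power2_eq_square)
  ultimately show A: "s * \<psi> \<theta> - 4 * C2 * e * s \<le> \<rho> (e + s) \<theta> - \<rho> e \<theta>" using 1 by linarith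
  have sd: "\<rho> (e + s) \<theta> + \<rho> (e - s) \<theta> - 2 * \<rho> e \<theta> \<le> 0"
    using e s \<theta> by (intro rho_second_difference) auto
  have E: "(s / e) * 0 + (1 - s / e) * e = e - s" using e by (simp add: field_simps)
  have "(s / e) * \<rho> 0 \<theta> + (1 - s / e) * \<rho> e \<theta> \<le> \<rho> (e - s) \<theta>"
    using rho_concave[of 0 e "s / e" \<theta>, unfolded E] e s a0_pos by simp
  then have "\<rho> e \<theta> - \<rho> (e - s) \<theta> \<le> (s / e) * (\<rho> e \<theta> - R)"
    using rho_0[OF \<theta>] by (simp add: algebra_simps)
  also have "\<dots> \<le> (s / e) * (e * \<psi> \<theta>)" using re e s by (intro mult_left_mono) auto
  also have "\<dots> = s * \<psi> \<theta>" using e by simp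
  finally show B: "\<rho> e \<theta> - \<rho> (e - s) \<theta> \<le> s * \<psi> \<theta>" .
  show "s * \<psi> \<theta> - 4 * C2 * e * s \<le> \<rho> e \<theta> - \<rho> (e - s) \<theta>" using A sd by linarith
  show "\<rho> (e + s) \<theta> - \<rho> e \<theta> \<le> s * \<psi> \<theta>" using B sd by linarith
qed

end

section \<open>A second-order criterion for concavity\<close>

text \<open>If F dipped below a chord, F minus the chord minus \<delta> (t - x) (t - y) would for
  small \<delta> still have a negative interior minimum. There its second difference is nonnegative,
  so that of F is at least 2 \<delta> s^2.\<close>

lemma concave_if_second_difference_le:
  fixes F :: "real \<Rightarrow> real"
  assumes cont: "continuous_on {0<..<a} F"
    and sd: "\<And>e \<eta>. 0 < e \<Longrightarrow> e < a \<Longrightarrow> 0 < \<eta> \<Longrightarrow> \<exists>s0>0. \<forall>s. 0 < s \<and> s < s0 \<longrightarrow> F (e + s) + F (e - s) - 2 * F e \<le> \<eta> * s\<^sup>2"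
    and e: "e1 \<in> {0<..<a}" "e2 \<in> {0<..<a}" and l: "0 \<le> l" "l \<le> 1"
  shows "l * F e1 + (1 - l) * F e2 \<le> F (l * e1 + (1 - l) * e2)"
proof -
  have *: "l * F x + (1 - l) * F y \<le> F (l * x + (1 - l) * y)"
    if xy: "0 < x" "x < y" "y < a" and l: "0 \<le> l" "l \<le> 1" for x y l
  proof (rule ccontr)
    assume neg: "\<not> ?thesis"
    define z where "z = l * x + (1 - l) * y"
    have z: "z - x = (1 - l) * (y - x)" "y - z = l * (y - x)" by (simp_all add: z_def algebra_simps)
    have "0 \<le> z - x" "0 \<le> y - z" unfolding z using l xy by auto
    then have zxy: "x \<le> z" "z \<le> y" by linarith+
    define k where "k = (F y - F x) / (y - x)"
    have k: "(y - x) * k = F y - F x" using xy by (simp add: k_def)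
    define c where "c t = F x + (t - x) * k" for t
    have cz: "c z = l * F x + (1 - l) * F y"
    proof -
      have "c z = F x + (1 - l) * ((y - x) * k)" by (simp only: c_def z(1) mult.assoc)
      then show ?thesis unfolding k by (simp add: algebra_simps)
    qed
    have gap: "F z - c z < 0" using neg cz by (simp add: z_def)
    \<comment> \<open>The parabola is at most (y - x)^2 in modulus at z, so this \<delta> uses up no
      more than half of the dip; the summand 1 makes the inequality easy to handle.\<close>
    define \<delta> where "\<delta> = (c z - F z) / (2 * (1 + (y - x)\<^sup>2))"
    have \<delta>: "\<delta> > 0" using gap by (simp add: \<delta>_def add_pos_nonneg)
    define H where "H t = F t - c t - \<delta> * ((t - x) * (t - y))" for t
    have "continuous_on {x..y} H"
      unfolding H_def c_def using xy
      by (intro continuous_intros continuous_on_subset[OF cont]) auto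
    then obtain m where m: "m \<in> {x..y}" "\<And>t. t \<in> {x..y} \<Longrightarrow> H m \<le> H t"
      using continuous_attains_inf[of "{x..y}" H] xy by auto
    have "- ((z - x) * (z - y)) \<le> (y - x)\<^sup>2"
    proof -
      have "(z - x) * (y - z) \<le> (y - x) * (y - x)" using zxy by (intro mult_mono) auto
      then show ?thesis by (simp add: power2_eq_square algebra_simps)
    qed
    then have "\<delta> * (- ((z - x) * (z - y))) \<le> \<delta> * (1 + (y - x)\<^sup>2)" using \<delta> by (intro mult_left_mono) auto
    also have "\<dots> = (c z - F z) / 2"
    proof -
      have "1 + (y - x)\<^sup>2 > 0" by (simp add: add_pos_nonneg)
      then show ?thesis by (simp add: \<delta>_def field_simps)
    qed
    finally have "H z < 0" using gap by (simp add: H_def)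
    then have Hm: "H m < 0" using m(2)[of z] zxy by auto
    have "H x = 0" "H y = 0" using k by (simp_all add: H_def c_def)
    then have "m \<noteq> x" "m \<noteq> y" using Hm by auto
    then have mm: "x < m" "m < y" using m(1) by auto
    then have "0 < m" "m < a" using xy by auto
    from sd[OF this \<delta>] obtain s0 where s0: "s0 > 0" "\<And>s. 0 < s \<Longrightarrow> s < s0 \<Longrightarrow> F (m + s) + F (m - s) - 2 * F m \<le> \<delta> * s\<^sup>2"
      by blast
    define s where "s = min (s0 / 2) (min (m - x) (y - m))"
    have s: "0 < s" "s < s0" "s \<le> m - x" "s \<le> y - m" using s0(1) mm by (auto simp: s_def)
    have "0 \<le> H (m + s) + H (m - s) - 2 * H m"
      using m(2)[of "m + s"] m(2)[of "m - s"] s mm by auto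
    also have "\<dots> = F (m + s) + F (m - s) - 2 * F m - 2 * \<delta> * s\<^sup>2"
    proof -
      have "c (m + s) + c (m - s) - 2 * c m = 0" by (simp add: c_def algebra_simps)
      then show ?thesis by (simp add: H_def power2_eq_square algebra_simps)
    qed
    also have "\<dots> \<le> - \<delta> * s\<^sup>2" using s0(2)[OF s(1,2)] by simp
    also have "\<dots> < 0" using \<delta> s by simp
    finally show False by simp
  qed
  consider "e1 < e2" | "e2 < e1" | "e1 = e2" by linarith
  then show ?thesis
  proof cases
    case 1
    then show ?thesis using * e l by auto
  next
    case 2
    then show ?thesis using *[of e2 e1 "1 - l"] e l by (simp add: add.commute)
  next
    case 3
    then show ?thesis by (simp add: algebra_simps)
  qed
qed

text \<open>The Taylor remainder has a derivative that vanishes to first order at 0, hence is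
  bounded by \<kappa> |t| nearby; the mean value inequality adds the second factor |t|.\<close>

lemma powr_second_order:
  fixes p \<kappa> :: real
  assumes "\<kappa> > 0"
  shows "\<exists>\<delta>>0. \<delta> < 1 \<and> (\<forall>t. \<bar>t\<bar> < \<delta> \<longrightarrow> \<bar>(1 + t) powr p - (1 + p * t + p * (p - 1) / 2 * t\<^sup>2)\<bar> \<le> \<kappa> * t\<^sup>2)"
proof -
  define f where "f t = (1 + t) powr p - (1 + p * t + p * (p - 1) / 2 * t\<^sup>2)" for t
  define f' where "f' t = p * (1 + t) powr (p - 1) - (p + p * (p - 1) * t)" for t
  have d1: "(f has_real_derivative f' t) (at t)" if "\<bar>t\<bar> < 1" for t
    unfolding f_def f'_def using that by (auto intro!: derivative_eq_intros)
  have d2: "(f' has_real_derivative 0) (at 0)"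
    unfolding f'_def by (auto intro!: derivative_eq_intros)
  have "((\<lambda>t. (f' t - f' 0) / (t - 0)) \<longlongrightarrow> 0) (at 0)"
    using d2 unfolding has_field_derivative_iff by simp
  from LIM_D[OF this assms] obtain d where d: "d > 0"
    "\<And>t. t \<noteq> 0 \<Longrightarrow> \<bar>t\<bar> < d \<Longrightarrow> \<bar>(f' t - f' 0) / t\<bar> < \<kappa>"
    by auto
  have f'b: "\<bar>f' t\<bar> \<le> \<kappa> * \<bar>t\<bar>" if "\<bar>t\<bar> < d" for t
    using d(2)[of t] that by (cases "t = 0") (auto simp: f'_def abs_divide field_simps)
  show ?thesis
  proof (intro exI[of _ "min d (1/2)"] conjI allI impI)
    show "min d (1/2) > 0" "min d (1/2) < 1" using d by auto
    fix t assume t: "\<bar>t\<bar> < min d (1/2)"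
    have "norm (f t - f 0) \<le> (\<kappa> * \<bar>t\<bar>) * norm (t - 0)"
    proof (rule differentiable_bound[of "closed_segment 0 t" f "\<lambda>x h. f' x * h"])
      fix x assume x: "x \<in> closed_segment 0 t"
      then have xt: "\<bar>x\<bar> \<le> \<bar>t\<bar>" by (auto simp: closed_segment_eq_real_ivl split: if_splits)
      have "(f has_derivative (\<lambda>h. f' x * h)) (at x)"
        using d1[of x] xt t by (auto simp: has_field_derivative_def)
      then show "(f has_derivative (\<lambda>h. f' x * h)) (at x within closed_segment 0 t)"
        by (rule has_derivative_at_withinI)
      have "\<bar>f' x\<bar> \<le> \<kappa> * \<bar>x\<bar>" using xt t by (intro f'b) auto
      also have "\<dots> \<le> \<kappa> * \<bar>t\<bar>" using xt assms by (intro mult_left_mono) auto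
      finally have "\<bar>f' x\<bar> \<le> \<kappa> * \<bar>t\<bar>" .
      then have "norm (f' x * h) \<le> \<kappa> * \<bar>t\<bar> * norm h" for h
        by (simp add: abs_mult mult_right_mono)
      then show "onorm (\<lambda>h. f' x * h) \<le> \<kappa> * \<bar>t\<bar>"
        using assms by (intro onorm_bound) auto
    qed auto
    then have "\<bar>f t\<bar> \<le> \<kappa> * t\<^sup>2" by (simp add: f_def power2_eq_square abs_mult_self mult.assoc)
    then show "\<bar>(1 + t) powr p - (1 + p * t + p * (p - 1) / 2 * t\<^sup>2)\<bar> \<le> \<kappa> * t\<^sup>2" by (simp add: f_def)
  qed
qed

text \<open>Here X is the p-concave Lebesgue part of f = X - j, and the hypothesis H compares the second
  variation of j with the loss in passing from X to f.\<close>

lemma powr_second_difference_le: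
  fixes X j :: "real \<Rightarrow> real" and p B e d :: real
  defines "f \<equiv> \<lambda>e. X e - j e"
  assumes p: "0 < p" "p < 1" and B: "B > 0" and d: "d > 0"
    and X0: "X e > 0" and f0: "f e > 0"
    and Xb: "\<And>s. 0 < s \<Longrightarrow> s < d \<Longrightarrow> \<bar>X (e + s) - X e\<bar> \<le> B * s \<and> \<bar>X (e - s) - X e\<bar> \<le> B * s"
    and jb: "\<And>s. 0 < s \<Longrightarrow> s < d \<Longrightarrow> \<bar>j (e + s) - j e\<bar> \<le> B * s \<and> \<bar>j (e - s) - j e\<bar> \<le> B * s"
    and Xc: "\<And>s. 0 < s \<Longrightarrow> s < d \<Longrightarrow> X (e + s) powr p + X (e - s) powr p \<le> 2 * X e powr p"
    and H: "\<And>\<eta>. \<eta> > 0 \<Longrightarrow> \<exists>s0>0. \<forall>s. 0 < s \<and> s < s0 \<longrightarrow>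
      (1 - p) / 2 * (((X (e + s) - X e)\<^sup>2 + (X (e - s) - X e)\<^sup>2) * (- j e) / (X e * f e)
        + 2 * ((X (e + s) - X e) * (j (e + s) - j e) + (X (e - s) - X e) * (j (e - s) - j e)) / f e)
      \<le> (j (e + s) + j (e - s) - 2 * j e) + \<eta> * s\<^sup>2"
    and \<eta>: "\<eta> > 0"
  shows "\<exists>s0>0. \<forall>s. 0 < s \<and> s < s0 \<longrightarrow> f (e + s) powr p + f (e - s) powr p - 2 * f e powr p \<le> \<eta> * s\<^sup>2"
proof -
  define X0 where "X0 = X e"
  define f0 where "f0 = f e"
  have pos: "X0 > 0" "f0 > 0" using \<open>X e > 0\<close> \<open>f e > 0\<close> by (auto simp: X0_def f0_def)
  define c where "c = (1 - p) / 2"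
  have c: "c > 0" using p by (simp add: c_def)
  define L where "L = p * f0 powr p / f0"
  have L: "L > 0" using p pos by (simp add: L_def)
  define \<eta>1 where "\<eta>1 = \<eta> / (4 * L)"
  have \<eta>1: "\<eta>1 > 0" using \<eta> L by (simp add: \<eta>1_def)
  define A where "A = 2 * B\<^sup>2 / (p * X0)"
  define A' where "A' = 8 * B\<^sup>2 * f0 powr p / f0\<^sup>2"
  have A: "A > 0" "A' > 0" using B p pos by (auto simp: A_def A'_def)
  \<comment> \<open>The Taylor remainder enters once for X and once for f; A and A' are the factors
    with which it is multiplied there, per s^2.\<close>
  define \<kappa> where "\<kappa> = min (\<eta>1 / A) (\<eta> / (2 * A'))"
  have \<kappa>: "\<kappa> > 0" "\<kappa> * A \<le> \<eta>1" "\<kappa> * A' \<le> \<eta> / 2"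
    using \<eta>1 A \<eta> by (auto simp: \<kappa>_def min_def field_simps)
  obtain \<delta> where \<delta>: "\<delta> > 0" "\<delta> < 1"
    "\<And>t. \<bar>t\<bar> < \<delta> \<Longrightarrow> \<bar>(1 + t) powr p - (1 + p * t + p * (p - 1) / 2 * t\<^sup>2)\<bar> \<le> \<kappa> * t\<^sup>2"
    using powr_second_order[OF \<kappa>(1), of p] by blast
  obtain s1 where s1: "s1 > 0" "\<And>s. 0 < s \<Longrightarrow> s < s1 \<Longrightarrow>
      c * (((X (e + s) - X e)\<^sup>2 + (X (e - s) - X e)\<^sup>2) * (- j e) / (X e * f e)
        + 2 * ((X (e + s) - X e) * (j (e + s) - j e) + (X (e - s) - X e) * (j (e - s) - j e)) / f e)
      \<le> (j (e + s) + j (e - s) - 2 * j e) + \<eta>1 * s\<^sup>2"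
    using H[OF \<eta>1] unfolding c_def by blast
  define s0 where "s0 = min (min s1 d) (min (\<delta> * X0 / B) (\<delta> * f0 / (2 * B)))"
  have "s0 > 0" using s1 d \<delta> pos B by (simp add: s0_def)
  moreover have "f (e + s) powr p + f (e - s) powr p - 2 * f e powr p \<le> \<eta> * s\<^sup>2" if s: "0 < s" "s < s0" for s
  proof -
    have sd: "s < s1" "s < d" "B * s < \<delta> * X0" "2 * B * s < \<delta> * f0"
      using s B by (auto simp: s0_def field_simps)
    define x1 where "x1 = X (e + s) - X e"
    define x2 where "x2 = X (e - s) - X e"
    define y1 where "y1 = j (e + s) - j e"
    define y2 where "y2 = j (e - s) - j e"
    have xb: "\<bar>x1\<bar> \<le> B * s" "\<bar>x2\<bar> \<le> B * s" and yb: "\<bar>y1\<bar> \<le> B * s" "\<bar>y2\<bar> \<le> B * s"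
      using Xb[OF s(1) sd(2)] jb[OF s(1) sd(2)] by (auto simp: x1_def x2_def y1_def y2_def)
    have xs: "x1\<^sup>2 \<le> B\<^sup>2 * s\<^sup>2" "x2\<^sup>2 \<le> B\<^sup>2 * s\<^sup>2"
      using power_mono[OF xb(1), of 2] power_mono[OF xb(2), of 2] by (auto simp: power_mult_distrib)
    have ds: "(x1 - y1)\<^sup>2 \<le> 4 * B\<^sup>2 * s\<^sup>2" "(x2 - y2)\<^sup>2 \<le> 4 * B\<^sup>2 * s\<^sup>2"
    proof -
      have "\<bar>x1 - y1\<bar> \<le> 2 * B * s" "\<bar>x2 - y2\<bar> \<le> 2 * B * s" using xb yb by linarith+
      then show "(x1 - y1)\<^sup>2 \<le> 4 * B\<^sup>2 * s\<^sup>2" "(x2 - y2)\<^sup>2 \<le> 4 * B\<^sup>2 * s\<^sup>2"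
        using power_mono[of "\<bar>x1 - y1\<bar>" "2 * B * s" 2] power_mono[of "\<bar>x2 - y2\<bar>" "2 * B * s" 2]
        by (auto simp: power_mult_distrib)
    qed
    have tay: "\<bar>(m + x) powr p - m powr p * (1 + p * (x / m) + p * (p - 1) / 2 * (x / m)\<^sup>2)\<bar> \<le> m powr p * (\<kappa> * (x / m)\<^sup>2)"
      if m: "m > 0" and x: "\<bar>x\<bar> < \<delta> * m" for m x
    proof -
      have t: "\<bar>x / m\<bar> < \<delta>" using m x by (simp add: abs_divide pos_divide_less_eq)
      have "m + x = m * (1 + x / m)" using m by (simp add: field_simps)
      moreover have "1 + x / m \<ge> 0" using t \<delta>(2) by linarith
      ultimately have "(m + x) powr p = m powr p * (1 + x / m) powr p" using m by (simp add: powr_mult)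
      then have "\<bar>(m + x) powr p - m powr p * (1 + p * (x / m) + p * (p - 1) / 2 * (x / m)\<^sup>2)\<bar>
          = m powr p * \<bar>(1 + x / m) powr p - (1 + p * (x / m) + p * (p - 1) / 2 * (x / m)\<^sup>2)\<bar>"
        by (simp add: right_diff_distrib[symmetric] abs_mult)
      also have "\<dots> \<le> m powr p * (\<kappa> * (x / m)\<^sup>2)" using \<delta>(3)[OF t] by (intro mult_left_mono) auto
      finally show ?thesis .
    qed
    have "X (e + s) powr p = (X0 + x1) powr p" "X (e - s) powr p = (X0 + x2) powr p"
      by (simp_all add: X0_def x1_def x2_def)
    then have "(X0 + x1) powr p + (X0 + x2) powr p \<le> 2 * X0 powr p"
      using Xc[OF s(1) sd(2)] by (simp add: X0_def)
    moreover have "(X0 + x1) powr p \<ge> X0 powr p * (1 + p * (x1 / X0) + p * (p - 1) / 2 * (x1 / X0)\<^sup>2) - X0 powr p * (\<kappa> * (x1 / X0)\<^sup>2)"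
      using tay[OF pos(1), of x1] xb sd by (simp add: abs_le_iff)
    moreover have "(X0 + x2) powr p \<ge> X0 powr p * (1 + p * (x2 / X0) + p * (p - 1) / 2 * (x2 / X0)\<^sup>2) - X0 powr p * (\<kappa> * (x2 / X0)\<^sup>2)"
      using tay[OF pos(1), of x2] xb sd by (simp add: abs_le_iff)
    ultimately have "X0 powr p * (1 + p * (x1 / X0) + p * (p - 1) / 2 * (x1 / X0)\<^sup>2 - \<kappa> * (x1 / X0)\<^sup>2
        + (1 + p * (x2 / X0) + p * (p - 1) / 2 * (x2 / X0)\<^sup>2 - \<kappa> * (x2 / X0)\<^sup>2)) \<le> X0 powr p * 2"
      by (simp add: algebra_simps)
    then have "p * (x1 / X0) + p * (p - 1) / 2 * (x1 / X0)\<^sup>2 - \<kappa> * (x1 / X0)\<^sup>2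
        + (p * (x2 / X0) + p * (p - 1) / 2 * (x2 / X0)\<^sup>2 - \<kappa> * (x2 / X0)\<^sup>2) \<le> 0"
      using pos by (subst (asm) mult_le_cancel_left_pos) auto
    moreover have id: "p * (a / X0) + p * (p - 1) / 2 * (a / X0)\<^sup>2 - \<kappa> * (a / X0)\<^sup>2
        = p * a / X0 - (p * c + \<kappa>) * (a\<^sup>2 / X0\<^sup>2)" for a
      by (simp add: c_def power_divide left_diff_distrib right_diff_distrib add_divide_distrib diff_divide_distrib distrib_right)
    moreover have "p * (x1 + x2) / X0 = p * x1 / X0 + p * x2 / X0"
      by (simp add: distrib_left add_divide_distrib)
    moreover have "(p * c + \<kappa>) * ((x1\<^sup>2 + x2\<^sup>2) / X0\<^sup>2) = (p * c + \<kappa>) * (x1\<^sup>2 / X0\<^sup>2) + (p * c + \<kappa>) * (x2\<^sup>2 / X0\<^sup>2)"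
      by (simp add: distrib_left add_divide_distrib)
    ultimately have "p * (x1 + x2) / X0 \<le> (p * c + \<kappa>) * ((x1\<^sup>2 + x2\<^sup>2) / X0\<^sup>2)"
      using id[of x1] id[of x2] by linarith
    then have "p * (x1 + x2) / X0 * (X0 / p) \<le> (p * c + \<kappa>) * ((x1\<^sup>2 + x2\<^sup>2) / X0\<^sup>2) * (X0 / p)"
      using pos p by (intro mult_right_mono) auto
    moreover have "(p * c + \<kappa>) * (S / X0\<^sup>2) * (X0 / p) = c * S / X0 + \<kappa> * (S / (p * X0))" for S
      using pos p by (simp add: power2_eq_square[of X0] field_simps)
    moreover have "p * (x1 + x2) / X0 * (X0 / p) = x1 + x2" using pos p by simp
    ultimately have "x1 + x2 \<le> c * (x1\<^sup>2 + x2\<^sup>2) / X0 + \<kappa> * ((x1\<^sup>2 + x2\<^sup>2) / (p * X0))"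
      by metis
    also have "\<kappa> * ((x1\<^sup>2 + x2\<^sup>2) / (p * X0)) \<le> \<kappa> * ((2 * B\<^sup>2 * s\<^sup>2) / (p * X0))"
      using xs pos p \<kappa> by (intro mult_left_mono divide_right_mono) auto
    also have "\<dots> = (\<kappa> * A) * s\<^sup>2" by (simp add: A_def)
    also have "\<dots> \<le> \<eta>1 * s\<^sup>2" using \<kappa> by (intro mult_right_mono) auto
    finally have sx: "x1 + x2 \<le> c * (x1\<^sup>2 + x2\<^sup>2) / X0 + \<eta>1 * s\<^sup>2" by simp
    \<comment> \<open>Up to the positive factor L, this is the second-order part of the second
      difference of f powr p.\<close>
    define E where "E = x1 - y1 + (x2 - y2) - c * ((x1 - y1)\<^sup>2 + (x2 - y2)\<^sup>2) / f0"
    have deficit: "X0 - f0 = j e" by (simp add: X0_def f0_def f_def)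
    \<comment> \<open>The source of hypothesis H: replacing x^2 / X0 by (x - y)^2 / f0 leaves a term
      in j(e), a mixed term in x y, and - y^2 / f0, which has the favourable sign and is
      dropped.\<close>
    have quot: "x\<^sup>2 / X0 - (x - y)\<^sup>2 / f0 \<le> x\<^sup>2 * (- j e) / (X0 * f0) + 2 * (x * y) / f0" for x y
    proof -
      have "x\<^sup>2 / X0 - (x - y)\<^sup>2 / f0 = x\<^sup>2 * (f0 - X0) / (X0 * f0) + 2 * (x * y) / f0 - y\<^sup>2 / f0"
        using pos by (simp add: power2_eq_square field_simps)
      also have "f0 - X0 = - j e" using deficit by simp
      finally show ?thesis using pos by simp
    qed
    have Q1: "c * (x1\<^sup>2 + x2\<^sup>2) / X0 - c * ((x1 - y1)\<^sup>2 + (x2 - y2)\<^sup>2) / f0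
        = c * ((x1\<^sup>2 / X0 - (x1 - y1)\<^sup>2 / f0) + (x2\<^sup>2 / X0 - (x2 - y2)\<^sup>2 / f0))"
      by (simp add: algebra_simps add_divide_distrib)
    also have "\<dots> \<le> c * ((x1\<^sup>2 * (- j e) / (X0 * f0) + 2 * (x1 * y1) / f0) + (x2\<^sup>2 * (- j e) / (X0 * f0) + 2 * (x2 * y2) / f0))"
      using c quot by (intro mult_left_mono add_mono) auto
    also have "\<dots> = c * ((x1\<^sup>2 + x2\<^sup>2) * (- j e) / (X0 * f0) + 2 * (x1 * y1 + x2 * y2) / f0)"
      by (simp only: distrib_left distrib_right add_divide_distrib ac_simps)
    also have "\<dots> \<le> (y1 + y2) + \<eta>1 * s\<^sup>2"
      using s1(2)[OF s(1) sd(1)] by (simp add: x1_def x2_def y1_def y2_def X0_def f0_def)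
    finally have Eb: "E \<le> 2 * \<eta>1 * s\<^sup>2" using sx unfolding E_def by linarith
    have "\<bar>x1 - y1\<bar> < \<delta> * f0" "\<bar>x2 - y2\<bar> < \<delta> * f0" using xb yb sd by linarith+
    note t1 = tay[OF pos(2) this(1)] and t2 = tay[OF pos(2) this(2)]
    have "f (e + s) = f0 + (x1 - y1)" "f (e - s) = f0 + (x2 - y2)"
      by (simp_all add: f_def f0_def x1_def x2_def y1_def y2_def)
    then have "f (e + s) powr p + f (e - s) powr p - 2 * f e powr p
       = (f0 + (x1 - y1)) powr p + (f0 + (x2 - y2)) powr p - 2 * f0 powr p" by (simp add: f0_def)
    also have "\<dots> \<le> f0 powr p * (1 + p * ((x1 - y1) / f0) + p * (p - 1) / 2 * ((x1 - y1) / f0)\<^sup>2) + f0 powr p * (\<kappa> * ((x1 - y1) / f0)\<^sup>2)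
        + (f0 powr p * (1 + p * ((x2 - y2) / f0) + p * (p - 1) / 2 * ((x2 - y2) / f0)\<^sup>2) + f0 powr p * (\<kappa> * ((x2 - y2) / f0)\<^sup>2)) - 2 * f0 powr p"
      using t1 t2 unfolding abs_le_iff by linarith
    also have "\<dots> = L * E + \<kappa> * (f0 powr p / f0\<^sup>2 * ((x1 - y1)\<^sup>2 + (x2 - y2)\<^sup>2))"
    proof -
      have id: "f0 powr p * (1 + p * (a / f0) + p * (p - 1) / 2 * (a / f0)\<^sup>2) + f0 powr p * (\<kappa> * (a / f0)\<^sup>2)
        = f0 powr p + L * (a - c * a\<^sup>2 / f0) + \<kappa> * (f0 powr p / f0\<^sup>2 * a\<^sup>2)" for a
        using pos by (simp add: L_def c_def power2_eq_square field_simps)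
      show ?thesis unfolding id E_def by (simp add: algebra_simps add_divide_distrib)
    qed
    also have "\<dots> \<le> L * (2 * \<eta>1 * s\<^sup>2) + \<kappa> * (f0 powr p / f0\<^sup>2 * (8 * B\<^sup>2 * s\<^sup>2))"
      using Eb L \<kappa> ds by (intro add_mono mult_left_mono) auto
    also have "\<dots> = \<eta> / 2 * s\<^sup>2 + (\<kappa> * A') * s\<^sup>2" using L by (simp add: \<eta>1_def A'_def)
    also have "\<dots> \<le> \<eta> / 2 * s\<^sup>2 + \<eta> / 2 * s\<^sup>2" using \<kappa> by (intro add_left_mono mult_right_mono) auto
    finally show ?thesis by simp
  qed
  ultimately show ?thesis by blast
qed

section \<open>Log-concavity of the density near R\<close>

text \<open>Otherwise the geometric mean of the values at x and z would exceed h(y), although y lies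
  between them.\<close>

lemma log_concave_decreasing_beyond:
  fixes h :: "real \<Rightarrow> real"
  assumes lc: "\<And>x y l. 0 < x \<Longrightarrow> 0 < y \<Longrightarrow> 0 < l \<Longrightarrow> l < 1 \<Longrightarrow> h x powr l * h y powr (1 - l) \<le> h (l * x + (1 - l) * y)"
    and xyz: "0 < x" "x < y" "y < z" and le: "h y \<le> h x" and pos: "0 < h y"
  shows "h z \<le> h y"
proof (rule ccontr)
  assume "\<not> h z \<le> h y"
  then have zy: "h y < h z" by simp
  define l where "l = (z - y) / (z - x)"
  have l: "0 < l" "l < 1" using xyz by (auto simp: l_def field_simps)
  have "l * (z - x) = z - y" using xyz by (simp add: l_def)
  then have y: "l * x + (1 - l) * z = y" by (simp add: algebra_simps)
  have "h y = h y powr l * h y powr (1 - l)" using pos by (simp flip: powr_add)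
  also have "\<dots> < h x powr l * h z powr (1 - l)"
    using le pos zy l by (intro mult_le_less_imp_less powr_less_mono2 powr_mono2) auto
  also have "\<dots> \<le> h y" using lc[of x z l] xyz l y by simp
  finally show False by simp
qed

lemma log_concave_increasing_before:
  fixes h :: "real \<Rightarrow> real"
  assumes lc: "\<And>x y l. 0 < x \<Longrightarrow> 0 < y \<Longrightarrow> 0 < l \<Longrightarrow> l < 1 \<Longrightarrow> h x powr l * h y powr (1 - l) \<le> h (l * x + (1 - l) * y)"
    and xyz: "0 < x" "x < y" "y < z" and le: "h y \<le> h z" and pos: "0 < h y"
  shows "h x \<le> h y"
proof (rule ccontr)
  assume "\<not> h x \<le> h y"
  then have xy: "h y < h x" by simp
  define l where "l = (z - y) / (z - x)"
  have l: "0 < l" "l < 1" using xyz by (auto simp: l_def field_simps)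
  have "l * (z - x) = z - y" using xyz by (simp add: l_def)
  then have y: "l * x + (1 - l) * z = y" by (simp add: algebra_simps)
  have "h y = h y powr l * h y powr (1 - l)" using pos by (simp flip: powr_add)
  also have "\<dots> < h x powr l * h z powr (1 - l)"
    using le pos xy l by (intro mult_less_le_imp_less powr_less_mono2 powr_mono2) auto
  also have "\<dots> \<le> h y" using lc[of x z l] xyz l y by simp
  finally show False by simp
qed

section \<open>Exponential comparison for the density\<close>

context rot_log_concave
begin

text \<open>\<phi>(t) is an infimum of quotients Q(s, t), each continuous in t, and \<phi>(y) \<le>
  Q(s, y) for y slightly below t.\<close>

lemma phi_left_continuous:
  assumes t: "0 < t" and \<kappa>: "\<phi> t < \<kappa>" and x: "x < t"
  shows "\<exists>y. x < y \<and> 0 < y \<and> y < t \<and> \<phi> y < \<kappa>"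
proof -
  obtain s where s: "0 < s" "s < t" "Q s t < \<kappa>"
    using phi_greatest[OF t, of \<kappa>] \<kappa> by force
  have "((\<lambda>y. Q s y) \<longlongrightarrow> Q s t) (at_left t)"
    unfolding Q_def using s shell_pos[of s t] G_continuous[OF t]
    by (auto intro!: tendsto_intros simp: isCont_def intro: filterlim_mono[OF _ order_refl at_le])
  then have "\<forall>\<^sub>F y in at_left t. Q s y < \<kappa>" using s(3) by (rule order_tendstoD)
  moreover have "\<forall>\<^sub>F y in at_left t. y \<in> {max s x<..<t}"
    using s x by (intro eventually_at_left_real) auto
  ultimately have "\<forall>\<^sub>F y in at_left t. Q s y < \<kappa> \<and> y \<in> {max s x<..<t}" by (rule eventually_conj)
  from eventually_happens'[OF trivial_limit_at_left_real this]
  obtain y where y: "Q s y < \<kappa>" "max s x < y" "y < t" by auto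
  then have "\<phi> y < \<kappa>" using phi_le[of s y] s by simp
  then show ?thesis using y s by auto
qed

lemma phi_exp_log_concave:
  assumes "0 < x" "0 < y" "0 < l" "l < 1"
  shows "(\<phi> x * exp (k * x)) powr l * (\<phi> y * exp (k * y)) powr (1 - l)
      \<le> \<phi> (l * x + (1 - l) * y) * exp (k * (l * x + (1 - l) * y))"
proof -
  have e: "exp (k * z) powr m = exp (k * (m * z))" for z m :: real
    by (simp add: powr_def mult_ac)
  have "(\<phi> x * exp (k * x)) powr l * (\<phi> y * exp (k * y)) powr (1 - l)
      = (\<phi> x powr l * \<phi> y powr (1 - l)) * (exp (k * x) powr l * exp (k * y) powr (1 - l))"
    using phi_nonneg[OF assms(1)] phi_nonneg[OF assms(2)] by (simp add: powr_mult)
  also have "exp (k * x) powr l * exp (k * y) powr (1 - l) = exp (k * (l * x + (1 - l) * y))"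
    unfolding e by (simp add: distrib_left exp_add)
  finally show ?thesis using phi_log_concave[OF assms] by (simp add: mult_right_mono)
qed

text \<open>The factor exp(k t) preserves log-concavity, and a log-concave function that has not
  increased from x to y does not increase afterwards. So a mean decay rate k over one interval
  persists beyond it.\<close>

lemma phi_decay:
  assumes xy: "0 < x" "x < y" and le: "\<phi> y \<le> \<phi> x * exp (- k * (y - x))"
    and st: "y \<le> s" "s \<le> t"
  shows "\<phi> t \<le> \<phi> s * exp (- k * (t - s))"
proof -
  define h where "h t = \<phi> t * exp (k * t)" for t
  note lc = phi_exp_log_concave[of _ _ _ k, folded h_def]
  have conv: "h b \<le> h a \<longleftrightarrow> \<phi> b \<le> \<phi> a * exp (- k * (b - a))" for a b
  proof -
    have "\<phi> b \<le> \<phi> a * exp (- k * (b - a)) \<longleftrightarrow> \<phi> b * exp (k * b) \<le> (\<phi> a * exp (- k * (b - a))) * exp (k * b)"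
      by simp
    also have "(\<phi> a * exp (- k * (b - a))) * exp (k * b) = \<phi> a * exp (k * a)"
      by (simp add: mult.assoc algebra_simps flip: exp_add)
    finally show ?thesis by (simp add: h_def)
  qed
  have pos: "0 < h z \<longleftrightarrow> \<phi> z \<noteq> 0" if "0 < z" for z
    using phi_nonneg[OF that] by (auto simp: h_def zero_less_mult_iff)
  have hyx: "h y \<le> h x" using le conv by simp
  have "h t \<le> h s"
  proof (cases "\<phi> s = 0 \<or> s = t")
    case True
    then show ?thesis
    proof
      assume "\<phi> s = 0"
      moreover have "\<phi> t \<le> \<phi> s" using xy st by (intro phi_antimono) auto
      ultimately show ?thesis using phi_nonneg[of t] xy st by (simp add: h_def)
    qed simp
  next
    case False
    then have s0: "h s > 0" using pos[of s] xy st by simp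
    have "\<phi> s \<le> \<phi> y" using xy st by (intro phi_antimono) auto
    then have y0: "h y > 0" using False pos[of y] xy phi_nonneg[of s] st by auto
    show ?thesis
    proof (cases "y = s")
      case True
      then show ?thesis
        using log_concave_decreasing_beyond[of h x y t] lc xy hyx y0 False st by auto
    next
      case ys: False
      then have "h s \<le> h y"
        using log_concave_decreasing_beyond[of h x y s] lc xy hyx y0 st by auto
      then show ?thesis
        using log_concave_decreasing_beyond[of h y s t] lc xy s0 False ys st by auto
    qed
  qed
  then show ?thesis using conv by simp
qed

lemma phi_growth_before:
  assumes xy: "0 < x" "x < y" and le: "\<phi> x \<le> \<phi> y * exp (k * (y - x))" and pos: "0 < \<phi> x"
    and st: "0 < s" "s \<le> t" "t \<le> x"
  shows "\<phi> s \<le> \<phi> t * exp (k * (t - s))"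
proof -
  define h where "h t = \<phi> t * exp (k * t)" for t
  note lc = phi_exp_log_concave[of _ _ _ k, folded h_def]
  have conv: "h a \<le> h b \<longleftrightarrow> \<phi> a \<le> \<phi> b * exp (k * (b - a))" for a b
  proof -
    have "\<phi> a \<le> \<phi> b * exp (k * (b - a)) \<longleftrightarrow> \<phi> a * exp (k * a) \<le> (\<phi> b * exp (k * (b - a))) * exp (k * a)"
      by simp
    also have "(\<phi> b * exp (k * (b - a))) * exp (k * a) = \<phi> b * exp (k * b)"
      by (simp add: mult.assoc algebra_simps flip: exp_add)
    finally show ?thesis by (simp add: h_def)
  qed
  have hp: "0 < h z" if "0 < z" "z \<le> x" for z
    using phi_antimono[OF that] pos by (simp add: h_def)
  have hxy: "h x \<le> h y" using le conv by simp
  have "h s \<le> h t"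
  proof (cases "s = t")
    case False
    show ?thesis
    proof (cases "t = x")
      case True
      then show ?thesis
        using log_concave_increasing_before[of h s x y] lc xy hxy hp st False by auto
    next
      case tx: False
      have "h t \<le> h x"
        using log_concave_increasing_before[of h t x y] lc xy hxy hp tx st by auto
      then show ?thesis
        using log_concave_increasing_before[of h s t x] lc xy hp tx st False by auto
    qed
  qed simp
  then show ?thesis using conv by simp
qed

text \<open>The derivative n \<omega> t^(n-1) \<phi>(t) is nonincreasing beyond y, so its value at
  the intermediate point z is a supergradient of G there.\<close>

lemma G_concave_beyond:
  assumes y: "0 < y" and q: "\<And>s t. y \<le> s \<Longrightarrow> s \<le> t \<Longrightarrow> t ^ (n - 1) * \<phi> t \<le> s ^ (n - 1) * \<phi> s"
    and ab: "y \<le> a" "y \<le> b" and l: "0 \<le> l" "l \<le> 1"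
  shows "l * G a + (1 - l) * G b \<le> G (l * a + (1 - l) * b)"
proof -
  have up: "G t - G s \<le> real n * \<omega> * (s ^ (n - 1) * \<phi> s) * (t - s)" if s: "y \<le> s" and t: "y \<le> t" for s t
  proof (cases "s \<le> t")
    case True
    have "G t - G s \<le> real n * \<omega> * (s ^ (n - 1) * \<phi> s) * (t - s)"
    proof (rule has_integral_le)
      show "((\<lambda>x. real n * \<omega> * x ^ (n - 1) * \<phi> x) has_integral G t - G s) {s..t}"
        using y s True by (intro G_has_integral) auto
      show "((\<lambda>x. real n * \<omega> * (s ^ (n - 1) * \<phi> s)) has_integral real n * \<omega> * (s ^ (n - 1) * \<phi> s) * (t - s)) {s..t}"
        using has_integral_const_real[of "real n * \<omega> * (s ^ (n - 1) * \<phi> s)" s t] True by (simp add: mult.commute)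
      show "real n * \<omega> * x ^ (n - 1) * \<phi> x \<le> real n * \<omega> * (s ^ (n - 1) * \<phi> s)" if "x \<in> {s..t}" for x
        using q[of s x] s that by (simp add: mult.assoc mult_left_mono)
    qed
    then show ?thesis .
  next
    case False
    have "real n * \<omega> * (s ^ (n - 1) * \<phi> s) * (s - t) \<le> G s - G t"
    proof (rule has_integral_le)
      show "((\<lambda>x. real n * \<omega> * x ^ (n - 1) * \<phi> x) has_integral G s - G t) {t..s}"
        using y t False by (intro G_has_integral) auto
      show "((\<lambda>x. real n * \<omega> * (s ^ (n - 1) * \<phi> s)) has_integral real n * \<omega> * (s ^ (n - 1) * \<phi> s) * (s - t)) {t..s}"
        using has_integral_const_real[of "real n * \<omega> * (s ^ (n - 1) * \<phi> s)" t s] False by (simp add: mult.commute)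
      show "real n * \<omega> * (s ^ (n - 1) * \<phi> s) \<le> real n * \<omega> * x ^ (n - 1) * \<phi> x" if "x \<in> {t..s}" for x
        using q[of x s] t that by (simp add: mult.assoc mult_left_mono)
    qed
    then show ?thesis by (simp add: algebra_simps)
  qed
  define z where "z = l * a + (1 - l) * b"
  define k where "k = real n * \<omega> * (z ^ (n - 1) * \<phi> z)"
  have "l * y + (1 - l) * y \<le> z" unfolding z_def using ab l by (intro add_mono mult_left_mono) auto
  then have z: "y \<le> z" by (simp add: algebra_simps)
  have "l * (G a - G z) + (1 - l) * (G b - G z) \<le> l * (k * (a - z)) + (1 - l) * (k * (b - z))"
    using up[OF z ab(1)] up[OF z ab(2)] l by (intro add_mono mult_left_mono) (auto simp: k_def)
  also have "\<dots> = k * (l * a + (1 - l) * b - z)" by (simp add: algebra_simps)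
  also have "\<dots> = 0" by (simp add: z_def)
  finally have "l * G a + (1 - l) * G b \<le> G z" by (simp add: algebra_simps)
  then show ?thesis unfolding z_def .
qed

text \<open>The decay rate (n - 1) / x is what it takes for t^(n-1) \<phi>(t) to be nonincreasing beyond y.\<close>

definition steep_at :: "real \<Rightarrow> bool" where
  "steep_at R \<longleftrightarrow> (\<exists>x y. 0 < x \<and> x < y \<and> y < R \<and> \<phi> y \<le> \<phi> x * exp (- ((real n - 1) / x) * (y - x)))"

text \<open>From s on, t^(n-1) grows at most at the exponential rate (n - 1) / s. For s beyond x
  this is below the decay rate (n - 1) / x of \<phi>.\<close>

lemma steep_G_concave:
  assumes "steep_at R"
  shows "\<exists>y. 0 < y \<and> y < R \<and> (\<forall>a b l. y \<le> a \<longrightarrow> y \<le> b \<longrightarrow> 0 \<le> l \<longrightarrow> l \<le> 1 \<longrightarrow>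
    l * G a + (1 - l) * G b \<le> G (l * a + (1 - l) * b))"
proof -
  obtain x y where xy: "0 < x" "x < y" "y < R" "\<phi> y \<le> \<phi> x * exp (- ((real n - 1) / x) * (y - x))"
    using assms by (auto simp: steep_at_def)
  have q: "t ^ (n - 1) * \<phi> t \<le> s ^ (n - 1) * \<phi> s" if st: "y \<le> s" "s \<le> t" for s t
  proof -
    have s: "0 < s" using xy st by simp
    have "t / s = 1 + (t - s) / s" using s by (simp add: field_simps)
    also have "\<dots> \<le> exp ((t - s) / s)" by (rule exp_ge_add_one_self)
    finally have "(t / s) ^ (n - 1) \<le> exp ((t - s) / s) ^ (n - 1)" using s st by (intro power_mono) auto
    also have "\<dots> = exp ((real n - 1) * ((t - s) / s))"
      using dim by (simp add: exp_of_nat_mult[symmetric] of_nat_diff)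
    also have "\<dots> \<le> exp (((real n - 1) / x) * (t - s))"
    proof -
      have "(real n - 1) * (t - s) / s \<le> (real n - 1) * (t - s) / x"
        using xy st dim by (intro divide_left_mono) auto
      then show ?thesis by simp
    qed
    finally have p: "(t / s) ^ (n - 1) \<le> exp (((real n - 1) / x) * (t - s))" .
    have "\<phi> t \<le> \<phi> s * exp (- ((real n - 1) / x) * (t - s))"
      by (rule phi_decay[OF xy(1,2,4) st])
    then have "(t / s) ^ (n - 1) * \<phi> t \<le> exp (((real n - 1) / x) * (t - s)) * (\<phi> s * exp (- ((real n - 1) / x) * (t - s)))"
      using p phi_nonneg[of t] s st by (intro mult_mono) auto
    also have "\<dots> = \<phi> s" by (simp add: mult_ac flip: exp_add)
    finally show ?thesis using s by (simp add: power_divide field_simps)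
  qed
  show ?thesis
  proof (intro exI[of _ y] conjI allI impI)
    fix a b l :: real assume "y \<le> a" "y \<le> b" "0 \<le> l" "l \<le> 1"
    then show "l * G a + (1 - l) * G b \<le> G (l * a + (1 - l) * b)"
      using xy by (intro G_concave_beyond[OF _ q]) auto
  qed (use xy in auto)
qed

text \<open>If \<phi>(R) = 0, then left continuity makes \<phi> so small just before R that the
  decay from R / 2 is fast enough, unless \<phi>(R / 2) = 0 already; R is steep either way.\<close>

lemma not_steep_pos:
  assumes R: "0 < R" and ns: "\<not> steep_at R"
  shows "0 < \<phi> R"
proof (rule ccontr)
  assume "\<not> 0 < \<phi> R"
  then have 0: "\<phi> R = 0" using phi_nonneg[OF R] by simp
  define k where "k = (real n - 1) / (R / 2)"
  have k: "k \<ge> 0" using R dim by (simp add: k_def)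
  show False
  proof (cases "\<phi> (R / 2) = 0")
    case True
    have "\<phi> (3 * R / 4) \<le> 0" using phi_antimono[of "R / 2" "3 * R / 4"] True R by simp
    then have "steep_at R" unfolding steep_at_def
      using True R by (intro exI[of _ "R / 2"] exI[of _ "3 * R / 4"]) auto
    with ns show False by simp
  next
    case False
    then have "\<phi> (R / 2) > 0" using phi_nonneg[of "R / 2"] R by simp
    then have "\<phi> R < \<phi> (R / 2) * exp (- k * (R - R / 2))" using 0 by simp
    then obtain y where y: "R / 2 < y" "y < R" "\<phi> y < \<phi> (R / 2) * exp (- k * (R - R / 2))"
      using phi_left_continuous[OF R, of _ "R / 2"] R by auto
    have "k * (y - R / 2) \<le> k * (R - R / 2)" using y k by (intro mult_left_mono) auto
    then have "\<phi> (R / 2) * exp (- k * (R - R / 2)) \<le> \<phi> (R / 2) * exp (- k * (y - R / 2))"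
      using \<open>\<phi> (R / 2) > 0\<close> by (intro mult_left_mono) auto
    with y(3) have "\<phi> y \<le> \<phi> (R / 2) * exp (- k * (y - R / 2))" by linarith
    then have "steep_at R" unfolding steep_at_def
      using y R by (intro exI[of _ "R / 2"] exI[of _ y]) (auto simp: k_def)
    with ns show False by simp
  qed
qed

text \<open>The negation of \<open>steep_at\<close> speaks of points y before R; left continuity
  carries it to R itself.\<close>

lemma not_steep_bound:
  assumes R: "0 < R" and ns: "\<not> steep_at R" and x: "0 < x" "x < R"
  shows "\<phi> x * exp (- ((real n - 1) / x) * (R - x)) \<le> \<phi> R"
proof (rule ccontr)
  define k where "k = (real n - 1) / x"
  have k: "k \<ge> 0" using x dim by (simp add: k_def)
  assume "\<not> ?thesis"
  then have "\<phi> R < \<phi> x * exp (- k * (R - x))" by (simp add: k_def)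
  then obtain y where y: "x < y" "y < R" "\<phi> y < \<phi> x * exp (- k * (R - x))"
    using phi_left_continuous[OF R, of _ x] x by auto
  have "k * (y - x) \<le> k * (R - x)" using y k by (intro mult_left_mono) auto
  then have "\<phi> x * exp (- k * (R - x)) \<le> \<phi> x * exp (- k * (y - x))"
    using phi_nonneg[OF x(1)] by (intro mult_left_mono) auto
  with y(3) have "\<phi> y \<le> \<phi> x * exp (- k * (y - x))" by linarith
  then have "steep_at R" unfolding steep_at_def
    using y x by (intro exI[of _ x] exI[of _ y]) (auto simp: k_def)
  with ns show False by simp
qed

text \<open>v is the supremum of the chord slopes of V = - ln \<phi> from x to R, by convexity its
  left derivative at R. Every rate below v is attained by some chord and then persists from a point
  before R on. Finiteness of v is what the absence of steepness provides.\<close>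

lemma left_slope:
  assumes R: "0 < R" and ns: "\<not> steep_at R"
  obtains v where "0 \<le> v" "\<And>x. 0 < x \<Longrightarrow> x \<le> R \<Longrightarrow> \<phi> x \<le> \<phi> R * exp (v * (R - x))"
    and "\<And>v'. 0 \<le> v' \<Longrightarrow> v' < v \<Longrightarrow>
      \<exists>y. 0 < y \<and> y < R \<and> (\<forall>s t. y \<le> s \<longrightarrow> s \<le> t \<longrightarrow> \<phi> t \<le> \<phi> s * exp (- v' * (t - s)))"
proof -
  have \<alpha>: "0 < \<phi> R" by (rule not_steep_pos[OF R ns])
  have \<phi>pos: "0 < \<phi> x" if "0 < x" "x \<le> R" for x using phi_antimono[OF that] \<alpha> by simp
  define m where "m x = (ln (\<phi> x) - ln (\<phi> R)) / (R - x)" for x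
  have m_iff: "m x \<le> k \<longleftrightarrow> \<phi> x \<le> \<phi> R * exp (k * (R - x))" if x: "0 < x" "x < R" for x k
  proof -
    have "m x \<le> k \<longleftrightarrow> ln (\<phi> x) \<le> ln (\<phi> R) + k * (R - x)"
      using x by (simp add: m_def pos_divide_le_eq algebra_simps)
    also have "ln (\<phi> R) + k * (R - x) = ln (\<phi> R * exp (k * (R - x)))" using \<alpha> by (simp add: ln_mult)
    finally show ?thesis using \<alpha> \<phi>pos[of x] x by (simp add: ln_le_cancel_iff)
  qed
  define k where "k = (real n - 1) / (R / 2)"
  have k: "k \<ge> 0" using R dim by (simp add: k_def)
  have half: "\<phi> (R / 2) \<le> \<phi> R * exp (k * (R - R / 2))"
  proof -
    have "\<phi> (R / 2) * exp (- k * (R - R / 2)) \<le> \<phi> R" using not_steep_bound[OF R ns, of "R / 2"] R by (simp add: k_def)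
    then have "\<phi> (R / 2) * exp (- k * (R - R / 2)) * exp (k * (R - R / 2)) \<le> \<phi> R * exp (k * (R - R / 2))"
      by (intro mult_right_mono) auto
    then show ?thesis by (simp add: mult.assoc flip: exp_add)
  qed
  \<comment> \<open>For x beyond R / 2 the bound (n - 1) / x is at most k. To the left of R / 2 the
    rate k is propagated by log-concavity, since (n - 1) / x would blow up at 0.\<close>
  have bound: "m x \<le> k" if x: "0 < x" "x < R" for x
  proof (cases "x \<le> R / 2")
    case True
    have "\<phi> x \<le> \<phi> (R / 2) * exp (k * (R / 2 - x))"
      by (rule phi_growth_before[OF _ _ half \<phi>pos x(1) True order_refl]) (use R in auto)
    also have "\<dots> \<le> \<phi> R * exp (k * (R - R / 2)) * exp (k * (R / 2 - x))"
      using half by (intro mult_right_mono) auto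
    also have "\<dots> = \<phi> R * exp (k * (R - x))" by (simp add: mult.assoc algebra_simps flip: exp_add)
    finally show ?thesis using m_iff[OF x] by simp
  next
    case False
    have "\<phi> x * exp (- ((real n - 1) / x) * (R - x)) * exp (((real n - 1) / x) * (R - x)) \<le> \<phi> R * exp (((real n - 1) / x) * (R - x))"
      using not_steep_bound[OF R ns x] by (intro mult_right_mono) auto
    then have "\<phi> x \<le> \<phi> R * exp (((real n - 1) / x) * (R - x))" by (simp add: mult.assoc flip: exp_add)
    then have "m x \<le> (real n - 1) / x" using m_iff[OF x] by simp
    also have "\<dots> \<le> k" unfolding k_def using False R dim by (intro divide_left_mono) auto
    finally show ?thesis .
  qed
  have bdd: "bdd_above (m ` {0<..<R})" using bound by (intro bdd_aboveI2[of _ _ k]) auto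
  define v where "v = (SUP x\<in>{0<..<R}. m x)"
  have mv: "m x \<le> v" if "0 < x" "x < R" for x unfolding v_def using that by (intro cSUP_upper bdd) auto
  have "0 \<le> m (R / 2)" using phi_antimono[of "R / 2" R] R \<alpha> by (simp add: m_def)
  then have v0: "0 \<le> v" using mv[of "R / 2"] R by simp
  show thesis
  proof (rule that[OF v0])
    show "\<phi> x \<le> \<phi> R * exp (v * (R - x))" if "0 < x" "x \<le> R" for x
      using that m_iff[of x v] mv[of x] by (cases "x = R") auto
    fix v' assume v': "0 \<le> v'" "v' < v"
    then obtain x where x: "0 < x" "x < R" "v' < m x"
      unfolding v_def using R less_cSUP_iff[of "{0<..<R}" m v'] bdd by auto
    then have "\<not> \<phi> x \<le> \<phi> R * exp (v' * (R - x))" using m_iff[OF x(1,2), of v'] by simp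
    then have "\<phi> R * exp (v' * (R - x)) * exp (- v' * (R - x)) < \<phi> x * exp (- v' * (R - x))"
      by (intro mult_strict_right_mono) auto
    then have "\<phi> R < \<phi> x * exp (- v' * (R - x))" by (simp add: mult.assoc flip: exp_add)
    then obtain y where y: "x < y" "y < R" "\<phi> y < \<phi> x * exp (- v' * (R - x))"
      using phi_left_continuous[OF R, of _ x] x by auto
    have "v' * (y - x) \<le> v' * (R - x)" using y v' by (intro mult_left_mono) auto
    then have "\<phi> x * exp (- v' * (R - x)) \<le> \<phi> x * exp (- v' * (y - x))"
      using phi_nonneg[OF x(1)] by (intro mult_left_mono) auto
    with y(3) have yx: "\<phi> y \<le> \<phi> x * exp (- v' * (y - x))" by linarith
    show "\<exists>y. 0 < y \<and> y < R \<and> (\<forall>s t. y \<le> s \<longrightarrow> s \<le> t \<longrightarrow> \<phi> t \<le> \<phi> s * exp (- v' * (t - s)))"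
      using phi_decay[OF x(1) y(1) yx] x y by (intro exI[of _ y]) auto
  qed
qed

text \<open>The derivative of n \<omega> \<phi>(R) x^n exp(v (R - x)) dominates (n - v R) times the
  derivative of G, because v x \<le> v R. Integration up to R gives the claim, the part near 0 being
  negligible by \<open>G_le_power\<close>.\<close>

lemma G_left_slope_bound:
  assumes R: "0 < R" and pos: "0 < \<phi> R" and v: "0 \<le> v"
    and le: "\<And>x. 0 < x \<Longrightarrow> x \<le> R \<Longrightarrow> \<phi> x \<le> \<phi> R * exp (v * (R - x))"
  shows "(real n - v * R) * G R \<le> real n * \<omega> * \<phi> R * R ^ n"
proof (cases "real n - v * R \<le> 0")
  case True
  then have "(real n - v * R) * G R \<le> 0" by (simp add: mult_nonpos_nonneg)
  also have "0 \<le> real n * \<omega> * \<phi> R * R ^ n" using R pos by simp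
  finally show ?thesis .
next
  case False
  then have c: "0 < real n - v * R" by simp
  obtain M where M: "\<And>t. t > 0 \<Longrightarrow> G t \<le> M * t ^ n" using G_le_power[OF R pos] by blast
  have *: "(real n - v * R) * (G R - G s) \<le> real n * \<omega> * \<phi> R * R ^ n" if s: "0 < s" "s < R" for s
  proof -
    define E where "E x = real n * \<omega> * \<phi> R * (x ^ n * exp (v * (R - x)))" for x
    define E' where "E' x = real n * \<omega> * \<phi> R * ((real n * x ^ (n - 1) - v * x ^ n) * exp (v * (R - x)))" for x
    have "(E' has_integral (E R - E s)) {s..R}"
    proof (rule fundamental_theorem_of_calculus)
      fix x assume "x \<in> {s..R}"
      have "(E has_real_derivative E' x) (at x)"
        unfolding E_def E'_def by (auto intro!: derivative_eq_intros simp: algebra_simps)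
      then show "(E has_vector_derivative E' x) (at x within {s..R})"
        by (simp add: has_real_derivative_iff_has_vector_derivative has_vector_derivative_at_within)
    qed (use s in auto)
    moreover have "((\<lambda>x. (real n - v * R) * (real n * \<omega> * x ^ (n - 1) * \<phi> x)) has_integral (real n - v * R) * (G R - G s)) {s..R}"
      using s by (intro has_integral_mult_right G_has_integral) auto
    moreover have "(real n - v * R) * (real n * \<omega> * x ^ (n - 1) * \<phi> x) \<le> E' x" if x: "x \<in> {s..R}" for x
    proof -
      have x0: "0 < x" "x \<le> R" using x s by auto
      have "(real n - v * R) * (real n * \<omega> * x ^ (n - 1) * \<phi> x)
          \<le> (real n - v * R) * (real n * \<omega> * x ^ (n - 1) * (\<phi> R * exp (v * (R - x))))"
        using c x0 le[OF x0] by (intro mult_left_mono) auto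
      also have "\<dots> = real n * \<omega> * \<phi> R * (((real n - v * R) * x ^ (n - 1)) * exp (v * (R - x)))" by simp
      also have "\<dots> \<le> E' x"
      proof -
        have "v * x ^ n = v * x * x ^ (n - 1)" using dim by (simp add: power_eq_if)
        also have "\<dots> \<le> v * R * x ^ (n - 1)" using x0 v by (intro mult_right_mono mult_left_mono) auto
        finally have "(real n - v * R) * x ^ (n - 1) \<le> real n * x ^ (n - 1) - v * x ^ n"
          by (simp add: algebra_simps)
        then show ?thesis unfolding E'_def using pos by (intro mult_left_mono mult_right_mono) auto
      qed
      finally show ?thesis .
    qed
    ultimately have "(real n - v * R) * (G R - G s) \<le> E R - E s" using has_integral_le by blast
    also have "\<dots> \<le> E R" using s pos by (simp add: E_def)
    finally show ?thesis by (simp add: E_def)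
  qed
  show ?thesis
  proof (rule tendsto_le[OF _ tendsto_const])
    show "((\<lambda>s. (real n - v * R) * (G R - M * s ^ n)) \<longlongrightarrow> (real n - v * R) * G R) (at_right 0)"
      by (auto intro!: tendsto_eq_intros)
    show "\<forall>\<^sub>F s in at_right 0. (real n - v * R) * (G R - M * s ^ n) \<le> real n * \<omega> * \<phi> R * R ^ n"
    proof -
      have "(real n - v * R) * (G R - M * s ^ n) \<le> real n * \<omega> * \<phi> R * R ^ n" if s: "0 < s" "s < R" for s
      proof -
        have "(real n - v * R) * (G R - M * s ^ n) \<le> (real n - v * R) * (G R - G s)"
          using M[OF s(1)] c by (intro mult_left_mono) auto
        with *[OF s] show ?thesis by simp
      qed
      then show ?thesis using R by (auto simp: eventually_at_right_field intro!: exI[of _ R])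
    qed
  qed auto
qed

text \<open>By concavity of ln \<phi> the chord over [T1, T] is steeper than every chord to its
  left. Positivity at T makes its slope finite, and T1 is taken strictly between R and T.\<close>

lemma phi_Lipschitz:
  assumes R: "0 < R" and T: "R < T" "0 < \<phi> T"
  obtains N T1 where "0 \<le> N" "R < T1" "0 < \<phi> T1"
    "\<And>s t. R / 2 \<le> s \<Longrightarrow> s \<le> t \<Longrightarrow> t \<le> T1 \<Longrightarrow> \<phi> s - \<phi> t \<le> N * (t - s)"
proof -
  define T1 where "T1 = (R + T) / 2"
  have T1: "R < T1" "T1 < T" using T by (auto simp: T1_def)
  have p1: "0 < \<phi> T1" using phi_antimono[of T1 T] T1 R T by simp
  define k where "k = (ln (\<phi> T1) - ln (\<phi> T)) / (T - T1)"
  have k: "0 \<le> k" using phi_antimono[of T1 T] T1 R T p1 by (simp add: k_def)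
  have "k * (T - T1) = ln (\<phi> T1) - ln (\<phi> T)" using T1 by (simp add: k_def)
  then have eq: "\<phi> T1 = \<phi> T * exp (k * (T - T1))" using T p1 by (simp add: exp_diff)
  show thesis
  proof (rule that[of "\<phi> (R / 2) * k" T1])
    show "0 \<le> \<phi> (R / 2) * k" using k phi_nonneg[of "R / 2"] R by simp
    show "R < T1" "0 < \<phi> T1" by (fact T1(1), fact p1)
    fix s t assume st: "R / 2 \<le> s" "s \<le> t" "t \<le> T1"
    then have s: "0 < s" using R by linarith
    have "\<phi> s \<le> \<phi> t * exp (k * (t - s))"
      by (rule phi_growth_before[OF _ T1(2) eq_refl[OF eq] p1 s st(2,3)]) (use T1 R in auto)
    then have "\<phi> s * exp (- (k * (t - s))) \<le> \<phi> t * exp (k * (t - s)) * exp (- (k * (t - s)))"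
      by (intro mult_right_mono) auto
    then have "\<phi> s * exp (- (k * (t - s))) \<le> \<phi> t" by (simp add: mult.assoc flip: exp_add)
    moreover have "\<phi> s * (1 - k * (t - s)) \<le> \<phi> s * exp (- (k * (t - s)))"
      using exp_ge_add_one_self[of "- (k * (t - s))"] phi_nonneg[OF s] by (intro mult_left_mono) auto
    ultimately have "\<phi> s - \<phi> t \<le> \<phi> s * (k * (t - s))" by (simp add: algebra_simps)
    also have "\<dots> \<le> \<phi> (R / 2) * (k * (t - s))"
      using phi_antimono[of "R / 2" s] R st k by (intro mult_right_mono) auto
    finally show "\<phi> s - \<phi> t \<le> \<phi> (R / 2) * k * (t - s)" by simp
  qed
qed

text \<open>The radial form of j = \<alpha> L - f. Its derivative \<open>J' R\<close> vanishes at R,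
  is nonpositive before and nonnegative beyond, as \<phi> decreases.\<close>

definition J :: "real \<Rightarrow> real \<Rightarrow> real" where
  "J R t = \<phi> R * \<omega> * t ^ n - G t"

definition J' :: "real \<Rightarrow> real \<Rightarrow> real" where
  "J' R x = real n * \<omega> * x ^ (n - 1) * (\<phi> R - \<phi> x)"

lemma J_has_integral:
  assumes "0 < s" "s \<le> t"
  shows "(J' R has_integral (J R t - J R s)) {s..t}"
proof -
  have "((\<lambda>x. \<phi> R * \<omega> * (real n * x ^ (n - 1)) - real n * \<omega> * x ^ (n - 1) * \<phi> x)
      has_integral \<phi> R * \<omega> * (t ^ n - s ^ n) - (G t - G s)) {s..t}"
    using assms by (intro has_integral_diff has_integral_mult_right power_has_integral G_has_integral)
  moreover have "(\<lambda>x. \<phi> R * \<omega> * (real n * x ^ (n - 1)) - real n * \<omega> * x ^ (n - 1) * \<phi> x) = J' R"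
    by (auto simp: J'_def algebra_simps)
  moreover have "\<phi> R * \<omega> * (t ^ n - s ^ n) - (G t - G s) = J R t - J R s"
    by (simp add: J_def algebra_simps)
  ultimately show ?thesis by simp
qed

lemma linear_has_integral:
  fixes c d s t r :: real
  assumes "s \<le> t"
  shows "((\<lambda>x. c + d * (x - r)) has_integral (c * (t - s) + d / 2 * ((t - r)\<^sup>2 - (s - r)\<^sup>2))) {s..t}"
proof -
  have "((\<lambda>x. c + d * (x - r)) has_integral ((c * t + d / 2 * (t - r)\<^sup>2) - (c * s + d / 2 * (s - r)\<^sup>2))) {s..t}"
    using assms by (intro fundamental_theorem_of_calculus)
      (auto intro!: derivative_eq_intros simp flip: has_real_derivative_iff_has_vector_derivative)
  then show ?thesis by (simp add: algebra_simps)
qed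

text \<open>Both orders of r and t occur, since a change of parameter moves the boundary outward in
  some directions and inward in others.\<close>

lemma J_quadratic_lower:
  assumes r: "0 < r" and t: "0 < t"
    and up: "\<And>x. r \<le> x \<Longrightarrow> x \<le> t \<Longrightarrow> J' R r + d * (x - r) \<le> J' R x"
    and dn: "\<And>x. t \<le> x \<Longrightarrow> x \<le> r \<Longrightarrow> J' R x \<le> J' R r + d * (x - r)"
  shows "J' R r * (t - r) + d / 2 * (t - r)\<^sup>2 \<le> J R t - J R r"
proof (cases "r \<le> t")
  case True
  show ?thesis
    using has_integral_le[OF linear_has_integral[OF True, of "J' R r" d r] J_has_integral[OF r True]] up by simp
next
  case False
  then have tr: "t \<le> r" by simp
  show ?thesis
    using has_integral_le[OF J_has_integral[OF t tr] linear_has_integral[OF tr, of "J' R r" d r]] dn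
    by (simp add: algebra_simps)
qed

end

section \<open>Second variation\<close>

lemma sphere_law_mono:
  fixes f g :: "'a::euclidean_space \<Rightarrow> real"
  assumes "integrable sphere_law f" "integrable sphere_law g" "\<And>x. norm x = 1 \<Longrightarrow> f x \<le> g x"
  shows "(\<integral>x. f x \<partial>sphere_law) \<le> (\<integral>x. g x \<partial>sphere_law)"
proof (rule integral_mono_AE[OF assms(1,2)])
  show "AE x in sphere_law. f x \<le> g x"
    using AE_sphere_law by eventually_elim (use assms in auto)
qed

lemma sphere_law_cong:
  fixes f g :: "'a::euclidean_space \<Rightarrow> real"
  assumes [measurable]: "f \<in> borel_measurable borel" "g \<in> borel_measurable borel"
    and "\<And>x. norm x = 1 \<Longrightarrow> f x = g x"
  shows "(\<integral>x. f x \<partial>sphere_law) = (\<integral>x. g x \<partial>sphere_law)"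
proof (rule integral_cong_AE)
  show "AE x in sphere_law. f x = g x"
    using AE_sphere_law by eventually_elim (use assms in auto)
qed measurable

lemma sphere_law_integral_square_le:
  fixes f :: "'a::euclidean_space \<Rightarrow> real"
  assumes f: "integrable sphere_law f" and f2: "integrable sphere_law (\<lambda>x. (f x)\<^sup>2)"
  shows "(\<integral>x. f x \<partial>sphere_law)\<^sup>2 \<le> (\<integral>x. (f x)\<^sup>2 \<partial>sphere_law)"
proof -
  define m where "m = (\<integral>x. f x \<partial>sphere_law)"
  have "0 \<le> (\<integral>x. (f x - m)\<^sup>2 \<partial>sphere_law)" by simp
  also have "(\<lambda>x. (f x - m)\<^sup>2) = (\<lambda>x. (f x)\<^sup>2 - 2 * m * f x + m\<^sup>2)"
    by (auto simp: power2_eq_square algebra_simps)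
  also have "(\<integral>x. (f x)\<^sup>2 - 2 * m * f x + m\<^sup>2 \<partial>sphere_law) = (\<integral>x. (f x)\<^sup>2 \<partial>sphere_law) - 2 * m * m + m\<^sup>2"
    using f f2 by (simp add: m_def)
  finally show ?thesis by (simp add: m_def power2_eq_square)
qed

context rot_log_concave
begin

lemma G_pos:
  assumes "0 < t" "0 < \<phi> t"
  shows "0 < G t"
proof -
  have "0 < \<omega> * (t ^ n - (t / 2) ^ n) * \<phi> t" using assms shell_pos[of "t / 2" t] by simp
  also have "\<dots> \<le> G t - G (t / 2)" using assms by (intro G_increment) auto
  also have "\<dots> \<le> G t" by simp
  finally show ?thesis .
qed

lemma J_measurable [measurable]: "J R \<in> borel_measurable borel"
  unfolding J_def[abs_def] by measurable

lemma J_Lipschitz: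
  assumes lo: "0 < lo" and L: "\<And>x. lo \<le> x \<Longrightarrow> x \<le> hi \<Longrightarrow> \<bar>J' R x\<bar> \<le> L"
    and r: "lo \<le> r" "r \<le> hi" and t: "lo \<le> t" "t \<le> hi"
  shows "\<bar>J R t - J R r\<bar> \<le> L * \<bar>t - r\<bar>"
proof -
  have L0: "0 \<le> L" using L[OF r] by linarith
  have *: "\<bar>J R y - J R x\<bar> \<le> L * (y - x)" if "lo \<le> x" "x \<le> y" "y \<le> hi" for x y
  proof -
    have "norm (J R y - J R x) \<le> L * measure lborel {x..y}"
      using that lo L by (intro has_integral_bound_real[OF L0 finite.emptyI J_has_integral]) auto
    then show ?thesis using that by simp
  qed
  show ?thesis
  proof (cases "r \<le> t")
    case True
    then show ?thesis using *[of r t] r t by simp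
  next
    case False
    then show ?thesis using *[of t r] r t by (simp add: abs_minus_commute)
  qed
qed

lemma J'_bound:
  assumes lo: "0 < lo" "lo \<le> R" and x: "lo \<le> x" "x \<le> hi"
  shows "\<bar>J' R x\<bar> \<le> real n * \<omega> * hi ^ (n - 1) * (2 * \<phi> lo)"
proof -
  have "0 \<le> \<phi> R" "0 \<le> \<phi> x" "\<phi> R \<le> \<phi> lo" "\<phi> x \<le> \<phi> lo"
    using lo x by (auto intro: phi_nonneg phi_antimono)
  then have "\<bar>\<phi> R - \<phi> x\<bar> \<le> 2 * \<phi> lo" by linarith
  moreover have "x ^ (n - 1) \<le> hi ^ (n - 1)" using lo x by (intro power_mono) auto
  moreover have "\<bar>J' R x\<bar> = real n * \<omega> * x ^ (n - 1) * \<bar>\<phi> R - \<phi> x\<bar>"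
    using lo x by (simp add: J'_def abs_mult)
  ultimately show ?thesis using lo x by (simp add: mult_mono)
qed

text \<open>With \<open>deficit\<close> this is the splitting f = \<alpha> L - j for a single
  body.\<close>

definition volume_part :: "real \<Rightarrow> (real ^ 'n) set \<Rightarrow> real" where
  "volume_part R A = \<phi> R * \<omega> * star_volume A"

definition deficit :: "real \<Rightarrow> (real ^ 'n) set \<Rightarrow> real" where
  "deficit R A = (\<integral>x. J R (radial A x) \<partial>sphere_law)"

text \<open>First variations are bounded linearly by this distance; \<open>l1_square_le\<close>
  turns their products into multiples of \<open>l2\<close>, the unit in which the gain is
  measured.\<close>

definition l1 :: "(real ^ 'n) set \<Rightarrow> (real ^ 'n) set \<Rightarrow> real" where
  "l1 A B = (\<integral>x. \<bar>radial A x - radial B x\<bar> \<partial>sphere_law)"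

definition l2 :: "(real ^ 'n) set \<Rightarrow> (real ^ 'n) set \<Rightarrow> real" where
  "l2 A B = (\<integral>x. (radial A x - radial B x)\<^sup>2 \<partial>sphere_law)"

definition between :: "real \<Rightarrow> real \<Rightarrow> (real ^ 'n) set \<Rightarrow> bool" where
  "between lo hi A \<longleftrightarrow> star_body A \<and> (\<forall>x. norm x = 1 \<longrightarrow> lo \<le> radial A x \<and> radial A x \<le> hi)"

lemma betweenD:
  assumes "between lo hi A"
  shows "star_body A" "norm x = 1 \<Longrightarrow> lo \<le> radial A x" "norm x = 1 \<Longrightarrow> radial A x \<le> hi"
  using assms by (auto simp: between_def)

lemma integrable_J_radial:
  assumes A: "star_body A"
  shows "integrable sphere_law (\<lambda>x. J R (radial A x))"
  unfolding J_def using integrable_radial_power[OF A, of n] integrable_G_radial[OF A, of 1]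
  by (intro Bochner_Integration.integrable_diff integrable_mult_right) auto

lemma integrable_radial_diff:
  assumes A: "star_body A" and B: "star_body B"
  shows "integrable sphere_law (\<lambda>x. \<bar>radial A x - radial B x\<bar>)"
    and "integrable sphere_law (\<lambda>x. (radial A x - radial B x)\<^sup>2)"
proof -
  note [measurable] = borel_measurable_radial[OF A] borel_measurable_radial[OF B]
  obtain a where a: "0 < a" "A \<subseteq> cball 0 a" using A by (rule star_body_bounded)
  obtain b where b: "0 < b" "B \<subseteq> cball 0 b" using B by (rule star_body_bounded)
  have *: "\<bar>radial A x - radial B x\<bar> \<le> a + b" for x
    using radial_le[OF A a(2), of x] radial_le[OF B b(2), of x] radial_nonneg[OF A, of x] radial_nonneg[OF B, of x] a b
    by (simp add: abs_le_iff)
  show "integrable sphere_law (\<lambda>x. \<bar>radial A x - radial B x\<bar>)"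
    by (rule integrable_sphere_law_bounded[of _ "a + b"]) (measurable, use * in auto)
  show "integrable sphere_law (\<lambda>x. (radial A x - radial B x)\<^sup>2)"
    by (rule integrable_sphere_law_bounded[of _ "(a + b)\<^sup>2"])
      (measurable, use power_mono[OF *, where n = 2] in auto)
qed

lemma l2_nonneg: "0 \<le> l2 A B"
  by (simp add: l2_def)

lemma l1_square_le:
  assumes "star_body A" "star_body B"
  shows "(l1 A B)\<^sup>2 \<le> l2 A B"
  using sphere_law_integral_square_le[OF integrable_radial_diff(1)[OF assms]] integrable_radial_diff(2)[OF assms]
  by (simp add: l1_def l2_def)

lemma measure_eq_volume_part_deficit:
  assumes A: "star_body A"
  shows "measure \<gamma> A = volume_part R A - deficit R A"
proof -
  have "deficit R A = (\<integral>x. \<phi> R * \<omega> * radial A x ^ n - G (radial A x) \<partial>sphere_law)"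
    by (simp add: deficit_def J_def)
  also have "\<dots> = volume_part R A - (\<integral>x. G (radial A x) \<partial>sphere_law)"
    using integrable_radial_power[OF A, of n] integrable_G_radial[OF A, of 1]
    by (simp add: volume_part_def star_volume_eq)
  finally show ?thesis by (simp add: measure_star_body[OF A])
qed

lemma volume_part_diff:
  assumes A: "between lo hi A" and B: "between lo hi B" and lo: "0 < lo" and R: "0 < R"
  shows "\<bar>volume_part R A - volume_part R B\<bar> \<le> \<phi> R * \<omega> * (real n * hi ^ (n - 1)) * l1 A B"
proof -
  note a = betweenD[OF A] and b = betweenD[OF B]
  have *: "\<bar>r ^ n - t ^ n\<bar> \<le> real n * hi ^ (n - 1) * \<bar>r - t\<bar>" if "lo \<le> r" "r \<le> hi" "lo \<le> t" "t \<le> hi" for r t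
  proof -
    have **: "y ^ n - x ^ n \<le> real n * hi ^ (n - 1) * (y - x)" "x ^ n \<le> y ^ n" if "lo \<le> x" "x \<le> y" "y \<le> hi" for x y
    proof -
      have "y ^ n - x ^ n \<le> real n * y ^ (n - 1) * (y - x)"
        using that lo by (intro power_diff_bounds) auto
      also have "\<dots> \<le> real n * hi ^ (n - 1) * (y - x)"
        using that lo by (intro mult_right_mono mult_left_mono power_mono) auto
      finally show "y ^ n - x ^ n \<le> real n * hi ^ (n - 1) * (y - x)" .
      show "x ^ n \<le> y ^ n" using that lo by (intro power_mono) auto
    qed
    show ?thesis
      using **[of r t] **[of t r] that by (cases "r \<le> t") (auto simp: abs_if)
  qed
  have "\<bar>star_volume A - star_volume B\<bar> = \<bar>\<integral>x. radial A x ^ n - radial B x ^ n \<partial>sphere_law\<bar>"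
    using integrable_radial_power[OF a(1), of n] integrable_radial_power[OF b(1), of n] by (simp add: star_volume_eq)
  also have "\<dots> \<le> (\<integral>x. \<bar>radial A x ^ n - radial B x ^ n\<bar> \<partial>sphere_law)" by (rule integral_abs_bound)
  also have "\<dots> \<le> (\<integral>x. real n * hi ^ (n - 1) * \<bar>radial A x - radial B x\<bar> \<partial>sphere_law)"
    using integrable_radial_power[OF a(1), of n] integrable_radial_power[OF b(1), of n] integrable_radial_diff(1)[OF a(1) b(1)] a b *
    by (intro sphere_law_mono) auto
  also have "\<dots> = real n * hi ^ (n - 1) * l1 A B" by (simp add: l1_def)
  finally have "\<phi> R * \<omega> * \<bar>star_volume A - star_volume B\<bar> \<le> \<phi> R * \<omega> * (real n * hi ^ (n - 1) * l1 A B)"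
    using phi_nonneg[OF R] by (intro mult_left_mono) auto
  moreover have "\<bar>volume_part R A - volume_part R B\<bar> = \<phi> R * \<omega> * \<bar>star_volume A - star_volume B\<bar>"
    using phi_nonneg[OF R] by (simp add: volume_part_def abs_mult flip: right_diff_distrib)
  ultimately show ?thesis by (simp add: mult.assoc)
qed

lemma deficit_diff:
  assumes A: "between lo hi A" and B: "between lo hi B" and lo: "0 < lo"
    and L: "\<And>x. lo \<le> x \<Longrightarrow> x \<le> hi \<Longrightarrow> \<bar>J' R x\<bar> \<le> L"
  shows "\<bar>deficit R A - deficit R B\<bar> \<le> L * l1 A B"
proof -
  note a = betweenD[OF A] and b = betweenD[OF B]
  have "\<bar>deficit R A - deficit R B\<bar> = \<bar>\<integral>x. J R (radial A x) - J R (radial B x) \<partial>sphere_law\<bar>"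
    using integrable_J_radial[OF a(1)] integrable_J_radial[OF b(1)] by (simp add: deficit_def)
  also have "\<dots> \<le> (\<integral>x. \<bar>J R (radial A x) - J R (radial B x)\<bar> \<partial>sphere_law)" by (rule integral_abs_bound)
  also have "\<dots> \<le> (\<integral>x. L * \<bar>radial A x - radial B x\<bar> \<partial>sphere_law)"
    using integrable_J_radial[OF a(1)] integrable_J_radial[OF b(1)] integrable_radial_diff(1)[OF a(1) b(1)] a b
    by (intro sphere_law_mono) (auto intro!: J_Lipschitz[OF lo L])
  also have "\<dots> = L * l1 A B" by (simp add: l1_def)
  finally show ?thesis .
qed

lemma l1_le:
  assumes A: "star_body A" and B: "star_body B" and "\<And>x. norm x = 1 \<Longrightarrow> \<bar>radial A x - radial B x\<bar> \<le> c"
  shows "l1 A B \<le> c"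
proof -
  have "l1 A B \<le> (\<integral>x. c \<partial>(sphere_law :: (real ^ 'n) measure))"
    unfolding l1_def using assms integrable_radial_diff(1)[OF A B] by (intro sphere_law_mono) auto
  then show ?thesis by simp
qed

lemma measure_between_ge:
  assumes A: "between lo hi A"
  shows "G lo \<le> measure \<gamma> A"
proof -
  have "(\<integral>x. G lo \<partial>(sphere_law :: (real ^ 'n) measure)) \<le> measure \<gamma> A"
    unfolding measure_star_body[OF betweenD(1)[OF A]]
    using integrable_G_radial[OF betweenD(1)[OF A], of 1] betweenD[OF A]
    by (intro sphere_law_mono) (auto intro: G_mono)
  then show ?thesis by simp
qed

lemma volume_part_between_ge:
  assumes A: "between lo hi A" and lo: "0 < lo" and R: "0 < R"
  shows "\<phi> R * \<omega> * lo ^ n \<le> volume_part R A"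
proof -
  have "(\<integral>x. lo ^ n \<partial>(sphere_law :: (real ^ 'n) measure)) \<le> star_volume A"
    unfolding star_volume_eq
    using integrable_radial_power[OF betweenD(1)[OF A], of n] betweenD[OF A] lo
    by (intro sphere_law_mono) (auto intro!: power_mono)
  then have "lo ^ n \<le> star_volume A" by simp
  then show ?thesis unfolding volume_part_def using phi_nonneg[OF R] by (intro mult_left_mono) auto
qed

text \<open>The left-hand side of the assumption H of the second difference estimate; A, B and M stand for
  the bodies at the parameters e + s, e - s and e.\<close>

definition loss :: "real \<Rightarrow> (real ^ 'n) set \<Rightarrow> (real ^ 'n) set \<Rightarrow> (real ^ 'n) set \<Rightarrow> real" where
  "loss R A B M = (1 - 1 / real n) / 2 *
     (((volume_part R A - volume_part R M)\<^sup>2 + (volume_part R B - volume_part R M)\<^sup>2) * (- deficit R M) / (volume_part R M * measure \<gamma> M)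
      + 2 * ((volume_part R A - volume_part R M) * (deficit R A - deficit R M) + (volume_part R B - volume_part R M) * (deficit R B - deficit R M)) / measure \<gamma> M)"

text \<open>Reduces each case to the comparison of loss and second variation: Brunn-Minkowski and
  \<open>mid\<close> supply the concavity of the Lebesgue part, \<open>lip\<close> all first-order
  bounds. The family is arbitrary so that truncated bodies are covered too.\<close>

lemma concave_root_of_family:
  fixes P :: "real \<Rightarrow> (real ^ 'n) set"
  assumes R: "0 < lo" "lo \<le> R" and pos: "0 < \<phi> R"
    and P: "\<And>e. 0 < e \<Longrightarrow> e < a \<Longrightarrow> between lo hi (P e)"
    and mid: "\<And>e s. 0 < s \<Longrightarrow> s < e \<Longrightarrow> e + s < a \<Longrightarrow>
      (*\<^sub>R) (1/2) ` P (e + s) + (*\<^sub>R) (1 - 1/2) ` P (e - s) \<subseteq> P e"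
    and lip: "\<And>e s x. 0 < e \<Longrightarrow> 0 < s \<Longrightarrow> e + s < a \<Longrightarrow> norm x = 1 \<Longrightarrow>
      \<bar>radial (P (e + s)) x - radial (P e) x\<bar> \<le> B * s"
    and H: "\<And>e \<eta>. 0 < e \<Longrightarrow> e < a \<Longrightarrow> 0 < \<eta> \<Longrightarrow> \<exists>s0>0. \<forall>s. 0 < s \<and> s < s0 \<longrightarrow> s < e \<longrightarrow> e + s < a \<longrightarrow>
      loss R (P (e + s)) (P (e - s)) (P e) \<le> deficit R (P (e + s)) + deficit R (P (e - s)) - 2 * deficit R (P e) + \<eta> * s\<^sup>2"
    and e: "e1 \<in> {0<..<a}" "e2 \<in> {0<..<a}" and l: "0 \<le> l" "l \<le> 1"
  shows "l * measure \<gamma> (P e1) powr (1 / real n) + (1 - l) * measure \<gamma> (P e2) powr (1 / real n)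
    \<le> measure \<gamma> (P (l * e1 + (1 - l) * e2)) powr (1 / real n)"
proof -
  have R0: "0 < R" using R by simp
  define LX where "LX = \<phi> R * \<omega> * (real n * hi ^ (n - 1))"
  define LJ where "LJ = real n * \<omega> * hi ^ (n - 1) * (2 * \<phi> lo)"
  have hi: "0 < hi"
  proof -
    have "between lo hi (P e1)" using P e by auto
    moreover obtain x :: "real ^ 'n" where "norm x = 1" using vector_choose_size[of 1] by auto
    ultimately show ?thesis using R betweenD by fastforce
  qed
  have phlo: "0 < \<phi> lo" using phi_antimono[OF R] pos by simp
  have LX: "0 \<le> LX" and LJ: "0 \<le> LJ" using pos phlo hi by (auto simp: LX_def LJ_def)
  \<comment> \<open>A common Lipschitz constant for both parts and their difference. The summands 1
    make it positive, and \<bar>B\<bar> covers either sign of B.\<close>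
  define B' where "B' = (LX + LJ + 1) * (\<bar>B\<bar> + 1)"
  have B': "B' > 0" using LX LJ by (simp add: B'_def add_nonneg_pos)
  have PB: "l1 (P (e + s)) (P e) \<le> \<bar>B\<bar> * s" "l1 (P e) (P (e + s)) \<le> \<bar>B\<bar> * s"
    if "0 < e" "0 < s" "e + s < a" for e s
  proof -
    have *: "star_body (P (e + s))" "star_body (P e)"
      using betweenD(1)[OF P[of "e + s"]] betweenD(1)[OF P[of e]] that by auto
    have **: "\<bar>radial (P (e + s)) x - radial (P e) x\<bar> \<le> \<bar>B\<bar> * s" if "norm x = 1" for x
    proof -
      have "B * s \<le> \<bar>B\<bar> * s" using \<open>0 < s\<close> by (intro mult_right_mono) auto
      then show ?thesis using lip[of e s x] that \<open>0 < e\<close> \<open>0 < s\<close> \<open>e + s < a\<close> by linarith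
    qed
    show "l1 (P (e + s)) (P e) \<le> \<bar>B\<bar> * s" using * ** by (intro l1_le) auto
    show "l1 (P e) (P (e + s)) \<le> \<bar>B\<bar> * s" using * ** by (intro l1_le) (auto simp: abs_minus_commute)
  qed
  have Xl: "\<bar>volume_part R (P e) - volume_part R (P e')\<bar> \<le> LX * l1 (P e) (P e')" if "0 < e" "e < a" "0 < e'" "e' < a" for e e'
    unfolding LX_def using that by (intro volume_part_diff[OF P P R(1) R0])
  have Jl: "\<bar>deficit R (P e) - deficit R (P e')\<bar> \<le> LJ * l1 (P e) (P e')" if "0 < e" "e < a" "0 < e'" "e' < a" for e e'
    unfolding LJ_def using that by (intro deficit_diff[OF P P R(1)] J'_bound[OF R])
  have LB: "L * (\<bar>B\<bar> * s) \<le> B' * s" if "L = LX \<or> L = LJ \<or> L = LX + LJ" "0 < s" for L s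
  proof -
    have "L * \<bar>B\<bar> \<le> B'" unfolding B'_def using that LX LJ by (intro mult_mono) auto
    then show ?thesis using that(2) by (simp add: mult_right_mono flip: mult.assoc)
  qed
  have XB: "\<bar>volume_part R (P (e + s)) - volume_part R (P e)\<bar> \<le> B' * s" and JB: "\<bar>deficit R (P (e + s)) - deficit R (P e)\<bar> \<le> B' * s"
    if "0 < e" "0 < s" "e + s < a" for e s
  proof -
    have "LX * l1 (P (e + s)) (P e) \<le> LX * (\<bar>B\<bar> * s)" "LJ * l1 (P (e + s)) (P e) \<le> LJ * (\<bar>B\<bar> * s)"
      using PB[OF that] LX LJ by (auto intro: mult_left_mono)
    then show "\<bar>volume_part R (P (e + s)) - volume_part R (P e)\<bar> \<le> B' * s" "\<bar>deficit R (P (e + s)) - deficit R (P e)\<bar> \<le> B' * s"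
    proof -
      have "LX * (\<bar>B\<bar> * s) \<le> B' * s" "LJ * (\<bar>B\<bar> * s) \<le> B' * s"
        by (rule LB, simp, rule that(2))+
      moreover have "\<bar>volume_part R (P (e + s)) - volume_part R (P e)\<bar> \<le> LX * l1 (P (e + s)) (P e)"
        "\<bar>deficit R (P (e + s)) - deficit R (P e)\<bar> \<le> LJ * l1 (P (e + s)) (P e)"
        using that by (auto intro!: Xl Jl)
      ultimately show "\<bar>volume_part R (P (e + s)) - volume_part R (P e)\<bar> \<le> B' * s" "\<bar>deficit R (P (e + s)) - deficit R (P e)\<bar> \<le> B' * s"
        using \<open>LX * l1 (P (e + s)) (P e) \<le> LX * (\<bar>B\<bar> * s)\<close> \<open>LJ * l1 (P (e + s)) (P e) \<le> LJ * (\<bar>B\<bar> * s)\<close>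
        by linarith+
    qed
  qed
  have XB': "\<bar>volume_part R (P (e - s)) - volume_part R (P e)\<bar> \<le> B' * s" and JB': "\<bar>deficit R (P (e - s)) - deficit R (P e)\<bar> \<le> B' * s"
    if "0 < s" "s < e" "e < a" for e s
    using XB[of "e - s" s] JB[of "e - s" s] that by (auto simp: abs_minus_commute)
  have m: "measure \<gamma> (P e) = volume_part R (P e) - deficit R (P e)" if "0 < e" "e < a" for e
    using measure_eq_volume_part_deficit betweenD(1)[OF P[OF that]] by blast
  have mpos: "0 < measure \<gamma> (P e)" if "0 < e" "e < a" for e
    using measure_between_ge[OF P[OF that]] G_pos[OF R(1) phlo] by simp
  have cont: "continuous_on {0<..<a} (\<lambda>e. measure \<gamma> (P e) powr (1 / real n))"
  proof -
    have *: "dist (measure \<gamma> (P e)) (measure \<gamma> (P e')) \<le> 2 * B' * dist e e'" if "0 < e" "e < e'" "e' < a" for e e'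
      using XB[of e "e' - e"] JB[of e "e' - e"] that m[of e] m[of e'] by (simp add: dist_real_def)
    have "(2 * B')-lipschitz_on {0<..<a} (\<lambda>e. measure \<gamma> (P e))"
    proof (rule lipschitz_onI)
      fix e e' assume "e \<in> {0<..<a}" "e' \<in> {0<..<a}"
      then show "dist (measure \<gamma> (P e)) (measure \<gamma> (P e')) \<le> 2 * B' * dist e e'"
        using *[of e e'] *[of e' e] by (cases e e' rule: linorder_cases) (auto simp: dist_commute)
    qed (use B' in simp)
    then have "continuous_on {0<..<a} (\<lambda>e. measure \<gamma> (P e))" by (rule lipschitz_on_continuous_on)
    then show ?thesis
      using mpos by (intro continuous_intros) (auto simp: less_imp_neq[symmetric] dest: less_imp_neq[OF mpos, symmetric])
  qed
  show ?thesis
  proof (rule concave_if_second_difference_le[OF cont _ e l])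
    fix e \<eta> :: real assume e: "0 < e" "e < a" and \<eta>: "0 < \<eta>"
    have "\<exists>s0>0. \<forall>s. 0 < s \<and> s < s0 \<longrightarrow>
        (volume_part R (P (e + s)) - deficit R (P (e + s))) powr (1 / real n) + (volume_part R (P (e - s)) - deficit R (P (e - s))) powr (1 / real n)
          - 2 * (volume_part R (P e) - deficit R (P e)) powr (1 / real n) \<le> \<eta> * s\<^sup>2"
    proof (rule powr_second_difference_le[where B = B' and d = "min e (a - e)" and X = "\<lambda>e. volume_part R (P e)" and j = "\<lambda>e. deficit R (P e)"])
      show "0 < 1 / real n" by simp
      show "1 / real n < 1" using dim by simp
      show "0 < B'" by (rule B')
      show "0 < min e (a - e)" using e by simp
      show "0 < \<eta>" by (rule \<eta>)
      show "0 < volume_part R (P e)"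
      proof (rule less_le_trans[OF _ volume_part_between_ge[OF P[OF e] R(1) R0]])
        show "0 < \<phi> R * \<omega> * lo ^ n" using pos R by simp
      qed
      show "0 < volume_part R (P e) - deficit R (P e)" using mpos[OF e] m[OF e] by simp
      fix s :: real assume s: "0 < s" "s < min e (a - e)"
      show "\<bar>volume_part R (P (e + s)) - volume_part R (P e)\<bar> \<le> B' * s \<and> \<bar>volume_part R (P (e - s)) - volume_part R (P e)\<bar> \<le> B' * s"
        "\<bar>deficit R (P (e + s)) - deficit R (P e)\<bar> \<le> B' * s \<and> \<bar>deficit R (P (e - s)) - deficit R (P e)\<bar> \<le> B' * s"
        using XB XB' JB JB' s e by auto
      have sb: "star_body (P (e + s))" "star_body (P (e - s))" "star_body (P e)"
        using betweenD(1)[OF P[of "e + s"]] betweenD(1)[OF P[of "e - s"]] betweenD(1)[OF P[of e]] s e by auto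
      have "(1/2) * star_volume (P (e + s)) powr (1 / real n) + (1 - 1/2) * star_volume (P (e - s)) powr (1 / real n)
        \<le> star_volume ((*\<^sub>R) (1/2) ` P (e + s) + (*\<^sub>R) (1 - 1/2) ` P (e - s)) powr (1 / real n)"
        using pos R0 sb by (intro star_volume_brunn_minkowski) auto
      also have "\<dots> \<le> star_volume (P e) powr (1 / real n)"
      proof (rule powr_mono2)
        have S: "star_body ((*\<^sub>R) (1/2) ` P (e + s) + (*\<^sub>R) (1 - 1/2) ` P (e - s))"
          using sb by (intro star_body_sum) auto
        have sub: "(*\<^sub>R) (1/2) ` P (e + s) + (*\<^sub>R) (1 - 1/2) ` P (e - s) \<subseteq> P e"
          using s by (intro mid) auto
        show "star_volume ((*\<^sub>R) (1/2) ` P (e + s) + (*\<^sub>R) (1 - 1/2) ` P (e - s)) \<le> star_volume (P e)"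
          unfolding star_volume_eq
          using S sb radial_mono[OF S sb(3) sub] radial_nonneg[OF S]
          by (intro sphere_law_mono integrable_radial_power) (auto intro!: power_mono)
        show "0 \<le> star_volume ((*\<^sub>R) (1/2) ` P (e + s) + (*\<^sub>R) (1 - 1/2) ` P (e - s))"
          using star_volume_pos[OF S] by simp
      qed simp
      finally have "(\<phi> R * \<omega>) powr (1 / real n) * (star_volume (P (e + s)) powr (1 / real n) + star_volume (P (e - s)) powr (1 / real n))
          \<le> (\<phi> R * \<omega>) powr (1 / real n) * (2 * star_volume (P e) powr (1 / real n))"
        by (intro mult_left_mono) auto
      then show "volume_part R (P (e + s)) powr (1 / real n) + volume_part R (P (e - s)) powr (1 / real n) \<le> 2 * volume_part R (P e) powr (1 / real n)"
        using pos star_volume_pos[OF sb(1)] star_volume_pos[OF sb(2)] star_volume_pos[OF sb(3)]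
        by (simp add: volume_part_def powr_mult[of "\<phi> R * \<omega>"] distrib_left)
    next
      fix \<eta> :: real assume "\<eta> > 0"
      from H[OF e this] obtain s0 where s0: "s0 > 0" "\<And>s. 0 < s \<Longrightarrow> s < s0 \<Longrightarrow> s < e \<Longrightarrow> e + s < a \<Longrightarrow>
        loss R (P (e + s)) (P (e - s)) (P e) \<le> deficit R (P (e + s)) + deficit R (P (e - s)) - 2 * deficit R (P e) + \<eta> * s\<^sup>2"
        by blast
      show "\<exists>s0>0. \<forall>s. 0 < s \<and> s < s0 \<longrightarrow> (1 - 1 / real n) / 2 *
          (((volume_part R (P (e + s)) - volume_part R (P e))\<^sup>2 + (volume_part R (P (e - s)) - volume_part R (P e))\<^sup>2) * (- deficit R (P e)) / (volume_part R (P e) * (volume_part R (P e) - deficit R (P e)))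
          + 2 * ((volume_part R (P (e + s)) - volume_part R (P e)) * (deficit R (P (e + s)) - deficit R (P e)) + (volume_part R (P (e - s)) - volume_part R (P e)) * (deficit R (P (e - s)) - deficit R (P e))) / (volume_part R (P e) - deficit R (P e)))
        \<le> deficit R (P (e + s)) + deficit R (P (e - s)) - 2 * deficit R (P e) + \<eta> * s\<^sup>2"
        using s0 e by (intro exI[of _ "min s0 (min e (a - e))"]) (auto simp: loss_def m[OF e])
    qed
    then obtain s0 where s0: "s0 > 0" "\<And>s. 0 < s \<Longrightarrow> s < s0 \<Longrightarrow>
        (volume_part R (P (e + s)) - deficit R (P (e + s))) powr (1 / real n) + (volume_part R (P (e - s)) - deficit R (P (e - s))) powr (1 / real n)
          - 2 * (volume_part R (P e) - deficit R (P e)) powr (1 / real n) \<le> \<eta> * s\<^sup>2" by blast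
    show "\<exists>s0>0. \<forall>s. 0 < s \<and> s < s0 \<longrightarrow> measure \<gamma> (P (e + s)) powr (1 / real n) + measure \<gamma> (P (e - s)) powr (1 / real n)
        - 2 * measure \<gamma> (P e) powr (1 / real n) \<le> \<eta> * s\<^sup>2"
      using s0 e by (intro exI[of _ "min s0 (min e (a - e))"]) (auto simp: m)
  qed
qed

end

section \<open>Open sets of directions\<close>

lemma sphere_superlevel_measurable:
  fixes f :: "'a::euclidean_space \<Rightarrow> real"
  assumes "continuous_on (sphere 0 1) f"
  shows "{x. norm x = 1 \<and> m < f x} \<in> sets borel"
proof -
  have "openin (top_of_set (sphere 0 1)) (sphere 0 1 \<inter> f -` {m<..})"
    using assms by (rule continuous_openin_preimage_gen) auto
  then obtain T where T: "open T" "sphere 0 1 \<inter> f -` {m<..} = sphere 0 1 \<inter> T"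
    by (auto simp: openin_open)
  have "{x. norm x = 1 \<and> m < f x} = sphere 0 1 \<inter> T"
    unfolding T(2)[symmetric] by auto
  then show ?thesis using T(1) by simp
qed

text \<open>The cone over the superlevel set contains a nonempty open set, which is not null for
  Lebesgue measure.\<close>

lemma sphere_law_superlevel_pos:
  fixes f :: "'a::euclidean_space \<Rightarrow> real"
  assumes f: "continuous_on (sphere 0 1) f" and x0: "norm x0 = 1" "m < f x0"
  shows "0 < measure sphere_law {x. norm x = 1 \<and> m < f x}"
proof -
  let ?A = "{x. norm x = 1 \<and> m < f x}"
  let ?O = "ball (0::'a) 1 - {0}"
  let ?W = "?O \<inter> (f \<circ> sgn) -` {m<..}"
  have A: "?A \<in> sets borel" by (rule sphere_superlevel_measurable[OF f])
  have sgn: "continuous_on ?O sgn"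
    unfolding sgn_div_norm[abs_def] by (intro continuous_intros) auto
  have "sgn ` ?O \<subseteq> sphere 0 1"
  proof
    fix z assume "z \<in> sgn ` ?O"
    then obtain x :: 'a where "x \<noteq> 0" "z = sgn x" by auto
    then show "z \<in> sphere 0 1" by (simp add: norm_sgn)
  qed
  then have "continuous_on ?O (f \<circ> sgn)"
    by (rule continuous_on_compose[OF sgn continuous_on_subset[OF f]])
  then have W: "open ?W" by (rule continuous_open_preimage) auto
  have "sgn ((1/2) *\<^sub>R x0) = x0" using x0 by (simp add: sgn_scaleR sgn_div_norm)
  then have "(1/2) *\<^sub>R x0 \<in> ?W" using x0 by auto
  then have ne: "?W \<noteq> {}" by blast
  have "emeasure lborel ?W \<noteq> 0"
  proof
    assume "emeasure lborel ?W = 0"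
    then have "?W \<in> null_sets lebesgue" using W by (auto simp: null_sets_def)
    then have "negligible ?W" by (simp add: negligible_iff_null_sets)
    then show False using open_not_negligible[OF W ne] by simp
  qed
  moreover have "emeasure lborel ?W \<le> emeasure lborel {x. norm x \<le> 1 \<and> sgn x \<in> ?A}"
  proof (rule emeasure_mono)
    show "?W \<subseteq> {x. norm x \<le> 1 \<and> sgn x \<in> ?A}"
    proof
      fix x assume x: "x \<in> ?W"
      then have "norm (sgn x) = 1" by (simp add: norm_sgn)
      with x show "x \<in> {x. norm x \<le> 1 \<and> sgn x \<in> ?A}" by auto
    qed
    have "{x. norm x \<le> 1 \<and> sgn x \<in> ?A} = cball 0 1 \<inter> sgn -` ?A" by auto
    also have "\<dots> \<in> sets borel"
      using measurable_sets_borel[OF borel_measurable_sgn A] by auto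
    finally show "{x. norm x \<le> 1 \<and> sgn x \<in> ?A} \<in> sets lborel" by simp
  qed
  ultimately have "emeasure sphere_law ?A \<noteq> 0"
    using emeasure_sphere_law[OF A] by auto
  then show ?thesis
    by (simp add: sphere_law.emeasure_eq_measure zero_less_measure_iff)
qed

section \<open>Gain against loss when the density has a slope at R\<close>

context rot_log_concave
begin

lemma J_nonpos:
  assumes R: "0 < R"
  shows "0 \<le> - J R R"
proof -
  have "\<phi> R * \<omega> * R ^ n \<le> G R"
  proof (rule tendsto_le[OF _ tendsto_const])
    show "((\<lambda>s. \<omega> * (R ^ n - s ^ n) * \<phi> R) \<longlongrightarrow> \<phi> R * \<omega> * R ^ n) (at_right 0)"
      by (auto intro!: tendsto_eq_intros)
    have "\<omega> * (R ^ n - s ^ n) * \<phi> R \<le> G R" if "0 < s" "s < R" for s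
      using G_increment(1)[of s R] G_nonneg[of s] that by linarith
    then show "\<forall>\<^sub>F s in at_right 0. \<omega> * (R ^ n - s ^ n) * \<phi> R \<le> G R"
      using R by (auto simp: eventually_at_right_field intro!: exI[of _ R])
  qed auto
  then show ?thesis by (simp add: J_def)
qed

text \<open>Everything is measured in Z, the sum of the two squared distances. The gain is at least
  \<tau> Z / 2 - \<zeta> because J' increases at rate \<tau>; the loss is at most a constant times Z
  by \<open>l1_square_le\<close>. The term \<zeta> allows for radial functions that are not affine
  in the parameter.\<close>

lemma loss_le:
  assumes A: "between lo hi A" and B: "between lo hi B" and M: "between lo hi M"
    and lo: "0 < lo" "lo \<le> R" "R \<le> hi" and pos: "0 < \<phi> R"
    and \<tau>: "\<And>r t. lo \<le> r \<Longrightarrow> r \<le> t \<Longrightarrow> t \<le> hi \<Longrightarrow> \<tau> * (t - r) \<le> J' R t - J' R r" "0 \<le> \<tau>"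
    and L: "\<And>x. lo \<le> x \<Longrightarrow> x \<le> hi \<Longrightarrow> \<bar>J' R x\<bar> \<le> L"
    and cross: "\<And>x. norm x = 1 \<Longrightarrow> - \<zeta> \<le> J' R (radial M x) * (radial A x + radial B x - 2 * radial M x)"
    and \<zeta>: "\<zeta> \<le> c * L * (l2 A M + l2 B M)"
    and const: "(1 - 1 / real n) / 2 * ((\<phi> R * \<omega> * (real n * hi ^ (n - 1)))\<^sup>2 * (- J R R) / (\<phi> R * \<omega> * lo ^ n * G lo)
        + 2 * (\<phi> R * \<omega> * (real n * hi ^ (n - 1))) * L / G lo) + c * L \<le> \<tau> / 2"
  shows "loss R A B M \<le> deficit R A + deficit R B - 2 * deficit R M"
proof -
  have R0: "0 < R" using lo by simp
  note a = betweenD[OF A] and b = betweenD[OF B] and m = betweenD[OF M]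
  have quad: "J' R r * (t - r) + \<tau> / 2 * (t - r)\<^sup>2 \<le> J R t - J R r"
    if "lo \<le> r" "r \<le> hi" "lo \<le> t" "t \<le> hi" for r t
  proof (rule J_quadratic_lower)
    show "J' R r + \<tau> * (x - r) \<le> J' R x" if "r \<le> x" "x \<le> t" for x
      using \<tau>(1)[of r x] that \<open>lo \<le> r\<close> \<open>t \<le> hi\<close> by simp
    show "J' R x \<le> J' R r + \<tau> * (x - r)" if "t \<le> x" "x \<le> r" for x
      using \<tau>(1)[of x r] that \<open>lo \<le> t\<close> \<open>r \<le> hi\<close> by (simp add: algebra_simps)
  qed (use that lo in auto)
  define Z where "Z = l2 A M + l2 B M"
  have Z: "0 \<le> Z" using l2_nonneg by (simp add: Z_def)
  have "(\<integral>x. \<tau> / 2 * ((radial A x - radial M x)\<^sup>2 + (radial B x - radial M x)\<^sup>2) - \<zeta> \<partial>sphere_law)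
     \<le> (\<integral>x. J R (radial A x) + J R (radial B x) - 2 * J R (radial M x) \<partial>sphere_law)"
  proof (rule sphere_law_mono)
    show "integrable sphere_law (\<lambda>x. \<tau> / 2 * ((radial A x - radial M x)\<^sup>2 + (radial B x - radial M x)\<^sup>2) - \<zeta>)"
      using integrable_radial_diff(2)[OF a(1) m(1)] integrable_radial_diff(2)[OF b(1) m(1)] by auto
    show "integrable sphere_law (\<lambda>x. J R (radial A x) + J R (radial B x) - 2 * J R (radial M x))"
      using integrable_J_radial[OF a(1)] integrable_J_radial[OF b(1)] integrable_J_radial[OF m(1)] by auto
    fix x :: "real ^ 'n" assume x: "norm x = 1"
    show "\<tau> / 2 * ((radial A x - radial M x)\<^sup>2 + (radial B x - radial M x)\<^sup>2) - \<zeta>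
      \<le> J R (radial A x) + J R (radial B x) - 2 * J R (radial M x)"
      using quad[OF m(2,3)[OF x] a(2,3)[OF x]] quad[OF m(2,3)[OF x] b(2,3)[OF x]] cross[OF x]
      by (simp add: algebra_simps)
  qed
  then have gain: "\<tau> / 2 * Z - \<zeta> \<le> deficit R A + deficit R B - 2 * deficit R M"
    using integrable_J_radial[OF a(1)] integrable_J_radial[OF b(1)] integrable_J_radial[OF m(1)]
      integrable_radial_diff(2)[OF a(1) m(1)] integrable_radial_diff(2)[OF b(1) m(1)]
    by (simp add: deficit_def Z_def l2_def)
  \<comment> \<open>J is minimal at R, since J' vanishes there and increases. Hence - j is largest
    for the ball of radius R, where it is known explicitly.\<close>
  have JR: "J R R \<le> deficit R M"
  proof -
    have "(\<integral>x. J R R \<partial>(sphere_law :: (real ^ 'n) measure)) \<le> deficit R M"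
      unfolding deficit_def
    proof (rule sphere_law_mono)
      fix x :: "real ^ 'n" assume x: "norm x = 1"
      have "J' R R = 0" by (simp add: J'_def)
      then have "\<tau> / 2 * (radial M x - R)\<^sup>2 \<le> J R (radial M x) - J R R"
        using quad[of R "radial M x"] m(2,3)[OF x] lo by simp
      moreover have "0 \<le> \<tau> / 2 * (radial M x - R)\<^sup>2" using \<tau>(2) by simp
      ultimately show "J R R \<le> J R (radial M x)" by linarith
    qed (use integrable_J_radial[OF m(1)] in auto)
    then show ?thesis by simp
  qed
  define x1 where "x1 = volume_part R A - volume_part R M"
  define x2 where "x2 = volume_part R B - volume_part R M"
  define y1 where "y1 = deficit R A - deficit R M"
  define y2 where "y2 = deficit R B - deficit R M"
  define q where "q = \<phi> R * \<omega> * (real n * hi ^ (n - 1))"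
  have q: "0 \<le> q" using pos lo by (simp add: q_def)
  have L0: "0 \<le> L" using L[of R] lo by fastforce
  have x: "\<bar>x1\<bar> \<le> q * l1 A M" "\<bar>x2\<bar> \<le> q * l1 B M"
    unfolding x1_def x2_def q_def by (rule volume_part_diff[OF _ M lo(1) R0], rule A, rule volume_part_diff[OF _ M lo(1) R0], rule B)
  have y: "\<bar>y1\<bar> \<le> L * l1 A M" "\<bar>y2\<bar> \<le> L * l1 B M"
    unfolding y1_def y2_def by (rule deficit_diff[OF _ M lo(1) L], rule A, assumption, assumption, rule deficit_diff[OF _ M lo(1) L], rule B)
  have l12: "(l1 A M)\<^sup>2 \<le> l2 A M" "(l1 B M)\<^sup>2 \<le> l2 B M" using l1_square_le a b m by auto
  have sq: "x\<^sup>2 \<le> q\<^sup>2 * l2" if "\<bar>x\<bar> \<le> q * l1" "l1\<^sup>2 \<le> l2" for x l1 l2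
  proof -
    have "x\<^sup>2 \<le> (q * l1)\<^sup>2" using power_mono[OF that(1), where n = 2] by simp
    also have "\<dots> \<le> q\<^sup>2 * l2" using that(2) by (simp add: power_mult_distrib mult_left_mono)
    finally show ?thesis .
  qed
  have xy: "x * y \<le> q * L * l2" if "\<bar>x\<bar> \<le> q * l1" "\<bar>y\<bar> \<le> L * l1" "l1\<^sup>2 \<le> l2" for x y l1 l2
  proof -
    have "x * y \<le> \<bar>x\<bar> * \<bar>y\<bar>" by (metis abs_ge_self abs_mult)
    also have "\<dots> \<le> (q * l1) * (L * l1)" using that by (intro mult_mono) auto
    also have "\<dots> = q * L * l1\<^sup>2" by (simp add: power2_eq_square)
    also have "\<dots> \<le> q * L * l2" using that q L0 by (intro mult_left_mono) auto
    finally show ?thesis .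
  qed
  have X2: "x1\<^sup>2 + x2\<^sup>2 \<le> q\<^sup>2 * Z" using sq[OF x(1) l12(1)] sq[OF x(2) l12(2)] by (simp add: Z_def distrib_left)
  have XY: "x1 * y1 + x2 * y2 \<le> q * L * Z" using xy[OF x(1) y(1) l12(1)] xy[OF x(2) y(2) l12(2)] by (simp add: Z_def distrib_left)
  have Glo: "0 < G lo" using phi_antimono[OF lo(1,2)] pos by (intro G_pos lo) simp
  have mG: "G lo \<le> measure \<gamma> M" by (rule measure_between_ge[OF M])
  have Xlo: "\<phi> R * \<omega> * lo ^ n \<le> volume_part R M" by (rule volume_part_between_ge[OF M lo(1) R0])
  have Xpos: "0 < \<phi> R * \<omega> * lo ^ n" using pos lo by simp
  note JRneg = J_nonpos[OF R0]
  have D: "0 < volume_part R M * measure \<gamma> M" using Xlo Xpos mG Glo by simp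
  have t1: "(x1\<^sup>2 + x2\<^sup>2) * (- deficit R M) / (volume_part R M * measure \<gamma> M) \<le> q\<^sup>2 * (- J R R) / (\<phi> R * \<omega> * lo ^ n * G lo) * Z"
  proof -
    have "(x1\<^sup>2 + x2\<^sup>2) * (- deficit R M) \<le> (x1\<^sup>2 + x2\<^sup>2) * (- J R R)" using JR by (intro mult_left_mono) auto
    also have "\<dots> \<le> (q\<^sup>2 * Z) * (- J R R)" using X2 JRneg by (intro mult_right_mono) auto
    finally have "(x1\<^sup>2 + x2\<^sup>2) * (- deficit R M) / (volume_part R M * measure \<gamma> M) \<le> (q\<^sup>2 * Z) * (- J R R) / (volume_part R M * measure \<gamma> M)"
      using D by (intro divide_right_mono) auto
    also have "\<dots> \<le> (q\<^sup>2 * Z) * (- J R R) / (\<phi> R * \<omega> * lo ^ n * G lo)"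
    proof (rule divide_left_mono)
      show "\<phi> R * \<omega> * lo ^ n * G lo \<le> volume_part R M * measure \<gamma> M"
        by (rule mult_mono[OF Xlo mG]) (use Xlo Xpos Glo in auto)
      show "0 \<le> q\<^sup>2 * Z * - J R R" using JRneg Z by (intro mult_nonneg_nonneg) auto
      show "0 < volume_part R M * measure \<gamma> M * (\<phi> R * \<omega> * lo ^ n * G lo)"
        by (rule mult_pos_pos[OF D mult_pos_pos[OF Xpos Glo]])
    qed
    finally show ?thesis by (simp add: mult_ac)
  qed
  have t2: "2 * (x1 * y1 + x2 * y2) / measure \<gamma> M \<le> 2 * q * L / G lo * Z"
  proof -
    have "2 * (x1 * y1 + x2 * y2) / measure \<gamma> M \<le> 2 * (q * L * Z) / measure \<gamma> M"
      using XY mG Glo by (intro divide_right_mono) auto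
    also have "\<dots> \<le> 2 * (q * L * Z) / G lo"
      using mG Glo q L0 Z by (intro divide_left_mono) auto
    finally show ?thesis by (simp add: mult_ac)
  qed
  have "loss R A B M = (1 - 1 / real n) / 2 * ((x1\<^sup>2 + x2\<^sup>2) * (- deficit R M) / (volume_part R M * measure \<gamma> M) + 2 * (x1 * y1 + x2 * y2) / measure \<gamma> M)"
    by (simp add: loss_def x1_def x2_def y1_def y2_def)
  also have "\<dots> \<le> (1 - 1 / real n) / 2 * (q\<^sup>2 * (- J R R) / (\<phi> R * \<omega> * lo ^ n * G lo) * Z + 2 * q * L / G lo * Z)"
    using t1 t2 dim by (intro mult_left_mono add_mono) auto
  also have "\<dots> = (1 - 1 / real n) / 2 * (q\<^sup>2 * (- J R R) / (\<phi> R * \<omega> * lo ^ n * G lo) + 2 * q * L / G lo) * Z"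
    by (simp only: distrib_right mult.assoc)
  also have "\<dots> \<le> (\<tau> / 2 - c * L) * Z"
    using const Z unfolding q_def[symmetric] by (intro mult_right_mono) auto
  also have "\<dots> \<le> \<tau> / 2 * Z - \<zeta>" using \<zeta> by (simp add: Z_def left_diff_distrib)
  finally show ?thesis using gain by simp
qed

text \<open>In the limit d -> 0 the loss constant is at most (1 - 1/n) k / 2 by
  \<open>G_left_slope_bound\<close>, L tends to 0, and J' has slope arbitrarily close to k. The
  strict margin survives for small d. The outer radius \<open>hi d\<close> is R for truncated bodies
  and R + d otherwise.\<close>

lemma slope_constants:
  assumes R: "0 < R" and pos: "0 < \<phi> R" and v: "0 < v"
    and le: "\<And>x. 0 < x \<Longrightarrow> x \<le> R \<Longrightarrow> \<phi> x \<le> \<phi> R * exp (v * (R - x))"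
    and decay: "\<And>v'. 0 \<le> v' \<Longrightarrow> v' < v \<Longrightarrow>
      \<exists>y. 0 < y \<and> y < R \<and> (\<forall>s t. y \<le> s \<longrightarrow> s \<le> t \<longrightarrow> \<phi> t \<le> \<phi> s * exp (- v' * (t - s)))"
    and N: "0 \<le> N" and d1: "0 < d1"
    and hi: "\<And>d. 0 < d \<Longrightarrow> d < d1 \<Longrightarrow> R \<le> hi d \<and> hi d \<le> R + d \<and> \<phi> R - N * d \<le> \<phi> (hi d)"
    and c: "0 \<le> c"
  shows "\<exists>d \<tau> L. 0 < d \<and> d < d1 \<and> d < R \<and> 0 \<le> \<tau> \<and>
    (\<forall>r t. R - d \<le> r \<longrightarrow> r \<le> t \<longrightarrow> t \<le> hi d \<longrightarrow> \<tau> * (t - r) \<le> J' R t - J' R r) \<and>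
    (\<forall>x. R - d \<le> x \<longrightarrow> x \<le> hi d \<longrightarrow> \<bar>J' R x\<bar> \<le> L) \<and>
    (1 - 1 / real n) / 2 * ((\<phi> R * \<omega> * (real n * hi d ^ (n - 1)))\<^sup>2 * (- J R R) / (\<phi> R * \<omega> * (R - d) ^ n * G (R - d))
        + 2 * (\<phi> R * \<omega> * (real n * hi d ^ (n - 1))) * L / G (R - d)) + c * L \<le> \<tau> / 2"
proof -
  define k where "k = real n * \<omega> * R ^ (n - 1) * \<phi> R * v"
  have k: "0 < k" using R pos v by (simp add: k_def)
  have nn: "real n \<ge> 2" using dim by simp
  \<comment> \<open>The margin 1 / n is divided up: with 1 / (8 n) here and 1 / (4 n) in \<tau>, the
    limit of \<open>ld\<close> still exceeds \<tau>, and \<tau> / 2 still exceeds (1 - 1/n) k /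
    2.\<close>
  define v' where "v' = v * (1 - 1 / (8 * real n))"
  have v': "0 \<le> v'" "v' < v" using v nn by (auto simp: v'_def field_simps)
  obtain y where y: "0 < y" "y < R" "\<And>s t. y \<le> s \<Longrightarrow> s \<le> t \<Longrightarrow> \<phi> t \<le> \<phi> s * exp (- v' * (t - s))"
    using decay[OF v'] by blast
  define \<tau> where "\<tau> = k * (1 - 1 / (4 * real n))"
  have \<tau>: "0 \<le> \<tau>" using k nn by (simp add: \<tau>_def field_simps)
  \<comment> \<open>\<open>ld\<close> bounds the slope of J' from below and \<open>Ld\<close> bounds
    its modulus on [R - d, hi d]; \<open>Ad\<close> is the left side of the final inequality with hi
    d enlarged to R + d. All three converge as d -> 0.\<close>
  define ld where "ld d = real n * \<omega> * ((R - d) ^ (n - 1) * (\<phi> R - N * d) * v' - (real n - 1) * (R + d) ^ (n - 2) * \<phi> R * (exp (v * d) - 1))" for d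
  define Ld where "Ld d = real n * \<omega> * (R + d) ^ (n - 1) * (\<phi> R * (exp (v * d) - 1) + N * d)" for d
  define Ad where "Ad d = (1 - 1 / real n) / 2 * ((\<phi> R * \<omega> * (real n * (R + d) ^ (n - 1)))\<^sup>2 * (- J R R) / (\<phi> R * \<omega> * (R - d) ^ n * G (R - d))
        + 2 * (\<phi> R * \<omega> * (real n * (R + d) ^ (n - 1))) * Ld d / G (R - d)) + c * Ld d" for d
  have GR: "0 < G R" by (rule G_pos[OF R pos])
  have tG: "((\<lambda>d. G (R - d)) \<longlongrightarrow> G R) (at_right 0)"
    using R by (auto intro!: isCont_tendsto_compose[OF G_continuous] tendsto_eq_intros)
  have tld: "(ld \<longlongrightarrow> k * (1 - 1 / (8 * real n))) (at_right 0)"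
    unfolding ld_def k_def v'_def by (auto intro!: tendsto_eq_intros)
  have tLd: "(Ld \<longlongrightarrow> 0) (at_right 0)"
    unfolding Ld_def by (auto intro!: tendsto_eq_intros)
  have tAd: "(Ad \<longlongrightarrow> (1 - 1 / real n) / 2 * ((\<phi> R * \<omega> * (real n * R ^ (n - 1)))\<^sup>2 * (- J R R) / (\<phi> R * \<omega> * R ^ n * G R))) (at_right 0)"
    unfolding Ad_def using R pos GR by (auto intro!: tendsto_eq_intros tG tLd)
  have JRneg: "- J R R \<le> v * R * G R / real n"
  proof -
    have "(real n - v * R) * G R \<le> real n * \<omega> * \<phi> R * R ^ n"
      by (rule G_left_slope_bound[OF R pos _ le]) (use v in auto)
    then have "real n * (- J R R) \<le> v * R * G R" by (simp add: J_def algebra_simps)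
    then show ?thesis using nn by (simp add: field_simps)
  qed
  have A0: "(1 - 1 / real n) / 2 * ((\<phi> R * \<omega> * (real n * R ^ (n - 1)))\<^sup>2 * (- J R R) / (\<phi> R * \<omega> * R ^ n * G R)) \<le> k / 2 * (1 - 1 / real n)"
  proof -
    have Rn: "R ^ n = R * R ^ (n - 1)" using dim by (simp add: power_eq_if)
    have "(\<phi> R * \<omega> * (real n * R ^ (n - 1)))\<^sup>2 * (- J R R) / (\<phi> R * \<omega> * R ^ n * G R)
       \<le> (\<phi> R * \<omega> * (real n * R ^ (n - 1)))\<^sup>2 * (v * R * G R / real n) / (\<phi> R * \<omega> * R ^ n * G R)"
      using JRneg R pos GR by (intro divide_right_mono mult_left_mono) auto
    also have "\<dots> = k"
      using R pos GR nn unfolding Rn k_def by (simp add: power2_eq_square field_simps)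
    finally have "(1 - 1 / real n) / 2 * ((\<phi> R * \<omega> * (real n * R ^ (n - 1)))\<^sup>2 * (- J R R) / (\<phi> R * \<omega> * R ^ n * G R)) \<le> (1 - 1 / real n) / 2 * k"
      using nn by (intro mult_left_mono) auto
    also have "\<dots> = k / 2 * (1 - 1 / real n)" by simp
    finally show ?thesis .
  qed
  have "\<forall>\<^sub>F d in at_right 0. \<tau> < ld d"
  proof (rule order_tendstoD(1)[OF tld])
    show "\<tau> < k * (1 - 1 / (8 * real n))" unfolding \<tau>_def using k nn by (intro mult_strict_left_mono) (auto simp: field_simps)
  qed
  moreover have "\<forall>\<^sub>F d in at_right 0. Ad d < \<tau> / 2"
  proof (rule order_tendstoD(2)[OF tAd])
    have "k / 2 * (1 - 1 / real n) < \<tau> / 2"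
      unfolding \<tau>_def using k nn by (simp add: field_simps)
    with A0 show "(1 - 1 / real n) / 2 * ((\<phi> R * \<omega> * (real n * R ^ (n - 1)))\<^sup>2 * (- J R R) / (\<phi> R * \<omega> * R ^ n * G R)) < \<tau> / 2" by linarith
  qed
  moreover have "\<forall>\<^sub>F d in at_right 0. 0 < d \<and> d < min d1 (R - y)"
    using d1 y by (auto simp: eventually_at_right_field intro!: exI[of _ "min d1 (R - y)"])
  ultimately have "\<forall>\<^sub>F d in at_right 0. \<tau> < ld d \<and> Ad d < \<tau> / 2 \<and> 0 < d \<and> d < min d1 (R - y)"
    by eventually_elim auto
  from eventually_happens'[OF trivial_limit_at_right_real this]
  obtain d where d: "\<tau> < ld d" "Ad d < \<tau> / 2" "0 < d" "d < d1" "d < R - y" by auto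
  have h: "R \<le> hi d" "hi d \<le> R + d" "\<phi> R - N * d \<le> \<phi> (hi d)" using hi[OF d(3,4)] by auto
  have up: "\<phi> x - \<phi> R \<le> \<phi> R * (exp (v * d) - 1)" if x: "R - d \<le> x" for x
  proof (cases "x \<le> R")
    case True
    have "\<phi> x \<le> \<phi> R * exp (v * (R - x))" using x d y True by (intro le) auto
    also have "\<dots> \<le> \<phi> R * exp (v * d)" using x v pos by (intro mult_left_mono) (auto intro: mult_left_mono)
    finally show ?thesis by (simp add: algebra_simps)
  next
    case False
    then have "\<phi> x \<le> \<phi> R" using R by (intro phi_antimono) auto
    moreover have "0 \<le> \<phi> R * (exp (v * d) - 1)" using pos v d by simp
    ultimately show ?thesis by simp
  qed
  have dn: "\<phi> R - N * d \<le> \<phi> x" if x: "R - d \<le> x" "x \<le> hi d" for x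
    using h(3) phi_antimono[of x "hi d"] x d y by simp
  have slope: "\<tau> * (t - r) \<le> J' R t - J' R r" if rt: "R - d \<le> r" "r \<le> t" "t \<le> hi d" for r t
  proof -
    have r0: "0 < r" "y \<le> r" using rt d y by auto
    \<comment> \<open>The increment of J' splits into r^(n-1) (\<phi>(r) - \<phi>(t)), which carries
      the slope, and this variation of the power, which is at worst slightly negative because
      \<phi>(t) hardly exceeds \<phi>(R).\<close>
    have p1: "- ((real n - 1) * (R + d) ^ (n - 2) * \<phi> R * (exp (v * d) - 1)) * (t - r) \<le> (t ^ (n - 1) - r ^ (n - 1)) * (\<phi> R - \<phi> t)"
    proof -
      have q0: "0 \<le> t ^ (n - 1) - r ^ (n - 1)" using r0 rt by (simp add: power_mono)
      have "t ^ (n - 1) - r ^ (n - 1) \<le> real (n - 1) * t ^ (n - 1 - 1) * (t - r)"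
        using r0 rt by (intro power_diff_bounds) auto
      also have "\<dots> \<le> real (n - 1) * (R + d) ^ (n - 1 - 1) * (t - r)"
        using r0 rt h by (intro mult_right_mono mult_left_mono power_mono) auto
      also have "\<dots> = (real n - 1) * (R + d) ^ (n - 2) * (t - r)" using dim by (simp add: of_nat_diff numeral_2_eq_2)
      finally have q1: "t ^ (n - 1) - r ^ (n - 1) \<le> (real n - 1) * (R + d) ^ (n - 2) * (t - r)" .
      have "(t ^ (n - 1) - r ^ (n - 1)) * (\<phi> t - \<phi> R) \<le> (t ^ (n - 1) - r ^ (n - 1)) * (\<phi> R * (exp (v * d) - 1))"
        using up[of t] rt q0 by (intro mult_left_mono) auto
      also have "\<dots> \<le> ((real n - 1) * (R + d) ^ (n - 2) * (t - r)) * (\<phi> R * (exp (v * d) - 1))"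
        using q1 pos v d by (intro mult_right_mono) auto
      finally show ?thesis by (simp add: algebra_simps)
    qed
    have p2: "(R - d) ^ (n - 1) * (\<phi> R - N * d) * v' * (t - r) \<le> r ^ (n - 1) * (\<phi> r - \<phi> t)"
    proof -
      have t0: "0 \<le> \<phi> t" using r0 rt by (intro phi_nonneg) auto
      have "\<phi> t * exp (v' * (t - r)) \<le> \<phi> r * exp (- v' * (t - r)) * exp (v' * (t - r))"
        using y(3)[OF r0(2) rt(2)] by (intro mult_right_mono) auto
      then have "\<phi> t * exp (v' * (t - r)) \<le> \<phi> r" by (simp add: mult.assoc flip: exp_add)
      moreover have "\<phi> t * (1 + v' * (t - r)) \<le> \<phi> t * exp (v' * (t - r))"
        using t0 by (intro mult_left_mono exp_ge_add_one_self) auto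
      ultimately have "\<phi> t * (v' * (t - r)) \<le> \<phi> r - \<phi> t" by (simp add: distrib_left)
      moreover have "(\<phi> R - N * d) * (v' * (t - r)) \<le> \<phi> t * (v' * (t - r))"
        using dn[of t] rt v' by (intro mult_right_mono) auto
      ultimately have m1: "(\<phi> R - N * d) * (v' * (t - r)) \<le> \<phi> r - \<phi> t" by simp
      have m2: "0 \<le> \<phi> r - \<phi> t" using phi_antimono[OF r0(1) rt(2)] by simp
      have "(R - d) ^ (n - 1) * ((\<phi> R - N * d) * (v' * (t - r))) \<le> (R - d) ^ (n - 1) * (\<phi> r - \<phi> t)"
        using m1 d y by (intro mult_left_mono) auto
      also have "\<dots> \<le> r ^ (n - 1) * (\<phi> r - \<phi> t)"
        using m2 rt d y by (intro mult_right_mono power_mono) auto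
      finally show ?thesis by (simp add: mult_ac)
    qed
    have "\<tau> * (t - r) \<le> ld d * (t - r)" using d rt by (intro mult_right_mono) auto
    also have "\<dots> = real n * \<omega> * ((R - d) ^ (n - 1) * (\<phi> R - N * d) * v' * (t - r) + - ((real n - 1) * (R + d) ^ (n - 2) * \<phi> R * (exp (v * d) - 1)) * (t - r))"
      by (simp add: ld_def algebra_simps)
    also have "\<dots> \<le> real n * \<omega> * (r ^ (n - 1) * (\<phi> r - \<phi> t) + (t ^ (n - 1) - r ^ (n - 1)) * (\<phi> R - \<phi> t))"
      using p1 p2 by (intro mult_left_mono add_mono) auto
    also have "\<dots> = J' R t - J' R r" by (simp add: J'_def algebra_simps)
    finally show ?thesis .
  qed
  have Lb: "\<bar>J' R x\<bar> \<le> Ld d" if x: "R - d \<le> x" "x \<le> hi d" for x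
  proof -
    have "0 \<le> \<phi> R * (exp (v * d) - 1)" "0 \<le> N * d" using pos v d N by auto
    then have "\<bar>\<phi> R - \<phi> x\<bar> \<le> \<phi> R * (exp (v * d) - 1) + N * d" using up[OF x(1)] dn[OF x] by linarith
    moreover have "x ^ (n - 1) \<le> (R + d) ^ (n - 1)" using x h d y by (intro power_mono) auto
    moreover have "\<bar>J' R x\<bar> = real n * \<omega> * x ^ (n - 1) * \<bar>\<phi> R - \<phi> x\<bar>"
      using x d y by (simp add: J'_def abs_mult)
    ultimately show ?thesis unfolding Ld_def using x d y R by (simp add: mult_mono)
  qed
  have fin: "(1 - 1 / real n) / 2 * ((\<phi> R * \<omega> * (real n * hi d ^ (n - 1)))\<^sup>2 * (- J R R) / (\<phi> R * \<omega> * (R - d) ^ n * G (R - d))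
        + 2 * (\<phi> R * \<omega> * (real n * hi d ^ (n - 1))) * Ld d / G (R - d)) + c * Ld d \<le> \<tau> / 2"
  proof -
    have L0: "0 \<le> Ld d" using Lb[of R] h d by fastforce
    have "hi d ^ (n - 1) \<le> (R + d) ^ (n - 1)" using h R by (intro power_mono) auto
    then have q: "\<phi> R * \<omega> * (real n * hi d ^ (n - 1)) \<le> \<phi> R * \<omega> * (real n * (R + d) ^ (n - 1))"
      using pos by (intro mult_left_mono) auto
    have q0: "0 \<le> \<phi> R * \<omega> * (real n * hi d ^ (n - 1))" using pos h R by simp
    have "0 < G (R - d)" using phi_antimono[of "R - d" R] pos d y by (intro G_pos) auto
    moreover have "0 < (R - d) ^ n" using d y by simp
    moreover note J_nonpos[OF R]
    moreover have "0 \<le> (1 - 1 / real n) / 2" using nn by simp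
    moreover note power_mono[OF q q0, where n = 2]
    ultimately have "(1 - 1 / real n) / 2 * ((\<phi> R * \<omega> * (real n * hi d ^ (n - 1)))\<^sup>2 * (- J R R) / (\<phi> R * \<omega> * (R - d) ^ n * G (R - d))
        + 2 * (\<phi> R * \<omega> * (real n * hi d ^ (n - 1))) * Ld d / G (R - d)) + c * Ld d \<le> Ad d"
      unfolding Ad_def using q q0 L0 pos
      by (intro add_right_mono mult_left_mono add_mono divide_right_mono mult_right_mono) auto
    with d(2) show ?thesis by linarith
  qed
  show ?thesis using d y \<tau> slope Lb fin by (intro exI[of _ d] exI[of _ \<tau>] exI[of _ "Ld d"]) auto
qed

end

section \<open>Concavity near the ball\<close>

lemma root_concave:
  fixes a b l :: real
  assumes n: "0 < n" and ab: "0 \<le> a" "0 \<le> b" and l: "0 \<le> l" "l \<le> 1"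
  shows "l * a powr (1 / real n) + (1 - l) * b powr (1 / real n) \<le> (l * a + (1 - l) * b) powr (1 / real n)"
proof -
  define x where "x = a powr (1 / real n)"
  define y where "y = b powr (1 / real n)"
  define m where "m = l * x + (1 - l) * y"
  have xy: "0 \<le> x" "0 \<le> y" by (auto simp: x_def y_def)
  have pw: "(c powr (1 / real n)) ^ n = c" if "0 \<le> c" for c
    using that n by (cases "c = 0") (auto simp: powr_powr simp flip: powr_realpow)
  have m0: "0 \<le> m" using xy l by (simp add: m_def)
  have tangent: "m ^ n + real n * m ^ (n - 1) * (t - m) \<le> t ^ n" if "0 \<le> t" for t
    using power_diff_bounds(1)[of m t n] power_diff_bounds(2)[of t m n] that m0
    by (cases "m \<le> t") (auto simp: algebra_simps)
  have "l * (m ^ n + real n * m ^ (n - 1) * (x - m)) + (1 - l) * (m ^ n + real n * m ^ (n - 1) * (y - m))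
      \<le> l * x ^ n + (1 - l) * y ^ n"
    using tangent xy l by (intro add_mono mult_left_mono) auto
  moreover have "l * (m ^ n + real n * m ^ (n - 1) * (x - m)) + (1 - l) * (m ^ n + real n * m ^ (n - 1) * (y - m))
      = m ^ n + real n * m ^ (n - 1) * (l * x + (1 - l) * y - m)" by (simp add: algebra_simps)
  ultimately have "m ^ n \<le> l * a + (1 - l) * b" using pw ab by (simp add: m_def x_def y_def)
  then have "(m ^ n) powr (1 / real n) \<le> (l * a + (1 - l) * b) powr (1 / real n)"
    using m0 by (intro powr_mono2) auto
  moreover have "(m ^ n) powr (1 / real n) = m"
    using m0 n by (cases "m = 0") (auto simp: powr_powr simp flip: powr_realpow)
  ultimately show ?thesis by (simp add: m_def x_def y_def)
qed

section \<open>Uniform bounds for the radial functions, and truncation by the ball\<close>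

context sphere_perturbation
begin

lemma rho_lower:
  assumes "\<bar>e\<bar> \<le> a0" "norm x = 1"
  shows "R - \<bar>e\<bar> * C \<le> \<rho> e x"
proof (cases "0 \<le> R - \<bar>e\<bar> * C")
  case True
  then show ?thesis unfolding \<rho>_def
    using radial_ge[OF star_body_KR[OF assms(1)] assms(2) cball_subset_K] by simp
next
  case False
  then show ?thesis using rho_nonneg[OF assms(1), of x] by linarith
qed

lemma rho_upper:
  assumes "\<bar>e\<bar> \<le> a0" "norm x = 1"
  shows "\<rho> e x \<le> R + \<bar>e\<bar> * C"
  using rho_le[OF assms] e_psi_bound[OF assms(2), of e] by linarith

text \<open>Concavity in the parameter bounds the increment above by the chord from 0 to e and below
  by the chord from e to a0. Staying below a0 / 2 keeps the latter long enough.\<close>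

lemma rho_Lipschitz:
  assumes e: "0 < e" "0 < s" "e + s \<le> a0 / 2" and x: "norm x = 1"
  shows "\<bar>\<rho> (e + s) x - \<rho> e x\<bar> \<le> 4 * C * s"
proof -
  have a: "0 < a0" by (rule a0_pos)
  have re: "\<rho> e x \<le> R + e * C" "\<rho> e x \<ge> R - e * C"
    using rho_upper[of e x] rho_lower[of e x] e x by auto
  have ra: "\<rho> a0 x \<ge> R - a0 * C" using rho_lower[of a0 x] a x by simp
  define l where "l = s / (e + s)"
  have l: "0 \<le> l" "l \<le> 1" using e by (auto simp: l_def)
  have E: "l * 0 + (1 - l) * (e + s) = e" using e by (simp add: l_def field_simps)
  have "l * R + (1 - l) * \<rho> (e + s) x \<le> \<rho> e x"
    using rho_concave[of 0 "e + s" l x, unfolded E] e l a rho_0[OF x] by simp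
  then have "(e + s) * (l * R + (1 - l) * \<rho> (e + s) x) \<le> (e + s) * \<rho> e x" using e by (intro mult_left_mono) auto
  moreover have "(e + s) * (l * R + (1 - l) * \<rho> (e + s) x) = s * R + e * \<rho> (e + s) x"
  proof -
    have "(e + s) * l = s" using e by (simp add: l_def)
    then have "(e + s) * (1 - l) = e" by (simp add: right_diff_distrib)
    with \<open>(e + s) * l = s\<close> show ?thesis by (metis distrib_left mult.assoc)
  qed
  ultimately have "e * (\<rho> (e + s) x - \<rho> e x) \<le> s * (\<rho> e x - R)" by (simp add: algebra_simps)
  also have "\<dots> \<le> s * (e * C)" using re e by (intro mult_left_mono) auto
  finally have "e * (\<rho> (e + s) x - \<rho> e x) \<le> e * (C * s)" by (simp add: mult_ac)
  then have up: "\<rho> (e + s) x - \<rho> e x \<le> C * s" using e by simp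
  define m where "m = s / (a0 - e)"
  have m: "0 \<le> m" "m \<le> 1" using e by (auto simp: m_def)
  have "m * (a0 - e) = s" using e by (simp add: m_def)
  then have E: "m * a0 + (1 - m) * e = e + s" by (simp add: algebra_simps)
  have "m * \<rho> a0 x + (1 - m) * \<rho> e x \<le> \<rho> (e + s) x"
    using rho_concave[of a0 e m x, unfolded E] e m a by simp
  then have "m * (\<rho> a0 x - \<rho> e x) \<le> \<rho> (e + s) x - \<rho> e x" by (simp add: algebra_simps)
  moreover have "m * (- (2 * a0 * C)) \<le> m * (\<rho> a0 x - \<rho> e x)"
  proof (rule mult_left_mono[OF _ m(1)])
    have "e * C \<le> a0 * C" using e C_ge by (intro mult_right_mono) auto
    then show "- (2 * a0 * C) \<le> \<rho> a0 x - \<rho> e x" using re ra by linarith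
  qed
  moreover have "m * (2 * a0 * C) \<le> 4 * C * s"
  proof -
    have "m \<le> s / (a0 / 2)" unfolding m_def using e a by (intro divide_left_mono) auto
    then have "m * (2 * a0 * C) \<le> s / (a0 / 2) * (2 * a0 * C)" using a C_ge by (intro mult_right_mono) auto
    then show ?thesis using a by simp
  qed
  ultimately have "- (4 * C * s) \<le> \<rho> (e + s) x - \<rho> e x" by linarith
  moreover have "C * s \<le> 4 * C * s" using C_ge e by simp
  ultimately show ?thesis using up by linarith
qed

lemma K_midpoint:
  "(*\<^sub>R) (1/2) ` K R (e + s) + (*\<^sub>R) (1 - 1/2) ` K R (e - s) \<subseteq> K R e"
proof -
  have "(1/2) * R + (1 - 1/2) * R = R" "(1/2) * (e + s) + (1 - 1/2) * (e - s) = e"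
    by (simp_all add: field_simps)
  then show ?thesis using sum_subset_K[of "1/2" "1 - 1/2" R "e + s" R "e - s"] by simp
qed

lemma K_Int_cball_combination:
  assumes l: "0 \<le> l" "l \<le> 1"
  shows "(*\<^sub>R) l ` (K R e \<inter> cball 0 R) + (*\<^sub>R) (1 - l) ` (K R f \<inter> cball 0 R) \<subseteq> K R (l * e + (1 - l) * f) \<inter> cball 0 R"
proof
  fix z assume "z \<in> (*\<^sub>R) l ` (K R e \<inter> cball 0 R) + (*\<^sub>R) (1 - l) ` (K R f \<inter> cball 0 R)"
  then obtain x y where xy: "x \<in> K R e" "norm x \<le> R" "y \<in> K R f" "norm y \<le> R" "z = l *\<^sub>R x + (1 - l) *\<^sub>R y"
    by (auto simp: set_plus_def)
  have "z \<in> (*\<^sub>R) l ` K R e + (*\<^sub>R) (1 - l) ` K R f"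
    unfolding xy(5) using xy by (intro set_plus_intro imageI)
  then have "z \<in> K (l * R + (1 - l) * R) (l * e + (1 - l) * f)"
    using sum_subset_K[of l "1 - l" R e R f] l by auto
  moreover have "l * R + (1 - l) * R = R" by (simp add: algebra_simps)
  moreover have "z \<in> cball 0 R"
    unfolding xy(5) using xy l by (intro convexD[OF convex_cball]) auto
  ultimately show "z \<in> K R (l * e + (1 - l) * f) \<inter> cball 0 R" by simp
qed

end

section \<open>Concavity along the family, case by case\<close>

locale perturbed_ball = rot_log_concave \<gamma> n \<omega> + sphere_perturbation \<psi> C R
  for \<gamma> :: "(real ^ 'n) measure" and n :: nat and \<omega> :: real and \<psi> :: "real ^ 'n \<Rightarrow> real" and C R :: real
begin

definition root_measure :: "real \<Rightarrow> real" where
  "root_measure e = measure \<gamma> (K R e) powr (1 / real n)"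

definition near_concave :: bool where
  "near_concave \<longleftrightarrow> (\<exists>a>0. a \<le> a0 \<and> (\<forall>e1\<in>{0<..<a}. \<forall>e2\<in>{0<..<a}. \<forall>l. 0 \<le> l \<longrightarrow> l \<le> 1 \<longrightarrow>
     l * root_measure e1 + (1 - l) * root_measure e2 \<le> root_measure (l * e1 + (1 - l) * e2)))"

lemma near_concaveI:
  assumes "0 < a" "a \<le> a0"
    and "\<And>e1 e2 l. e1 \<in> {0<..<a} \<Longrightarrow> e2 \<in> {0<..<a} \<Longrightarrow> 0 \<le> l \<Longrightarrow> l \<le> 1 \<Longrightarrow>
      l * root_measure e1 + (1 - l) * root_measure e2 \<le> root_measure (l * e1 + (1 - l) * e2)"
  shows near_concave
  unfolding near_concave_def using assms by blast

lemma combination_range: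
  fixes e1 e2 l a :: real
  assumes "e1 \<in> {0<..<a}" "e2 \<in> {0<..<a}" "0 \<le> l" "l \<le> 1"
  shows "0 < l * e1 + (1 - l) * e2" "l * e1 + (1 - l) * e2 < a"
proof -
  have m: "min e1 e2 \<le> l * e1 + (1 - l) * e2" "l * e1 + (1 - l) * e2 \<le> max e1 e2"
  proof -
    have "l * min e1 e2 + (1 - l) * min e1 e2 \<le> l * e1 + (1 - l) * e2"
      "l * e1 + (1 - l) * e2 \<le> l * max e1 e2 + (1 - l) * max e1 e2"
      using assms by (intro add_mono mult_left_mono; simp)+
    then show "min e1 e2 \<le> l * e1 + (1 - l) * e2" "l * e1 + (1 - l) * e2 \<le> max e1 e2"
      by (simp_all add: algebra_simps)
  qed
  with assms show "0 < l * e1 + (1 - l) * e2" "l * e1 + (1 - l) * e2 < a" by auto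
qed

lemma between_K:
  assumes "0 < e" "e < a" "a \<le> a0" "a * C \<le> d"
  shows "between (R - d) (R + d) (K R e)"
proof -
  have "e * C \<le> a * C" using assms C_ge by (intro mult_right_mono) auto
  then have eC: "\<bar>e\<bar> * C \<le> d" using assms by simp
  have e: "\<bar>e\<bar> \<le> a0" using assms by simp
  show ?thesis unfolding between_def
    using star_body_KR[OF e] rho_lower[OF e, unfolded \<rho>_def] rho_upper[OF e, unfolded \<rho>_def] eC by force
qed

lemma between_K_cball:
  assumes "0 < e" "e < a" "a \<le> a0" "a * C \<le> d" "0 < d"
  shows "between (R - d) R (K R e \<inter> cball 0 R)"
proof -
  note b = betweenD[OF between_K[OF assms(1-4)]]
  show ?thesis unfolding between_def radial_Int_cball[OF b(1) R_pos]
    using b star_body_Int_cball[OF b(1) R_pos] assms by (auto simp: min_le_iff_disj)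
qed

text \<open>G is concave and nondecreasing on the range of the radial functions, and these are
  concave in e. So the measure is concave in e, and taking the root, which is concave and
  increasing, preserves this.\<close>

lemma near_concave_steep:
  assumes "steep_at R"
  shows near_concave
proof -
  obtain y where y: "0 < y" "y < R" and conc: "\<And>a b l. y \<le> a \<Longrightarrow> y \<le> b \<Longrightarrow> 0 \<le> l \<Longrightarrow> l \<le> 1 \<Longrightarrow>
    l * G a + (1 - l) * G b \<le> G (l * a + (1 - l) * b)"
    using steep_G_concave[OF assms] by blast
  define a where "a = min a0 ((R - y) / C)"
  have a: "0 < a" "a \<le> a0" "a * C \<le> R - y" using y a0_pos C_ge by (auto simp: a_def min_def field_simps)
  show ?thesis
  proof (rule near_concaveI[OF a(1,2)])
    fix e1 e2 l :: real assume e: "e1 \<in> {0<..<a}" "e2 \<in> {0<..<a}" and l: "0 \<le> l" "l \<le> 1"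
    define e3 where "e3 = l * e1 + (1 - l) * e2"
    have e3: "0 < e3" "e3 < a" using combination_range[OF e l] by (auto simp: e3_def)
    have bt: "between y (R + (R - y)) (K R e)" if "0 < e" "e < a" for e
      using between_K[OF that a(2,3)] by simp
    have b1: "between y (R + (R - y)) (K R e1)" and b2: "between y (R + (R - y)) (K R e2)"
      and b3: "between y (R + (R - y)) (K R e3)" using bt e e3 by auto
    note i = integrable_G_radial[OF betweenD(1)[OF b1], of 1] integrable_G_radial[OF betweenD(1)[OF b2], of 1]
      integrable_G_radial[OF betweenD(1)[OF b3], of 1]
    have "l * measure \<gamma> (K R e1) + (1 - l) * measure \<gamma> (K R e2)
        = (\<integral>x. l * G (radial (K R e1) x) + (1 - l) * G (radial (K R e2) x) \<partial>sphere_law)"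
      using i by (simp add: measure_star_body[OF betweenD(1)[OF b1]] measure_star_body[OF betweenD(1)[OF b2]])
    also have "\<dots> \<le> (\<integral>x. G (radial (K R e3) x) \<partial>sphere_law)"
    proof (rule sphere_law_mono)
      fix x :: "real ^ 'n" assume x: "norm x = 1"
      have "l * G (radial (K R e1) x) + (1 - l) * G (radial (K R e2) x) \<le> G (l * radial (K R e1) x + (1 - l) * radial (K R e2) x)"
        using betweenD(2)[OF b1 x] betweenD(2)[OF b2 x] l by (intro conc)
      also have "\<dots> \<le> G (radial (K R e3) x)"
        using rho_concave[of e1 e2 l x] e a(2) l by (intro G_mono) (auto simp: \<rho>_def e3_def)
      finally show "l * G (radial (K R e1) x) + (1 - l) * G (radial (K R e2) x) \<le> G (radial (K R e3) x)" .
    qed (use i in auto)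
    also have "\<dots> = measure \<gamma> (K R e3)" by (simp add: measure_star_body[OF betweenD(1)[OF b3]])
    finally have "(l * measure \<gamma> (K R e1) + (1 - l) * measure \<gamma> (K R e2)) powr (1 / real n) \<le> root_measure e3"
      unfolding root_measure_def using l by (intro powr_mono2) auto
    then show "l * root_measure e1 + (1 - l) * root_measure e2 \<le> root_measure (l * e1 + (1 - l) * e2)"
      using root_concave[of n "measure \<gamma> (K R e1)" "measure \<gamma> (K R e2)" l] l
      by (simp add: root_measure_def e3_def)
  qed
qed

text \<open>A constant density makes J constant on (0, R], and J tends to 0 at the origin because
  there is no atom.\<close>

lemma flat_J_eq_0:
  assumes pos: "0 < \<phi> R" and flat: "\<And>x. 0 < x \<Longrightarrow> x \<le> R \<Longrightarrow> \<phi> x = \<phi> R" and t: "0 < t" "t \<le> R"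
  shows "J R t = 0"
proof -
  obtain M where M: "\<And>t. t > 0 \<Longrightarrow> G t \<le> M * t ^ n" using G_le_power[OF R_pos pos] by blast
  have JJ: "J R s = J R t" if s: "0 < s" "s < t" for s
    using G_increment[of s t] flat[of s] flat[of t] s t by (simp add: J_def algebra_simps)
  have "\<bar>J R t\<bar> \<le> 0"
  proof (rule tendsto_le[OF _ _ tendsto_const])
    show "((\<lambda>s. (\<phi> R * \<omega> + M) * s ^ n) \<longlongrightarrow> 0) (at_right 0)"
      by (auto intro!: tendsto_eq_intros simp: power_0_left)
    have "\<bar>J R t\<bar> \<le> (\<phi> R * \<omega> + M) * s ^ n" if s: "0 < s" "s < t" for s
    proof -
      have "0 \<le> \<phi> R * \<omega> * s ^ n" "0 \<le> G s" "G s \<le> M * s ^ n" using pos s M by auto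
      then have "\<bar>J R s\<bar> \<le> \<phi> R * \<omega> * s ^ n + M * s ^ n" unfolding J_def by linarith
      then show ?thesis by (simp add: JJ[OF s] distrib_right)
    qed
    then show "\<forall>\<^sub>F s in at_right 0. \<bar>J R t\<bar> \<le> (\<phi> R * \<omega> + M) * s ^ n"
      using t by (auto simp: eventually_at_right_field intro!: exI[of _ t])
  qed auto
  then show ?thesis by simp
qed

text \<open>On the truncated bodies the measure is a multiple of Lebesgue measure, and these bodies
  form a concave family; Brunn-Minkowski applies at once.\<close>

lemma near_concave_flat:
  assumes pos: "0 < \<phi> R" and flat: "\<And>x. 0 < x \<Longrightarrow> x \<le> R \<Longrightarrow> \<phi> x = \<phi> R"
    and eq: "\<And>e. 0 < e \<Longrightarrow> e < a0 \<Longrightarrow> measure \<gamma> (K R e) = measure \<gamma> (K R e \<inter> cball 0 R)"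
  shows near_concave
proof (rule near_concaveI[OF a0_pos order_refl])
  fix e1 e2 l :: real assume e: "e1 \<in> {0<..<a0}" "e2 \<in> {0<..<a0}" and l: "0 \<le> l" "l \<le> 1"
  define P where "P e = K R e \<inter> cball 0 R" for e
  have P: "star_body (P e)" if "0 < e" "e < a0" for e
    unfolding P_def using that by (intro star_body_Int_cball star_body_KR R_pos) auto
  have m: "measure \<gamma> (K R e) = \<phi> R * \<omega> * star_volume (P e)" if e: "0 < e" "e < a0" for e
  proof -
    have "deficit R (P e) = (\<integral>x. 0 \<partial>(sphere_law :: (real ^ 'n) measure))"
      unfolding deficit_def
    proof (rule sphere_law_cong)
      note [measurable] = borel_measurable_radial[OF P[OF e]]
      show "(\<lambda>x. J R (radial (P e) x)) \<in> borel_measurable borel" by measurable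
      fix x :: "real ^ 'n" assume "norm x = 1"
      then have "0 < radial (P e) x" "radial (P e) x \<le> R"
        using radial_pos[OF P[OF e]] radial_le[OF P[OF e], of R x] R_pos by (auto simp: P_def)
      then show "J R (radial (P e) x) = 0" using flat by (intro flat_J_eq_0[OF pos])
    qed auto
    then show ?thesis using eq[OF e] measure_eq_volume_part_deficit[OF P[OF e], of R] by (simp add: volume_part_def P_def)
  qed
  define e3 where "e3 = l * e1 + (1 - l) * e2"
  have e3: "0 < e3" "e3 < a0" using combination_range[OF e l] by (auto simp: e3_def)
  show "l * root_measure e1 + (1 - l) * root_measure e2 \<le> root_measure (l * e1 + (1 - l) * e2)"
  proof (cases "l = 0 \<or> l = 1")
    case True
    then show ?thesis by auto
  next
    case False
    then have l': "0 < l" "l < 1" using l by auto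
    have P1: "star_body (P e1)" and P2: "star_body (P e2)" and P3: "star_body (P e3)" using P e e3 by auto
    have S: "star_body ((*\<^sub>R) l ` P e1 + (*\<^sub>R) (1 - l) ` P e2)" by (rule star_body_sum[OF P1 P2 l'])
    have sub: "(*\<^sub>R) l ` P e1 + (*\<^sub>R) (1 - l) ` P e2 \<subseteq> P e3"
      unfolding P_def e3_def by (rule K_Int_cball_combination[OF l])
    have "star_volume ((*\<^sub>R) l ` P e1 + (*\<^sub>R) (1 - l) ` P e2) \<le> star_volume (P e3)"
      unfolding star_volume_eq using S P3 radial_mono[OF S P3 sub] radial_nonneg[OF S]
      by (intro sphere_law_mono integrable_radial_power) (auto intro!: power_mono)
    then have "star_volume ((*\<^sub>R) l ` P e1 + (*\<^sub>R) (1 - l) ` P e2) powr (1 / real n) \<le> star_volume (P e3) powr (1 / real n)"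
      using star_volume_pos[OF S] by (intro powr_mono2) auto
    then have "l * star_volume (P e1) powr (1 / real n) + (1 - l) * star_volume (P e2) powr (1 / real n) \<le> star_volume (P e3) powr (1 / real n)"
      using star_volume_brunn_minkowski[OF R_pos pos P1 P2 l'] by linarith
    then have "(\<phi> R * \<omega>) powr (1 / real n) * (l * star_volume (P e1) powr (1 / real n) + (1 - l) * star_volume (P e2) powr (1 / real n))
       \<le> (\<phi> R * \<omega>) powr (1 / real n) * star_volume (P e3) powr (1 / real n)"
      by (intro mult_left_mono) auto
    moreover have "root_measure e = (\<phi> R * \<omega>) powr (1 / real n) * star_volume (P e) powr (1 / real n)" if "0 < e" "e < a0" for e
      using pos star_volume_pos[OF P[OF that]] by (simp add: root_measure_def m[OF that] powr_mult)
    ultimately show ?thesis unfolding e3_def[symmetric] using e e3 by (simp add: distrib_left mult_ac)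
  qed
qed

lemma support_ends_at_R:
  assumes T: "\<And>t. R < t \<Longrightarrow> \<phi> t = 0" and A: "star_body A"
  shows "measure \<gamma> A = measure \<gamma> (A \<inter> cball 0 R)"
proof -
  have G: "G t = G R" if t: "R \<le> t" for t
  proof (rule antisym)
    show "G t \<le> G R"
    proof (cases "t = R")
      case False
      then have tR: "R < t" using t by simp
      have "G t \<le> G s" if s: "R < s" "s < t" for s
        using G_increment(2)[of s t] T[of s] s R_pos by simp
      moreover have "(G \<longlongrightarrow> G R) (at_right R)"
        using G_continuous[OF R_pos] by (simp add: isCont_def filterlim_at_split)
      ultimately show ?thesis
        using tR by (intro tendsto_le[OF _ _ tendsto_const, of "at_right R" G])
          (auto simp: eventually_at_right_field intro!: exI[of _ t])
    qed simp
  qed (use t in \<open>simp add: G_mono\<close>)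
  have "G (radial A x) = G (min (radial A x) R)" for x using G[of "radial A x"] by (cases "R \<le> radial A x") auto
  then show ?thesis
    by (simp add: measure_star_body[OF A] measure_star_body[OF star_body_Int_cball[OF A R_pos]] radial_Int_cball[OF A R_pos])
qed

text \<open>When the density vanishes outside the ball of radius R, only the truncated bodies matter; their
  radial functions stay concave in the parameter.\<close>

lemma near_concave_truncated:
  assumes pos: "0 < \<phi> R" and v: "0 < v"
    and le: "\<And>x. 0 < x \<Longrightarrow> x \<le> R \<Longrightarrow> \<phi> x \<le> \<phi> R * exp (v * (R - x))"
    and decay: "\<And>v'. 0 \<le> v' \<Longrightarrow> v' < v \<Longrightarrow>
      \<exists>y. 0 < y \<and> y < R \<and> (\<forall>s t. y \<le> s \<longrightarrow> s \<le> t \<longrightarrow> \<phi> t \<le> \<phi> s * exp (- v' * (t - s)))"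
    and T: "\<And>t. R < t \<Longrightarrow> \<phi> t = 0"
  shows near_concave
proof -
  let ?good = "\<lambda>d \<tau> L. 0 < d \<and> d < 1 \<and> d < R \<and> 0 \<le> \<tau> \<and>
    (\<forall>r t. R - d \<le> r \<longrightarrow> r \<le> t \<longrightarrow> t \<le> R \<longrightarrow> \<tau> * (t - r) \<le> J' R t - J' R r) \<and>
    (\<forall>x. R - d \<le> x \<longrightarrow> x \<le> R \<longrightarrow> \<bar>J' R x\<bar> \<le> L) \<and>
    (1 - 1 / real n) / 2 * ((\<phi> R * \<omega> * (real n * R ^ (n - 1)))\<^sup>2 * (- J R R) / (\<phi> R * \<omega> * (R - d) ^ n * G (R - d))
        + 2 * (\<phi> R * \<omega> * (real n * R ^ (n - 1))) * L / G (R - d)) + 0 * L \<le> \<tau> / 2"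
  \<comment> \<open>The outer radius is R itself. There J' is nonpositive, so concavity of the
    truncated radial functions is favourable: c = 0 here and \<zeta> = 0 below.\<close>
  have "\<exists>d \<tau> L. ?good d \<tau> L"
    by (rule slope_constants[OF R_pos pos v le decay order_refl zero_less_one, where hi = "\<lambda>_. R"]) auto
  then obtain d \<tau> L where good: "?good d \<tau> L" by (elim exE)
  then have d: "0 < d" "d < R" "0 \<le> \<tau>"
    and const: "(1 - 1 / real n) / 2 * ((\<phi> R * \<omega> * (real n * R ^ (n - 1)))\<^sup>2 * (- J R R) / (\<phi> R * \<omega> * (R - d) ^ n * G (R - d))
        + 2 * (\<phi> R * \<omega> * (real n * R ^ (n - 1))) * L / G (R - d)) + 0 * L \<le> \<tau> / 2"
    by blast+
  from good have \<tau>: "\<tau> * (t - r) \<le> J' R t - J' R r" if "R - d \<le> r" "r \<le> t" "t \<le> R" for r t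
    using that by blast
  from good have L: "\<bar>J' R x\<bar> \<le> L" if "R - d \<le> x" "x \<le> R" for x
    using that by blast
  define a where "a = min (a0 / 2) (d / C)"
  have a: "0 < a" "a \<le> a0" "a \<le> a0 / 2" "a * C \<le> d" using d a0_pos C_ge by (auto simp: a_def min_def field_simps)
  define P where "P e = K R e \<inter> cball 0 R" for e
  have bt: "between (R - d) R (P e)" if "0 < e" "e < a" for e
    unfolding P_def by (rule between_K_cball[OF that a(2,4) d(1)])
  have mid: "(*\<^sub>R) (1/2) ` P (e + s) + (*\<^sub>R) (1 - 1/2) ` P (e - s) \<subseteq> P e" for e s
  proof -
    have "(1/2) * (e + s) + (1 - 1/2) * (e - s) = e" by (simp add: field_simps)
    then show ?thesis using K_Int_cball_combination[of "1/2" "e + s" "e - s"] by (simp add: P_def)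
  qed
  have rad: "radial (P e) x = min (\<rho> e x) R" if "0 < e" "e < a" for e x
    unfolding P_def \<rho>_def using that a by (intro radial_Int_cball star_body_KR R_pos) auto
  show ?thesis
  proof (rule near_concaveI[OF a(1,2)])
    fix e1 e2 l :: real assume e: "e1 \<in> {0<..<a}" "e2 \<in> {0<..<a}" and l: "0 \<le> l" "l \<le> 1"
    have "l * measure \<gamma> (P e1) powr (1 / real n) + (1 - l) * measure \<gamma> (P e2) powr (1 / real n)
      \<le> measure \<gamma> (P (l * e1 + (1 - l) * e2)) powr (1 / real n)"
    proof (rule concave_root_of_family[of "R - d" R a R P "4 * C", OF _ _ pos bt mid _ _ e l])
      show "0 < R - d" "R - d \<le> R" using d by auto
      show "\<bar>radial (P (e + s)) x - radial (P e) x\<bar> \<le> 4 * C * s" if es: "0 < e" "0 < s" "e + s < a" "norm x = 1" for e s x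
        using rho_Lipschitz[of e s x] es a rad[of "e + s" x] rad[of e x] by (simp add: min_def abs_if split: if_splits)
      fix e \<eta> :: real assume e: "0 < e" "e < a" "0 < \<eta>"
      have "loss R (P (e + s)) (P (e - s)) (P e) \<le> deficit R (P (e + s)) + deficit R (P (e - s)) - 2 * deficit R (P e)"
        if s: "0 < s" "s < e" "e + s < a" for s
      proof (rule loss_le[OF _ _ bt[OF e(1,2)] _ _ order_refl pos \<tau> d(3) L _ _ const])
        show bp: "between (R - d) R (P (e + s))" "between (R - d) R (P (e - s))" using bt s e by auto
        show "0 < R - d" "R - d \<le> R" using d by auto
        fix x :: "real ^ 'n" assume x: "norm x = 1"
        have sb: "star_body (P (e + s))" "star_body (P (e - s))" "star_body (P e)"
          using betweenD(1)[OF bp(1)] betweenD(1)[OF bp(2)] betweenD(1)[OF bt[OF e(1,2)]] by auto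
        have "(1/2) * radial (P (e + s)) x + (1 - 1/2) * radial (P (e - s)) x \<le> radial (P e) x"
          using radial_sum_ge[OF sb(1,2), of "1/2" x] radial_mono[OF star_body_sum[OF sb(1,2)] sb(3) mid, of x] by simp
        then have sd: "radial (P (e + s)) x + radial (P (e - s)) x - 2 * radial (P e) x \<le> 0" by simp
        have r: "0 < radial (P e) x" "radial (P e) x \<le> R" using betweenD(2,3)[OF bt[OF e(1,2)] x] d by auto
        have "J' R (radial (P e) x) \<le> 0"
          using phi_antimono[OF r] r unfolding J'_def by (intro mult_nonneg_nonpos) auto
        then show "- 0 \<le> J' R (radial (P e) x) * (radial (P (e + s)) x + radial (P (e - s)) x - 2 * radial (P e) x)"
          using sd by (simp add: mult_nonpos_nonpos)
      qed (auto simp: )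
      then show "\<exists>s0>0. \<forall>s. 0 < s \<and> s < s0 \<longrightarrow> s < e \<longrightarrow> e + s < a \<longrightarrow>
          loss R (P (e + s)) (P (e - s)) (P e) \<le> deficit R (P (e + s)) + deficit R (P (e - s)) - 2 * deficit R (P e) + \<eta> * s\<^sup>2"
        using e by (intro exI[of _ 1]) (auto intro: add_increasing2)
    qed
    moreover have "measure \<gamma> (K R e) = measure \<gamma> (P e)" if "0 < e" "e < a" for e
      unfolding P_def using that a by (intro support_ends_at_R[OF T] star_body_KR) auto
    ultimately show "l * root_measure e1 + (1 - l) * root_measure e2 \<le> root_measure (l * e1 + (1 - l) * e2)"
      using e combination_range[OF e l] by (simp add: root_measure_def)
  qed
qed

end

context perturbed_ball
begin

text \<open>Beyond R the sign of J' turns the concavity of the radial functions into a cost of at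
  most 2 C2 L s^2. As \<psi> is not identically 0, the squared displacement is at least c0 s^2, and
  L is small near R. With c = 2 C2 / c0 the margin in \<open>slope_constants\<close> covers the
  cost.\<close>

lemma near_concave_sloped:
  assumes pos: "0 < \<phi> R" and v: "0 < v"
    and le: "\<And>x. 0 < x \<Longrightarrow> x \<le> R \<Longrightarrow> \<phi> x \<le> \<phi> R * exp (v * (R - x))"
    and decay: "\<And>v'. 0 \<le> v' \<Longrightarrow> v' < v \<Longrightarrow>
      \<exists>y. 0 < y \<and> y < R \<and> (\<forall>s t. y \<le> s \<longrightarrow> s \<le> t \<longrightarrow> \<phi> t \<le> \<phi> s * exp (- v' * (t - s)))"
    and T: "R < T" "0 < \<phi> T" and x0: "norm x0 = 1" "\<psi> x0 \<noteq> 0"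
  shows near_concave
proof -
  obtain N T1 where N: "0 \<le> N" "R < T1"
    "\<And>s t. R / 2 \<le> s \<Longrightarrow> s \<le> t \<Longrightarrow> t \<le> T1 \<Longrightarrow> \<phi> s - \<phi> t \<le> N * (t - s)"
    using phi_Lipschitz[OF R_pos T] by metis
  define m where "m = \<bar>\<psi> x0\<bar> / 2"
  define W where "W = {x. norm x = 1 \<and> m < \<bar>\<psi> x\<bar>}"
  have m: "0 < m" "m < \<bar>\<psi> x0\<bar>" using x0 by (auto simp: m_def)
  have W [measurable]: "W \<in> sets borel"
    unfolding W_def by (intro sphere_superlevel_measurable continuous_intros psi_continuous)
  have Wpos: "0 < measure sphere_law W"
    unfolding W_def using x0(1) m by (intro sphere_law_superlevel_pos continuous_intros psi_continuous)
  define c0 where "c0 = (m / 2)\<^sup>2 * measure sphere_law W"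
  have c0: "0 < c0" using m Wpos by (simp add: c0_def)
  define c where "c = 2 * C2 / c0"
  have c: "0 \<le> c" using C2_pos c0 by (simp add: c_def)
  let ?good = "\<lambda>d \<tau> L. 0 < d \<and> d < T1 - R \<and> d < R \<and> 0 \<le> \<tau> \<and>
    (\<forall>r t. R - d \<le> r \<longrightarrow> r \<le> t \<longrightarrow> t \<le> R + d \<longrightarrow> \<tau> * (t - r) \<le> J' R t - J' R r) \<and>
    (\<forall>x. R - d \<le> x \<longrightarrow> x \<le> R + d \<longrightarrow> \<bar>J' R x\<bar> \<le> L) \<and>
    (1 - 1 / real n) / 2 * ((\<phi> R * \<omega> * (real n * (R + d) ^ (n - 1)))\<^sup>2 * (- J R R) / (\<phi> R * \<omega> * (R - d) ^ n * G (R - d))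
        + 2 * (\<phi> R * \<omega> * (real n * (R + d) ^ (n - 1))) * L / G (R - d)) + c * L \<le> \<tau> / 2"
  have "\<exists>d \<tau> L. ?good d \<tau> L"
  proof (rule slope_constants[OF R_pos pos v le decay N(1) _ _ c, where hi = "\<lambda>d. R + d"])
    show "0 < T1 - R" using N by simp
    show "R \<le> R + d \<and> R + d \<le> R + d \<and> \<phi> R - N * d \<le> \<phi> (R + d)" if "0 < d" "d < T1 - R" for d
      using N(3)[of R "R + d"] that R_pos by simp
  qed auto
  then obtain d \<tau> L where good: "?good d \<tau> L" by (elim exE)
  then have d: "0 < d" "d < R" "0 \<le> \<tau>"
    and const: "(1 - 1 / real n) / 2 * ((\<phi> R * \<omega> * (real n * (R + d) ^ (n - 1)))\<^sup>2 * (- J R R) / (\<phi> R * \<omega> * (R - d) ^ n * G (R - d))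
        + 2 * (\<phi> R * \<omega> * (real n * (R + d) ^ (n - 1))) * L / G (R - d)) + c * L \<le> \<tau> / 2"
    by blast+
  from good have \<tau>: "\<tau> * (t - r) \<le> J' R t - J' R r" if "R - d \<le> r" "r \<le> t" "t \<le> R + d" for r t
    using that by blast
  from good have L: "\<bar>J' R x\<bar> \<le> L" if "R - d \<le> x" "x \<le> R + d" for x
    using that by blast
  have L0: "0 \<le> L" using L[of R] d by fastforce
  \<comment> \<open>The last entry keeps the error 4 C2 e s of \<open>rho_increment\<close> below s
    m / 2. On W, where \<psi> exceeds m in modulus, the boundary then moves by at least s m /
    2.\<close>
  define a where "a = min (a0 / 2) (min (d / C) (m / (8 * C2)))"
  have a: "0 < a" "a \<le> a0" "a \<le> a0 / 2" "a * C \<le> d" "4 * C2 * a \<le> m / 2"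
  proof -
    show "0 < a" using d a0_pos C_ge m C2_pos by (auto simp: a_def)
    show "a \<le> a0 / 2" unfolding a_def by (rule min.cobounded1)
    then show "a \<le> a0" using a0_pos by simp
    have "a \<le> d / C" "a \<le> m / (8 * C2)" by (auto simp: a_def)
    then show "a * C \<le> d" "4 * C2 * a \<le> m / 2" using C_ge C2_pos by (auto simp: pos_le_divide_eq mult_ac)
  qed
  have bt: "between (R - d) (R + d) (K R e)" if "0 < e" "e < a" for e
    by (rule between_K[OF that a(2,4)])
  show ?thesis
  proof (rule near_concaveI[OF a(1,2)])
    fix e1 e2 l :: real assume e: "e1 \<in> {0<..<a}" "e2 \<in> {0<..<a}" and l: "0 \<le> l" "l \<le> 1"
    show "l * root_measure e1 + (1 - l) * root_measure e2 \<le> root_measure (l * e1 + (1 - l) * e2)"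
      unfolding root_measure_def
    proof (rule concave_root_of_family[of "R - d" R a "R + d" "K R" "4 * C", OF _ _ pos bt K_midpoint _ _ e l])
      show "0 < R - d" "R - d \<le> R" using d by auto
      show "\<bar>radial (K R (e + s)) x - radial (K R e) x\<bar> \<le> 4 * C * s" if es: "0 < e" "0 < s" "e + s < a" "norm x = 1" for e s x
        using rho_Lipschitz[of e s x] es a by (simp add: \<rho>_def)
      fix e \<eta> :: real assume e: "0 < e" "e < a" "0 < \<eta>"
      have "loss R (K R (e + s)) (K R (e - s)) (K R e) \<le> deficit R (K R (e + s)) + deficit R (K R (e - s)) - 2 * deficit R (K R e)"
        if s: "0 < s" "s < e" "e + s < a" for s
      proof (rule loss_le[OF _ _ bt[OF e(1,2)] _ _ _ pos \<tau> d(3) L _ _ const])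
        show bp: "between (R - d) (R + d) (K R (e + s))" "between (R - d) (R + d) (K R (e - s))" using bt s e by auto
        show "0 < R - d" "R - d \<le> R" "R \<le> R + d" using d by auto
        have sb: "star_body (K R (e + s))" "star_body (K R (e - s))" "star_body (K R e)"
          using betweenD(1)[OF bp(1)] betweenD(1)[OF bp(2)] betweenD(1)[OF bt[OF e(1,2)]] by auto
        have "(\<integral>x. indicator W x * (s * (m / 2))\<^sup>2 \<partial>sphere_law) \<le> l2 (K R (e + s)) (K R e)"
          unfolding l2_def
        proof (rule sphere_law_mono)
          show "integrable sphere_law (\<lambda>x. indicator W x * (s * (m / 2))\<^sup>2)"
            by (intro integrable_sphere_law_bounded[of _ "(s * (m / 2))\<^sup>2"]) (auto split: split_indicator)
          fix x :: "real ^ 'n" assume x: "norm x = 1"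
          show "indicator W x * (s * (m / 2))\<^sup>2 \<le> (radial (K R (e + s)) x - radial (K R e) x)\<^sup>2"
          proof (cases "x \<in> W")
            case True
            have i: "s * \<psi> x - 4 * C2 * e * s \<le> \<rho> (e + s) x - \<rho> e x" "\<rho> (e + s) x - \<rho> e x \<le> s * \<psi> x"
              using rho_increment(1,2)[of e s x] e s a x by auto
            have "4 * C2 * e * s \<le> (m / 2) * s"
            proof (rule mult_right_mono)
              have "4 * C2 * e \<le> 4 * C2 * a" using e C2_pos by simp
              then show "4 * C2 * e \<le> m / 2" using a by simp
            qed (use s in simp)
            moreover have "s * m < \<bar>s * \<psi> x\<bar>" using True s by (simp add: W_def abs_mult)
            moreover have "0 < s * m" using s m by simp
            ultimately have "s * (m / 2) \<le> \<bar>\<rho> (e + s) x - \<rho> e x\<bar>" using i by (simp add: abs_if mult.commute split: if_splits)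
            then have "(s * (m / 2))\<^sup>2 \<le> \<bar>\<rho> (e + s) x - \<rho> e x\<bar>\<^sup>2" using s m by (intro power_mono) auto
            then show ?thesis using True by (simp add: \<rho>_def)
          qed simp
        qed (use integrable_radial_diff(2)[OF sb(1,3)] in auto)
        also have "(\<integral>x. indicator W x * (s * (m / 2))\<^sup>2 \<partial>sphere_law) = c0 * s\<^sup>2"
          by (simp add: c0_def power_mult_distrib power_divide)
        finally have "c0 * s\<^sup>2 \<le> l2 (K R (e + s)) (K R e) + l2 (K R (e - s)) (K R e)"
          using l2_nonneg[of "K R (e - s)" "K R e"] by simp
        then have "c * L * (c0 * s\<^sup>2) \<le> c * L * (l2 (K R (e + s)) (K R e) + l2 (K R (e - s)) (K R e))"
          using c L0 by (intro mult_left_mono) auto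
        then show "L * (2 * C2 * s\<^sup>2) \<le> c * L * (l2 (K R (e + s)) (K R e) + l2 (K R (e - s)) (K R e))"
          using c0 by (simp add: c_def mult_ac)
        fix x :: "real ^ 'n" assume x: "norm x = 1"
        define sd where "sd = radial (K R (e + s)) x + radial (K R (e - s)) x - 2 * radial (K R e) x"
        have sd: "- (2 * C2 * s\<^sup>2) \<le> sd" "sd \<le> 0"
          using rho_second_difference[of e s x] e s a x by (auto simp: \<rho>_def sd_def)
        have J: "\<bar>J' R (radial (K R e) x)\<bar> \<le> L" using betweenD(2,3)[OF bt[OF e(1,2)] x] by (intro L)
        have "- (J' R (radial (K R e) x) * sd) \<le> \<bar>J' R (radial (K R e) x)\<bar> * \<bar>sd\<bar>"
          by (metis abs_ge_minus_self abs_mult)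
        also have "\<dots> \<le> L * (2 * C2 * s\<^sup>2)" using J sd by (intro mult_mono) auto
        finally show "- (L * (2 * C2 * s\<^sup>2)) \<le> J' R (radial (K R e) x) * (radial (K R (e + s)) x + radial (K R (e - s)) x - 2 * radial (K R e) x)"
          by (simp add: sd_def)
      qed
      then show "\<exists>s0>0. \<forall>s. 0 < s \<and> s < s0 \<longrightarrow> s < e \<longrightarrow> e + s < a \<longrightarrow>
          loss R (K R (e + s)) (K R (e - s)) (K R e) \<le> deficit R (K R (e + s)) + deficit R (K R (e - s)) - 2 * deficit R (K R e) + \<eta> * s\<^sup>2"
        using e by (intro exI[of _ 1]) (auto intro: add_increasing2)
    qed
  qed
qed

text \<open>If the density is constant on the ball of radius R but not beyond, then j lives outside that
  ball. There the density drops superlinearly, so the second variation of j dominates j and its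
  first variation, uniformly over the directions with \<psi> close to its maximum M.\<close>

lemma near_concave_kink:
  assumes pos: "0 < \<phi> R" and flat: "\<And>x. 0 < x \<Longrightarrow> x \<le> R \<Longrightarrow> \<phi> x = \<phi> R"
    and T: "R < T" "0 < \<phi> T" and M: "norm xM = 1" "0 < \<psi> xM" "\<And>x. norm x = 1 \<Longrightarrow> \<psi> x \<le> \<psi> xM"
  shows near_concave
proof -
  define M where "M = \<psi> xM"
  have M0: "0 < M" and psiM: "\<And>x. norm x = 1 \<Longrightarrow> \<psi> x \<le> M" using M by (auto simp: M_def)
  obtain N T1 where N: "0 \<le> N" "R < T1" "0 < \<phi> T1"
    "\<And>s t. R / 2 \<le> s \<Longrightarrow> s \<le> t \<Longrightarrow> t \<le> T1 \<Longrightarrow> \<phi> s - \<phi> t \<le> N * (t - s)"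
    using phi_Lipschitz[OF R_pos T] by metis
  \<comment> \<open>By the Lipschitz bound the last entry keeps \<phi> above \<phi>(R) / 2 up to
    radius R + d; N + 1 allows for N = 0.\<close>
  define d where "d = min (R / 2) (min (T1 - R) (\<phi> R / (2 * (N + 1))))"
  have d: "0 < d" "d \<le> R / 2" "R + d \<le> T1" "N * d \<le> \<phi> R / 2"
  proof -
    show "0 < d" using R_pos N pos by (auto simp: d_def)
    show "d \<le> R / 2" unfolding d_def by (rule min.cobounded1)
    have "d \<le> T1 - R" by (simp add: d_def)
    then show "R + d \<le> T1" by simp
    have "N * d \<le> (N + 1) * (\<phi> R / (2 * (N + 1)))" using N \<open>0 < d\<close> by (intro mult_mono) (auto simp: d_def)
    moreover have "x * (y / (2 * x)) = y / 2" if "0 < x" for x y :: real using that by simp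
    from this[of "N + 1" "\<phi> R"] have "(N + 1) * (\<phi> R / (2 * (N + 1))) = \<phi> R / 2" using N by simp
    ultimately show "N * d \<le> \<phi> R / 2" by (simp only:)
  qed
  define lo where "lo = R - d"
  define hi where "hi = R + d"
  have lh: "0 < lo" "lo \<le> R" "R \<le> hi" "R / 2 \<le> lo" "hi \<le> T1" "0 < hi" using d R_pos by (auto simp: lo_def hi_def)
  \<comment> \<open>The drop of the density beyond R. By flatness J' is n \<omega> x^(n-1) times
    this drop at every x > 0.\<close>
  define cc where "cc t = \<phi> R - \<phi> (max R t)" for t
  have cc0: "cc t = 0" if "t \<le> R" for t using that by (simp add: cc_def)
  have ccmono: "cc s \<le> cc t" if "s \<le> t" for s t
    using that R_pos by (auto simp: cc_def intro!: phi_antimono)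
  have ccnn: "0 \<le> cc t" for t using ccmono[of "min t R" t] cc0[of "min t R"] by simp
  have [measurable]: "cc \<in> borel_measurable borel"
    by (rule borel_measurable_mono) (auto intro!: monoI ccmono)
  have ccle: "cc t \<le> \<phi> R" for t using phi_nonneg[of "max R t"] R_pos by (simp add: cc_def)
  have cclip: "cc t \<le> cc s + N * (t - s)" if "s \<le> t" "t \<le> hi" for s t
  proof -
    have "\<phi> (max R s) - \<phi> (max R t) \<le> N * (max R t - max R s)"
      using that lh R_pos by (intro N) auto
    also have "\<dots> \<le> N * (t - s)" using that N by (intro mult_left_mono) auto
    finally show ?thesis by (simp add: cc_def)
  qed
  have J'cc: "J' R x = real n * \<omega> * x ^ (n - 1) * cc x" if "0 < x" for x
    using flat[of x] that by (cases "x \<le> R") (auto simp: J'_def cc_def)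
  \<comment> \<open>Convexity makes V rise beyond r at least at its mean rate over [R, r], and its
    rise there is at least cc(r) / \<phi>(R). The factor 1/2 comes from \<phi>(t) \<ge> \<phi>(R) /
    2.\<close>
  have superlinear: "cc r / (2 * (r - R)) * (t - r) \<le> cc t - cc r" if r: "R < r" "r \<le> t" "t \<le> hi" for r t
  proof -
    have p: "0 < \<phi> r" "0 < \<phi> t" using phi_antimono[of r T1] phi_antimono[of t T1] N(3) r lh R_pos by linarith+
    define k where "k = ln (\<phi> R / \<phi> r) / (r - R)"
    have rR: "\<phi> r \<le> \<phi> R" using r R_pos by (intro phi_antimono) auto
    have k: "0 \<le> k" using p rR r by (simp add: k_def)
    have "exp (- k * (r - R)) = \<phi> r / \<phi> R" using p pos r by (simp add: k_def exp_minus)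
    then have dec: "\<phi> r \<le> \<phi> R * exp (- k * (r - R))" using pos by simp
    have "\<phi> t \<le> \<phi> r * exp (- k * (t - r))" by (rule phi_decay[OF R_pos r(1) dec order_refl r(2)])
    then have "\<phi> t * exp (k * (t - r)) \<le> \<phi> r * exp (- k * (t - r)) * exp (k * (t - r))" by (intro mult_right_mono) auto
    then have "\<phi> t * exp (k * (t - r)) \<le> \<phi> r" by (simp add: mult.assoc flip: exp_add)
    moreover have "\<phi> t * (1 + k * (t - r)) \<le> \<phi> t * exp (k * (t - r))"
      using p by (intro mult_left_mono exp_ge_add_one_self) auto
    ultimately have 1: "\<phi> t * (k * (t - r)) \<le> \<phi> r - \<phi> t" by (simp add: distrib_left)
    have "\<phi> R - \<phi> t \<le> N * (t - R)" using r lh R_pos by (intro N) auto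
    also have "\<dots> \<le> N * d" using r N by (intro mult_left_mono) (auto simp: hi_def)
    finally have ht: "\<phi> R / 2 \<le> \<phi> t" using d by simp
    have "ln (\<phi> r / \<phi> R) \<le> \<phi> r / \<phi> R - 1" using p pos by (intro ln_le_minus_one) simp
    then have "cc r / \<phi> R \<le> ln (\<phi> R / \<phi> r)" using p pos r by (simp add: cc_def ln_div diff_divide_distrib)
    then have "cc r / \<phi> R / (r - R) \<le> k" unfolding k_def using r by (intro divide_right_mono) auto
    then have h2: "cc r / \<phi> R / (r - R) * (t - r) \<le> k * (t - r)" using r by (intro mult_right_mono) auto
    have "\<phi> R / 2 * (cc r / \<phi> R / (r - R) * (t - r)) \<le> \<phi> t * (k * (t - r))"
      by (rule mult_mono[OF ht h2]) (use p pos r ccnn[of r] in auto)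
    moreover have "\<phi> R / 2 * (cc r / \<phi> R / (r - R) * (t - r)) = cc r / (2 * (r - R)) * (t - r)" using pos r by simp
    ultimately have "cc r / (2 * (r - R)) * (t - r) \<le> \<phi> r - \<phi> t" using 1 by linarith
    then show ?thesis using r by (simp add: cc_def max_def)
  qed
  define q where "q = real n * \<omega> * hi ^ (n - 1)"
  have q: "0 < q" using lh by (simp add: q_def)
  have J'mono: "J' R x \<le> J' R y" if "lo \<le> x" "x \<le> y" for x y
    using that lh J'cc[of x] J'cc[of y] ccmono[of x y] ccnn by (simp add: mult_mono power_mono)
  have J'le: "\<bar>J' R x\<bar> \<le> q * cc x" if "lo \<le> x" "x \<le> hi" for x
    using that lh J'cc[of x] ccnn[of x] by (simp add: q_def abs_mult mult_mono power_mono)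
  have Jlin: "J' R r * (t - r) \<le> J R t - J R r" if "lo \<le> r" "lo \<le> t" for r t
    using J_quadratic_lower[of r t R 0] J'mono that lh by simp
  define B where "B = 4 * C"
  have B: "0 < B" using C_ge by (simp add: B_def)
  \<comment> \<open>Outside U the radius is at most R + e M / 2. On W it is at least that, even
    after the error C2 e^2 \<le> e M / 16. So the drop integrated over W pays for the complement of
    U.\<close>
  define W where "W = {x. norm x = 1 \<and> 3 * M / 4 < \<psi> x}"
  define U where "U = {x. norm x = 1 \<and> M / 2 < \<psi> x}"
  have U [measurable]: "U \<in> sets borel" and W [measurable]: "W \<in> sets borel"
    unfolding U_def W_def by (intro sphere_superlevel_measurable psi_continuous)+
  have Wpos: "0 < measure sphere_law W"
    unfolding W_def using M(1) M0 by (intro sphere_law_superlevel_pos[of _ xM] psi_continuous) (auto simp: M_def)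
  \<comment> \<open>The 64 collects the slope cc / (2 e M), the factor 1/2 of the quadratic term and
    the squared displacement (s M / 4)^2.\<close>
  define k1 where "k1 = real n * \<omega> * R ^ (n - 1) * M / 64"
  define k2 where "k2 = q * (2 * C2)"
  define k3 where "k3 = 1 + 1 / measure sphere_law W"
  define k4 where "k4 = q * B"
  define k5 where "k5 = \<phi> R * \<omega> * (real n * hi ^ (n - 1)) * B"
  define k6 where "k6 = 2 * k5 * k4 / G lo"
  have Glo: "0 < G lo" using lh phi_antimono[of lo R] pos by (intro G_pos) auto
  have ks: "0 < k1" "0 < k2" "0 < k3" "0 < k4" "0 < k5" "0 < k6"
  proof -
    show "0 < k1" using R_pos M0 by (simp add: k1_def)
    show "0 < k2" using q C2_pos by (simp add: k2_def)
    show "0 < k3" using Wpos by (simp add: k3_def add_pos_pos)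
    show k4: "0 < k4" using q B by (simp add: k4_def)
    show k5: "0 < k5" using pos lh B by (simp add: k5_def)
    show "0 < k6" using k4 k5 Glo by (simp add: k6_def)
  qed
  \<comment> \<open>The last entry lets the gain k1 / e exceed (k6 + k2) k3, the total loss once the
    mean drop over the sphere is bounded by the mean over U.\<close>
  define a where "a = min (min (a0 / 2) (d / C)) (min (M / (16 * C2)) (k1 / ((k6 + k2) * k3)))"
  have a: "0 < a" "a \<le> a0" "a \<le> a0 / 2" "a * C \<le> d" "4 * C2 * a \<le> M / 4" "a * ((k6 + k2) * k3) \<le> k1"
  proof -
    have kk: "0 < (k6 + k2) * k3" using ks by simp
    show "0 < a" using d a0_pos C_ge M0 C2_pos ks kk by (auto simp: a_def)
    show "a \<le> a0 / 2" unfolding a_def by (rule min.coboundedI1[OF min.cobounded1])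
    then show "a \<le> a0" using a0_pos by simp
    have "a \<le> d / C" "a \<le> M / (16 * C2)" "a \<le> k1 / ((k6 + k2) * k3)" by (auto simp: a_def)
    then show "a * C \<le> d" "4 * C2 * a \<le> M / 4" "a * ((k6 + k2) * k3) \<le> k1"
      using C_ge C2_pos kk by (auto simp: pos_le_divide_eq mult_ac)
  qed
  have bt: "between lo hi (K R e)" if "0 < e" "e < a" for e
    unfolding lo_def hi_def by (rule between_K[OF that a(2,4)])
  have JR: "J R R = 0" using flat by (intro flat_J_eq_0[OF pos _ R_pos order_refl])
  show ?thesis
  proof (rule near_concaveI[OF a(1,2)])
    fix e1 e2 l :: real assume e12: "e1 \<in> {0<..<a}" "e2 \<in> {0<..<a}" and l: "0 \<le> l" "l \<le> 1"
    show "l * root_measure e1 + (1 - l) * root_measure e2 \<le> root_measure (l * e1 + (1 - l) * e2)"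
      unfolding root_measure_def
    proof (rule concave_root_of_family[of lo R a hi "K R" B, OF lh(1,2) pos bt K_midpoint _ _ e12 l])
      show lip: "\<bar>radial (K R (e + s)) x - radial (K R e) x\<bar> \<le> B * s" if es: "0 < e" "0 < s" "e + s < a" "norm x = 1" for e s x
        using rho_Lipschitz[of e s x] es a by (simp add: \<rho>_def B_def)
      fix e \<eta> :: real assume e: "0 < e" "e < a" and \<eta>: "0 < \<eta>"
      define r0 where "r0 = radial (K R e)"
      have sb0: "star_body (K R e)" by (rule betweenD(1)[OF bt[OF e]])
      have [measurable]: "r0 \<in> borel_measurable borel" unfolding r0_def by (rule borel_measurable_radial[OF sb0])
      have r0: "lo \<le> r0 x" "r0 x \<le> hi" if "norm x = 1" for x using betweenD(2,3)[OF bt[OF e] that] by (auto simp: r0_def)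
      have r0up: "r0 x \<le> R + e * \<psi> x" if "norm x = 1" for x using rho_le[of e x] that e a by (simp add: \<rho>_def r0_def)
      have r0lo: "R + e * \<psi> x - C2 * e\<^sup>2 \<le> r0 x" if "norm x = 1" for x using rho_ge[of e x] that e a by (simp add: \<rho>_def r0_def)
      have C2e: "C2 * e\<^sup>2 \<le> e * (M / 16)"
      proof -
        have "4 * C2 * e \<le> 4 * C2 * a" using e C2_pos by simp
        then have "C2 * e \<le> M / 16" using a by simp
        then have "e * (C2 * e) \<le> e * (M / 16)" using e by (intro mult_left_mono) auto
        then show ?thesis by (simp add: power2_eq_square mult_ac)
      qed
      define I where "I = (\<integral>x. indicator U x * cc (r0 x) \<partial>sphere_law)"
      define Iall where "Iall = (\<integral>x. cc (r0 x) \<partial>sphere_law)"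
      have int1: "integrable sphere_law (\<lambda>x. indicator U x * cc (r0 x))"
        by (intro integrable_sphere_law_bounded[of _ "\<phi> R"]) (auto split: split_indicator simp: ccnn ccle pos less_imp_le)
      have int2: "integrable sphere_law (\<lambda>x. cc (r0 x))"
        by (intro integrable_sphere_law_bounded[of _ "\<phi> R"]) (auto simp: ccnn ccle)
      have I0: "0 \<le> I" unfolding I_def by (intro integral_nonneg_AE) (auto simp: ccnn split: split_indicator)
      have Iall0: "0 \<le> Iall" unfolding Iall_def by (intro integral_nonneg_AE) (auto simp: ccnn)
      have Iall: "Iall \<le> k3 * I"
      proof -
        define c where "c = cc (R + e * M / 2)"
        have "(\<integral>x. indicator W x * c \<partial>sphere_law) \<le> I"
          unfolding I_def
        proof (rule sphere_law_mono[OF _ int1])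
          show "integrable sphere_law (\<lambda>x. indicator W x * c)"
            by (intro integrable_sphere_law_bounded[of _ "\<bar>c\<bar>"]) (auto split: split_indicator)
          fix x :: "real ^ 'n" assume x: "norm x = 1"
          show "indicator W x * c \<le> indicator U x * cc (r0 x)"
          proof (cases "x \<in> W")
            case True
            then have p: "3 * M / 4 < \<psi> x" by (simp add: W_def)
            then have "e * (3 * M / 4) \<le> e * \<psi> x" using e by (intro mult_left_mono) auto
            moreover have "0 \<le> e * M" using e M0 by simp
            ultimately have "R + e * M / 2 \<le> r0 x" using r0lo[OF x] C2e by (simp add: mult_ac)
            moreover have "x \<in> U" using p x M0 by (simp add: U_def)
            ultimately show ?thesis using True by (simp add: c_def ccmono)
          qed (auto split: split_indicator simp: ccnn)
        qed
        then have cW: "measure sphere_law W * c \<le> I" by simp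
        have "Iall \<le> (\<integral>x. indicator U x * cc (r0 x) + c \<partial>sphere_law)"
          unfolding Iall_def
        proof (rule sphere_law_mono[OF int2])
          fix x :: "real ^ 'n" assume x: "norm x = 1"
          show "cc (r0 x) \<le> indicator U x * cc (r0 x) + c"
          proof (cases "x \<in> U")
            case False
            then have "\<psi> x \<le> M / 2" using x by (simp add: U_def)
            then have "e * \<psi> x \<le> e * (M / 2)" using e by (intro mult_left_mono) auto
            then show ?thesis using False r0up[OF x] by (auto simp: c_def intro!: ccmono)
          qed (simp add: c_def ccnn)
        qed (use int1 in auto)
        also have "\<dots> = I + c" using int1 by (simp add: I_def)
        also have "\<dots> \<le> I + I / measure sphere_law W" using cW Wpos by (simp add: pos_le_divide_eq mult.commute)
        finally show ?thesis by (simp add: k3_def distrib_right)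
      qed
      \<comment> \<open>The first variation of j sees the drop at radii larger by up to B s, an
        excess of at most N B s. For s below s0 this excess costs at most \<eta> s^2.\<close>
      define s0 where "s0 = \<eta> / (k6 * N * B + 1)"
      have s0: "0 < s0" using \<eta> ks N B by (simp add: s0_def add_nonneg_pos)
      have "loss R (K R (e + s)) (K R (e - s)) (K R e) \<le> deficit R (K R (e + s)) + deficit R (K R (e - s)) - 2 * deficit R (K R e) + \<eta> * s\<^sup>2"
        if s: "0 < s" "s < s0" "s < e" "e + s < a" for s
      proof -
        define r1 where "r1 = radial (K R (e + s))"
        define r2 where "r2 = radial (K R (e - s))"
        have bp: "between lo hi (K R (e + s))" "between lo hi (K R (e - s))" using bt s e by auto
        have sb: "star_body (K R (e + s))" "star_body (K R (e - s))" using betweenD(1) bp by blast+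
        have r1: "lo \<le> r1 x" "r1 x \<le> hi" if "norm x = 1" for x using betweenD(2,3)[OF bp(1) that] by (auto simp: r1_def)
        have r2: "lo \<le> r2 x" "r2 x \<le> hi" if "norm x = 1" for x using betweenD(2,3)[OF bp(2) that] by (auto simp: r2_def)
        have lip1: "\<bar>r1 x - r0 x\<bar> \<le> B * s" if "norm x = 1" for x using lip[of e s x] e s that by (simp add: r1_def r0_def)
        have lip2: "\<bar>r2 x - r0 x\<bar> \<le> B * s" if "norm x = 1" for x
          using lip[of "e - s" s x] e s that by (simp add: r2_def r0_def abs_minus_commute)
        note intJ = integrable_J_radial[OF sb(1), of R] integrable_J_radial[OF sb(2), of R] integrable_J_radial[OF sb0, of R]
        have gain: "s\<^sup>2 * (k1 / e * I - k2 * Iall) \<le> deficit R (K R (e + s)) + deficit R (K R (e - s)) - 2 * deficit R (K R e)"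
        proof -
          have "(\<integral>x. s\<^sup>2 * (k1 / e * (indicator U x * cc (r0 x)) - k2 * cc (r0 x)) \<partial>sphere_law)
              \<le> (\<integral>x. J R (r1 x) + J R (r2 x) - 2 * J R (r0 x) \<partial>sphere_law)"
          proof (rule sphere_law_mono)
            show "integrable sphere_law (\<lambda>x. s\<^sup>2 * (k1 / e * (indicator U x * cc (r0 x)) - k2 * cc (r0 x)))"
              using int1 int2 by auto
            show "integrable sphere_law (\<lambda>x. J R (r1 x) + J R (r2 x) - 2 * J R (r0 x))"
              using intJ by (simp add: r0_def r1_def r2_def)
            fix x :: "real ^ 'n" assume x: "norm x = 1"
            have sd: "- (2 * C2 * s\<^sup>2) \<le> r1 x + r2 x - 2 * r0 x" "r1 x + r2 x - 2 * r0 x \<le> 0"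
              using rho_second_difference[of e s x] e s a x by (auto simp: \<rho>_def r0_def r1_def r2_def)
            have J'0: "0 \<le> J' R (r0 x)" "J' R (r0 x) \<le> q * cc (r0 x)"
              using J'le[OF r0[OF x]] J'cc[of "r0 x"] r0[OF x] lh ccnn by auto
            have cross: "- (k2 * cc (r0 x)) * s\<^sup>2 \<le> J' R (r0 x) * (r1 x + r2 x - 2 * r0 x)"
            proof -
              have "J' R (r0 x) * (- (r1 x + r2 x - 2 * r0 x)) \<le> (q * cc (r0 x)) * (2 * C2 * s\<^sup>2)"
                using J'0 sd q ccnn by (intro mult_mono) auto
              moreover have "J' R (r0 x) * (- (r1 x + r2 x - 2 * r0 x)) = - (J' R (r0 x) * (r1 x + r2 x - 2 * r0 x))" by (rule mult_minus_right)
              moreover have "(q * cc (r0 x)) * (2 * C2 * s\<^sup>2) = k2 * cc (r0 x) * s\<^sup>2" by (simp add: k2_def)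
              ultimately show ?thesis by simp
            qed
            have J2: "J' R (r0 x) * (r2 x - r0 x) \<le> J R (r2 x) - J R (r0 x)" using Jlin r0[OF x] r2[OF x] by blast
            \<comment> \<open>The quadratic term is credited only to directions in U, which move
              outward from a radius already beyond R; elsewhere monotonicity of J' suffices.\<close>
            have J1: "J' R (r0 x) * (r1 x - r0 x) + k1 / e * (indicator U x * cc (r0 x)) * s\<^sup>2 \<le> J R (r1 x) - J R (r0 x)"
            proof (cases "x \<in> U")
              case False
              then show ?thesis using Jlin r0[OF x] r1[OF x] by simp
            next
              case True
              then have p: "M / 2 < \<psi> x" by (simp add: U_def)
              have "e * (M / 2) \<le> e * \<psi> x" using p e by (intro mult_left_mono) auto
              moreover have "0 < e * M" using e M0 by simp
              ultimately have rR: "R < r0 x" using r0lo[OF x] C2e by (simp add: mult_ac)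
              have "e * \<psi> x \<le> e * M" using psiM[OF x] e by (intro mult_left_mono) auto
              then have rM: "r0 x - R \<le> e * M" using r0up[OF x] by simp
              have inc: "s * (M / 4) \<le> r1 x - r0 x"
              proof -
                have "s * \<psi> x - 4 * C2 * e * s \<le> r1 x - r0 x"
                  using rho_increment(1)[of e s x] e s a x by (simp add: \<rho>_def r0_def r1_def)
                moreover have "4 * C2 * e * s \<le> M / 4 * s"
                proof (rule mult_right_mono)
                  have "4 * C2 * e \<le> 4 * C2 * a" using e C2_pos by simp
                  then show "4 * C2 * e \<le> M / 4" using a by simp
                qed (use s in simp)
                moreover have "s * (M / 2) \<le> s * \<psi> x" using p s by (intro mult_left_mono) auto
                ultimately show ?thesis by (simp add: mult_ac)
              qed
              then have r10: "r0 x \<le> r1 x" using s M0 by (smt (verit) mult_pos_pos divide_pos_pos)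
              define dd where "dd = real n * \<omega> * R ^ (n - 1) * (cc (r0 x) / (2 * (r0 x - R)))"
              have dd0: "0 \<le> dd" using rR R_pos ccnn by (simp add: dd_def)
              have "J' R (r0 x) * (r1 x - r0 x) + dd / 2 * (r1 x - r0 x)\<^sup>2 \<le> J R (r1 x) - J R (r0 x)"
              proof (rule J_quadratic_lower)
                show "0 < r0 x" "0 < r1 x" using r0[OF x] r1[OF x] lh by auto
                show "J' R y \<le> J' R (r0 x) + dd * (y - r0 x)" if "r1 x \<le> y" "y \<le> r0 x" for y
                proof -
                  have "y = r0 x" using that r10 by linarith
                  then show ?thesis by simp
                qed
                fix y assume y: "r0 x \<le> y" "y \<le> r1 x"
                have y0: "0 < y" "0 < r0 x" "y \<le> hi" using y rR R_pos r1[OF x] by auto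
                have "dd * (y - r0 x) \<le> real n * \<omega> * R ^ (n - 1) * (cc y - cc (r0 x))"
                  unfolding dd_def using superlinear[OF rR y(1) y0(3)] R_pos
                  by (simp only: mult.assoc) (intro mult_left_mono, auto)
                also have "\<dots> \<le> real n * \<omega> * y ^ (n - 1) * (cc y - cc (r0 x))"
                  using ccmono[OF y(1)] y rR R_pos by (intro mult_right_mono mult_left_mono power_mono) auto
                also have "\<dots> \<le> real n * \<omega> * y ^ (n - 1) * cc y - real n * \<omega> * r0 x ^ (n - 1) * cc (r0 x)"
                proof -
                  have "real n * \<omega> * r0 x ^ (n - 1) * cc (r0 x) \<le> real n * \<omega> * y ^ (n - 1) * cc (r0 x)"
                    using y y0 ccnn by (intro mult_right_mono mult_left_mono power_mono) auto
                  then show ?thesis by (simp add: right_diff_distrib)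
                qed
                finally show "J' R (r0 x) + dd * (y - r0 x) \<le> J' R y"
                  using J'cc[OF y0(1)] J'cc[OF y0(2)] by simp
              qed
              moreover have "k1 / e * cc (r0 x) * s\<^sup>2 \<le> dd / 2 * (r1 x - r0 x)\<^sup>2"
              proof -
                have "k1 / e * cc (r0 x) * s\<^sup>2 = real n * \<omega> * R ^ (n - 1) * (cc (r0 x) / (2 * (e * M))) / 2 * (s * (M / 4))\<^sup>2"
                  using e M0 by (simp add: k1_def power2_eq_square field_simps)
                also have "\<dots> \<le> dd / 2 * (r1 x - r0 x)\<^sup>2"
                proof (rule mult_mono)
                  have "cc (r0 x) / (2 * (e * M)) \<le> cc (r0 x) / (2 * (r0 x - R))"
                    using rM rR ccnn e M0 by (intro divide_left_mono) auto
                  then show "real n * \<omega> * R ^ (n - 1) * (cc (r0 x) / (2 * (e * M))) / 2 \<le> dd / 2"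
                    unfolding dd_def using R_pos by (intro divide_right_mono mult_left_mono) auto
                  show "(s * (M / 4))\<^sup>2 \<le> (r1 x - r0 x)\<^sup>2" using inc s M0 by (intro power_mono) auto
                qed (use dd0 in auto)
                finally show ?thesis .
              qed
              moreover have "indicator U x = (1 :: real)" using True by simp
              ultimately show ?thesis by (simp only: mult_1_left)
            qed
            have "s\<^sup>2 * (k1 / e * (indicator U x * cc (r0 x)) - k2 * cc (r0 x))
                = k1 / e * (indicator U x * cc (r0 x)) * s\<^sup>2 + - (k2 * cc (r0 x)) * s\<^sup>2" by (simp add: algebra_simps)
            also have "\<dots> \<le> k1 / e * (indicator U x * cc (r0 x)) * s\<^sup>2 + J' R (r0 x) * (r1 x + r2 x - 2 * r0 x)"
              using cross by simp
            also have "\<dots> = (J' R (r0 x) * (r1 x - r0 x) + k1 / e * (indicator U x * cc (r0 x)) * s\<^sup>2) + J' R (r0 x) * (r2 x - r0 x)"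
              by (simp add: algebra_simps)
            also have "\<dots> \<le> (J R (r1 x) - J R (r0 x)) + (J R (r2 x) - J R (r0 x))" using J1 J2 by (rule add_mono)
            finally show "s\<^sup>2 * (k1 / e * (indicator U x * cc (r0 x)) - k2 * cc (r0 x)) \<le> J R (r1 x) + J R (r2 x) - 2 * J R (r0 x)"
              by simp
          qed
          then show ?thesis
            using int1 int2 intJ by (simp add: I_def Iall_def deficit_def r0_def r1_def r2_def)
        qed
        \<comment> \<open>A plain Lipschitz bound on j would be too weak. Bounding J' by the drop at
          the larger of the two radii makes the loss linear in the drop, like the gain.\<close>
        have jb: "\<bar>deficit R A - deficit R (K R e)\<bar> \<le> k4 * s * (Iall + N * B * s)"
          if A: "between lo hi A" and lipA: "\<And>x. norm x = 1 \<Longrightarrow> \<bar>radial A x - r0 x\<bar> \<le> B * s" for A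
        proof -
          note intA = integrable_J_radial[OF betweenD(1)[OF A], of R]
          have "\<bar>deficit R A - deficit R (K R e)\<bar> = \<bar>\<integral>x. J R (radial A x) - J R (r0 x) \<partial>sphere_law\<bar>"
            using intA intJ by (simp add: deficit_def r0_def)
          also have "\<dots> \<le> (\<integral>x. \<bar>J R (radial A x) - J R (r0 x)\<bar> \<partial>sphere_law)" by (rule integral_abs_bound)
          also have "\<dots> \<le> (\<integral>x. k4 * s * (cc (r0 x) + N * B * s) \<partial>sphere_law)"
          proof (rule sphere_law_mono)
            show "integrable sphere_law (\<lambda>x. \<bar>J R (radial A x) - J R (r0 x)\<bar>)" using intA intJ by (simp add: r0_def)
            show "integrable sphere_law (\<lambda>x. k4 * s * (cc (r0 x) + N * B * s))" using int2 by auto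
            fix x :: "real ^ 'n" assume x: "norm x = 1"
            define mx where "mx = max (radial A x) (r0 x)"
            have mx: "lo \<le> mx" "mx \<le> hi" using r0[OF x] betweenD(2,3)[OF A x] by (auto simp: mx_def)
            have "\<bar>J R (radial A x) - J R (r0 x)\<bar> \<le> (q * cc mx) * \<bar>radial A x - r0 x\<bar>"
            proof (rule J_Lipschitz[OF lh(1)])
              show "\<bar>J' R y\<bar> \<le> q * cc mx" if "lo \<le> y" "y \<le> mx" for y
              proof -
                have "\<bar>J' R y\<bar> \<le> q * cc y" using that mx by (intro J'le) auto
                also have "\<dots> \<le> q * cc mx" using ccmono[OF that(2)] q by (intro mult_left_mono) auto
                finally show ?thesis .
              qed
            qed (use r0[OF x] betweenD(2,3)[OF A x] in \<open>auto simp: mx_def\<close>)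
            also have "\<dots> \<le> (q * (cc (r0 x) + N * B * s)) * (B * s)"
            proof (rule mult_mono)
              have "cc mx \<le> cc (r0 x) + N * (mx - r0 x)" using mx by (intro cclip) (auto simp: mx_def)
              also have "N * (mx - r0 x) \<le> N * (B * s)" using lipA[OF x] N B s by (intro mult_left_mono) (auto simp: mx_def max_def)
              finally show "q * cc mx \<le> q * (cc (r0 x) + N * B * s)" using q by (simp add: mult.assoc)
            qed (use lipA[OF x] q N B s ccnn in auto)
            also have "\<dots> = k4 * s * (cc (r0 x) + N * B * s)" by (simp add: k4_def)
            finally show "\<bar>J R (radial A x) - J R (r0 x)\<bar> \<le> k4 * s * (cc (r0 x) + N * B * s)" .
          qed
          also have "\<dots> = k4 * s * (Iall + N * B * s)" using int2 by (simp add: Iall_def)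
          finally show ?thesis .
        qed
        have xb: "\<bar>volume_part R A - volume_part R (K R e)\<bar> \<le> k5 * s"
          if A: "between lo hi A" and lipA: "\<And>x. norm x = 1 \<Longrightarrow> \<bar>radial A x - r0 x\<bar> \<le> B * s" for A
        proof -
          have "\<bar>volume_part R A - volume_part R (K R e)\<bar> \<le> \<phi> R * \<omega> * (real n * hi ^ (n - 1)) * l1 A (K R e)"
            by (rule volume_part_diff[OF A bt[OF e] lh(1) R_pos])
          also have "\<dots> \<le> \<phi> R * \<omega> * (real n * hi ^ (n - 1)) * (B * s)"
            using l1_le[OF betweenD(1)[OF A] sb0] lipA pos lh by (intro mult_left_mono) (auto simp: r0_def)
          finally show ?thesis by (simp add: k5_def mult_ac)
        qed
        define x1 where "x1 = volume_part R (K R (e + s)) - volume_part R (K R e)"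
        define x2 where "x2 = volume_part R (K R (e - s)) - volume_part R (K R e)"
        define y1 where "y1 = deficit R (K R (e + s)) - deficit R (K R e)"
        define y2 where "y2 = deficit R (K R (e - s)) - deficit R (K R e)"
        define Y where "Y = k4 * s * (Iall + N * B * s)"
        have Y0: "0 \<le> Y" using ks s Iall0 N B by (simp add: Y_def)
        have b: "\<bar>x1\<bar> \<le> k5 * s" "\<bar>x2\<bar> \<le> k5 * s" "\<bar>y1\<bar> \<le> Y" "\<bar>y2\<bar> \<le> Y"
          unfolding x1_def x2_def y1_def y2_def Y_def
          using xb[OF bp(1)] xb[OF bp(2)] jb[OF bp(1)] jb[OF bp(2)] lip1 lip2 by (auto simp: r1_def r2_def)
        have xy: "x * y \<le> k5 * s * Y" if "\<bar>x\<bar> \<le> k5 * s" "\<bar>y\<bar> \<le> Y" for x y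
        proof -
          have "x * y \<le> \<bar>x\<bar> * \<bar>y\<bar>" by (metis abs_ge_self abs_mult)
          also have "\<dots> \<le> k5 * s * Y" using that by (intro mult_mono) auto
          finally show ?thesis .
        qed
        define mm where "mm = measure \<gamma> (K R e)"
        have mm: "G lo \<le> mm" unfolding mm_def by (rule measure_between_ge[OF bt[OF e]])
        \<comment> \<open>The deficit is nonnegative here, so the term of \<open>loss\<close> with -
          j(e) has the favourable sign and only the mixed terms remain.\<close>
        have deficit0: "0 \<le> deficit R (K R e)"
        proof -
          have "(\<integral>x. 0 \<partial>(sphere_law :: (real ^ 'n) measure)) \<le> deficit R (K R e)"
            unfolding deficit_def
          proof (rule sphere_law_mono)
            fix x :: "real ^ 'n" assume x: "norm x = 1"
            have "J' R R = 0" by (simp add: J'_def)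
            then show "0 \<le> J R (radial (K R e) x)"
              using Jlin[of R "r0 x"] r0[OF x] lh JR by (simp add: r0_def)
          qed (use intJ in auto)
          then show ?thesis by simp
        qed
        have volume_part0: "0 \<le> volume_part R (K R e)" using star_volume_pos[OF sb0] pos by (simp add: volume_part_def)
        have "loss R (K R (e + s)) (K R (e - s)) (K R e) = (1 - 1 / real n) / 2 *
            ((x1\<^sup>2 + x2\<^sup>2) * (- deficit R (K R e)) / (volume_part R (K R e) * mm) + 2 * (x1 * y1 + x2 * y2) / mm)"
          by (simp add: loss_def x1_def x2_def y1_def y2_def mm_def)
        also have "\<dots> \<le> (1 - 1 / real n) / 2 * (0 + 2 * (k5 * s * Y + k5 * s * Y) / G lo)"
        proof (rule mult_left_mono[OF add_mono])
          show "(x1\<^sup>2 + x2\<^sup>2) * (- deficit R (K R e)) / (volume_part R (K R e) * mm) \<le> 0"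
            using deficit0 volume_part0 mm Glo by (intro divide_nonpos_nonneg mult_nonneg_nonpos) auto
          have "2 * (x1 * y1 + x2 * y2) / mm \<le> 2 * (k5 * s * Y + k5 * s * Y) / mm"
            using xy[OF b(1,3)] xy[OF b(2,4)] mm Glo by (intro divide_right_mono mult_left_mono add_mono) auto
          also have "\<dots> \<le> 2 * (k5 * s * Y + k5 * s * Y) / G lo"
            using mm Glo Y0 ks s by (intro divide_left_mono) auto
          finally show "2 * (x1 * y1 + x2 * y2) / mm \<le> 2 * (k5 * s * Y + k5 * s * Y) / G lo" .
          show "0 \<le> (1 - 1 / real n) / 2" using dim by simp
        qed
        also have "\<dots> \<le> 1 / 2 * (2 * (k5 * s * Y + k5 * s * Y) / G lo)"
          using Y0 ks s Glo by (intro mult_mono) auto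
        also have "\<dots> = k6 * (s * (s * (Iall + N * B * s)))"
          by (simp add: k6_def Y_def)
        also have "\<dots> = s\<^sup>2 * (k6 * Iall + k6 * N * B * s)"
          by (simp add: power2_eq_square algebra_simps)
        also have "\<dots> \<le> s\<^sup>2 * (k1 / e * I - k2 * Iall + \<eta>)"
        proof (rule mult_left_mono)
          have "k6 * N * B * s \<le> (k6 * N * B + 1) * s0" using s ks N B by (intro mult_mono) auto
          also have "\<dots> = \<eta>"
          proof -
            have "0 < k6 * N * B + 1" using ks N B by (simp add: add_nonneg_pos)
            then show ?thesis by (simp add: s0_def)
          qed
          finally have 1: "k6 * N * B * s \<le> \<eta>" .
          have "(k6 + k2) * Iall \<le> (k6 + k2) * (k3 * I)" using Iall ks by (intro mult_left_mono) auto
          also have "\<dots> = (k6 + k2) * k3 * I" by simp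
          also have "\<dots> \<le> k1 / e * I"
          proof (rule mult_right_mono[OF _ I0])
            have "e * ((k6 + k2) * k3) \<le> a * ((k6 + k2) * k3)" using e ks by (intro mult_right_mono) auto
            also have "\<dots> \<le> k1" by (rule a(6))
            finally show "(k6 + k2) * k3 \<le> k1 / e" using e by (simp add: pos_le_divide_eq mult.commute)
          qed
          finally show "k6 * Iall + k6 * N * B * s \<le> k1 / e * I - k2 * Iall + \<eta>"
            using 1 by (simp add: distrib_right)
        qed simp
        also have "\<dots> = s\<^sup>2 * (k1 / e * I - k2 * Iall) + \<eta> * s\<^sup>2" by (simp add: algebra_simps)
        finally show ?thesis using gain by linarith
      qed
      then show "\<exists>s0>0. \<forall>s. 0 < s \<and> s < s0 \<longrightarrow> s < e \<longrightarrow> e + s < a \<longrightarrow>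
          loss R (K R (e + s)) (K R (e - s)) (K R e) \<le> deficit R (K R (e + s)) + deficit R (K R (e - s)) - 2 * deficit R (K R e) + \<eta> * s\<^sup>2"
        using s0 by blast
    qed
  qed
qed

text \<open>The strict estimates need a direction in which \<psi> is positive (v = 0) or nonzero (v
  > 0). Otherwise the bodies lie in the ball on which the measure is flat, respectively they all
  coincide.\<close>

lemma near_concave: near_concave
proof (cases "steep_at R")
  case True
  then show ?thesis by (rule near_concave_steep)
next
  case False
  have pos: "0 < \<phi> R" by (rule not_steep_pos[OF R_pos False])
  obtain v where v: "0 \<le> v" "\<And>x. 0 < x \<Longrightarrow> x \<le> R \<Longrightarrow> \<phi> x \<le> \<phi> R * exp (v * (R - x))"
    "\<And>v'. 0 \<le> v' \<Longrightarrow> v' < v \<Longrightarrow>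
      \<exists>y. 0 < y \<and> y < R \<and> (\<forall>s t. y \<le> s \<longrightarrow> s \<le> t \<longrightarrow> \<phi> t \<le> \<phi> s * exp (- v' * (t - s)))"
    using left_slope[OF R_pos False] by blast
  show ?thesis
  proof (cases "\<exists>T>R. 0 < \<phi> T")
    case False
    then have T: "\<phi> t = 0" if "R < t" for t using that phi_nonneg[of t] R_pos by force
    show ?thesis
    proof (cases "v = 0")
      case True
      have flat: "\<phi> x = \<phi> R" if "0 < x" "x \<le> R" for x
        using v(2)[OF that] phi_antimono[OF that] True by simp
      have eq: "measure \<gamma> (K R e) = measure \<gamma> (K R e \<inter> cball 0 R)" if "0 < e" "e < a0" for e
        using that by (intro support_ends_at_R[OF T] star_body_KR) auto
      show ?thesis by (rule near_concave_flat[OF pos flat eq])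
    next
      case False
      then show ?thesis using v T by (intro near_concave_truncated[OF pos _ v(2,3) T]) auto
    qed
  next
    case True
    then obtain T where T: "R < T" "0 < \<phi> T" by blast
    show ?thesis
    proof (cases "v = 0")
      case v0: True
      have flat: "\<phi> x = \<phi> R" if "0 < x" "x \<le> R" for x
        using v(2)[OF that] phi_antimono[OF that] v0 by simp
      obtain z :: "real ^ 'n" where "norm z = 1" using vector_choose_size[of 1] by auto
      then have "sphere (0 :: real ^ 'n) 1 \<noteq> {}" by (metis mem_sphere_0 empty_iff)
      then obtain xM where xM: "norm xM = 1" "\<And>x. norm x = 1 \<Longrightarrow> \<psi> x \<le> \<psi> xM"
        using continuous_attains_sup[OF compact_sphere _ psi_continuous] by auto
      show ?thesis
      proof (cases "0 < \<psi> xM")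
        case True
        show ?thesis by (rule near_concave_kink[OF pos flat T xM(1) True xM(2)])
      next
        case False
        have "K R e = K R e \<inter> cball 0 R" if e: "0 < e" "e < a0" for e
        proof -
          have sb: "star_body (K R e)" using e by (intro star_body_KR) auto
          have "norm x \<le> R" if x: "x \<in> K R e" for x
          proof (cases "x = 0")
            case False
            then have n: "norm (sgn x) = 1" by (simp add: norm_sgn)
            have "norm x \<le> radial (K R e) (sgn x)" using star_body_eq_Collect[OF sb] x by blast
            also have "\<dots> \<le> R + e * \<psi> (sgn x)" using rho_le[OF _ n, of e] e by (simp add: \<rho>_def)
            also have "\<dots> \<le> R" using xM(2)[OF n] \<open>\<not> 0 < \<psi> xM\<close> e by (simp add: mult_nonneg_nonpos)
            finally show ?thesis .
          qed (use R_pos in simp)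
          then show ?thesis by auto
        qed
        then have eq: "measure \<gamma> (K R e) = measure \<gamma> (K R e \<inter> cball 0 R)" if "0 < e" "e < a0" for e
          using that by metis
        show ?thesis by (rule near_concave_flat[OF pos flat eq])
      qed
    next
      case vn: False
      then have vp: "0 < v" using v(1) by simp
      show ?thesis
      proof (cases "\<exists>x. norm x = 1 \<and> \<psi> x \<noteq> 0")
        case True
        then obtain x0 where x0: "norm x0 = 1" "\<psi> x0 \<noteq> 0" by blast
        show ?thesis by (rule near_concave_sloped[OF pos vp v(2,3) T x0])
      next
        case False
        then have KR: "K R e = K R 0" for e by (simp add: K_def)
        have "root_measure e = root_measure 0" for e unfolding root_measure_def KR[of e] by (rule refl)
        then have "l * root_measure e1 + (1 - l) * root_measure e2 \<le> root_measure (l * e1 + (1 - l) * e2)" for l e1 e2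
          by (metis add_diff_cancel_left' diff_add_cancel distrib_right mult_1 order_refl)
        then show ?thesis by (intro near_concaveI[OF a0_pos order_refl])
      qed
    qed
  qed
qed

end

theorem theorem1p3:
  fixes \<gamma> :: "(real ^ 'n) measure" and R :: real and \<psi> :: "real ^ 'n \<Rightarrow> real"
  assumes "CARD('n) \<ge> 2"
    and "radon_measure \<gamma>"
    and "rotation_invariant_measure \<gamma>"
    and "log_concave_measure \<gamma>"
    and "R > 0"
    and "C2_on_submanifold (sphere 0 1) \<psi>"
  shows "\<exists>a>0. \<forall>\<epsilon>\<^sub>1\<in>{0<..<a}. \<forall>\<epsilon>\<^sub>2\<in>{0<..<a}. \<exists>K\<^sub>1 K\<^sub>2 :: (real ^ 'n) set.
           convex_body K\<^sub>1 \<and> (\<forall>u\<in>sphere 0 1. support_function K\<^sub>1 u = R + \<epsilon>\<^sub>1 * \<psi> u) \<and>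
           convex_body K\<^sub>2 \<and> (\<forall>u\<in>sphere 0 1. support_function K\<^sub>2 u = R + \<epsilon>\<^sub>2 * \<psi> u) \<and>
           (\<forall>l\<in>{0..1::real}.
              measure \<gamma> ((*\<^sub>R) l ` K\<^sub>1 + (*\<^sub>R) (1 - l) ` K\<^sub>2) powr (1 / real CARD('n))
                \<ge> l * measure \<gamma> K\<^sub>1 powr (1 / real CARD('n))
                   + (1 - l) * measure \<gamma> K\<^sub>2 powr (1 / real CARD('n)))"
proof -
  obtain C where C: "C \<ge> 1" "\<And>v. v \<in> sphere 0 1 \<Longrightarrow> \<exists>b. b \<bullet> v = \<psi> v \<and> norm b \<le> C \<and>
      (\<forall>u\<in>sphere 0 1. \<bar>b \<bullet> u - \<psi> u\<bar> \<le> C * (norm (u - v))\<^sup>2)"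
    using C2_on_sphere_quadratic[OF assms(6)] by blast
  interpret perturbed_ball \<gamma> "CARD('n)" "unit_ball_vol (real CARD('n))" \<psi> C R
  proof (intro perturbed_ball.intro rot_log_concave.intro sphere_perturbation.intro)
    show "\<exists>b. b \<bullet> v = \<psi> v \<and> norm b \<le> C \<and> (\<forall>u. norm u = 1 \<longrightarrow> \<bar>b \<bullet> u - \<psi> u\<bar> \<le> C * (norm (u - v))\<^sup>2)"
      if "norm v = 1" for v
      using C(2)[of v] that by (simp only: mem_sphere_0 Ball_def)
  qed (fact refl assms C(1))+
  obtain a where a: "a > 0" "a \<le> a0" and conc: "\<And>e1 e2 l. e1 \<in> {0<..<a} \<Longrightarrow> e2 \<in> {0<..<a} \<Longrightarrow> 0 \<le> l \<Longrightarrow> l \<le> 1 \<Longrightarrow>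
     l * root_measure e1 + (1 - l) * root_measure e2 \<le> root_measure (l * e1 + (1 - l) * e2)"
    using near_concave unfolding near_concave_def by blast
  show ?thesis
  proof (intro exI[of _ a] conjI ballI a(1))
    fix e1 e2 assume e: "e1 \<in> {0<..<a}" "e2 \<in> {0<..<a}"
    have eC: "\<bar>e1\<bar> * C \<le> R / 2" "\<bar>e2\<bar> * C \<le> R / 2"
      using a0_bound[of e1] a0_bound[of e2] e a R_pos by auto
    have le: "l * measure \<gamma> (K R e1) powr (1 / real CARD('n)) + (1 - l) * measure \<gamma> (K R e2) powr (1 / real CARD('n))
        \<le> measure \<gamma> ((*\<^sub>R) l ` K R e1 + (*\<^sub>R) (1 - l) ` K R e2) powr (1 / real CARD('n))" if l: "l \<in> {0..1}" for l
    proof -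
      have "l * R + (1 - l) * R = R" by (simp add: algebra_simps)
      \<comment> \<open>This inclusion turns concavity along the family into the inequality for
        Minkowski combinations, since the measure is monotone.\<close>
      then have "K R (l * e1 + (1 - l) * e2) \<subseteq> (*\<^sub>R) l ` K R e1 + (*\<^sub>R) (1 - l) ` K R e2"
        using K_subset_sum[of l "1 - l" R R e1 e2] l eC R_pos by simp
      then have "measure \<gamma> (K R (l * e1 + (1 - l) * e2)) \<le> measure \<gamma> ((*\<^sub>R) l ` K R e1 + (*\<^sub>R) (1 - l) ` K R e2)"
        using R_pos by (intro measure_gamma_mono compact_scaled_sum compact_K) auto
      then have "root_measure (l * e1 + (1 - l) * e2) \<le> measure \<gamma> ((*\<^sub>R) l ` K R e1 + (*\<^sub>R) (1 - l) ` K R e2) powr (1 / real CARD('n))"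
        unfolding root_measure_def by (intro powr_mono2) auto
      with conc[OF e, of l] l show ?thesis by (simp add: root_measure_def)
    qed
    show "\<exists>K\<^sub>1 K\<^sub>2 :: (real ^ 'n) set.
           convex_body K\<^sub>1 \<and> (\<forall>u\<in>sphere 0 1. support_function K\<^sub>1 u = R + e1 * \<psi> u) \<and>
           convex_body K\<^sub>2 \<and> (\<forall>u\<in>sphere 0 1. support_function K\<^sub>2 u = R + e2 * \<psi> u) \<and>
           (\<forall>l\<in>{0..1::real}.
              measure \<gamma> ((*\<^sub>R) l ` K\<^sub>1 + (*\<^sub>R) (1 - l) ` K\<^sub>2) powr (1 / real CARD('n))
                \<ge> l * measure \<gamma> K\<^sub>1 powr (1 / real CARD('n))
                   + (1 - l) * measure \<gamma> K\<^sub>2 powr (1 / real CARD('n)))"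
    proof (rule exI[of _ "K R e1"], rule exI[of _ "K R e2"], intro conjI ballI le)
      show "convex_body (K R e1)" "convex_body (K R e2)" using R_pos eC by (auto intro: convex_body_K)
      fix v :: "real ^ 'n" assume "v \<in> sphere 0 1"
      then have v: "norm v = 1" by simp
      show "support_function (K R e1) v = R + e1 * \<psi> v" by (rule support_function_K[OF v eC(1)])
      show "support_function (K R e2) v = R + e2 * \<psi> v" by (rule support_function_K[OF v eC(2)])
    qed
  qed
qed

end
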